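(* Let $\mathsf{wilf}$ denote the number of Wilf-equivalence classes on the set of all mesh patterns of length $2$, i.e. on the set of all pairs $(\pi,R)$ with $\pi\in\mathfrak S_2$ and $R\subseteq\{0,1,2\}\times\{0,1,2\}$. Then $46\le \mathsf{wilf}\le 47$.
   Context: $\mathfrak S_n$ is the set of permutations of $[n]=\{1,\dots,n\}$, written in one-line notation $\sigma=\sigma_1\cdots\sigma_n$. A mesh pattern of length $2$ is a pair $p=(\pi,R)$ with $\pi\in\mathfrak S_2$ and $R\subseteq\{0,1,2\}\times\{0,1,2\}$ (the set of shaded cells, each cell being named by its bottom-left corner (column, row)). An occurrence of $p$ in $\sigma\in\mathfrak S_n$ is a pair of positions $i_1<i_2$ such that $\sigma_{i_1}\sigma_{i_2}$ is order-isomorphic to $\pi$ and, with $i_0=0$, $i_3=n+1$, $v_0=0$, $v_1<v_2$ the two values $\sigma_{i_1},\sigma_{i_2}$ in increasing order, and $v_3=n+1$, for every $(x,y)\in R$ there is no index $\ell$ with $i_x<\ell<i_{x+1}$ and $v_y<\sigma_\ell<v_{y+1}$. $\sigma$ avoids $p$ if it has no occurrence of $p$; $\mathfrak S_n(p)$ is the set of $\sigma\in\mathfrak S_n$ avoiding $p$. Two patterns $p_1,p_2$ are Wilf-equivalent if $|\mathfrak S_n(p_1)|=|\mathfrak S_n(p_2)|$ for all $n\ge 0$. *)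

theory Defs
  imports "HOL-Combinatorics.Permutations"
begin

text \<open>
  A permutation of \<open>[n]\<close> is a function \<open>\<sigma>\<close> with \<open>\<sigma> permutes {1..n}\<close>; its one-line notation is
  \<open>\<sigma> 1, \<dots>, \<sigma> n\<close>.  A mesh pattern is a pair \<open>(\<pi>, R)\<close>, where \<open>R\<close> is the set of shaded cells, a cell
  being named by the (column, row) coordinates of its bottom-left corner.
\<close>

type_synonym mesh_pattern = "(nat \<Rightarrow> nat) \<times> (nat \<times> nat) set"

definition mesh_patterns2 :: "mesh_pattern set" where
  "mesh_patterns2 = {\<pi>. \<pi> permutes {1..2}} \<times> Pow ({0..2} \<times> {0..2})"

text \<open>
  The grid lines of a candidate occurrence at positions \<open>i1 < i2\<close>: the positions
  \<open>i\<^sub>0 = 0, i\<^sub>1, i\<^sub>2, i\<^sub>3 = n + 1\<close> and, in increasing order, the values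
  \<open>v\<^sub>0 = 0, v\<^sub>1, v\<^sub>2, v\<^sub>3 = n + 1\<close>.
\<close>

definition grid_pos :: "nat \<Rightarrow> nat \<Rightarrow> nat \<Rightarrow> nat \<Rightarrow> nat" where
  "grid_pos n i1 i2 x = [0, i1, i2, n + 1] ! x"

definition grid_val :: "nat \<Rightarrow> (nat \<Rightarrow> nat) \<Rightarrow> nat \<Rightarrow> nat \<Rightarrow> nat \<Rightarrow> nat" where
  "grid_val n \<sigma> i1 i2 y = [0, min (\<sigma> i1) (\<sigma> i2), max (\<sigma> i1) (\<sigma> i2), n + 1] ! y"

definition mesh_occurrence :: "mesh_pattern \<Rightarrow> nat \<Rightarrow> (nat \<Rightarrow> nat) \<Rightarrow> nat \<Rightarrow> nat \<Rightarrow> bool" where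
  "mesh_occurrence p n \<sigma> i1 i2 \<longleftrightarrow>
     1 \<le> i1 \<and> i1 < i2 \<and> i2 \<le> n \<and>
     (\<forall>a\<in>{1..2}. \<forall>b\<in>{1..2}.
        \<sigma> (grid_pos n i1 i2 a) < \<sigma> (grid_pos n i1 i2 b) \<longleftrightarrow> fst p a < fst p b) \<and>
     (\<forall>(x, y)\<in>snd p. \<not> (\<exists>l\<in>{1..n}.
        grid_pos n i1 i2 x < l \<and> l < grid_pos n i1 i2 (x + 1) \<and>
        grid_val n \<sigma> i1 i2 y < \<sigma> l \<and> \<sigma> l < grid_val n \<sigma> i1 i2 (y + 1)))"

definition mesh_avoids :: "mesh_pattern \<Rightarrow> nat \<Rightarrow> (nat \<Rightarrow> nat) \<Rightarrow> bool" where
  "mesh_avoids p n \<sigma> \<longleftrightarrow> (\<nexists>i1 i2. mesh_occurrence p n \<sigma> i1 i2)"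

definition avoiders :: "nat \<Rightarrow> mesh_pattern \<Rightarrow> (nat \<Rightarrow> nat) set" where
  "avoiders n p = {\<sigma>. \<sigma> permutes {1..n} \<and> mesh_avoids p n \<sigma>}"

definition wilf_equivalent :: "mesh_pattern \<Rightarrow> mesh_pattern \<Rightarrow> bool" where
  "wilf_equivalent p q \<longleftrightarrow> (\<forall>n. card (avoiders n p) = card (avoiders n q))"

definition wilf_relation :: "mesh_pattern rel" where
  "wilf_relation = {(p, q) \<in> mesh_patterns2 \<times> mesh_patterns2. wilf_equivalent p q}"

definition wilf :: nat where
  "wilf = card (mesh_patterns2 // wilf_relation)"

end

theory Submission
  imports Defs "HOL-Library.Multiset" "HOL-Library.FuncSet"
begin

text \<open>Complement reduces the underlying permutation 21 to 12, which leaves 512 shadings \<open>R\<close>. Upper bound: inverse,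
  reverse-complement, two bijections available when the left column is shaded (reversing all entries but the first,
  and rotating the permutation diagram on a torus), and four ways to shade a cell without changing the set of avoiders
  connect these shadings up to a few exceptional equivalences. The latter come from three sources: the pattern is
  contained in every permutation with an ascent pair; two patterns obey the same growth rule when a
  last entry is appended (the label being the set of sizes of the slot sets that would destroy the current
  occurrences); or containment is read off the inversion code, where it can be counted or transported by a bijection.
  Lower bound: the numbers of avoiders of length 3 and 6 take 46 different pairs of values.\<close>

section \<open>Occurrences and symmetries\<close>

text \<open>An inequivalence needs a single length, but an equivalence must hold for all lengths at
  once, and the patterns concerned have occurrences of quite different shapes. In the generating
  tree the obstacle is that a label ought to record which slots destroy which occurrences, i.e. a
  whole family of sets. It shrinks to a set of numbers because these families are chains: the slots
  can be ranked so that each set becomes an initial segment of ranks, and a slot destroys an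
  occurrence exactly if its rank is below the size of the set. A second label component predicts the
  sizes created by the new entry. Codes help when an occurrence constrains the coordinates one by
  one: then only the numbers of admissible values matter, or coordinates can be changed
  independently. The connections leave 47 representatives; two of them are neither connected nor
  separated here, which is the gap of one between the bounds.\<close>

definition perms :: "nat \<Rightarrow> (nat \<Rightarrow> nat) set" where
  "perms n = {\<sigma>. \<sigma> permutes {1..n}}"

text \<open>The strip index is meaningful only for \<open>x \<notin> {a, b}\<close>.\<close>

definition strip :: "nat \<Rightarrow> nat \<Rightarrow> nat \<Rightarrow> nat" where
  "strip a b x = (if x < a then 0 else if x < b then 1 else 2)"

definition occ :: "(nat \<times> nat) set \<Rightarrow> nat \<Rightarrow> (nat \<Rightarrow> nat) \<Rightarrow> nat \<Rightarrow> nat \<Rightarrow> bool" where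
  "occ R n \<sigma> i j \<longleftrightarrow> 1 \<le> i \<and> i < j \<and> j \<le> n \<and> \<sigma> i < \<sigma> j \<and>
     (\<forall>l\<in>{1..n}. l \<noteq> i \<longrightarrow> l \<noteq> j \<longrightarrow> (strip i j l, strip (\<sigma> i) (\<sigma> j) (\<sigma> l)) \<notin> R)"

definition av :: "(nat \<times> nat) set \<Rightarrow> nat \<Rightarrow> (nat \<Rightarrow> nat) set" where
  "av R n = {\<sigma> \<in> perms n. \<nexists>i j. occ R n \<sigma> i j}"

definition weq :: "(nat \<times> nat) set \<Rightarrow> (nat \<times> nat) set \<Rightarrow> bool" where
  "weq R R' \<longleftrightarrow> (\<forall>n. card (av R n) = card (av R' n))"

lemma perms_inj: "\<sigma> \<in> perms n \<Longrightarrow> \<sigma> i = \<sigma> j \<longleftrightarrow> i = j"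
  unfolding perms_def by (metis mem_Collect_eq permutes_inj injD)

lemma perms_range: "\<sigma> \<in> perms n \<Longrightarrow> \<sigma> i \<in> {1..n} \<longleftrightarrow> i \<in> {1..n}"
  unfolding perms_def by (metis mem_Collect_eq permutes_in_image)

lemma perms_ge1: "\<sigma> \<in> perms n \<Longrightarrow> 1 \<le> i \<Longrightarrow> i \<le> n \<Longrightarrow> 1 \<le> \<sigma> i"
  using perms_range[of \<sigma> n i] by auto

lemma perms_len: "\<sigma> \<in> perms n \<Longrightarrow> 1 \<le> i \<Longrightarrow> i \<le> n \<Longrightarrow> \<sigma> i \<le> n"
  using perms_range[of \<sigma> n i] by auto

lemma perms_out: "\<sigma> \<in> perms n \<Longrightarrow> i \<notin> {1..n} \<Longrightarrow> \<sigma> i = i"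
  unfolding perms_def by (simp add: permutes_def)

lemma perms_surj: "\<sigma> \<in> perms n \<Longrightarrow> v \<in> {1..n} \<Longrightarrow> \<exists>i\<in>{1..n}. \<sigma> i = v"
  unfolding perms_def by (metis mem_Collect_eq permutes_def permutes_in_image)

lemma finite_perms [simp]: "finite (perms n)"
  unfolding perms_def by (simp add: finite_permutations)

lemma card_perms: "card (perms n) = fact n"
  unfolding perms_def by (simp add: card_permutations)

lemma permsI:
  assumes "\<And>i. i \<in> {1..n} \<Longrightarrow> \<sigma> i \<in> {1..n}" "\<And>i. i \<notin> {1..n} \<Longrightarrow> \<sigma> i = i"
    "\<And>i j. i \<in> {1..n} \<Longrightarrow> j \<in> {1..n} \<Longrightarrow> \<sigma> i = \<sigma> j \<Longrightarrow> i = j"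
  shows "\<sigma> \<in> perms n"
proof -
  have "inj_on \<sigma> {1..n}" using assms(3) by (rule inj_onI)
  moreover have "\<sigma> ` {1..n} \<subseteq> {1..n}" using assms(1) by auto
  ultimately have "bij_betw \<sigma> {1..n} {1..n}"
    by (simp add: bij_betw_def endo_inj_surj)
  then show ?thesis unfolding perms_def using assms(2) by (auto intro: bij_imp_permutes)
qed

lemma finite_av [simp]: "finite (av R n)"
  unfolding av_def by simp

lemma weq_refl [simp]: "weq R R" and weq_sym: "weq R R' \<Longrightarrow> weq R' R"
  and weq_trans: "weq R R' \<Longrightarrow> weq R' R'' \<Longrightarrow> weq R R''"
  by (auto simp: weq_def)

lemma card_filter_eq:
  assumes "finite X" "finite Y" "card X = card Y"
    "card {x \<in> X. P x} = card {y \<in> Y. Q y}"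
  shows "card {x \<in> X. \<not> P x} = card {y \<in> Y. \<not> Q y}"
proof -
  have "{x \<in> X. \<not> P x} = X - {x \<in> X. P x}" "{y \<in> Y. \<not> Q y} = Y - {y \<in> Y. Q y}" by auto
  then show ?thesis using assms by (simp add: card_Diff_subset)
qed

lemma weqI_contain:
  assumes "\<And>n. card {\<sigma> \<in> perms n. \<exists>i j. occ R n \<sigma> i j} = card {\<sigma> \<in> perms n. \<exists>i j. occ R' n \<sigma> i j}"
  shows "weq R R'"
  unfolding weq_def av_def by (intro allI card_filter_eq) (use assms in auto)

text \<open>As \<open>perms n\<close> is finite, an injective self-map is already a bijection, so
  the symmetries need no explicit inverse.\<close>

lemma weqI_inj:
  assumes "\<And>n. f n ` perms n \<subseteq> perms n" "\<And>n. inj_on (f n) (perms n)"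
    "\<And>n \<sigma>. \<sigma> \<in> perms n \<Longrightarrow> (\<exists>i j. occ R n \<sigma> i j) \<longleftrightarrow> (\<exists>i j. occ R' n (f n \<sigma>) i j)"
  shows "weq R R'"
proof -
  have "card (av R n) = card (av R' n)" for n
  proof -
    have "bij_betw (f n) (perms n) (perms n)"
      using assms(1,2) by (simp add: bij_betw_def endo_inj_surj)
    moreover have "f n ` av R n = av R' n"
    proof (intro equalityI subsetI)
      fix x assume "x \<in> f n ` av R n"
      then obtain \<sigma> where s: "\<sigma> \<in> perms n" "\<nexists>i j. occ R n \<sigma> i j" "x = f n \<sigma>" by (auto simp: av_def)
      then show "x \<in> av R' n" using assms(1)[of n] assms(3)[OF s(1)] by (auto simp: av_def)
    next
      fix x assume x: "x \<in> av R' n"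
      then have "x \<in> f n ` perms n" using calculation by (simp add: av_def bij_betw_def)
      then obtain \<sigma> where s: "\<sigma> \<in> perms n" "x = f n \<sigma>" by blast
      then have "\<sigma> \<in> av R n" using assms(3)[OF s(1)] x unfolding av_def by blast
      then show "x \<in> f n ` av R n" using s by blast
    qed
    ultimately have "bij_betw (f n) (av R n) (av R' n)"
      by (metis (no_types, lifting) av_def bij_betw_subset mem_Collect_eq subsetI)
    then show ?thesis by (rule bij_betw_same_card)
  qed
  then show ?thesis by (simp add: weq_def)
qed

lemma avI_coincide:
  assumes "\<And>n \<sigma>. \<sigma> \<in> perms n \<Longrightarrow> (\<exists>i j. occ R n \<sigma> i j) \<longleftrightarrow> (\<exists>i j. occ R' n \<sigma> i j)"
  shows "weq R R'"
  by (rule weqI_inj[where f = "\<lambda>_ \<sigma>. \<sigma>"]) (use assms in auto)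

section \<open>Reverse-complement and inverse\<close>

definition kappa :: "nat \<Rightarrow> nat \<Rightarrow> nat" where
  "kappa n v = (if 1 \<le> v \<and> v \<le> n then n + 1 - v else v)"

lemma kappa_kappa [simp]: "kappa n (kappa n v) = v"
  by (auto simp: kappa_def)

lemma kappa_perms: "kappa n \<in> perms n"
  by (rule permsI) (auto simp: kappa_def split: if_splits)

lemma perms_comp: "\<sigma> \<in> perms n \<Longrightarrow> \<tau> \<in> perms n \<Longrightarrow> \<sigma> \<circ> \<tau> \<in> perms n"
  unfolding perms_def by (simp add: permutes_compose)

lemma perms_inv: "\<sigma> \<in> perms n \<Longrightarrow> inv \<sigma> \<in> perms n"
  unfolding perms_def by (simp add: permutes_inv)

lemma kappa_eq [simp]: "kappa n u = kappa n v \<longleftrightarrow> u = v"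
  by (metis kappa_kappa)

lemma kappa_in [simp]: "1 \<le> kappa n v \<and> kappa n v \<le> n \<longleftrightarrow> 1 \<le> v \<and> v \<le> n"
  by (auto simp: kappa_def)

lemma kappa_less: "1 \<le> u \<Longrightarrow> u \<le> n \<Longrightarrow> 1 \<le> v \<Longrightarrow> v \<le> n \<Longrightarrow> kappa n u < kappa n v \<longleftrightarrow> v < u"
  by (auto simp: kappa_def)

lemma strip_kappa:
  assumes "a < b" "x \<noteq> a" "x \<noteq> b" "{a,b,x} \<subseteq> {1..n}"
  shows "strip (kappa n b) (kappa n a) (kappa n x) = 2 - strip a b x"
  using assms by (auto simp: strip_def kappa_def)

lemma strip_le2 [simp]: "strip a b x \<le> 2"
  by (simp add: strip_def)

text \<open>Subtraction is truncated, so the preimage of a shading under \<open>rot\<close> may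
  contain cells outside the board. They are harmless because \<open>strip\<close> never exceeds
  2.\<close>

definition rot :: "nat \<times> nat \<Rightarrow> nat \<times> nat" where "rot = (\<lambda>(x, y). (2 - x, 2 - y))"

lemma occ_rc1:
  assumes \<sigma>: "\<sigma> \<in> perms n" and o: "occ (rot -` R) n \<sigma> i j"
  shows "occ R n (kappa n \<circ> \<sigma> \<circ> kappa n) (kappa n j) (kappa n i)"
proof -
  have ij: "1 \<le> i" "i < j" "j \<le> n" "\<sigma> i < \<sigma> j" using o by (auto simp: occ_def)
  have r: "1 \<le> \<sigma> i" "\<sigma> j \<le> n" using perms_ge1[OF \<sigma>] perms_len[OF \<sigma>] ij by auto
  show ?thesis unfolding occ_def
  proof (intro conjI ballI impI)
    fix l assume l: "l \<in> {1..n}" "l \<noteq> kappa n j" "l \<noteq> kappa n i"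
    define k where "k = kappa n l"
    have lk: "l = kappa n k" by (simp add: k_def)
    have k: "k \<in> {1..n}" "k \<noteq> i" "k \<noteq> j" using l kappa_in[of n k] unfolding lk by auto
    have nn: "(strip i j k, strip (\<sigma> i) (\<sigma> j) (\<sigma> k)) \<notin> rot -` R"
      using o k by (auto simp: occ_def)
    have s1: "strip (kappa n j) (kappa n i) l = 2 - strip i j k"
      unfolding lk by (rule strip_kappa) (use ij k in auto)
    have s2: "strip (kappa n (\<sigma> j)) (kappa n (\<sigma> i)) (kappa n (\<sigma> k)) = 2 - strip (\<sigma> i) (\<sigma> j) (\<sigma> k)"
      by (rule strip_kappa) (use ij r k perms_range[OF \<sigma>, of k] perms_inj[OF \<sigma>] in auto)
    show "(strip (kappa n j) (kappa n i) l, strip ((kappa n \<circ> \<sigma> \<circ> kappa n) (kappa n j))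
          ((kappa n \<circ> \<sigma> \<circ> kappa n) (kappa n i)) ((kappa n \<circ> \<sigma> \<circ> kappa n) l)) \<notin> R"
      using nn s1 s2 by (simp add: rot_def k_def)
  qed (use ij r in \<open>auto simp: kappa_def\<close>)
qed

lemma weq_rc:
  assumes "R \<subseteq> {0..2} \<times> {0..2}"
  shows "weq (rot -` R) R"
proof (rule weqI_inj[where f = "\<lambda>n \<sigma>. kappa n \<circ> \<sigma> \<circ> kappa n"])
  fix n
  show "(\<lambda>\<sigma>. kappa n \<circ> \<sigma> \<circ> kappa n) ` perms n \<subseteq> perms n"
    using kappa_perms perms_comp by blast
  have *: "kappa n \<circ> (kappa n \<circ> \<sigma> \<circ> kappa n) \<circ> kappa n = \<sigma>" for \<sigma> by (auto simp: fun_eq_iff)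
  show "inj_on (\<lambda>\<sigma>. kappa n \<circ> \<sigma> \<circ> kappa n) (perms n)" by (rule inj_onI) (metis *)
  fix \<sigma> assume \<sigma>: "\<sigma> \<in> perms n"
  \<comment> \<open>On indices up to 2 the rotation is an involution, so \<open>occ_rc1\<close>
    applied to the rotated permutation gives the converse direction.\<close>
  have **: "occ (rot -` rot -` R) n \<sigma> i j \<longleftrightarrow> occ R n \<sigma> i j" for \<sigma> i j
    unfolding occ_def rot_def by (simp add: strip_def)
  show "(\<exists>i j. occ (rot -` R) n \<sigma> i j) \<longleftrightarrow> (\<exists>i j. occ R n (kappa n \<circ> \<sigma> \<circ> kappa n) i j)"
    using occ_rc1[OF \<sigma>] occ_rc1[of "kappa n \<circ> \<sigma> \<circ> kappa n" n "rot -` R"] * **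
      perms_comp[OF perms_comp[OF kappa_perms \<sigma>] kappa_perms] by metis
qed

text \<open>Inversion reflects the diagram in its main diagonal: positions and values change roles,
  and an ascending pair stays ascending.\<close>

lemma occ_inv1:
  assumes \<sigma>: "\<sigma> \<in> perms n" and o: "occ (R\<inverse>) n \<sigma> i j"
  shows "occ R n (inv \<sigma>) (\<sigma> i) (\<sigma> j)"
proof -
  have ij: "1 \<le> i" "i < j" "j \<le> n" "\<sigma> i < \<sigma> j" using o by (auto simp: occ_def)
  have r: "1 \<le> \<sigma> i" "\<sigma> j \<le> n" using perms_ge1[OF \<sigma>] perms_len[OF \<sigma>] ij by auto
  have inv: "inv \<sigma> (\<sigma> x) = x" for x using perms_inj[OF \<sigma>] by (simp add: inj_def inv_f_f)
  show ?thesis unfolding occ_def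
  proof (intro conjI ballI impI)
    fix l assume l: "l \<in> {1..n}" "l \<noteq> \<sigma> i" "l \<noteq> \<sigma> j"
    then obtain k where k: "k \<in> {1..n}" "l = \<sigma> k" using perms_surj[OF \<sigma>] by metis
    then have "(strip i j k, strip (\<sigma> i) (\<sigma> j) (\<sigma> k)) \<notin> R\<inverse>" using o l by (auto simp: occ_def)
    then show "(strip (\<sigma> i) (\<sigma> j) l, strip (inv \<sigma> (\<sigma> i)) (inv \<sigma> (\<sigma> j)) (inv \<sigma> l)) \<notin> R"
      by (simp add: inv k)
  qed (use ij r inv in auto)
qed

lemma weq_inverse: "weq (R\<inverse>) R"
proof (rule weqI_inj[where f = "\<lambda>n. inv"])
  fix n
  show "inv ` perms n \<subseteq> perms n" using perms_inv by blast
  have *: "inv (inv \<sigma>) = \<sigma>" if "\<sigma> \<in> perms n" for \<sigma>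
    using that unfolding perms_def by (simp add: permutes_inv_inv)
  show "inj_on inv (perms n)" by (rule inj_onI) (metis *)
  fix \<sigma> assume \<sigma>: "\<sigma> \<in> perms n"
  show "(\<exists>i j. occ (R\<inverse>) n \<sigma> i j) \<longleftrightarrow> (\<exists>i j. occ R n (inv \<sigma>) i j)"
    using occ_inv1[OF \<sigma>, of R] occ_inv1[OF perms_inv[OF \<sigma>], of "R\<inverse>"] *[OF \<sigma>] by (metis converse_converse)
qed

section \<open>The generating tree\<close>

text \<open>A child in the generating tree. Slot \<open>r\<close> is the gap directly above the
  value \<open>r\<close>: the new last entry exceeds exactly the old values up to \<open>r\<close>,
  and the others are lifted by one.\<close>

definition ext :: "nat \<Rightarrow> nat \<Rightarrow> (nat \<Rightarrow> nat) \<Rightarrow> nat \<Rightarrow> nat" where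
  "ext n r \<sigma> i = (if i = Suc n then Suc r else if i \<le> n then (if \<sigma> i \<le> r then \<sigma> i else Suc (\<sigma> i)) else i)"

lemma ext_last [simp]: "ext n r \<sigma> (Suc n) = Suc r"
  by (simp add: ext_def)

lemma ext_less [simp]: "i \<le> n \<Longrightarrow> j \<le> n \<Longrightarrow> ext n r \<sigma> i < ext n r \<sigma> j \<longleftrightarrow> \<sigma> i < \<sigma> j"
  by (auto simp: ext_def)

lemma ext_less_last [simp]: "i \<le> n \<Longrightarrow> ext n r \<sigma> i < Suc r \<longleftrightarrow> \<sigma> i \<le> r"
  by (auto simp: ext_def)

lemma last_less_ext [simp]: "i \<le> n \<Longrightarrow> Suc r < ext n r \<sigma> i \<longleftrightarrow> r < \<sigma> i"
  by (auto simp: ext_def)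

lemma ext_le_r [simp]: "i \<le> n \<Longrightarrow> ext n r \<sigma> i \<le> r \<longleftrightarrow> \<sigma> i \<le> r"
  by (auto simp: ext_def)

lemma perms_0: "perms 0 = {id}"
  by (auto simp: perms_def)

lemma ext_perms: "\<sigma> \<in> perms n \<Longrightarrow> r \<le> n \<Longrightarrow> ext n r \<sigma> \<in> perms (Suc n)"
proof (rule permsI)
  assume \<sigma>: "\<sigma> \<in> perms n" and r: "r \<le> n"
  fix i assume i: "i \<in> {1..Suc n}"
  show "ext n r \<sigma> i \<in> {1..Suc n}"
    using perms_ge1[OF \<sigma>, of i] perms_len[OF \<sigma>, of i] r i by (auto simp: ext_def)
  fix j assume j: "j \<in> {1..Suc n}" and e: "ext n r \<sigma> i = ext n r \<sigma> j"
  show "i = j" using perms_inj[OF \<sigma>, of i j] e i j by (auto simp: ext_def split: if_splits)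
next
  fix i assume "\<sigma> \<in> perms n" "r \<le> n" "i \<notin> {1..Suc n}"
  then show "ext n r \<sigma> i = i" using perms_out[of \<sigma> n i] by (auto simp: ext_def)
qed

lemma ext_inj:
  assumes \<sigma>: "\<sigma> \<in> perms n" and \<tau>: "\<tau> \<in> perms n" and e: "ext n r \<sigma> = ext n s \<tau>"
  shows "\<sigma> = \<tau> \<and> r = s"
proof -
  have rs: "r = s" using fun_cong[OF e, of "Suc n"] by simp
  have "\<sigma> i = \<tau> i" for i
  proof (cases "i \<in> {1..n}")
    case True
    then show ?thesis using fun_cong[OF e, of i] rs by (auto simp: ext_def split: if_splits)
  qed (use perms_out \<sigma> \<tau> in metis)
  then show ?thesis using rs by auto
qed

lemma inj_on_ext: "inj_on (\<lambda>(\<sigma>, r). ext n r \<sigma>) (perms n \<times> {..n})"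
  using ext_inj by (fastforce simp: inj_on_def)

text \<open>Surjectivity is by counting: both sides have \<open>(n + 1)!\<close> elements.\<close>

lemma bij_ext: "bij_betw (\<lambda>(\<sigma>, r). ext n r \<sigma>) (perms n \<times> {..n}) (perms (Suc n))"
proof -
  have "(\<lambda>(\<sigma>, r). ext n r \<sigma>) ` (perms n \<times> {..n}) = perms (Suc n)"
  proof (rule card_subset_eq)
    show "(\<lambda>(\<sigma>, r). ext n r \<sigma>) ` (perms n \<times> {..n}) \<subseteq> perms (Suc n)"
      using ext_perms by auto
    show "card ((\<lambda>(\<sigma>, r). ext n r \<sigma>) ` (perms n \<times> {..n})) = card (perms (Suc n))"
      using card_image[OF inj_on_ext] by (simp add: card_cartesian_product card_perms)
  qed simp
  then show ?thesis by (simp add: bij_betw_def inj_on_ext)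
qed

lemma perms_SucE:
  assumes "\<sigma> \<in> perms (Suc n)"
  obtains \<tau> r where "\<tau> \<in> perms n" "r \<le> n" "\<sigma> = ext n r \<tau>"
proof -
  have "\<sigma> \<in> (\<lambda>(\<sigma>, r). ext n r \<sigma>) ` (perms n \<times> {..n})"
    using bij_ext[of n] assms by (simp add: bij_betw_def)
  then show ?thesis using that by auto
qed

lemma card_perms_Suc:
  "card {\<sigma> \<in> perms (Suc n). P \<sigma>} = (\<Sum>\<sigma>\<in>perms n. card {r. r \<le> n \<and> P (ext n r \<sigma>)})"
proof -
  have "bij_betw (\<lambda>(\<sigma>, r). ext n r \<sigma>) (Sigma (perms n) (\<lambda>\<sigma>. {r. r \<le> n \<and> P (ext n r \<sigma>)})) {\<sigma> \<in> perms (Suc n). P \<sigma>}"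
    unfolding bij_betw_def
  proof
    show "inj_on (\<lambda>(\<sigma>, r). ext n r \<sigma>) (Sigma (perms n) (\<lambda>\<sigma>. {r. r \<le> n \<and> P (ext n r \<sigma>)}))"
      by (rule inj_on_subset[OF inj_on_ext]) auto
    show "(\<lambda>(\<sigma>, r). ext n r \<sigma>) ` Sigma (perms n) (\<lambda>\<sigma>. {r. r \<le> n \<and> P (ext n r \<sigma>)}) = {\<sigma> \<in> perms (Suc n). P \<sigma>}"
      using ext_perms by (auto elim!: perms_SucE)
  qed
  then show ?thesis by (simp flip: bij_betw_same_card)
qed

text \<open>The whole multiset of labels is followed, and not just a count, because the label of a
  child decides how its own children are labelled.\<close>

lemma mset_perms_Suc:
  "image_mset f (mset_set (perms (Suc n))) =
   (\<Sum>\<sigma>\<in>#mset_set (perms n). image_mset (\<lambda>r. f (ext n r \<sigma>)) (mset_set {..n}))"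
proof -
  have "mset_set (perms (Suc n)) = image_mset (\<lambda>(\<sigma>, r). ext n r \<sigma>) (mset_set (perms n \<times> {..n}))"
    using bij_ext[of n] by (simp add: bij_betw_def image_mset_mset_set)
  moreover have "image_mset g (mset_set (A \<times> B)) = (\<Sum>a\<in>#mset_set A. image_mset (\<lambda>b. g (a, b)) (mset_set B))"
    if "finite A" "finite B" for g :: "(nat \<Rightarrow> nat) \<times> nat \<Rightarrow> 'a" and A B
    using that(1)
  proof (induction A)
    case (insert a A)
    have "insert a A \<times> B = (Pair a ` B) \<union> A \<times> B" by auto
    moreover have "(Pair a ` B) \<inter> A \<times> B = {}" using insert by auto
    ultimately have "mset_set (insert a A \<times> B) = mset_set (Pair a ` B) + mset_set (A \<times> B)"
      using that insert by (simp add: mset_set_Union)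
    moreover have "mset_set (Pair a ` B) = image_mset (Pair a) (mset_set B)"
      by (simp add: image_mset_mset_set inj_on_def)
    ultimately show ?case using insert by (simp add: multiset.map_comp comp_def)
  qed simp
  ultimately show ?thesis by (simp add: multiset.map_comp comp_def split_def)
qed

text \<open>A label \<open>L\<close> grows along the generating tree by the rule \<open>\<delta>\<close>, up to a bijective renaming \<open>\<pi>\<close> of the
  \<open>n + 1\<close> slots for the new last entry. The multiset of labels then depends on the rule only.\<close>

definition realises :: "(nat \<Rightarrow> (nat \<Rightarrow> nat) \<Rightarrow> 'l) \<Rightarrow> (nat \<Rightarrow> 'l \<Rightarrow> nat \<Rightarrow> 'l) \<Rightarrow> 'l \<Rightarrow> bool" where
  "realises L \<delta> l0 \<longleftrightarrow> L 0 id = l0 \<and> (\<forall>n. \<forall>\<sigma>\<in>perms n. \<exists>\<pi>. bij_betw \<pi> {..n} {..n} \<and>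
     (\<forall>r\<le>n. L (Suc n) (ext n r \<sigma>) = \<delta> n (L n \<sigma>) (\<pi> r)))"

lemma realises_mset:
  assumes "realises L \<delta> l0" "realises L' \<delta> l0"
  shows "image_mset (L n) (mset_set (perms n)) = image_mset (L' n) (mset_set (perms n))"
proof (induction n)
  case 0
  have "L 0 id = L' 0 id" using assms unfolding realises_def by metis
  then show ?case by (simp add: perms_0)
next
  case (Suc n)
  have *: "image_mset (M (Suc n)) (mset_set (perms (Suc n))) =
      (\<Sum>l\<in>#image_mset (M n) (mset_set (perms n)). image_mset (\<delta> n l) (mset_set {..n}))"
    if M: "realises M \<delta> l0" for M
  proof -
    have "image_mset (\<lambda>r. M (Suc n) (ext n r \<sigma>)) (mset_set {..n}) = image_mset (\<delta> n (M n \<sigma>)) (mset_set {..n})"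
      if s: "\<sigma> \<in> perms n" for \<sigma>
    proof -
      obtain \<pi> where \<pi>: "bij_betw \<pi> {..n} {..n}" "\<forall>r\<le>n. M (Suc n) (ext n r \<sigma>) = \<delta> n (M n \<sigma>) (\<pi> r)"
        using bspec[OF spec[OF conjunct2[OF M[unfolded realises_def]]] s] by (elim exE conjE)
      have "image_mset (\<lambda>r. M (Suc n) (ext n r \<sigma>)) (mset_set {..n}) =
          image_mset (\<lambda>r. \<delta> n (M n \<sigma>) (\<pi> r)) (mset_set {..n})"
        using \<pi>(2) by (intro image_mset_cong) auto
      also have "\<dots> = image_mset (\<delta> n (M n \<sigma>)) (image_mset \<pi> (mset_set {..n}))"
        by (simp add: multiset.map_comp comp_def)
      \<comment> \<open>Renaming the slots only permutes the children, so their multiset of labels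
        is unchanged.\<close>
      also have "image_mset \<pi> (mset_set {..n}) = mset_set {..n}"
        using \<pi>(1) by (simp add: image_mset_mset_set bij_betw_def)
      finally show ?thesis .
    qed
    then show ?thesis unfolding mset_perms_Suc multiset.map_comp comp_def
      by - (rule arg_cong[of _ _ sum_mset], rule image_mset_cong, simp)
  qed
  show ?case unfolding *[OF assms(1)] *[OF assms(2)] Suc ..
qed

lemma realises_card:
  assumes "realises L \<delta> l0" "realises L' \<delta> l0"
  shows "card {\<sigma> \<in> perms n. P (L n \<sigma>)} = card {\<sigma> \<in> perms n. P (L' n \<sigma>)}"
proof -
  have *: "card {\<sigma> \<in> perms n. P (M n \<sigma>)} = size (filter_mset P (image_mset (M n) (mset_set (perms n))))" for M
    by (simp add: filter_mset_image_mset)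
  show ?thesis using realises_mset[OF assms, of n] by (simp only: *)
qed

text \<open>Induction on the number of sets: a largest member \<open>A\<close> contains all others.
  Its elements receive the lowest ranks by induction, the elements outside \<open>A\<close> the
  remaining ones; so every member of the chain becomes an initial segment.\<close>

lemma chain_enum:
  assumes "finite \<I>" "\<Union>\<I> \<subseteq> S" "finite S" "\<And>A B. A \<in> \<I> \<Longrightarrow> B \<in> \<I> \<Longrightarrow> A \<subseteq> B \<or> B \<subseteq> A"
  shows "\<exists>\<pi>. bij_betw \<pi> S {..<card S} \<and> (\<forall>A\<in>\<I>. \<forall>r\<in>S. r \<in> A \<longleftrightarrow> \<pi> r < card A)"
  using assms
proof (induction "card \<I>" arbitrary: \<I> S)
  case 0
  then show ?case using ex_bij_betw_finite_nat[of S] by (auto simp: atLeast0LessThan)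
next
  case (Suc k)
  then have ne: "\<I> \<noteq> {}" by auto
  have "\<exists>A\<in>\<I>. \<forall>B\<in>\<I>. card B \<le> card A"
  proof -
    have "Max (card ` \<I>) \<in> card ` \<I>" using Suc.prems(1) ne by (intro Max_in) auto
    then obtain A where "A \<in> \<I>" "card A = Max (card ` \<I>)" by auto
    then show ?thesis using Suc.prems(1) by (metis Max_ge finite_imageI imageI)
  qed
  then obtain A where A: "A \<in> \<I>" "\<And>B. B \<in> \<I> \<Longrightarrow> card B \<le> card A" by blast
  have fin: "finite B" if "B \<in> \<I>" for B using Suc.prems(2,3) that by (meson Union_upper finite_subset)
  have sub: "B \<subseteq> A" if "B \<in> \<I>" for B
  proof (rule ccontr)
    assume "\<not> B \<subseteq> A"
    then have "A \<subset> B" using Suc.prems(4) A(1) that by blast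
    then have "card A < card B" by (rule psubset_card_mono[OF fin[OF that]])
    then show False using A(2)[OF that] by simp
  qed
  have AS: "A \<subseteq> S" using A Suc.prems(2) by blast
  have "\<exists>\<pi>. bij_betw \<pi> A {..<card A} \<and> (\<forall>B\<in>\<I> - {A}. \<forall>r\<in>A. r \<in> B \<longleftrightarrow> \<pi> r < card B)"
  proof (rule Suc.hyps(1))
    show "k = card (\<I> - {A})" using Suc.hyps(2) A(1) by (simp add: card_Diff_singleton)
    show "\<Union> (\<I> - {A}) \<subseteq> A" using sub by blast
    show "B \<subseteq> C \<or> C \<subseteq> B" if "B \<in> \<I> - {A}" "C \<in> \<I> - {A}" for B C using Suc.prems(4) that by blast
  qed (use Suc.prems(1) fin[OF A(1)] in auto)
  then obtain \<pi>1 where p1: "bij_betw \<pi>1 A {..<card A}" "\<forall>B\<in>\<I> - {A}. \<forall>r\<in>A. r \<in> B \<longleftrightarrow> \<pi>1 r < card B" by blast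
  have "card (S - A) = card {card A..<card S}" using AS Suc.prems(3) fin[OF A(1)] by (simp add: card_Diff_subset)
  then obtain \<pi>2 where p2: "bij_betw \<pi>2 (S - A) {card A..<card S}"
    using Suc.prems(3) by (metis finite_Diff finite_atLeastLessThan finite_same_card_bij)
  define \<pi> where "\<pi> r = (if r \<in> A then \<pi>1 r else \<pi>2 r)" for r
  have "bij_betw \<pi> A {..<card A}" "bij_betw \<pi> (S - A) {card A..<card S}"
    using p1(1) p2 bij_betw_cong[of A \<pi> \<pi>1] bij_betw_cong[of "S - A" \<pi> \<pi>2] by (simp_all add: \<pi>_def)
  then have "bij_betw \<pi> (A \<union> (S - A)) ({..<card A} \<union> {card A..<card S})"
    by (rule bij_betw_combine) auto
  moreover have "A \<union> (S - A) = S" using AS by auto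
  moreover have "{..<card A} \<union> {card A..<card S} = {..<card S}"
    using card_mono[OF Suc.prems(3) AS] by auto
  ultimately have b: "bij_betw \<pi> S {..<card S}" by simp
  have "r \<in> B \<longleftrightarrow> \<pi> r < card B" if B: "B \<in> \<I>" and r: "r \<in> S" for B r
  proof (cases "r \<in> A")
    case True
    then have "\<pi> r = \<pi>1 r" "\<pi>1 r < card A" using p1(1) by (auto simp: \<pi>_def bij_betw_def)
    then show ?thesis using p1(2) B True by (cases "B = A") auto
  next
    case False
    then have "\<pi> r = \<pi>2 r" "card A \<le> \<pi>2 r" using p2 r by (auto simp: \<pi>_def bij_betw_def)
    then show ?thesis using False sub[OF B] A(2)[OF B] by auto
  qed
  then show ?case using b by blast
qed

text \<open>The slots at which a new last entry destroys the occurrence.\<close>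

definition forb :: "(nat \<times> nat) set \<Rightarrow> nat \<Rightarrow> (nat \<Rightarrow> nat) \<Rightarrow> nat \<Rightarrow> nat \<Rightarrow> nat set" where
  "forb R n \<sigma> i j = {r. r \<le> n \<and> (2, strip (\<sigma> i) (\<sigma> j) r) \<in> R}"

text \<open>Closed form for the size of the slot set: below the first value, between the values and
  from the second value on there are \<open>\<sigma> i\<close>,
  \<open>\<sigma> j - \<sigma> i\<close> and \<open>Suc n - \<sigma> j\<close> slots.\<close>

definition fsize :: "(nat \<times> nat) set \<Rightarrow> nat \<Rightarrow> (nat \<Rightarrow> nat) \<Rightarrow> nat \<Rightarrow> nat \<Rightarrow> nat" where
  "fsize R n \<sigma> i j = (if (2, 0) \<in> R then \<sigma> i else 0) + (if (2, 1) \<in> R then \<sigma> j - \<sigma> i else 0) +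
     (if (2, 2) \<in> R then Suc n - \<sigma> j else 0)"

lemma strip_ext: "i \<le> n \<Longrightarrow> j \<le> n \<Longrightarrow> l \<le> n \<Longrightarrow>
    strip (ext n r \<sigma> i) (ext n r \<sigma> j) (ext n r \<sigma> l) = strip (\<sigma> i) (\<sigma> j) (\<sigma> l)"
  by (simp add: strip_def)

text \<open>Relative to the old pair the appended entry lies in the row given by
  \<open>strip\<close> at \<open>r\<close> itself, and it always lies in the right column. Only the
  shading of that column can destroy the occurrence.\<close>

lemma occ_ext_old:
  assumes "j \<le> n"
  shows "occ R (Suc n) (ext n r \<sigma>) i j \<longleftrightarrow> occ R n \<sigma> i j \<and> (2, strip (\<sigma> i) (\<sigma> j) r) \<notin> R"
proof (cases "1 \<le> i \<and> i < j")
  case True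
  then have "strip (ext n r \<sigma> i) (ext n r \<sigma> j) (Suc r) = strip (\<sigma> i) (\<sigma> j) r" "strip i j (Suc n) = 2"
    using assms by (auto simp: strip_def)
  moreover have "strip (ext n r \<sigma> i) (ext n r \<sigma> j) (ext n r \<sigma> l) = strip (\<sigma> i) (\<sigma> j) (\<sigma> l)" if "l \<in> {1..n}" for l
    using True assms that by (intro strip_ext) auto
  moreover have "{1..Suc n} = insert (Suc n) {1..n}" by auto
  ultimately show ?thesis using assms True by (auto simp: occ_def)
qed (auto simp: occ_def)

lemma occ_ext_new:
  "occ R (Suc n) (ext n r \<sigma>) i (Suc n) \<longleftrightarrow> 1 \<le> i \<and> i \<le> n \<and> \<sigma> i \<le> r \<and>
     (\<forall>l\<in>{1..n}. l \<noteq> i \<longrightarrow> (if l < i then 0 else 1, strip (\<sigma> i) (Suc r) (\<sigma> l)) \<notin> R)"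
proof (cases "1 \<le> i \<and> i \<le> n")
  case True
  then have "strip (ext n r \<sigma> i) (Suc r) (ext n r \<sigma> l) = strip (\<sigma> i) (Suc r) (\<sigma> l)"
    "strip i (Suc n) l = (if l < i then 0 else 1)" if "l \<in> {1..n}" for l
    using that by (auto simp: strip_def less_Suc_eq_le)
  moreover have "{1..Suc n} = insert (Suc n) {1..n}" by auto
  ultimately show ?thesis using True by (auto simp: occ_def)
qed (auto simp: occ_def)

lemma card_forb:
  assumes "\<sigma> i < \<sigma> j" "\<sigma> j \<le> n"
  shows "card (forb R n \<sigma> i j) = fsize R n \<sigma> i j"
proof -
  have "forb R n \<sigma> i j = (if (2, 0) \<in> R then {..<\<sigma> i} else {}) \<union> (if (2, 1) \<in> R then {\<sigma> i..<\<sigma> j} else {}) \<union>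
     (if (2, 2) \<in> R then {\<sigma> j..n} else {})"
    using assms by (auto simp: forb_def strip_def)
  also have "card \<dots> = fsize R n \<sigma> i j"
    unfolding fsize_def using assms
    by (subst card_Un_disjoint; (subst card_Un_disjoint)?) auto
  finally show ?thesis .
qed

text \<open>The new entry lands in an unshaded row of the right column, so only that row gains a
  slot and the shaded rows keep their sizes.\<close>

lemma fsize_ext:
  assumes "i \<le> n" "j \<le> n" "\<sigma> i < \<sigma> j" "\<sigma> j \<le> n" "r \<le> n" "(2, strip (\<sigma> i) (\<sigma> j) r) \<notin> R"
  shows "fsize R (Suc n) (ext n r \<sigma>) i j = fsize R n \<sigma> i j"
  using assms by (auto simp: fsize_def ext_def strip_def split: if_splits)

definition sizes :: "(nat \<times> nat) set \<Rightarrow> nat \<Rightarrow> (nat \<Rightarrow> nat) \<Rightarrow> nat set" where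
  "sizes R n \<sigma> = {fsize R n \<sigma> i j |i j. occ R n \<sigma> i j}"

definition new_sizes :: "(nat \<times> nat) set \<Rightarrow> nat \<Rightarrow> (nat \<Rightarrow> nat) \<Rightarrow> nat \<Rightarrow> nat set" where
  "new_sizes R n \<sigma> r = {fsize R (Suc n) (ext n r \<sigma>) i (Suc n) |i. occ R (Suc n) (ext n r \<sigma>) i (Suc n)}"

lemma sizes_empty: "sizes R n \<sigma> = {} \<longleftrightarrow> (\<nexists>i j. occ R n \<sigma> i j)"
  by (auto simp: sizes_def)

lemma sizes_0: "sizes R 0 \<sigma> = {}"
  by (auto simp: sizes_def occ_def)

text \<open>\<open>\<pi>\<close> is the rank of the slot \<open>r\<close>. An old occurrence
  survives exactly if \<open>r\<close> is outside its slot set, i.e. if the size of the set is at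
  most the rank, and its size is then unchanged.\<close>

lemma sizes_ext:
  assumes \<sigma>: "\<sigma> \<in> perms n" and r: "r \<le> n"
    and \<pi>: "\<And>i j. occ R n \<sigma> i j \<Longrightarrow> r \<in> forb R n \<sigma> i j \<longleftrightarrow> \<pi> < card (forb R n \<sigma> i j)"
  shows "sizes R (Suc n) (ext n r \<sigma>) = {f \<in> sizes R n \<sigma>. f \<le> \<pi>} \<union> new_sizes R n \<sigma> r"
proof -
  have o: "i \<le> n" "j \<le> n" "\<sigma> i < \<sigma> j" "\<sigma> j \<le> n" if "occ R n \<sigma> i j" for i j
    using that perms_len[OF \<sigma>, of j] by (auto simp: occ_def)
  have k: "(2, strip (\<sigma> i) (\<sigma> j) r) \<notin> R \<longleftrightarrow> fsize R n \<sigma> i j \<le> \<pi>" if "occ R n \<sigma> i j" for i j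
    using \<pi>[OF that] card_forb[of \<sigma> i j n R] o[OF that] r by (auto simp: forb_def)
  have s: "occ R (Suc n) (ext n r \<sigma>) i j \<Longrightarrow> j \<le> n \<or> j = Suc n" for i j by (auto simp: occ_def)
  have "sizes R (Suc n) (ext n r \<sigma>) =
     {fsize R (Suc n) (ext n r \<sigma>) i j |i j. j \<le> n \<and> occ R (Suc n) (ext n r \<sigma>) i j} \<union> new_sizes R n \<sigma> r"
    unfolding sizes_def new_sizes_def using s by blast
  also have "{fsize R (Suc n) (ext n r \<sigma>) i j |i j. j \<le> n \<and> occ R (Suc n) (ext n r \<sigma>) i j} =
     {fsize R n \<sigma> i j |i j. occ R n \<sigma> i j \<and> fsize R n \<sigma> i j \<le> \<pi>}"
  proof -
    have "(f = fsize R (Suc n) (ext n r \<sigma>) i j \<and> j \<le> n \<and> occ R (Suc n) (ext n r \<sigma>) i j) \<longleftrightarrow>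
       (f = fsize R n \<sigma> i j \<and> occ R n \<sigma> i j \<and> fsize R n \<sigma> i j \<le> \<pi>)" for f i j
      using occ_ext_old[of j n R r \<sigma> i] o[of i j] k[of i j] fsize_ext[of i n j \<sigma> r R] r by metis
    then show ?thesis by auto
  qed
  also have "\<dots> = {f \<in> sizes R n \<sigma>. f \<le> \<pi>}" by (auto simp: sizes_def)
  finally show ?thesis .
qed

lemma weq_realises:
  assumes "realises (\<lambda>n \<sigma>. (a n \<sigma>, sizes R n \<sigma>)) \<delta> l0" "realises (\<lambda>n \<sigma>. (a' n \<sigma>, sizes R' n \<sigma>)) \<delta> l0"
  shows "weq R R'"
  unfolding weq_def av_def using realises_card[OF assms, where P = "\<lambda>l. snd l = {}"]
  by (simp add: sizes_empty)

text \<open>Chains of slot sets can be enumerated compatibly, so that a slot is described by its rank alone.\<close>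

lemma chain_slots:
  assumes \<sigma>: "\<sigma> \<in> perms n"
    and nest: "\<And>i j k l. occ R n \<sigma> i j \<Longrightarrow> occ R n \<sigma> k l \<Longrightarrow>
      forb R n \<sigma> i j \<subseteq> forb R n \<sigma> k l \<or> forb R n \<sigma> k l \<subseteq> forb R n \<sigma> i j"
    and X: "\<And>A. A \<in> \<X> \<Longrightarrow> A \<subseteq> {..n}"
      "\<And>A B. A \<in> \<X> \<Longrightarrow> B \<in> \<X> \<Longrightarrow> A \<subseteq> B \<or> B \<subseteq> A"
      "\<And>A i j. A \<in> \<X> \<Longrightarrow> occ R n \<sigma> i j \<Longrightarrow> A \<subseteq> forb R n \<sigma> i j \<or> forb R n \<sigma> i j \<subseteq> A"
  obtains \<pi> where "bij_betw \<pi> {..n} {..n}"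
    "\<And>A r. A \<in> \<X> \<Longrightarrow> r \<le> n \<Longrightarrow> r \<in> A \<longleftrightarrow> \<pi> r < card A"
    "\<And>r. r \<le> n \<Longrightarrow> sizes R (Suc n) (ext n r \<sigma>) = {f \<in> sizes R n \<sigma>. f \<le> \<pi> r} \<union> new_sizes R n \<sigma> r"
proof -
  \<comment> \<open>The sets in \<open>\<X>\<close> join the chain so that the rank also decides
    membership in them, for instance whether the slot creates a new occurrence.\<close>
  define \<I> where "\<I> = \<X> \<union> {forb R n \<sigma> i j |i j. occ R n \<sigma> i j}"
  have sub: "\<Union>\<I> \<subseteq> {..n}" using X(1) by (auto simp: \<I>_def forb_def)
  then have "finite \<I>" by (meson Sup_le_iff PowI finite_Pow_iff finite_atMost finite_subset subsetI)
  moreover have "A \<subseteq> B \<or> B \<subseteq> A" if "A \<in> \<I>" "B \<in> \<I>" for A B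
    using that nest X(2,3) unfolding \<I>_def by blast
  ultimately obtain \<pi> where \<pi>: "bij_betw \<pi> {..n} {..<card {..n}}" "\<forall>A\<in>\<I>. \<forall>r\<in>{..n}. r \<in> A \<longleftrightarrow> \<pi> r < card A"
    using chain_enum[of \<I> "{..n}"] sub by auto
  show ?thesis
  proof
    show "bij_betw \<pi> {..n} {..n}" using \<pi>(1) by (simp add: lessThan_Suc_atMost)
    show "r \<in> A \<longleftrightarrow> \<pi> r < card A" if "A \<in> \<X>" "r \<le> n" for A r using \<pi>(2) that by (auto simp: \<I>_def)
    show "sizes R (Suc n) (ext n r \<sigma>) = {f \<in> sizes R n \<sigma>. f \<le> \<pi> r} \<union> new_sizes R n \<sigma> r" if "r \<le> n" for r
      by (rule sizes_ext[OF \<sigma> that]) (use \<pi>(2) that in \<open>auto simp: \<I>_def\<close>)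
  qed
qed

text \<open>Strict inequalities make the conditions vacuous at the two values of the pair
  themselves, so no exception for its own points is needed.\<close>

definition clear :: "(nat \<times> nat) set \<Rightarrow> nat \<Rightarrow> nat \<Rightarrow> nat \<Rightarrow> nat \<Rightarrow> bool" where
  "clear R x a b v \<longleftrightarrow> (v < a \<longrightarrow> (x, 0) \<notin> R) \<and> (a < v \<longrightarrow> v < b \<longrightarrow> (x, 1) \<notin> R) \<and> (b < v \<longrightarrow> (x, 2) \<notin> R)"

lemma clear_strip: "a < b \<Longrightarrow> v \<noteq> a \<Longrightarrow> v \<noteq> b \<Longrightarrow> clear R x a b v \<longleftrightarrow> (x, strip a b v) \<notin> R"
  by (auto simp: clear_def strip_def)

lemma occ_cols:
  assumes \<sigma>: "\<sigma> \<in> perms n"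
  shows "occ R n \<sigma> i j \<longleftrightarrow> 1 \<le> i \<and> i < j \<and> j \<le> n \<and> \<sigma> i < \<sigma> j \<and>
     (\<forall>l. 1 \<le> l \<longrightarrow> l < i \<longrightarrow> clear R 0 (\<sigma> i) (\<sigma> j) (\<sigma> l)) \<and>
     (\<forall>l. i < l \<longrightarrow> l < j \<longrightarrow> clear R 1 (\<sigma> i) (\<sigma> j) (\<sigma> l)) \<and>
     (\<forall>l. j < l \<longrightarrow> l \<le> n \<longrightarrow> clear R 2 (\<sigma> i) (\<sigma> j) (\<sigma> l))" (is "_ \<longleftrightarrow> ?r")
proof (cases "1 \<le> i \<and> i < j \<and> j \<le> n \<and> \<sigma> i < \<sigma> j")
  case True
  have *: "clear R x (\<sigma> i) (\<sigma> j) (\<sigma> l) \<longleftrightarrow> (x, strip (\<sigma> i) (\<sigma> j) (\<sigma> l)) \<notin> R" if "l \<noteq> i" "l \<noteq> j" for x l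
    using that True perms_inj[OF \<sigma>] by (intro clear_strip) auto
  have s: "strip i j l = (if l < i then 0 else if l < j then 1 else 2)" for l by (simp add: strip_def)
  show ?thesis
  proof
    assume "occ R n \<sigma> i j"
    then have o: "l \<in> {1..n} \<Longrightarrow> l \<noteq> i \<Longrightarrow> l \<noteq> j \<Longrightarrow> (strip i j l, strip (\<sigma> i) (\<sigma> j) (\<sigma> l)) \<notin> R" for l
      unfolding occ_def by blast
    have "clear R 0 (\<sigma> i) (\<sigma> j) (\<sigma> l)" if "1 \<le> l" "l < i" for l
      using o[of l] *[of l] that True by (simp add: s)
    moreover have "clear R 1 (\<sigma> i) (\<sigma> j) (\<sigma> l)" if "i < l" "l < j" for l
      using o[of l] *[of l] that True by (simp add: s)
    moreover have "clear R 2 (\<sigma> i) (\<sigma> j) (\<sigma> l)" if "j < l" "l \<le> n" for l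
      using o[of l] *[of l] that True by (simp add: s)
    ultimately show ?r using True by blast
  next
    assume ?r
    then show "occ R n \<sigma> i j" using True * unfolding occ_def s by (metis atLeastAtMost_iff linorder_neqE_nat)
  qed
qed (auto simp: occ_def)

lemma occ_len:
  assumes "\<sigma> \<in> perms n" "occ R n \<sigma> i j"
  shows "1 \<le> i" "i < j" "j \<le> n" "\<sigma> i < \<sigma> j" "1 \<le> \<sigma> i" "\<sigma> j \<le> n"
  using assms perms_ge1[OF assms(1), of i] perms_len[OF assms(1), of j] by (auto simp: occ_def)

lemma occ_clear:
  assumes "\<sigma> \<in> perms n" "occ R n \<sigma> i j"
  shows "1 \<le> l \<Longrightarrow> l < i \<Longrightarrow> clear R 0 (\<sigma> i) (\<sigma> j) (\<sigma> l)"
    "i < l \<Longrightarrow> l < j \<Longrightarrow> clear R 1 (\<sigma> i) (\<sigma> j) (\<sigma> l)"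
    "j < l \<Longrightarrow> l \<le> n \<Longrightarrow> clear R 2 (\<sigma> i) (\<sigma> j) (\<sigma> l)"
  using assms(2) unfolding occ_cols[OF assms(1)] by blast+

lemma occI:
  assumes "\<sigma> \<in> perms n" "1 \<le> i" "i < j" "j \<le> n" "\<sigma> i < \<sigma> j"
    "\<And>l. 1 \<le> l \<Longrightarrow> l < i \<Longrightarrow> clear R 0 (\<sigma> i) (\<sigma> j) (\<sigma> l)"
    "\<And>l. i < l \<Longrightarrow> l < j \<Longrightarrow> clear R 1 (\<sigma> i) (\<sigma> j) (\<sigma> l)"
    "\<And>l. j < l \<Longrightarrow> l \<le> n \<Longrightarrow> clear R 2 (\<sigma> i) (\<sigma> j) (\<sigma> l)"
  shows "occ R n \<sigma> i j"
  unfolding occ_cols[OF assms(1)] using assms(2-) by blast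

text \<open>The version of \<open>clear\<close> for occurrences ending in the new entry, expressed
  by the old values: an old \<open>v\<close> lies below the new entry exactly if
  \<open>v \<le> r\<close>.\<close>

definition nclear :: "(nat \<times> nat) set \<Rightarrow> nat \<Rightarrow> nat \<Rightarrow> nat \<Rightarrow> nat \<Rightarrow> bool" where
  "nclear R x a r v \<longleftrightarrow> (v < a \<longrightarrow> (x, 0) \<notin> R) \<and> (a < v \<longrightarrow> v \<le> r \<longrightarrow> (x, 1) \<notin> R) \<and> (r < v \<longrightarrow> (x, 2) \<notin> R)"

lemma nclear_strip: "a \<le> r \<Longrightarrow> v \<noteq> a \<Longrightarrow> nclear R x a r v \<longleftrightarrow> (x, strip a (Suc r) v) \<notin> R"
  by (auto simp: nclear_def strip_def)

lemma occ_new_len: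
  assumes "occ R (Suc n) (ext n r \<sigma>) i (Suc n)"
  shows "1 \<le> i" "i \<le> n" "\<sigma> i \<le> r"
  using assms by (auto simp: occ_ext_new)

lemma occ_new_clear:
  assumes \<sigma>: "\<sigma> \<in> perms n" and o: "occ R (Suc n) (ext n r \<sigma>) i (Suc n)"
  shows "1 \<le> l \<Longrightarrow> l < i \<Longrightarrow> nclear R 0 (\<sigma> i) r (\<sigma> l)"
    "i < l \<Longrightarrow> l \<le> n \<Longrightarrow> nclear R 1 (\<sigma> i) r (\<sigma> l)"
proof -
  have *: "1 \<le> l \<Longrightarrow> l \<le> n \<Longrightarrow> l \<noteq> i \<Longrightarrow> (if l < i then 0 else 1, strip (\<sigma> i) (Suc r) (\<sigma> l)) \<notin> R" for l
    using o unfolding occ_ext_new by (meson atLeastAtMost_iff)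
  show "1 \<le> l \<Longrightarrow> l < i \<Longrightarrow> nclear R 0 (\<sigma> i) r (\<sigma> l)"
    using *[of l] occ_new_len[OF o] nclear_strip[of "\<sigma> i" r "\<sigma> l" R 0] perms_inj[OF \<sigma>, of l i] by auto
  show "i < l \<Longrightarrow> l \<le> n \<Longrightarrow> nclear R 1 (\<sigma> i) r (\<sigma> l)"
    using *[of l] occ_new_len[OF o] nclear_strip[of "\<sigma> i" r "\<sigma> l" R 1] perms_inj[OF \<sigma>, of l i] by auto
qed

lemma occ_newI:
  assumes \<sigma>: "\<sigma> \<in> perms n" and i: "1 \<le> i" "i \<le> n" "\<sigma> i \<le> r"
    and 0: "\<And>l. 1 \<le> l \<Longrightarrow> l < i \<Longrightarrow> nclear R 0 (\<sigma> i) r (\<sigma> l)"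
    and 1: "\<And>l. i < l \<Longrightarrow> l \<le> n \<Longrightarrow> nclear R 1 (\<sigma> i) r (\<sigma> l)"
  shows "occ R (Suc n) (ext n r \<sigma>) i (Suc n)"
  unfolding occ_ext_new
proof (intro conjI ballI impI i)
  fix l assume l: "l \<in> {1..n}" "l \<noteq> i"
  then have ne: "\<sigma> l \<noteq> \<sigma> i" using perms_inj[OF \<sigma>] by auto
  show "(if l < i then 0 else 1, strip (\<sigma> i) (Suc r) (\<sigma> l)) \<notin> R"
  proof (cases "l < i")
    case True
    then show ?thesis using 0[of l] nclear_strip[OF i(3) ne, of R 0] l by simp
  next
    case False
    then have "nclear R 1 (\<sigma> i) r (\<sigma> l)" using 1[of l] l by simp
    then show ?thesis using nclear_strip[OF i(3) ne, of R 1] False by simp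
  qed
qed

lemma mem_forb:
  "\<sigma> i < \<sigma> j \<Longrightarrow> r \<in> forb R n \<sigma> i j \<longleftrightarrow> r \<le> n \<and> (r < \<sigma> i \<longrightarrow> (2, 0) \<in> R) \<and>
     (\<sigma> i \<le> r \<longrightarrow> r < \<sigma> j \<longrightarrow> (2, 1) \<in> R) \<and> (\<sigma> j \<le> r \<longrightarrow> (2, 2) \<in> R)"
  by (auto simp: forb_def strip_def)

lemma sizes_1: "sizes R (Suc 0) \<sigma> = {}"
  by (auto simp: sizes_def occ_def)

lemma perms_pos: "\<sigma> \<in> perms n \<Longrightarrow> 1 \<le> v \<Longrightarrow> v \<le> n \<Longrightarrow> \<exists>i. 1 \<le> i \<and> i \<le> n \<and> \<sigma> i = v"
  using perms_surj[of \<sigma> n v] by auto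

section \<open>Slots relative to the minimum\<close>

definition pos1 :: "nat \<Rightarrow> (nat \<Rightarrow> nat) \<Rightarrow> nat" where
  "pos1 n \<sigma> = (THE t. 1 \<le> t \<and> t \<le> n \<and> \<sigma> t = 1)"

lemma pos1:
  assumes "\<sigma> \<in> perms n" "1 \<le> n"
  shows "1 \<le> pos1 n \<sigma>" "pos1 n \<sigma> \<le> n" "\<sigma> (pos1 n \<sigma>) = 1"
proof -
  obtain t where t: "1 \<le> t" "t \<le> n" "\<sigma> t = 1" using perms_pos[OF assms(1), of 1] assms(2) by auto
  have "pos1 n \<sigma> = t" unfolding pos1_def
    by (rule the_equality) (use t perms_inj[OF assms(1)] in metis)+
  then show "1 \<le> pos1 n \<sigma>" "pos1 n \<sigma> \<le> n" "\<sigma> (pos1 n \<sigma>) = 1" using t by auto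
qed

lemma pos1_unique: "\<sigma> \<in> perms n \<Longrightarrow> 1 \<le> n \<Longrightarrow> \<sigma> t = 1 \<Longrightarrow> t = pos1 n \<sigma>"
  using pos1(3)[of \<sigma> n] perms_inj[of \<sigma> n] by metis

lemma pos1_ext:
  assumes \<sigma>: "\<sigma> \<in> perms n" and n: "1 \<le> n" and r: "r \<le> n"
  shows "pos1 (Suc n) (ext n r \<sigma>) = (if r = 0 then Suc n else pos1 n \<sigma>)"
proof -
  have "ext n r \<sigma> (if r = 0 then Suc n else pos1 n \<sigma>) = 1"
    using pos1[OF \<sigma> n] by (simp add: ext_def)
  then show ?thesis using pos1_unique[OF ext_perms[OF \<sigma> r]] by simp
qed

text \<open>Pair the entry 1 with a new last entry at a slot \<open>r \<ge> 1\<close>. Cell (0,1) is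
  then occupied exactly if \<open>r\<close> is in \<open>mzone\<close>, and cell (0,2) exactly if
  \<open>r\<close> is in \<open>mzone'\<close>.\<close>

definition mzone :: "nat \<Rightarrow> (nat \<Rightarrow> nat) \<Rightarrow> nat set" where
  "mzone n \<sigma> = {r. r \<le> n \<and> (\<exists>l. 1 \<le> l \<and> l < pos1 n \<sigma> \<and> \<sigma> l \<le> r)}"

definition mzone' :: "nat \<Rightarrow> (nat \<Rightarrow> nat) \<Rightarrow> nat set" where
  "mzone' n \<sigma> = {r. 1 \<le> r \<and> r \<le> n \<and> (\<exists>l. 1 \<le> l \<and> l < pos1 n \<sigma> \<and> r < \<sigma> l)}"

lemma mzone_eq:
  assumes \<sigma>: "\<sigma> \<in> perms n" and n: "1 \<le> n"
  obtains "pos1 n \<sigma> = 1" "mzone n \<sigma> = {}"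
    | l where "1 \<le> l" "l < pos1 n \<sigma>" "\<And>k. 1 \<le> k \<Longrightarrow> k < pos1 n \<sigma> \<Longrightarrow> \<sigma> l \<le> \<sigma> k" "mzone n \<sigma> = {\<sigma> l..n}"
proof (cases "pos1 n \<sigma> = 1")
  case True
  then show ?thesis using that(1) by (auto simp: mzone_def)
next
  case False
  let ?S = "\<sigma> ` {1..<pos1 n \<sigma>}"
  have "Min ?S \<in> ?S" using False pos1[OF \<sigma> n] by (intro Min_in) auto
  then obtain l where l: "l \<in> {1..<pos1 n \<sigma>}" "\<sigma> l = Min ?S" by (metis imageE)
  have le: "\<sigma> l \<le> \<sigma> k" if "1 \<le> k" "k < pos1 n \<sigma>" for k
    unfolding l(2) using that by (intro Min_le) auto
  have "mzone n \<sigma> = {\<sigma> l..n}" using l(1) le by (fastforce simp: mzone_def)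
  then show ?thesis using that(2)[of l] l(1) le by auto
qed

lemma mzone'_eq:
  assumes \<sigma>: "\<sigma> \<in> perms n" and n: "1 \<le> n"
  obtains "pos1 n \<sigma> = 1" "mzone' n \<sigma> = {}"
    | l where "1 \<le> l" "l < pos1 n \<sigma>" "\<And>k. 1 \<le> k \<Longrightarrow> k < pos1 n \<sigma> \<Longrightarrow> \<sigma> k \<le> \<sigma> l" "mzone' n \<sigma> = {1..<\<sigma> l}"
proof (cases "pos1 n \<sigma> = 1")
  case True
  then show ?thesis using that(1) by (auto simp: mzone'_def)
next
  case False
  let ?S = "\<sigma> ` {1..<pos1 n \<sigma>}"
  have "Max ?S \<in> ?S" using False pos1[OF \<sigma> n] by (intro Max_in) auto
  then obtain l where l: "l \<in> {1..<pos1 n \<sigma>}" "\<sigma> l = Max ?S" by (metis imageE)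
  have le: "\<sigma> k \<le> \<sigma> l" if "1 \<le> k" "k < pos1 n \<sigma>" for k
    unfolding l(2) using that by (intro Max_ge) auto
  have "\<sigma> l \<le> n" using perms_len[OF \<sigma>, of l] l(1) pos1[OF \<sigma> n] by auto
  then have "mzone' n \<sigma> = {1..<\<sigma> l}" using l(1) le by (fastforce simp: mzone'_def)
  then show ?thesis using that(2)[of l] l(1) le by auto
qed

text \<open>Slot 0 makes the new last entry the minimum, and all other entries then lie to its
  left.\<close>

lemma mzone_ext0:
  assumes \<sigma>: "\<sigma> \<in> perms n" and n: "1 \<le> n"
  shows "mzone (Suc n) (ext n 0 \<sigma>) = {2..Suc n}" "mzone' (Suc n) (ext n 0 \<sigma>) = {1..n}"
proof -
  have p: "pos1 (Suc n) (ext n 0 \<sigma>) = Suc n" using pos1_ext[OF \<sigma> n, of 0] by simp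
  have e: "ext n 0 \<sigma> l = Suc (\<sigma> l)" if "1 \<le> l" "l \<le> n" for l
    using that perms_ge1[OF \<sigma>, of l] by (simp add: ext_def)
  obtain a where a: "1 \<le> a" "a \<le> n" "\<sigma> a = 1" using perms_pos[OF \<sigma>, of 1] n by auto
  obtain b where b: "1 \<le> b" "b \<le> n" "\<sigma> b = n" using perms_pos[OF \<sigma>, of n] n by auto
  show "mzone (Suc n) (ext n 0 \<sigma>) = {2..Suc n}"
  proof (intro equalityI subsetI)
    fix x assume "x \<in> mzone (Suc n) (ext n 0 \<sigma>)"
    then show "x \<in> {2..Suc n}" using e perms_ge1[OF \<sigma>] by (fastforce simp: mzone_def p)
  next
    fix x assume "x \<in> {2..Suc n}"
    then show "x \<in> mzone (Suc n) (ext n 0 \<sigma>)" using e[of a] a unfolding mzone_def p by (auto intro!: exI[of _ a])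
  qed
  show "mzone' (Suc n) (ext n 0 \<sigma>) = {1..n}"
  proof (intro equalityI subsetI)
    fix x assume "x \<in> mzone' (Suc n) (ext n 0 \<sigma>)"
    then obtain l where "1 \<le> x" "1 \<le> l" "l \<le> n" "x < ext n 0 \<sigma> l" by (auto simp: mzone'_def p)
    then show "x \<in> {1..n}" using e[of l] perms_len[OF \<sigma>, of l] by simp
  next
    fix x assume "x \<in> {1..n}"
    then show "x \<in> mzone' (Suc n) (ext n 0 \<sigma>)" using e[of b] b unfolding mzone'_def p by (auto intro!: exI[of _ b])
  qed
qed

text \<open>For \<open>r \<noteq> 0\<close> the entries left of 1 stay the same, and the final
  segment of slots above their minimum gains a slot exactly if the insertion happens inside
  it.\<close>

lemma card_mzone_ext:
  assumes \<sigma>: "\<sigma> \<in> perms n" and n: "1 \<le> n" and r: "r \<le> n"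
  shows "card (mzone (Suc n) (ext n r \<sigma>)) =
    (if r = 0 then n else if r \<in> mzone n \<sigma> then Suc (card (mzone n \<sigma>)) else card (mzone n \<sigma>))"
proof (cases "r = 0")
  case True
  then show ?thesis using mzone_ext0(1)[OF \<sigma> n] by simp
next
  case False
  then have p: "pos1 (Suc n) (ext n r \<sigma>) = pos1 n \<sigma>" using pos1_ext[OF \<sigma> n r] by simp
  show ?thesis
  proof (cases rule: mzone_eq[OF \<sigma> n])
    case 1
    then have "mzone (Suc n) (ext n r \<sigma>) = {}" by (auto simp: mzone_def p)
    then show ?thesis using 1 False by simp
  next
    case (2 l)
    have ln: "l \<le> n" using 2(2) pos1(2)[OF \<sigma> n] by simp
    have le: "ext n r \<sigma> l \<le> ext n r \<sigma> k" if "1 \<le> k" "k < pos1 n \<sigma>" for k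
      using 2(3)[OF that] pos1(2)[OF \<sigma> n] that ln by (simp add: ext_def)
    have "mzone (Suc n) (ext n r \<sigma>) = {ext n r \<sigma> l..Suc n}"
      using 2(1,2) le unfolding mzone_def p by fastforce
    then show ?thesis using 2(4) False ln perms_len[OF \<sigma> 2(1) ln] r by (auto simp: ext_def)
  qed
qed

lemma card_mzone'_ext:
  assumes \<sigma>: "\<sigma> \<in> perms n" and n: "1 \<le> n" and r: "r \<le> n"
  shows "card (mzone' (Suc n) (ext n r \<sigma>)) =
    (if r = 0 then n else if r \<in> mzone' n \<sigma> then Suc (card (mzone' n \<sigma>)) else card (mzone' n \<sigma>))"
proof (cases "r = 0")
  case True
  then show ?thesis using mzone_ext0(2)[OF \<sigma> n] by simp
next
  case False
  then have p: "pos1 (Suc n) (ext n r \<sigma>) = pos1 n \<sigma>" using pos1_ext[OF \<sigma> n r] by simp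
  show ?thesis
  proof (cases rule: mzone'_eq[OF \<sigma> n])
    case 1
    then have "mzone' (Suc n) (ext n r \<sigma>) = {}" by (auto simp: mzone'_def p)
    then show ?thesis using 1 False by simp
  next
    case (2 l)
    have ln: "l \<le> n" using 2(2) pos1(2)[OF \<sigma> n] by simp
    have le: "ext n r \<sigma> k \<le> ext n r \<sigma> l" if "1 \<le> k" "k < pos1 n \<sigma>" for k
      using 2(3)[OF that] pos1(2)[OF \<sigma> n] that ln by (simp add: ext_def)
    have "ext n r \<sigma> l \<le> Suc n" using perms_len[OF \<sigma> 2(1) ln] ln by (simp add: ext_def)
    then have "mzone' (Suc n) (ext n r \<sigma>) = {1..<ext n r \<sigma> l}"
      using 2(1,2) le unfolding mzone'_def p by fastforce
    then show ?thesis using 2(4) False ln perms_ge1[OF \<sigma> 2(1) ln] by (auto simp: ext_def)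
  qed
qed

section \<open>Inversion codes\<close>

text \<open>\<open>rcode \<sigma> i\<close> is the slot at which the \<open>i\<close>-th entry is
  inserted in the generating tree. \<open>bcode\<close> is the usual inversion table; the two add up
  to \<open>i - 1\<close>.\<close>

definition rcode :: "(nat \<Rightarrow> nat) \<Rightarrow> nat \<Rightarrow> nat" where
  "rcode \<sigma> i = card {l. 1 \<le> l \<and> l < i \<and> \<sigma> l < \<sigma> i}"

definition bcode :: "(nat \<Rightarrow> nat) \<Rightarrow> nat \<Rightarrow> nat" where
  "bcode \<sigma> i = card {l. 1 \<le> l \<and> l < i \<and> \<sigma> i < \<sigma> l}"

definition codes :: "nat \<Rightarrow> (nat \<Rightarrow> nat) set" where
  "codes n = (\<Pi>\<^sub>E i\<in>{1..n}. {..<i})"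

lemma finite_codes [simp]: "finite (codes n)"
  unfolding codes_def by (intro finite_PiE) auto

lemma card_codes: "card (codes n) = fact n"
  unfolding codes_def by (simp add: card_PiE fact_prod)

lemma rcode_bcode:
  assumes "\<sigma> \<in> perms n" "1 \<le> i"
  shows "rcode \<sigma> i + bcode \<sigma> i = i - 1"
proof -
  have ne: "l < i \<Longrightarrow> \<sigma> l < \<sigma> i \<or> \<sigma> i < \<sigma> l" for l using perms_inj[OF assms(1), of l i] by auto
  have "{1..<i} = {l. 1 \<le> l \<and> l < i \<and> \<sigma> l < \<sigma> i} \<union> {l. 1 \<le> l \<and> l < i \<and> \<sigma> i < \<sigma> l}"
    by (auto dest: ne)
  moreover have "card ({l. 1 \<le> l \<and> l < i \<and> \<sigma> l < \<sigma> i} \<union> {l. 1 \<le> l \<and> l < i \<and> \<sigma> i < \<sigma> l}) = rcode \<sigma> i + bcode \<sigma> i"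
    unfolding rcode_def bcode_def by (rule card_Un_disjoint) auto
  ultimately show ?thesis by (metis card_atLeastLessThan)
qed

lemma rcode_ext: "i \<le> n \<Longrightarrow> rcode (ext n r \<sigma>) i = rcode \<sigma> i"
proof -
  assume i: "i \<le> n"
  have "{l. 1 \<le> l \<and> l < i \<and> ext n r \<sigma> l < ext n r \<sigma> i} = {l. 1 \<le> l \<and> l < i \<and> \<sigma> l < \<sigma> i}"
    using i by auto
  then show ?thesis by (simp add: rcode_def)
qed

lemma rcode_ext_last:
  assumes \<sigma>: "\<sigma> \<in> perms n" and r: "r \<le> n"
  shows "rcode (ext n r \<sigma>) (Suc n) = r"
proof -
  have "{l. 1 \<le> l \<and> l < Suc n \<and> ext n r \<sigma> l < ext n r \<sigma> (Suc n)} = {l. 1 \<le> l \<and> l \<le> n \<and> \<sigma> l \<le> r}"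
    by (auto simp: less_Suc_eq_le)
  moreover have "bij_betw \<sigma> {l. 1 \<le> l \<and> l \<le> n \<and> \<sigma> l \<le> r} {1..r}"
    unfolding bij_betw_def
  proof
    show "inj_on \<sigma> {l. 1 \<le> l \<and> l \<le> n \<and> \<sigma> l \<le> r}" using perms_inj[OF \<sigma>] by (auto simp: inj_on_def)
    show "\<sigma> ` {l. 1 \<le> l \<and> l \<le> n \<and> \<sigma> l \<le> r} = {1..r}"
    proof (intro equalityI subsetI)
      fix v assume "v \<in> \<sigma> ` {l. 1 \<le> l \<and> l \<le> n \<and> \<sigma> l \<le> r}"
      then obtain l where "1 \<le> l" "l \<le> n" "\<sigma> l \<le> r" "v = \<sigma> l" by auto
      then show "v \<in> {1..r}" using perms_ge1[OF \<sigma>, of l] by simp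
    next
      fix v assume v: "v \<in> {1..r}"
      have "\<exists>l. 1 \<le> l \<and> l \<le> n \<and> \<sigma> l = v" by (rule perms_pos[OF \<sigma>]) (use v r in auto)
      then show "v \<in> \<sigma> ` {l. 1 \<le> l \<and> l \<le> n \<and> \<sigma> l \<le> r}" using v by auto
    qed
  qed
  ultimately show ?thesis unfolding rcode_def using bij_betw_same_card by fastforce
qed

text \<open>The last coordinate is the slot of the last entry, so peeling off last entries recovers
  the permutation. Surjectivity follows since both sets have \<open>n!\<close> elements.\<close>

lemma bij_rcode: "bij_betw (\<lambda>\<sigma>. restrict (rcode \<sigma>) {1..n}) (perms n) (codes n)"
proof -
  have inj: "\<sigma> = \<tau>" if "\<sigma> \<in> perms n" "\<tau> \<in> perms n" "\<And>i. 1 \<le> i \<Longrightarrow> i \<le> n \<Longrightarrow> rcode \<sigma> i = rcode \<tau> i" for \<sigma> \<tau>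
    using that
  proof (induction n arbitrary: \<sigma> \<tau>)
    case 0
    then show ?case by (simp add: perms_0)
  next
    case (Suc n)
    obtain \<sigma>' r where s: "\<sigma>' \<in> perms n" "r \<le> n" "\<sigma> = ext n r \<sigma>'" using Suc.prems(1) by (rule perms_SucE)
    obtain \<tau>' t where t: "\<tau>' \<in> perms n" "t \<le> n" "\<tau> = ext n t \<tau>'" using Suc.prems(2) by (rule perms_SucE)
    have "r = t" using Suc.prems(3)[of "Suc n"] s t by (simp add: rcode_ext_last)
    moreover have "\<sigma>' = \<tau>'"
    proof (rule Suc.IH[OF s(1) t(1)])
      fix i assume "1 \<le> i" "i \<le> n"
      then show "rcode \<sigma>' i = rcode \<tau>' i" using Suc.prems(3)[of i] s t by (simp add: rcode_ext)
    qed
    ultimately show ?case using s t by simp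
  qed
  have i: "inj_on (\<lambda>\<sigma>. restrict (rcode \<sigma>) {1..n}) (perms n)"
  proof (rule inj_onI)
    fix \<sigma> \<tau> assume a: "\<sigma> \<in> perms n" "\<tau> \<in> perms n" "restrict (rcode \<sigma>) {1..n} = restrict (rcode \<tau>) {1..n}"
    show "\<sigma> = \<tau>" by (rule inj[OF a(1,2)]) (metis a(3) atLeastAtMost_iff restrict_apply')
  qed
  have "(\<lambda>\<sigma>. restrict (rcode \<sigma>) {1..n}) ` perms n \<subseteq> codes n"
  proof clarify
    fix \<sigma> assume \<sigma>: "\<sigma> \<in> perms n"
    have "rcode \<sigma> i < i" if "1 \<le> i" for i using rcode_bcode[OF \<sigma> that] that by simp
    then show "restrict (rcode \<sigma>) {1..n} \<in> codes n" by (auto simp: codes_def)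
  qed
  then have "(\<lambda>\<sigma>. restrict (rcode \<sigma>) {1..n}) ` perms n = codes n"
    by (rule card_subset_eq[OF finite_codes]) (simp only: card_image[OF i] card_perms card_codes)
  then show ?thesis using i by (simp add: bij_betw_def)
qed

lemma card_rcode:
  assumes "\<And>\<sigma>. \<sigma> \<in> perms n \<Longrightarrow> P \<sigma> \<longleftrightarrow> Q (restrict (rcode \<sigma>) {1..n})"
  shows "card {\<sigma> \<in> perms n. P \<sigma>} = card {c \<in> codes n. Q c}"
proof -
  have "bij_betw (\<lambda>\<sigma>. restrict (rcode \<sigma>) {1..n}) {\<sigma> \<in> perms n. P \<sigma>} {c \<in> codes n. Q c}"
    by (rule bij_betw_Collect[OF bij_rcode]) (simp add: assms)
  then show ?thesis by (rule bij_betw_same_card)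
qed

lemma bij_flip_codes: "bij_betw (\<lambda>c. restrict (\<lambda>i. i - 1 - c i) {1..n}) (codes n) (codes n)"
proof -
  have *: "restrict (\<lambda>i. i - 1 - restrict (\<lambda>i. i - 1 - c i) {1..n} i) {1..n} = c" if "c \<in> codes n" for c
  proof
    fix i
    show "restrict (\<lambda>i. i - 1 - restrict (\<lambda>i. i - 1 - c i) {1..n} i) {1..n} i = c i"
    proof (cases "i \<in> {1..n}")
      case True
      then have "c i < i" using that by (auto simp: codes_def PiE_def Pi_def)
      then have "i - 1 - (i - 1 - c i) = c i" by linarith
      then show ?thesis by (simp only: restrict_apply'[OF True])
    next
      case False
      then show ?thesis using that by (auto simp: codes_def PiE_def extensional_def)
    qed
  qed
  show ?thesis
    by (rule bij_betw_byWitness[where f' = "\<lambda>c. restrict (\<lambda>i. i - 1 - c i) {1..n}"])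
      (use * in \<open>auto simp: codes_def\<close>)
qed

text \<open>Reflecting every coordinate, \<open>c i\<close> to \<open>i - 1 - c i\<close>, is a
  bijection of the codes that turns \<open>rcode\<close> into \<open>bcode\<close>.\<close>

lemma card_bcode:
  assumes "\<And>\<sigma>. \<sigma> \<in> perms n \<Longrightarrow> P \<sigma> \<longleftrightarrow> Q (restrict (bcode \<sigma>) {1..n})"
  shows "card {\<sigma> \<in> perms n. P \<sigma>} = card {c \<in> codes n. Q c}"
proof -
  let ?f = "\<lambda>c. restrict (\<lambda>i. i - 1 - c i) {1..n}"
  have "?f (restrict (rcode \<sigma>) {1..n}) = restrict (bcode \<sigma>) {1..n}" if \<sigma>: "\<sigma> \<in> perms n" for \<sigma>
  proof
    fix i show "?f (restrict (rcode \<sigma>) {1..n}) i = restrict (bcode \<sigma>) {1..n} i"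
      using rcode_bcode[OF \<sigma>, of i] by auto
  qed
  then have "card {\<sigma> \<in> perms n. P \<sigma>} = card {c \<in> codes n. Q (?f c)}"
    using assms by (intro card_rcode) simp
  also have "bij_betw ?f {c \<in> codes n. Q (?f c)} {c \<in> codes n. Q c}"
    by (rule bij_betw_Collect[OF bij_flip_codes]) simp
  then have "card {c \<in> codes n. Q (?f c)} = card {c \<in> codes n. Q c}" by (rule bij_betw_same_card)
  finally show ?thesis .
qed

lemma codes_less: "c \<in> codes n \<Longrightarrow> 1 \<le> i \<Longrightarrow> i \<le> n \<Longrightarrow> c i < i"
  by (auto simp: codes_def PiE_def Pi_def)

lemma codesI: "(\<And>i. 1 \<le> i \<Longrightarrow> i \<le> n \<Longrightarrow> c i < i) \<Longrightarrow> (\<And>i. i \<notin> {1..n} \<Longrightarrow> c i = undefined) \<Longrightarrow> c \<in> codes n"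
  by (auto simp: codes_def PiE_def Pi_def extensional_def)

lemma codes_out: "c \<in> codes n \<Longrightarrow> i \<notin> {1..n} \<Longrightarrow> c i = undefined"
  by (auto simp: codes_def PiE_def extensional_def)

text \<open>For an ascent, the entries counted at \<open>Suc i\<close> are those counted at
  \<open>i\<close>, the entry \<open>i\<close> itself, and the earlier entries with values strictly
  between; the equation says that there are none of the last kind.\<close>

lemma rcode_adjacent:
  assumes \<sigma>: "\<sigma> \<in> perms n" and i: "1 \<le> i"
  shows "rcode \<sigma> (Suc i) = Suc (rcode \<sigma> i) \<longleftrightarrow>
    \<sigma> i < \<sigma> (Suc i) \<and> (\<forall>l. 1 \<le> l \<longrightarrow> l < i \<longrightarrow> \<not> (\<sigma> i < \<sigma> l \<and> \<sigma> l < \<sigma> (Suc i)))"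
proof (cases "\<sigma> i < \<sigma> (Suc i)")
  case True
  let ?A = "{l. 1 \<le> l \<and> l < i \<and> \<sigma> l < \<sigma> i}" and ?B = "{l. 1 \<le> l \<and> l < i \<and> \<sigma> i < \<sigma> l \<and> \<sigma> l < \<sigma> (Suc i)}"
  have ne: "l < i \<Longrightarrow> \<sigma> l < \<sigma> i \<or> \<sigma> i < \<sigma> l" for l using perms_inj[OF \<sigma>, of l i] by auto
  have "{l. 1 \<le> l \<and> l < Suc i \<and> \<sigma> l < \<sigma> (Suc i)} = insert i (?A \<union> ?B)"
    using True i by (auto simp: less_Suc_eq dest: ne)
  moreover have "card (insert i (?A \<union> ?B)) = Suc (card (?A \<union> ?B))" by (rule card_insert_disjoint) auto
  moreover have "card (?A \<union> ?B) = card ?A + card ?B" by (rule card_Un_disjoint) auto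
  ultimately have "rcode \<sigma> (Suc i) = Suc (rcode \<sigma> i) \<longleftrightarrow> card ?B = 0" by (simp add: rcode_def)
  moreover have "finite ?B" by auto
  ultimately show ?thesis using True by (auto simp: card_eq_0_iff)
next
  case False
  have "rcode \<sigma> (Suc i) \<le> rcode \<sigma> i"
    unfolding rcode_def using False by (intro card_mono) (auto simp: less_Suc_eq)
  then show ?thesis using False by simp
qed

lemma bcode_adjacent:
  assumes \<sigma>: "\<sigma> \<in> perms n" and i: "1 \<le> i"
  shows "bcode \<sigma> (Suc i) = bcode \<sigma> i \<longleftrightarrow>
    \<sigma> i < \<sigma> (Suc i) \<and> (\<forall>l. 1 \<le> l \<longrightarrow> l < i \<longrightarrow> \<not> (\<sigma> i < \<sigma> l \<and> \<sigma> l < \<sigma> (Suc i)))"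
proof -
  have "rcode \<sigma> i + bcode \<sigma> i = i - 1" "rcode \<sigma> (Suc i) + bcode \<sigma> (Suc i) = i"
    using rcode_bcode[OF \<sigma>, of i] rcode_bcode[OF \<sigma>, of "Suc i"] i by auto
  then have "bcode \<sigma> (Suc i) = bcode \<sigma> i \<longleftrightarrow> rcode \<sigma> (Suc i) = Suc (rcode \<sigma> i)" using i by linarith
  then show ?thesis using rcode_adjacent[OF assms] by simp
qed

lemma rcode_0: "rcode \<sigma> i = 0 \<longleftrightarrow> (\<forall>l. 1 \<le> l \<longrightarrow> l < i \<longrightarrow> \<sigma> i \<le> \<sigma> l)"
proof -
  have "finite {l. 1 \<le> l \<and> l < i \<and> \<sigma> l < \<sigma> i}" by auto
  then show ?thesis unfolding rcode_def by (auto simp: not_less)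
qed

text \<open>An entry after \<open>j\<close> and below it has the entry \<open>j\<close> and
  everything larger than that to its left. Conversely, at the first later entry not below
  \<open>\<sigma> j\<close>, all larger entries to the left sit before \<open>j\<close> and exceed
  \<open>\<sigma> j\<close>, so its code is not larger.\<close>

lemma rlmax_bcode:
  "(\<forall>l. j < l \<longrightarrow> l \<le> n \<longrightarrow> \<sigma> l < \<sigma> j) \<longleftrightarrow> (\<forall>l. j < l \<longrightarrow> l \<le> n \<longrightarrow> bcode \<sigma> j < bcode \<sigma> l)"
  if \<sigma>: "\<sigma> \<in> perms n" and j: "1 \<le> j"
proof
  assume a: "\<forall>l. j < l \<longrightarrow> l \<le> n \<longrightarrow> \<sigma> l < \<sigma> j"
  show "\<forall>l. j < l \<longrightarrow> l \<le> n \<longrightarrow> bcode \<sigma> j < bcode \<sigma> l"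
  proof (intro allI impI)
    fix l assume l: "j < l" "l \<le> n"
    then have "\<sigma> l < \<sigma> j" using a by simp
    then show "bcode \<sigma> j < bcode \<sigma> l"
      unfolding bcode_def using l j by (intro psubset_card_mono) auto
  qed
next
  assume a: "\<forall>l. j < l \<longrightarrow> l \<le> n \<longrightarrow> bcode \<sigma> j < bcode \<sigma> l"
  show "\<forall>l. j < l \<longrightarrow> l \<le> n \<longrightarrow> \<sigma> l < \<sigma> j"
  proof (intro allI impI)
    fix l assume "j < l" "l \<le> n"
    then show "\<sigma> l < \<sigma> j"
    proof (induction l rule: less_induct)
      case (less l)
      show ?case
      proof (rule ccontr)
        assume n: "\<not> \<sigma> l < \<sigma> j"
        have "{m. 1 \<le> m \<and> m < l \<and> \<sigma> l < \<sigma> m} \<subseteq> {m. 1 \<le> m \<and> m < j \<and> \<sigma> j < \<sigma> m}"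
        proof
          fix m assume m: "m \<in> {m. 1 \<le> m \<and> m < l \<and> \<sigma> l < \<sigma> m}"
          have "m < j" using less.IH[of m] m n less.prems by (cases m j rule: linorder_cases) auto
          then show "m \<in> {m. 1 \<le> m \<and> m < j \<and> \<sigma> j < \<sigma> m}" using m n by simp
        qed
        then have "bcode \<sigma> l \<le> bcode \<sigma> j" unfolding bcode_def by (intro card_mono) auto
        then show False using a less.prems by fastforce
      qed
    qed
  qed
qed

section \<open>A rule with one creating slot\<close>

definition jstep :: "nat \<Rightarrow> unit \<times> nat set \<Rightarrow> nat \<Rightarrow> unit \<times> nat set" where
  "jstep n l b = ((), {f \<in> snd l. f \<le> b} \<union> (if b = n \<and> n \<ge> 1 then {n} else {}))"

text \<open>Only the slot \<open>c n\<close> creates occurrences, all of size \<open>n\<close>. It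
  belongs to no slot set, hence destroys nothing and can be given the highest rank
  \<open>n\<close>.\<close>

lemma realises_J:
  assumes nest: "\<And>n \<sigma> i j k l. \<sigma> \<in> perms n \<Longrightarrow> occ R n \<sigma> i j \<Longrightarrow> occ R n \<sigma> k l \<Longrightarrow>
      forb R n \<sigma> i j \<subseteq> forb R n \<sigma> k l \<or> forb R n \<sigma> k l \<subseteq> forb R n \<sigma> i j"
    and c: "\<And>n. n \<ge> 1 \<Longrightarrow> c n \<le> n"
    and cf: "\<And>n \<sigma> i j. \<sigma> \<in> perms n \<Longrightarrow> occ R n \<sigma> i j \<Longrightarrow> c n \<notin> forb R n \<sigma> i j"
    and new: "\<And>n \<sigma> r. \<sigma> \<in> perms n \<Longrightarrow> n \<ge> 1 \<Longrightarrow> r \<le> n \<Longrightarrow> new_sizes R n \<sigma> r = (if r = c n then {n} else {})"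
  shows "realises (\<lambda>n \<sigma>. ((), sizes R n \<sigma>)) jstep ((), {})"
  unfolding realises_def
proof (intro conjI allI ballI)
  show "((), sizes R 0 id) = ((), {})" by (simp add: sizes_0)
  fix n \<sigma> assume \<sigma>: "\<sigma> \<in> perms n"
  show "\<exists>\<pi>. bij_betw \<pi> {..n} {..n} \<and> (\<forall>r\<le>n. ((), sizes R (Suc n) (ext n r \<sigma>)) =
      jstep n ((), sizes R n \<sigma>) (\<pi> r))"
  proof (cases "n = 0")
    case True
    then show ?thesis using bij_betw_id[of "{..n}"] by (auto simp: sizes_0 sizes_1 jstep_def)
  next
    case False
    have sub: "forb R n \<sigma> i j \<subseteq> {..n} - {c n}" if "occ R n \<sigma> i j" for i j
      using cf[OF \<sigma> that] by (auto simp: forb_def)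
    \<comment> \<open>The complement of \<open>c n\<close> contains every slot set; as a member of
      the chain it forces rank \<open>n\<close> on \<open>c n\<close>.\<close>
    obtain \<pi> where \<pi>: "bij_betw \<pi> {..n} {..n}"
      "\<And>A r. A \<in> {{..n} - {c n}} \<Longrightarrow> r \<le> n \<Longrightarrow> r \<in> A \<longleftrightarrow> \<pi> r < card A"
      "\<And>r. r \<le> n \<Longrightarrow> sizes R (Suc n) (ext n r \<sigma>) = {f \<in> sizes R n \<sigma>. f \<le> \<pi> r} \<union> new_sizes R n \<sigma> r"
      by (rule chain_slots[OF \<sigma> nest[OF \<sigma>], where \<X> = "{{..n} - {c n}}"]) (use sub in auto)
    have "r = c n \<longleftrightarrow> \<pi> r = n" if "r \<le> n" for r
      using \<pi>(2)[of "{..n} - {c n}" r] that c[of n] False bij_betw_apply[OF \<pi>(1), of r] by auto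
    then have "\<forall>r\<le>n. sizes R (Suc n) (ext n r \<sigma>) = {f \<in> sizes R n \<sigma>. f \<le> \<pi> r} \<union> (if \<pi> r = n \<and> 1 \<le> n then {n} else {})"
      using \<pi>(3) new[OF \<sigma>] False by simp
    then show ?thesis using \<pi>(1) by (auto simp: jstep_def)
  qed
qed

section \<open>Equivalences from the generating tree\<close>

text \<open>All values \<open>1..r\<close> would have to sit at position \<open>i\<close>, so there
  is only one of them.\<close>

lemma perms_le_all:
  assumes "\<sigma> \<in> perms n" "\<And>l. 1 \<le> l \<Longrightarrow> l \<le> n \<Longrightarrow> l \<noteq> i \<Longrightarrow> r < \<sigma> l" "1 \<le> i" "i \<le> n" "\<sigma> i \<le> r" "r \<le> n"
  shows "r = 1 \<and> \<sigma> i = 1"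
proof -
  have "1 \<le> \<sigma> i" using perms_ge1[OF assms(1)] assms by auto
  moreover have "v = \<sigma> i" if v: "1 \<le> v" "v \<le> r" for v
  proof -
    obtain l where "1 \<le> l" "l \<le> n" "\<sigma> l = v" using perms_pos[OF assms(1), of v] v assms(6) by auto
    then show ?thesis using assms(2)[of l] v by fastforce
  qed
  ultimately show ?thesis using assms(5) by (metis le_trans order_refl)
qed

text \<open>Every other old entry must exceed the new one, which leaves the entry 1 together with
  slot 1. The slot sets are the final segments starting at the second value.\<close>

lemma realises_J1: "realises (\<lambda>n \<sigma>. ((), sizes {(2,2),(0,1),(1,1),(0,0),(1,0)} n \<sigma>)) jstep ((), {})"
  (is "realises (\<lambda>n \<sigma>. ((), sizes ?R n \<sigma>)) _ _")
proof (rule realises_J[where c = "\<lambda>_. 1"])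
  fix n :: nat and \<sigma> r assume \<sigma>: "\<sigma> \<in> perms n" and n: "1 \<le> n" and r: "r \<le> n"
  have o: "occ ?R (Suc n) (ext n r \<sigma>) i (Suc n) \<longleftrightarrow> 1 \<le> i \<and> i \<le> n \<and> r = 1 \<and> \<sigma> i = 1" for i
  proof
    assume a: "occ ?R (Suc n) (ext n r \<sigma>) i (Suc n)"
    have "r < \<sigma> l" if "1 \<le> l" "l \<le> n" "l \<noteq> i" for l
      using occ_new_clear[OF \<sigma> a, of l] that perms_inj[OF \<sigma>, of l i]
      by (cases "l < i") (auto simp: nclear_def)
    then show "1 \<le> i \<and> i \<le> n \<and> r = 1 \<and> \<sigma> i = 1"
      using perms_le_all[OF \<sigma>, of i r] occ_new_len[OF a] r by blast
  next
    assume a: "1 \<le> i \<and> i \<le> n \<and> r = 1 \<and> \<sigma> i = 1"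
    have "nclear ?R x (\<sigma> i) r (\<sigma> l)" if "1 \<le> l" "l \<le> n" "x < 2" for l x
      using perms_ge1[OF \<sigma>, of l] that a by (simp add: nclear_def)
    then show "occ ?R (Suc n) (ext n r \<sigma>) i (Suc n)"
      using a by (intro occ_newI[OF \<sigma>]) auto
  qed
  show "new_sizes ?R n \<sigma> r = (if r = 1 then {n} else {})"
    unfolding new_sizes_def o using perms_pos[OF \<sigma>, of 1] n by (auto simp: fsize_def)
next
  fix n \<sigma> i j assume \<sigma>: "\<sigma> \<in> perms n" and o: "occ ?R n \<sigma> i j"
  then show "1 \<notin> forb ?R n \<sigma> i j" using occ_len[OF \<sigma> o] by (simp add: mem_forb)
next
  fix n \<sigma> i j k l assume \<sigma>: "\<sigma> \<in> perms n" and o: "occ ?R n \<sigma> i j" and p: "occ ?R n \<sigma> k l"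
  show "forb ?R n \<sigma> i j \<subseteq> forb ?R n \<sigma> k l \<or> forb ?R n \<sigma> k l \<subseteq> forb ?R n \<sigma> i j"
    using occ_len[OF \<sigma> o] occ_len[OF \<sigma> p] by (cases "\<sigma> j \<le> \<sigma> l") (auto simp: mem_forb)
qed auto

text \<open>Every other old entry must lie below the first point, which is therefore the maximum,
  and the slot is the top one. The slot sets are the initial segments below the first value.\<close>

lemma realises_J3: "realises (\<lambda>n \<sigma>. ((), sizes {(0,2),(1,2),(0,1),(1,1),(2,0)} n \<sigma>)) jstep ((), {})"
  (is "realises (\<lambda>n \<sigma>. ((), sizes ?R n \<sigma>)) _ _")
proof (rule realises_J[where c = "\<lambda>n. n"])
  fix n :: nat and \<sigma> r assume \<sigma>: "\<sigma> \<in> perms n" and n: "1 \<le> n" and r: "r \<le> n"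
  have o: "occ ?R (Suc n) (ext n r \<sigma>) i (Suc n) \<longleftrightarrow> 1 \<le> i \<and> i \<le> n \<and> r = n \<and> \<sigma> i = n" for i
  proof
    assume a: "occ ?R (Suc n) (ext n r \<sigma>) i (Suc n)"
    obtain l where l: "1 \<le> l" "l \<le> n" "\<sigma> l = n" using perms_pos[OF \<sigma> n] by auto
    have "\<sigma> l \<le> \<sigma> i"
      using occ_new_clear[OF \<sigma> a, of l] l by (cases l i rule: linorder_cases) (auto simp: nclear_def)
    then show "1 \<le> i \<and> i \<le> n \<and> r = n \<and> \<sigma> i = n"
      using l r occ_new_len[OF a] by auto
  next
    assume a: "1 \<le> i \<and> i \<le> n \<and> r = n \<and> \<sigma> i = n"
    have "nclear ?R x (\<sigma> i) r (\<sigma> l)" if "1 \<le> l" "l \<le> n" "x < 2" for l x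
      using perms_len[OF \<sigma>, of l] that a by (simp add: nclear_def)
    then show "occ ?R (Suc n) (ext n r \<sigma>) i (Suc n)"
      using a by (intro occ_newI[OF \<sigma>]) auto
  qed
  show "new_sizes ?R n \<sigma> r = (if r = n then {n} else {})"
    unfolding new_sizes_def o using perms_pos[OF \<sigma>, of n] n by (auto simp: fsize_def ext_def)
next
  fix n \<sigma> i j assume \<sigma>: "\<sigma> \<in> perms n" and o: "occ ?R n \<sigma> i j"
  then show "n \<notin> forb ?R n \<sigma> i j" using occ_len[OF \<sigma> o] by (simp add: mem_forb)
next
  fix n \<sigma> i j k l assume \<sigma>: "\<sigma> \<in> perms n" and o: "occ ?R n \<sigma> i j" and p: "occ ?R n \<sigma> k l"
  show "forb ?R n \<sigma> i j \<subseteq> forb ?R n \<sigma> k l \<or> forb ?R n \<sigma> k l \<subseteq> forb ?R n \<sigma> i j"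
    using occ_len[OF \<sigma> o] occ_len[OF \<sigma> p] by (cases "\<sigma> i \<le> \<sigma> k") (auto simp: mem_forb)
qed auto

lemma weq_J1_J3: "weq {(2,2),(0,1),(1,1),(0,0),(1,0)} {(0,2),(1,2),(0,1),(1,1),(2,0)}"
  by (rule weq_realises[OF realises_J1 realises_J3])

text \<open>All old entries must lie between the first point and the new one, so the first point is
  the entry 1 and the slot is the top one. The slot sets are the intervals between the two
  values.\<close>

lemma weq_J2_J3: "weq {(0,2),(1,2),(2,1),(0,0),(1,0)} {(0,2),(1,2),(0,1),(1,1),(2,0)}" (is "weq ?R ?R'")
proof (rule weq_realises[OF realises_J[where c = "\<lambda>n. n"] realises_J3])
  fix n :: nat and \<sigma> r assume \<sigma>: "\<sigma> \<in> perms n" and n: "1 \<le> n" and r: "r \<le> n"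
  have o: "occ ?R (Suc n) (ext n r \<sigma>) i (Suc n) \<longleftrightarrow> 1 \<le> i \<and> i \<le> n \<and> r = n \<and> \<sigma> i = 1" for i
  proof
    assume a: "occ ?R (Suc n) (ext n r \<sigma>) i (Suc n)"
    obtain l where l: "1 \<le> l" "l \<le> n" "\<sigma> l = n" using perms_pos[OF \<sigma> n] by auto
    have "\<sigma> l \<le> r"
      using occ_new_clear[OF \<sigma> a, of l] l occ_new_len[OF a] by (cases l i rule: linorder_cases) (auto simp: nclear_def)
    moreover obtain k where k: "1 \<le> k" "k \<le> n" "\<sigma> k = 1" using perms_pos[OF \<sigma>, of 1] n by auto
    have "\<sigma> i \<le> \<sigma> k"
      using occ_new_clear[OF \<sigma> a, of k] k by (cases k i rule: linorder_cases) (auto simp: nclear_def)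
    ultimately show "1 \<le> i \<and> i \<le> n \<and> r = n \<and> \<sigma> i = 1"
      using l k r occ_new_len[OF a] perms_ge1[OF \<sigma>, of i] by auto
  next
    assume a: "1 \<le> i \<and> i \<le> n \<and> r = n \<and> \<sigma> i = 1"
    have "nclear ?R x (\<sigma> i) r (\<sigma> l)" if "1 \<le> l" "l \<le> n" "x < 2" for l x
      using perms_len[OF \<sigma>, of l] perms_ge1[OF \<sigma>, of l] that a by (simp add: nclear_def)
    then show "occ ?R (Suc n) (ext n r \<sigma>) i (Suc n)"
      using a n by (intro occ_newI[OF \<sigma>]) auto
  qed
  show "new_sizes ?R n \<sigma> r = (if r = n then {n} else {})"
  proof -
    have f: "fsize ?R (Suc n) (ext n r \<sigma>) i (Suc n) = n" if "1 \<le> i \<and> i \<le> n \<and> r = n \<and> \<sigma> i = 1" for i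
      using that n by (simp add: fsize_def ext_def)
    obtain k where k: "1 \<le> k" "k \<le> n" "\<sigma> k = 1" using perms_pos[OF \<sigma>, of 1] n by auto
    have "new_sizes ?R n \<sigma> r = {m. m = n \<and> (\<exists>i. 1 \<le> i \<and> i \<le> n \<and> r = n \<and> \<sigma> i = 1)}"
      unfolding new_sizes_def o using f by (intro Collect_cong) metis
    then show ?thesis using k by auto
  qed
next
  fix n \<sigma> i j assume \<sigma>: "\<sigma> \<in> perms n" and o: "occ ?R n \<sigma> i j"
  then show "n \<notin> forb ?R n \<sigma> i j" using occ_len[OF \<sigma> o] by (simp add: mem_forb)
next
  have *: "forb ?R n \<sigma> i j \<subseteq> forb ?R n \<sigma> k l \<or> forb ?R n \<sigma> k l \<subseteq> forb ?R n \<sigma> i j"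
    if \<sigma>: "\<sigma> \<in> perms n" and o: "occ ?R n \<sigma> i j" and p: "occ ?R n \<sigma> k l" and le: "j \<le> l" for n \<sigma> i j k l
  proof (cases "j = l")
    case True
    then show ?thesis using occ_len[OF \<sigma> o] occ_len[OF \<sigma> p] by (cases "\<sigma> i \<le> \<sigma> k") (auto simp: mem_forb)
  next
    case False
    \<comment> \<open>Every entry before position \<open>l\<close> lies between the values of the
      later pair, hence so does the whole interval of the earlier pair.\<close>
    have "\<sigma> k \<le> \<sigma> m \<and> \<sigma> m \<le> \<sigma> l" if "1 \<le> m" "m < l" for m
      using occ_clear(1,2)[OF \<sigma> p, of m] that occ_len[OF \<sigma> p] by (cases m k rule: linorder_cases) (auto simp: clear_def)
    from this[of i] this[of j] show ?thesis
      using False le occ_len[OF \<sigma> o] occ_len[OF \<sigma> p] by (auto simp: mem_forb)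
  qed
  fix n \<sigma> i j k l assume \<sigma>: "\<sigma> \<in> perms n" and o: "occ ?R n \<sigma> i j" and p: "occ ?R n \<sigma> k l"
  show "forb ?R n \<sigma> i j \<subseteq> forb ?R n \<sigma> k l \<or> forb ?R n \<sigma> k l \<subseteq> forb ?R n \<sigma> i j"
    using *[OF \<sigma> o p] *[OF \<sigma> p o] by (cases "j \<le> l") auto
qed auto

section \<open>A rule conditional on the last entry being 1\<close>

definition kstep :: "nat \<Rightarrow> bool \<times> nat set \<Rightarrow> nat \<Rightarrow> bool \<times> nat set" where
  "kstep n l b = (b = n, {f \<in> snd l. f \<le> b} \<union> (if fst l \<and> Suc b = n then {n} else {}))"

text \<open>Slot 0 makes the new last entry 1, and slot \<open>c n\<close> creates occurrences
  provided the last entry is 1. Neither destroys anything, so they take the two highest ranks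
  \<open>n\<close> and \<open>n - 1\<close>; the boolean component remembers the last entry.\<close>

lemma realises_K:
  assumes nest: "\<And>n \<sigma> i j k l. \<sigma> \<in> perms n \<Longrightarrow> occ R n \<sigma> i j \<Longrightarrow> occ R n \<sigma> k l \<Longrightarrow>
      forb R n \<sigma> i j \<subseteq> forb R n \<sigma> k l \<or> forb R n \<sigma> k l \<subseteq> forb R n \<sigma> i j"
    and c: "\<And>n. n \<ge> 1 \<Longrightarrow> 1 \<le> c n \<and> c n \<le> n"
    and cf: "\<And>n \<sigma> i j. \<sigma> \<in> perms n \<Longrightarrow> occ R n \<sigma> i j \<Longrightarrow> 0 \<notin> forb R n \<sigma> i j \<and> c n \<notin> forb R n \<sigma> i j"
    and new: "\<And>n \<sigma> r. \<sigma> \<in> perms n \<Longrightarrow> n \<ge> 1 \<Longrightarrow> r \<le> n \<Longrightarrow>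
      new_sizes R n \<sigma> r = (if \<sigma> n = 1 \<and> r = c n then {n} else {})"
  shows "realises (\<lambda>n \<sigma>. (n \<ge> 1 \<and> \<sigma> n = 1, sizes R n \<sigma>)) kstep (False, {})"
  unfolding realises_def
proof (intro conjI allI ballI)
  show "(0 \<ge> (1::nat) \<and> id 0 = (1::nat), sizes R 0 id) = (False, {})" by (simp add: sizes_0)
  fix n \<sigma> assume \<sigma>: "\<sigma> \<in> perms n"
  show "\<exists>\<pi>. bij_betw \<pi> {..n} {..n} \<and> (\<forall>r\<le>n. (1 \<le> Suc n \<and> ext n r \<sigma> (Suc n) = 1, sizes R (Suc n) (ext n r \<sigma>)) =
      kstep n (1 \<le> n \<and> \<sigma> n = 1, sizes R n \<sigma>) (\<pi> r))"
  proof (cases "n = 0")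
    case True
    then show ?thesis using bij_betw_id[of "{..n}"] by (auto simp: sizes_0 sizes_1 kstep_def)
  next
    case False
    let ?A = "{..n} - {0}" and ?B = "{..n} - {0, c n}"
    have c1: "1 \<le> c n" "c n \<le> n" using c[of n] False by auto
    have sub: "forb R n \<sigma> i j \<subseteq> ?B" if "occ R n \<sigma> i j" for i j
      using cf[OF \<sigma> that] by (auto simp: forb_def)
    obtain \<pi> where \<pi>: "bij_betw \<pi> {..n} {..n}"
      "\<And>A r. A \<in> {?A, ?B} \<Longrightarrow> r \<le> n \<Longrightarrow> r \<in> A \<longleftrightarrow> \<pi> r < card A"
      "\<And>r. r \<le> n \<Longrightarrow> sizes R (Suc n) (ext n r \<sigma>) = {f \<in> sizes R n \<sigma>. f \<le> \<pi> r} \<union> new_sizes R n \<sigma> r"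
      by (rule chain_slots[OF \<sigma> nest[OF \<sigma>], where \<X> = "{?A, ?B}"]) (use sub in auto)
    have cards: "card ?A = n" "card ?B = n - 1" using c1 by (auto simp: card_Diff_subset)
    have "r = 0 \<longleftrightarrow> \<pi> r = n" "r = c n \<longleftrightarrow> Suc (\<pi> r) = n" if "r \<le> n" for r
      using \<pi>(2)[of ?A r] \<pi>(2)[of ?B r] that c1 bij_betw_apply[OF \<pi>(1), of r] unfolding cards by auto
    then have "\<forall>r\<le>n. (r = 0) = (\<pi> r = n) \<and> sizes R (Suc n) (ext n r \<sigma>) = {f \<in> sizes R n \<sigma>. f \<le> \<pi> r} \<union>
       (if \<sigma> n = 1 \<and> Suc (\<pi> r) = n then {n} else {})"
      using \<pi>(3) new[OF \<sigma>] False by simp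
    then show ?thesis using \<pi>(1) False by (auto simp: kstep_def)
  qed
qed

text \<open>The full middle column makes the last old entry the first point. Then all other entries
  must exceed the new one, which forces last entry 1 and slot 1. The slot sets are final
  segments.\<close>

lemma realises_K1:
  "realises (\<lambda>n \<sigma>. (n \<ge> 1 \<and> \<sigma> n = 1, sizes {(1,2),(2,2),(0,1),(1,1),(0,0),(1,0)} n \<sigma>)) kstep (False, {})"
  (is "realises (\<lambda>n \<sigma>. (_, sizes ?R n \<sigma>)) _ _")
proof (rule realises_K[where c = "\<lambda>_. 1"])
  fix n :: nat and \<sigma> r assume \<sigma>: "\<sigma> \<in> perms n" and n: "1 \<le> n" and r: "r \<le> n"
  have o: "occ ?R (Suc n) (ext n r \<sigma>) i (Suc n) \<longleftrightarrow> i = n \<and> \<sigma> n = 1 \<and> r = 1" for i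
  proof
    assume a: "occ ?R (Suc n) (ext n r \<sigma>) i (Suc n)"
    have i: "i = n"
    proof (rule ccontr)
      assume "i \<noteq> n"
      then have "i < n" using occ_new_len[OF a] by simp
      then show False using occ_new_clear(2)[OF \<sigma> a, of n] perms_inj[OF \<sigma>, of n i]
        by (auto simp: nclear_def)
    qed
    obtain k where k: "1 \<le> k" "k \<le> n" "\<sigma> k = 1" using perms_pos[OF \<sigma>, of 1] n by auto
    have s: "\<sigma> n = 1"
      using occ_new_clear(1)[OF \<sigma> a, of k] k i perms_ge1[OF \<sigma>, of n] by (cases "k = n") (auto simp: nclear_def)
    moreover have "r = 1"
    proof (rule ccontr)
      assume "r \<noteq> 1"
      then have r2: "2 \<le> r" using occ_new_len[OF a] i s by simp
      then obtain m where m: "1 \<le> m" "m \<le> n" "\<sigma> m = 2" using perms_pos[OF \<sigma>, of 2] r by auto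
      then show False using occ_new_clear(1)[OF \<sigma> a, of m] r2 i s by (cases "m = n") (auto simp: nclear_def)
    qed
    ultimately show "i = n \<and> \<sigma> n = 1 \<and> r = 1" using i by simp
  next
    assume a: "i = n \<and> \<sigma> n = 1 \<and> r = 1"
    have "nclear ?R 0 (\<sigma> i) r (\<sigma> l)" if "1 \<le> l" "l < n" for l
      using perms_ge1[OF \<sigma>, of l] that a by (simp add: nclear_def)
    then show "occ ?R (Suc n) (ext n r \<sigma>) i (Suc n)"
      using a n by (intro occ_newI[OF \<sigma>]) auto
  qed
  show "new_sizes ?R n \<sigma> r = (if \<sigma> n = 1 \<and> r = 1 then {n} else {})"
    unfolding new_sizes_def o by (auto simp: fsize_def)
next
  fix n \<sigma> i j assume \<sigma>: "\<sigma> \<in> perms n" and o: "occ ?R n \<sigma> i j"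
  then show "0 \<notin> forb ?R n \<sigma> i j \<and> 1 \<notin> forb ?R n \<sigma> i j" using occ_len[OF \<sigma> o] by (simp add: mem_forb)
next
  fix n \<sigma> i j k l assume \<sigma>: "\<sigma> \<in> perms n" and o: "occ ?R n \<sigma> i j" and p: "occ ?R n \<sigma> k l"
  show "forb ?R n \<sigma> i j \<subseteq> forb ?R n \<sigma> k l \<or> forb ?R n \<sigma> k l \<subseteq> forb ?R n \<sigma> i j"
    using occ_len[OF \<sigma> o] occ_len[OF \<sigma> p] by (cases "\<sigma> j \<le> \<sigma> l") (auto simp: mem_forb)
qed auto

text \<open>Again the first point is the last old entry, but now all earlier entries lie between the
  two points, so the last entry is 1 and the slot is the top one. The slot sets are intervals
  between the two values.\<close>

lemma realises_K2:
  "realises (\<lambda>n \<sigma>. (n \<ge> 1 \<and> \<sigma> n = 1, sizes {(0,2),(1,2),(1,1),(2,1),(0,0),(1,0)} n \<sigma>)) kstep (False, {})"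
  (is "realises (\<lambda>n \<sigma>. (_, sizes ?R n \<sigma>)) _ _")
proof (rule realises_K[where c = "\<lambda>n. n"])
  fix n :: nat and \<sigma> r assume \<sigma>: "\<sigma> \<in> perms n" and n: "1 \<le> n" and r: "r \<le> n"
  have o: "occ ?R (Suc n) (ext n r \<sigma>) i (Suc n) \<longleftrightarrow> i = n \<and> \<sigma> n = 1 \<and> r = n" for i
  proof
    assume a: "occ ?R (Suc n) (ext n r \<sigma>) i (Suc n)"
    have i: "i = n"
    proof (rule ccontr)
      assume "i \<noteq> n"
      then have "i < n" using occ_new_len[OF a] by simp
      then show False using occ_new_clear(2)[OF \<sigma> a, of n] perms_inj[OF \<sigma>, of n i]
        by (auto simp: nclear_def)
    qed
    obtain k where k: "1 \<le> k" "k \<le> n" "\<sigma> k = 1" using perms_pos[OF \<sigma>, of 1] n by auto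
    have s: "\<sigma> n = 1"
      using occ_new_clear(1)[OF \<sigma> a, of k] k i perms_ge1[OF \<sigma>, of n] by (cases "k = n") (auto simp: nclear_def)
    moreover obtain m where m: "1 \<le> m" "m \<le> n" "\<sigma> m = n" using perms_pos[OF \<sigma>, of n] n by auto
    have "n \<le> r" using occ_new_clear(1)[OF \<sigma> a, of m] i s m occ_new_len[OF a] by (cases "m = n") (auto simp: nclear_def)
    ultimately show "i = n \<and> \<sigma> n = 1 \<and> r = n" using i r by simp
  next
    assume a: "i = n \<and> \<sigma> n = 1 \<and> r = n"
    have "nclear ?R 0 (\<sigma> i) r (\<sigma> l)" if "1 \<le> l" "l < n" for l
      using perms_ge1[OF \<sigma>, of l] perms_len[OF \<sigma>, of l] that a by (simp add: nclear_def)
    then show "occ ?R (Suc n) (ext n r \<sigma>) i (Suc n)"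
      using a n by (intro occ_newI[OF \<sigma>]) auto
  qed
  show "new_sizes ?R n \<sigma> r = (if \<sigma> n = 1 \<and> r = n then {n} else {})"
    unfolding new_sizes_def o using n by (auto simp: fsize_def ext_def)
next
  fix n \<sigma> i j assume \<sigma>: "\<sigma> \<in> perms n" and o: "occ ?R n \<sigma> i j"
  then show "0 \<notin> forb ?R n \<sigma> i j \<and> n \<notin> forb ?R n \<sigma> i j" using occ_len[OF \<sigma> o] by (simp add: mem_forb)
next
  have *: "forb ?R n \<sigma> i j \<subseteq> forb ?R n \<sigma> k l \<or> forb ?R n \<sigma> k l \<subseteq> forb ?R n \<sigma> i j"
    if \<sigma>: "\<sigma> \<in> perms n" and o: "occ ?R n \<sigma> i j" and p: "occ ?R n \<sigma> k l" and le: "j \<le> l" for n \<sigma> i j k l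
  proof (cases "j = l")
    case True
    then show ?thesis using occ_len[OF \<sigma> o] occ_len[OF \<sigma> p] by (cases "\<sigma> i \<le> \<sigma> k") (auto simp: mem_forb)
  next
    case False
    have "\<sigma> k \<le> \<sigma> m \<and> \<sigma> m \<le> \<sigma> l" if m: "1 \<le> m" "m < l" for m
      using occ_clear(1,2)[OF \<sigma> p, of m] m occ_len[OF \<sigma> p] by (cases m k rule: linorder_cases) (auto simp: clear_def)
    from this[of i] this[of j] show ?thesis
      using False le occ_len[OF \<sigma> o] occ_len[OF \<sigma> p] by (auto simp: mem_forb)
  qed
  fix n \<sigma> i j k l assume \<sigma>: "\<sigma> \<in> perms n" and o: "occ ?R n \<sigma> i j" and p: "occ ?R n \<sigma> k l"
  show "forb ?R n \<sigma> i j \<subseteq> forb ?R n \<sigma> k l \<or> forb ?R n \<sigma> k l \<subseteq> forb ?R n \<sigma> i j"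
    using *[OF \<sigma> o p] *[OF \<sigma> p o] by (cases "j \<le> l") auto
qed auto

lemma weq_K: "weq {(1,2),(2,2),(0,1),(1,1),(0,0),(1,0)} {(0,2),(1,2),(1,1),(2,1),(0,0),(1,0)}"
  by (rule weq_realises[OF realises_K1 realises_K2])

section \<open>A rule governed by the entries left of the minimum\<close>

definition estep :: "nat \<Rightarrow> nat \<times> nat set \<Rightarrow> nat \<Rightarrow> nat \<times> nat set" where
  "estep n l b = (if b = n then (n, snd l)
     else if b < fst l then (Suc (fst l), {f \<in> snd l. f \<le> b})
     else (fst l, insert (Suc b) {f \<in> snd l. f \<le> b}))"

text \<open>\<open>Z\<close> is the zone of slots where a new entry cannot pair with the minimum,
  and \<open>seg n\<close> is a chain of \<open>k\<close>-element slot sets passing through it. A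
  nonzero slot outside the zone creates the size at which \<open>seg n\<close> first contains the
  slot, i.e. its rank plus one. Slot 0 destroys nothing and has rank \<open>n\<close>.\<close>

lemma realises_E:
  assumes nest: "\<And>n \<sigma> i j k l. \<sigma> \<in> perms n \<Longrightarrow> occ R n \<sigma> i j \<Longrightarrow> occ R n \<sigma> k l \<Longrightarrow>
      forb R n \<sigma> i j \<subseteq> forb R n \<sigma> k l \<or> forb R n \<sigma> k l \<subseteq> forb R n \<sigma> i j"
    and cf: "\<And>n \<sigma> i j. \<sigma> \<in> perms n \<Longrightarrow> occ R n \<sigma> i j \<Longrightarrow> 0 \<notin> forb R n \<sigma> i j"
    and Z: "\<And>n \<sigma>. \<sigma> \<in> perms n \<Longrightarrow> n \<ge> 1 \<Longrightarrow> Z n \<sigma> \<subseteq> {1..n}"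
    and seg: "\<And>n. seg n 0 = {}" "\<And>n k. seg n k \<subseteq> seg n (Suc k)"
       "\<And>n k. k \<le> n \<Longrightarrow> seg n k \<subseteq> {1..n} \<and> card (seg n k) = k"
    and Zseg: "\<And>n \<sigma>. \<sigma> \<in> perms n \<Longrightarrow> n \<ge> 1 \<Longrightarrow> Z n \<sigma> = seg n (card (Z n \<sigma>))"
    and occseg: "\<And>n \<sigma> i j k. \<sigma> \<in> perms n \<Longrightarrow> occ R n \<sigma> i j \<Longrightarrow> card (Z n \<sigma>) \<le> k \<Longrightarrow> k \<le> n \<Longrightarrow>
       seg n k \<subseteq> forb R n \<sigma> i j \<or> forb R n \<sigma> i j \<subseteq> seg n k"
    and Zext: "\<And>n \<sigma> r. \<sigma> \<in> perms n \<Longrightarrow> n \<ge> 1 \<Longrightarrow> r \<le> n \<Longrightarrow> card (Z (Suc n) (ext n r \<sigma>)) =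
       (if r = 0 then n else if r \<in> Z n \<sigma> then Suc (card (Z n \<sigma>)) else card (Z n \<sigma>))"
    and new: "\<And>n \<sigma> r. \<sigma> \<in> perms n \<Longrightarrow> n \<ge> 1 \<Longrightarrow> r \<le> n \<Longrightarrow>
      new_sizes R n \<sigma> r = (if r \<noteq> 0 \<and> r \<notin> Z n \<sigma> then {k. k \<le> n \<and> r \<in> seg n k \<and> r \<notin> seg n (k - 1)} else {})"
    and Z0: "Z 0 id = {}" "Z (Suc 0) (ext 0 0 id) = {}"
  shows "realises (\<lambda>n \<sigma>. (card (Z n \<sigma>), sizes R n \<sigma>)) estep (0, {})"
  unfolding realises_def
proof (intro conjI allI ballI)
  show "(card (Z 0 id), sizes R 0 id) = (0, {})" by (simp add: sizes_0 Z0)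
  fix n \<sigma> assume \<sigma>: "\<sigma> \<in> perms n"
  show "\<exists>\<pi>. bij_betw \<pi> {..n} {..n} \<and> (\<forall>r\<le>n. (card (Z (Suc n) (ext n r \<sigma>)), sizes R (Suc n) (ext n r \<sigma>)) =
      estep n (card (Z n \<sigma>), sizes R n \<sigma>) (\<pi> r))"
  proof (cases "n = 0")
    case True
    then have "\<sigma> = id" using \<sigma> by (simp add: perms_0)
    then show ?thesis using True bij_betw_id[of "{..n}"] by (auto simp: sizes_0 sizes_1 estep_def Z0)
  next
    case False
    then have n: "n \<ge> 1" by simp
    \<comment> \<open>The segments from the zone upwards and the set of nonzero slots all join the
      chain. This fixes the rank of each slot outside the zone; inside the zone only membership
      matters.\<close>
    let ?m = "card (Z n \<sigma>)" and ?X = "{seg n k |k. card (Z n \<sigma>) \<le> k \<and> k \<le> n} \<union> {{1..n}}"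
    have mn: "?m \<le> n" using card_mono[OF _ Z[OF \<sigma> n]] by simp
    have mono: "seg n k \<subseteq> seg n l" if "k \<le> l" for k l using lift_Suc_mono_le[of "seg n", OF seg(2)] that by blast
    have f1: "forb R n \<sigma> i j \<subseteq> {1..n}" if "occ R n \<sigma> i j" for i j
    proof
      fix x assume x: "x \<in> forb R n \<sigma> i j"
      then have "x \<noteq> 0" using cf[OF \<sigma> that] by metis
      then show "x \<in> {1..n}" using x by (auto simp: forb_def)
    qed
    obtain \<pi> where \<pi>: "bij_betw \<pi> {..n} {..n}"
      "\<And>A r. A \<in> ?X \<Longrightarrow> r \<le> n \<Longrightarrow> r \<in> A \<longleftrightarrow> \<pi> r < card A"
      "\<And>r. r \<le> n \<Longrightarrow> sizes R (Suc n) (ext n r \<sigma>) = {f \<in> sizes R n \<sigma>. f \<le> \<pi> r} \<union> new_sizes R n \<sigma> r"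
    proof (rule chain_slots[OF \<sigma> nest[OF \<sigma>], where \<X> = ?X])
      show "A \<subseteq> {..n}" if "A \<in> ?X" for A using that seg(3)[of _ n] by fastforce
      show "A \<subseteq> B \<or> B \<subseteq> A" if AB: "A \<in> ?X" "B \<in> ?X" for A B
      proof -
        have "A = {1..n} \<or> (\<exists>k\<le>n. A = seg n k)" "B = {1..n} \<or> (\<exists>k\<le>n. B = seg n k)" using AB by auto
        then consider "A = {1..n}" "B \<subseteq> {1..n}" | "B = {1..n}" "A \<subseteq> {1..n}" | k l where "A = seg n k" "B = seg n l"
          using seg(3)[of _ n] by blast
        then show ?thesis
        proof cases
          case 3
          then show ?thesis using mono[of k l] mono[of l k] by (cases "k \<le> l") auto
        qed auto
      qed
      show "A \<subseteq> forb R n \<sigma> i j \<or> forb R n \<sigma> i j \<subseteq> A" if "A \<in> ?X" "occ R n \<sigma> i j" for A i j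
        using that occseg[OF \<sigma>, of i j] f1[of i j] by blast
    qed auto
    have p0: "r = 0 \<longleftrightarrow> \<pi> r = n" if "r \<le> n" for r
      using \<pi>(2)[of "{1..n}" r] that bij_betw_apply[OF \<pi>(1), of r] by auto
    have ps: "r \<in> seg n k \<longleftrightarrow> \<pi> r < k" if "r \<le> n" "?m \<le> k" "k \<le> n" for r k
      using \<pi>(2)[of "seg n k" r] that seg(3)[of k n] by auto
    have pz: "r \<in> Z n \<sigma> \<longleftrightarrow> \<pi> r < ?m" if "r \<le> n" for r
    proof -
      have "r \<in> Z n \<sigma> \<longleftrightarrow> r \<in> seg n ?m" by (subst Zseg[OF \<sigma> n]) simp
      then show ?thesis using ps[of r ?m] that mn by simp
    qed
    have "(card (Z (Suc n) (ext n r \<sigma>)), sizes R (Suc n) (ext n r \<sigma>)) =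
      estep n (?m, sizes R n \<sigma>) (\<pi> r)" if r: "r \<le> n" for r
    proof -
      have "{k. k \<le> n \<and> r \<in> seg n k \<and> r \<notin> seg n (k - 1)} = {Suc (\<pi> r)}" if "r \<noteq> 0" "r \<notin> Z n \<sigma>"
      proof -
        have lt: "\<pi> r < n" using p0[OF r] that bij_betw_apply[OF \<pi>(1), of r] r by force
        have ge: "?m \<le> \<pi> r" using pz[OF r] that by simp
        have "k = Suc (\<pi> r)" if k: "k \<le> n" "r \<in> seg n k" "r \<notin> seg n (k - 1)" for k
        proof -
          have "r \<notin> seg n ?m" using \<open>r \<notin> Z n \<sigma>\<close> Zseg[OF \<sigma> n] by metis
          then have "?m < k" using k(2) mono[of k ?m] by (meson in_mono not_le)
          then show ?thesis using ps[of r k] ps[of r "k - 1"] k r by auto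
        qed
        moreover have "r \<in> seg n (Suc (\<pi> r))" "r \<notin> seg n (\<pi> r)" using ps[OF r] lt ge by auto
        ultimately show ?thesis using lt by auto
      qed
      \<comment> \<open>Slot 0 is in no slot set, so sizes are at most \<open>n\<close> and rank
        \<open>n\<close> filters out nothing.\<close>
      moreover have "sizes R n \<sigma> = {f \<in> sizes R n \<sigma>. f \<le> n}"
      proof -
        have "fsize R n \<sigma> i j \<le> n" if "occ R n \<sigma> i j" for i j
          using card_mono[OF _ f1[OF that]] card_forb[of \<sigma> i j n R] occ_len[OF \<sigma> that] by simp
        then show ?thesis by (auto simp: sizes_def)
      qed
      ultimately show ?thesis
        using \<pi>(3)[OF r] new[OF \<sigma> n r] Zext[OF \<sigma> n r] p0[OF r] pz[OF r] unfolding estep_def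
        by (auto simp del: One_nat_def)
    qed
    then show ?thesis using \<pi>(1) by blast
  qed
qed

lemma pos1_singleton: "pos1 (Suc 0) (ext 0 0 id) = 1"
  using pos1[OF ext_perms[of id 0 0]] by (simp add: perms_0)

text \<open>Row 0 is shaded in the first two columns, so a new occurrence starts at the entry 1, and
  cell (0,1) excludes the slots of \<open>mzone\<close>. The slot sets are final segments, and so
  are the reference segments.\<close>

lemma realises_E1:
  "realises (\<lambda>n \<sigma>. (card (mzone n \<sigma>), sizes {(2,2),(0,1),(0,0),(1,0)} n \<sigma>)) estep (0, {})"
  (is "realises (\<lambda>n \<sigma>. (_, sizes ?R n \<sigma>)) _ _")
proof (rule realises_E[where seg = "\<lambda>n k. {Suc n - k..n}"])
  fix n \<sigma> i j k l assume \<sigma>: "\<sigma> \<in> perms n" and o: "occ ?R n \<sigma> i j" and p: "occ ?R n \<sigma> k l"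
  show "forb ?R n \<sigma> i j \<subseteq> forb ?R n \<sigma> k l \<or> forb ?R n \<sigma> k l \<subseteq> forb ?R n \<sigma> i j"
    using occ_len[OF \<sigma> o] occ_len[OF \<sigma> p] by (cases "\<sigma> j \<le> \<sigma> l") (auto simp: mem_forb)
next
  fix n \<sigma> i j assume \<sigma>: "\<sigma> \<in> perms n" and o: "occ ?R n \<sigma> i j"
  then show "0 \<notin> forb ?R n \<sigma> i j" using occ_len[OF \<sigma> o] by (simp add: mem_forb)
next
  fix n :: nat and \<sigma> assume \<sigma>: "\<sigma> \<in> perms n" and n: "1 \<le> n"
  show "mzone n \<sigma> \<subseteq> {1..n}"
    by (cases rule: mzone_eq[OF \<sigma> n]) (use perms_ge1[OF \<sigma>] pos1(2)[OF \<sigma> n] in fastforce)+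
  show "mzone n \<sigma> = {Suc n - card (mzone n \<sigma>)..n}"
  proof (cases rule: mzone_eq[OF \<sigma> n])
    case (2 l)
    then have "\<sigma> l \<le> n" using pos1(2)[OF \<sigma> n] by (intro perms_len[OF \<sigma>]) auto
    then show ?thesis using 2 by simp
  qed simp
next
  fix n \<sigma> i j k assume \<sigma>: "\<sigma> \<in> perms n" and o: "occ ?R n \<sigma> i j"
  show "{Suc n - k..n} \<subseteq> forb ?R n \<sigma> i j \<or> forb ?R n \<sigma> i j \<subseteq> {Suc n - k..n}"
    using occ_len[OF \<sigma> o] by (cases "\<sigma> j \<le> Suc n - k") (auto simp: mem_forb)
next
  fix n :: nat and \<sigma> r assume \<sigma>: "\<sigma> \<in> perms n" and n: "1 \<le> n" and r: "r \<le> n"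
  have o: "occ ?R (Suc n) (ext n r \<sigma>) i (Suc n) \<longleftrightarrow> i = pos1 n \<sigma> \<and> r \<noteq> 0 \<and> r \<notin> mzone n \<sigma>" for i
  proof
    assume a: "occ ?R (Suc n) (ext n r \<sigma>) i (Suc n)"
    note p = pos1[OF \<sigma> n]
    have "\<sigma> i \<le> \<sigma> (pos1 n \<sigma>)" using occ_new_clear[OF \<sigma> a, of "pos1 n \<sigma>"] p
      by (cases "pos1 n \<sigma>" i rule: linorder_cases) (auto simp: nclear_def)
    then have s: "\<sigma> i = 1" using p perms_ge1[OF \<sigma>, of i] occ_new_len[OF a] by simp
    then have i: "i = pos1 n \<sigma>" using pos1_unique[OF \<sigma> n] by blast
    have "r < \<sigma> l" if "1 \<le> l" "l < i" for l
      using occ_new_clear(1)[OF \<sigma> a that] s that perms_inj[OF \<sigma>, of l i] by (auto simp: nclear_def)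
    then show "i = pos1 n \<sigma> \<and> r \<noteq> 0 \<and> r \<notin> mzone n \<sigma>"
      using i occ_new_len[OF a] s by (fastforce simp: mzone_def)
  next
    assume a: "i = pos1 n \<sigma> \<and> r \<noteq> 0 \<and> r \<notin> mzone n \<sigma>"
    have "nclear ?R 0 (\<sigma> i) r (\<sigma> l)" if "1 \<le> l" "l < i" for l
    proof -
      have "r < \<sigma> l" using a that r by (auto simp: mzone_def)
      then show ?thesis using perms_ge1[OF \<sigma>, of l] a pos1[OF \<sigma> n] that by (simp add: nclear_def)
    qed
    moreover have "nclear ?R 1 (\<sigma> i) r (\<sigma> l)" if "i < l" "l \<le> n" for l
      using perms_ge1[OF \<sigma>, of l] a pos1[OF \<sigma> n] that by (simp add: nclear_def)
    ultimately show "occ ?R (Suc n) (ext n r \<sigma>) i (Suc n)"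
      using a pos1[OF \<sigma> n] by (intro occ_newI[OF \<sigma>]) auto
  qed
  have "{k. k \<le> n \<and> r \<in> {Suc n - k..n} \<and> r \<notin> {Suc n - (k - 1)..n}} = {Suc n - r}" if "r \<noteq> 0"
    using that r by auto
  then show "new_sizes ?R n \<sigma> r = (if r \<noteq> 0 \<and> r \<notin> mzone n \<sigma> then
      {k. k \<le> n \<and> r \<in> {Suc n - k..n} \<and> r \<notin> {Suc n - (k - 1)..n}} else {})"
    unfolding new_sizes_def o by (simp add: fsize_def)
qed (use card_mzone_ext pos1_singleton in \<open>auto simp: mzone_def pos1_def\<close>)

text \<open>A new occurrence again starts at the entry 1, but cell (0,2) now excludes the slots of
  \<open>mzone'\<close>. The slot sets are the intervals between the two values, and the reference
  segments start at slot 1.\<close>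

lemma realises_E2:
  "realises (\<lambda>n \<sigma>. (card (mzone' n \<sigma>), sizes {(0,2),(2,1),(0,0),(1,0)} n \<sigma>)) estep (0, {})"
  (is "realises (\<lambda>n \<sigma>. (_, sizes ?R n \<sigma>)) _ _")
proof (rule realises_E[where seg = "\<lambda>n k. {1..k}"])
  have min: "\<sigma> i \<le> \<sigma> m" if \<sigma>: "\<sigma> \<in> perms n" and o: "occ ?R n \<sigma> i j" and m: "1 \<le> m" "m \<le> j" for n \<sigma> i j m
    using occ_clear(1,2)[OF \<sigma> o, of m] occ_len[OF \<sigma> o] m
    by (cases "m = j"; cases m i rule: linorder_cases) (auto simp: clear_def)
  have *: "forb ?R n \<sigma> i j \<subseteq> forb ?R n \<sigma> k l \<or> forb ?R n \<sigma> k l \<subseteq> forb ?R n \<sigma> i j"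
    if \<sigma>: "\<sigma> \<in> perms n" and o: "occ ?R n \<sigma> i j" and p: "occ ?R n \<sigma> k l" and le: "j \<le> l" for n \<sigma> i j k l
  \<comment> \<open>If the pairs overlap in position, each first value is minimal on a prefix
    containing the other one, so they coincide. Otherwise the later pair starts no higher and, by
    cell (0,2), ends no lower than the earlier one.\<close>
  proof (cases "k < j")
    case True
    have "\<sigma> i = \<sigma> k"
      using min[OF \<sigma> o, of k] min[OF \<sigma> p, of i] occ_len[OF \<sigma> o] occ_len[OF \<sigma> p] True le by simp
    then show ?thesis using occ_len[OF \<sigma> o] occ_len[OF \<sigma> p] by (cases "\<sigma> j \<le> \<sigma> l") (auto simp: mem_forb)
  next
    case False
    have "\<sigma> k \<le> \<sigma> i" using min[OF \<sigma> p, of i] occ_len[OF \<sigma> o] le by simp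
    then have "k \<noteq> j" using occ_len[OF \<sigma> o] by auto
    then have "\<sigma> j \<le> \<sigma> l" using occ_clear(1)[OF \<sigma> p, of j] occ_len[OF \<sigma> o] False by (auto simp: clear_def)
    then show ?thesis using \<open>\<sigma> k \<le> \<sigma> i\<close> occ_len[OF \<sigma> o] occ_len[OF \<sigma> p] by (auto simp: mem_forb)
  qed
  fix n \<sigma> i j k l assume \<sigma>: "\<sigma> \<in> perms n" and o: "occ ?R n \<sigma> i j" and p: "occ ?R n \<sigma> k l"
  show "forb ?R n \<sigma> i j \<subseteq> forb ?R n \<sigma> k l \<or> forb ?R n \<sigma> k l \<subseteq> forb ?R n \<sigma> i j"
    using *[OF \<sigma> o p] *[OF \<sigma> p o] by (cases "j \<le> l") auto
next
  fix n \<sigma> i j assume \<sigma>: "\<sigma> \<in> perms n" and o: "occ ?R n \<sigma> i j"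
  then show "0 \<notin> forb ?R n \<sigma> i j" using occ_len[OF \<sigma> o] by (simp add: mem_forb)
next
  fix n :: nat and \<sigma> assume \<sigma>: "\<sigma> \<in> perms n" and n: "1 \<le> n"
  show "mzone' n \<sigma> \<subseteq> {1..n}" by (auto simp: mzone'_def)
  show "mzone' n \<sigma> = {1..card (mzone' n \<sigma>)}"
    by (cases rule: mzone'_eq[OF \<sigma> n]) auto
next
  fix n \<sigma> i j k assume \<sigma>: "\<sigma> \<in> perms n" and o: "occ ?R n \<sigma> i j" and k: "card (mzone' n \<sigma>) \<le> k"
  note l = occ_len[OF \<sigma> o]
  then have n: "1 \<le> n" by simp
  note p = pos1[OF \<sigma> n]
  show "{1..k} \<subseteq> forb ?R n \<sigma> i j \<or> forb ?R n \<sigma> i j \<subseteq> {1..k}"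
  proof (cases "\<sigma> i = 1")
    case True
    then show ?thesis using l by (cases "\<sigma> j \<le> k") (auto simp: mem_forb)
  next
    case False
    \<comment> \<open>The first value is minimal among the entries up to \<open>j\<close>, so an
      occurrence without the entry 1 ends before it. Then the entry at \<open>j\<close> puts all its
      slots into the zone.\<close>
    have "j < pos1 n \<sigma>"
    proof (rule ccontr)
      assume "\<not> j < pos1 n \<sigma>"
      then have "\<sigma> i \<le> \<sigma> (pos1 n \<sigma>)"
        using occ_clear(1,2)[OF \<sigma> o, of "pos1 n \<sigma>"] l p
        by (cases "pos1 n \<sigma> = j"; cases "pos1 n \<sigma>" i rule: linorder_cases) (auto simp: clear_def)
      then show False using False l p by simp
    qed
    then have "forb ?R n \<sigma> i j \<subseteq> mzone' n \<sigma>" using l by (auto simp: mem_forb mzone'_def intro!: exI[of _ j])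
    also have "\<dots> \<subseteq> {1..k}" using k by (cases rule: mzone'_eq[OF \<sigma> n]) auto
    finally show ?thesis by blast
  qed
next
  fix n :: nat and \<sigma> r assume \<sigma>: "\<sigma> \<in> perms n" and n: "1 \<le> n" and r: "r \<le> n"
  have o: "occ ?R (Suc n) (ext n r \<sigma>) i (Suc n) \<longleftrightarrow> i = pos1 n \<sigma> \<and> r \<noteq> 0 \<and> r \<notin> mzone' n \<sigma>" for i
  proof
    assume a: "occ ?R (Suc n) (ext n r \<sigma>) i (Suc n)"
    note p = pos1[OF \<sigma> n]
    have "\<sigma> i \<le> \<sigma> (pos1 n \<sigma>)" using occ_new_clear[OF \<sigma> a, of "pos1 n \<sigma>"] p
      by (cases "pos1 n \<sigma>" i rule: linorder_cases) (auto simp: nclear_def)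
    then have s: "\<sigma> i = 1" using p perms_ge1[OF \<sigma>, of i] occ_new_len[OF a] by simp
    then have i: "i = pos1 n \<sigma>" using pos1_unique[OF \<sigma> n] by blast
    have "\<sigma> l \<le> r" if "1 \<le> l" "l < i" for l
      using occ_new_clear(1)[OF \<sigma> a that] by (auto simp: nclear_def)
    then show "i = pos1 n \<sigma> \<and> r \<noteq> 0 \<and> r \<notin> mzone' n \<sigma>"
      using i occ_new_len[OF a] s by (fastforce simp: mzone'_def)
  next
    assume a: "i = pos1 n \<sigma> \<and> r \<noteq> 0 \<and> r \<notin> mzone' n \<sigma>"
    have "nclear ?R 0 (\<sigma> i) r (\<sigma> l)" if "1 \<le> l" "l < i" for l
    proof -
      have "\<sigma> l \<le> r" using a that r by (auto simp: mzone'_def)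
      then show ?thesis using perms_ge1[OF \<sigma>, of l] a pos1[OF \<sigma> n] that by (simp add: nclear_def)
    qed
    moreover have "nclear ?R 1 (\<sigma> i) r (\<sigma> l)" if "i < l" "l \<le> n" for l
      using perms_ge1[OF \<sigma>, of l] a pos1[OF \<sigma> n] that by (simp add: nclear_def)
    ultimately show "occ ?R (Suc n) (ext n r \<sigma>) i (Suc n)"
      using a pos1[OF \<sigma> n] by (intro occ_newI[OF \<sigma>]) auto
  qed
  have "{k. k \<le> n \<and> r \<in> {1..k} \<and> r \<notin> {1..k - 1}} = {r}" if "r \<noteq> 0"
    using that r by auto
  moreover have "ext n r \<sigma> (pos1 n \<sigma>) = 1" if "r \<noteq> 0" using pos1[OF \<sigma> n] that by (simp add: ext_def)
  ultimately show "new_sizes ?R n \<sigma> r = (if r \<noteq> 0 \<and> r \<notin> mzone' n \<sigma> then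
      {k. k \<le> n \<and> r \<in> {1..k} \<and> r \<notin> {1..k - 1}} else {})"
    unfolding new_sizes_def o by (simp add: fsize_def)
qed (use card_mzone'_ext pos1_singleton in \<open>auto simp: mzone'_def pos1_def\<close>)

lemma weq_E: "weq {(2,2),(0,1),(0,0),(1,0)} {(0,2),(2,1),(0,0),(1,0)}"
  by (rule weq_realises[OF realises_E1 realises_E2])

section \<open>A rule for a minimum that separates large from small entries\<close>

definition gstep :: "nat \<Rightarrow> nat option \<times> nat set \<Rightarrow> nat \<Rightarrow> nat option \<times> nat set" where
  "gstep n l b = (if b = n then (Some n, snd l) else
     (case fst l of None \<Rightarrow> (None, {f \<in> snd l. f \<le> b})
      | Some j \<Rightarrow> if j \<le> b then (Some j, insert (Suc j) {f \<in> snd l. f \<le> b}) else (None, {f \<in> snd l. f \<le> b})))"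

text \<open>\<open>cand\<close> says that the entry 1 can still serve as a first point, and
  \<open>K\<close> holds the slots that would end this. After any other nonzero slot the size
  \<open>pos1 n \<sigma>\<close> is present: either the new entry creates it, or an old occurrence
  of that size survives. So the rule need not tell the two cases apart.\<close>

lemma realises_G:
  assumes nest: "\<And>n \<sigma> i j k l. \<sigma> \<in> perms n \<Longrightarrow> occ R n \<sigma> i j \<Longrightarrow> occ R n \<sigma> k l \<Longrightarrow>
      forb R n \<sigma> i j \<subseteq> forb R n \<sigma> k l \<or> forb R n \<sigma> k l \<subseteq> forb R n \<sigma> i j"
    and cf: "\<And>n \<sigma> i j. \<sigma> \<in> perms n \<Longrightarrow> occ R n \<sigma> i j \<Longrightarrow> 0 \<notin> forb R n \<sigma> i j"
    and K: "\<And>n \<sigma>. \<sigma> \<in> perms n \<Longrightarrow> n \<ge> 1 \<Longrightarrow> cand n \<sigma> \<Longrightarrow> K n \<sigma> \<subseteq> {1..n} \<and> card (K n \<sigma>) = pos1 n \<sigma> - 1"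
    and occK: "\<And>n \<sigma> i j. \<sigma> \<in> perms n \<Longrightarrow> cand n \<sigma> \<Longrightarrow> occ R n \<sigma> i j \<Longrightarrow>
       K n \<sigma> \<subseteq> forb R n \<sigma> i j \<or> forb R n \<sigma> i j \<subseteq> K n \<sigma>"
    and cext: "\<And>n \<sigma> r. \<sigma> \<in> perms n \<Longrightarrow> n \<ge> 1 \<Longrightarrow> r \<le> n \<Longrightarrow>
       cand (Suc n) (ext n r \<sigma>) \<longleftrightarrow> r = 0 \<or> cand n \<sigma> \<and> r \<notin> K n \<sigma>"
    and new: "\<And>n \<sigma> r. \<sigma> \<in> perms n \<Longrightarrow> n \<ge> 1 \<Longrightarrow> r \<le> n \<Longrightarrow> cand n \<sigma> \<Longrightarrow> r \<noteq> 0 \<Longrightarrow> r \<notin> K n \<sigma> \<Longrightarrow>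
      new_sizes R n \<sigma> r = {pos1 n \<sigma>} \<or>
      new_sizes R n \<sigma> r = {} \<and> (\<exists>i k. occ R n \<sigma> i k \<and> fsize R n \<sigma> i k = pos1 n \<sigma> \<and> r \<notin> forb R n \<sigma> i k)"
    and new0: "\<And>n \<sigma> r. \<sigma> \<in> perms n \<Longrightarrow> n \<ge> 1 \<Longrightarrow> r \<le> n \<Longrightarrow> \<not> (cand n \<sigma> \<and> r \<noteq> 0 \<and> r \<notin> K n \<sigma>) \<Longrightarrow> new_sizes R n \<sigma> r = {}"
    and c1: "cand (Suc 0) (ext 0 0 id)"
  shows "realises (\<lambda>n \<sigma>. (if n \<ge> 1 \<and> cand n \<sigma> then Some (pos1 n \<sigma> - 1) else None, sizes R n \<sigma>)) gstep (None, {})"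
  unfolding realises_def
proof (intro conjI allI ballI)
  show "(if (0::nat) \<ge> 1 \<and> cand 0 id then Some (pos1 0 id - 1) else None, sizes R 0 id) = (None, {})" by (simp add: sizes_0)
  fix n \<sigma> assume \<sigma>: "\<sigma> \<in> perms n"
  let ?s = "\<lambda>n \<sigma>. if n \<ge> 1 \<and> cand n \<sigma> then Some (pos1 n \<sigma> - 1) else None"
  show "\<exists>\<pi>. bij_betw \<pi> {..n} {..n} \<and> (\<forall>r\<le>n. (?s (Suc n) (ext n r \<sigma>), sizes R (Suc n) (ext n r \<sigma>)) =
      gstep n (?s n \<sigma>, sizes R n \<sigma>) (\<pi> r))"
  proof (cases "n = 0")
    case True
    then have "\<sigma> = id" using \<sigma> by (simp add: perms_0)
    moreover have "pos1 (Suc 0) (ext 0 0 id) = 1"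
      using pos1[OF ext_perms[of id 0 0]] by (simp add: perms_0)
    ultimately show ?thesis using True bij_betw_id[of "{..n}"] c1 by (auto simp: sizes_0 sizes_1 gstep_def)
  next
    case False
    then have n: "n \<ge> 1" by simp
    note p = pos1[OF \<sigma> n]
    let ?X = "insert {1..n} (if cand n \<sigma> then {K n \<sigma>} else {})"
    have f1: "forb R n \<sigma> i j \<subseteq> {1..n}" if "occ R n \<sigma> i j" for i j
    proof
      fix x assume x: "x \<in> forb R n \<sigma> i j"
      then have "x \<noteq> 0" using cf[OF \<sigma> that] by metis
      then show "x \<in> {1..n}" using x by (auto simp: forb_def)
    qed
    obtain \<pi> where \<pi>: "bij_betw \<pi> {..n} {..n}"
      "\<And>A r. A \<in> ?X \<Longrightarrow> r \<le> n \<Longrightarrow> r \<in> A \<longleftrightarrow> \<pi> r < card A"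
      "\<And>r. r \<le> n \<Longrightarrow> sizes R (Suc n) (ext n r \<sigma>) = {f \<in> sizes R n \<sigma>. f \<le> \<pi> r} \<union> new_sizes R n \<sigma> r"
    proof (rule chain_slots[OF \<sigma> nest[OF \<sigma>], where \<X> = ?X])
      show "A \<subseteq> {..n}" if "A \<in> ?X" for A using that K[OF \<sigma> n] by (auto split: if_splits)
      show "A \<subseteq> B \<or> B \<subseteq> A" if AB: "A \<in> ?X" "B \<in> ?X" for A B
        using AB K[OF \<sigma> n] by (auto split: if_splits)
      show "A \<subseteq> forb R n \<sigma> i j \<or> forb R n \<sigma> i j \<subseteq> A" if A: "A \<in> ?X" and o: "occ R n \<sigma> i j" for A i j
        using A occK[OF \<sigma> _ o] f1[OF o] by (auto split: if_splits)
    qed auto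
    have p0: "r = 0 \<longleftrightarrow> \<pi> r = n" if "r \<le> n" for r
      using \<pi>(2)[of "{1..n}" r] that bij_betw_apply[OF \<pi>(1), of r] by auto
    have pk: "r \<in> K n \<sigma> \<longleftrightarrow> \<pi> r < pos1 n \<sigma> - 1" if "r \<le> n" "cand n \<sigma>" for r
      using \<pi>(2)[of "K n \<sigma>" r] that K[OF \<sigma> n] by auto
    have le: "sizes R n \<sigma> = {f \<in> sizes R n \<sigma>. f \<le> n}"
    proof -
      have "fsize R n \<sigma> i j \<le> n" if "occ R n \<sigma> i j" for i j
        using card_mono[OF _ f1[OF that]] card_forb[of \<sigma> i j n R] occ_len[OF \<sigma> that] by simp
      then show ?thesis by (auto simp: sizes_def)
    qed
    have "(?s (Suc n) (ext n r \<sigma>), sizes R (Suc n) (ext n r \<sigma>)) = gstep n (?s n \<sigma>, sizes R n \<sigma>) (\<pi> r)"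
      if r: "r \<le> n" for r
    proof (cases "r = 0")
      case True
      then show ?thesis
        using cext[OF \<sigma> n r] pos1_ext[OF \<sigma> n r] new0[OF \<sigma> n r] \<pi>(3)[OF r] p0[OF r] le
        by (simp add: gstep_def)
    next
      case r0: False
      show ?thesis
      proof (cases "cand n \<sigma> \<and> r \<notin> K n \<sigma>")
        case True
        have pn: "pos1 n \<sigma> - 1 \<le> \<pi> r" "\<pi> r \<noteq> n" using pk[OF r] True p0[OF r] r0 by auto
        have "sizes R (Suc n) (ext n r \<sigma>) = insert (pos1 n \<sigma>) {f \<in> sizes R n \<sigma>. f \<le> \<pi> r}"
        proof (cases "new_sizes R n \<sigma> r = {pos1 n \<sigma>}")
          case True
          then show ?thesis using \<pi>(3)[OF r] by auto
        next
          case False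
          then obtain i k where ik: "new_sizes R n \<sigma> r = {}" "occ R n \<sigma> i k" "fsize R n \<sigma> i k = pos1 n \<sigma>" "r \<notin> forb R n \<sigma> i k"
            using new[OF \<sigma> n r] True r0 by blast
          then have "fsize R (Suc n) (ext n r \<sigma>) i k = pos1 n \<sigma>" "occ R (Suc n) (ext n r \<sigma>) i k"
            using occ_len[OF \<sigma> ik(2)] fsize_ext[of i n k \<sigma> r R] occ_ext_old[of k n R r \<sigma> i] r by (auto simp: forb_def)
          then have "pos1 n \<sigma> \<in> sizes R (Suc n) (ext n r \<sigma>)" unfolding sizes_def by force
          then show ?thesis using \<pi>(3)[OF r] ik(1) by auto
        qed
        then show ?thesis
          using cext[OF \<sigma> n r] pos1_ext[OF \<sigma> n r] True r0 pn n p by (simp add: gstep_def)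
      next
        case False
        have "\<pi> r \<noteq> n" using p0[OF r] r0 by auto
        then show ?thesis
          using cext[OF \<sigma> n r] new0[OF \<sigma> n r] \<pi>(3)[OF r] r0 False pk[OF r] n by (auto simp: gstep_def)
      qed
    qed
    then show ?thesis using \<pi>(1) by blast
  qed
qed

lemma pos1_min:
  assumes "\<sigma> \<in> perms n" "1 \<le> i" "i \<le> n" "\<And>m. 1 \<le> m \<Longrightarrow> m \<le> n \<Longrightarrow> \<sigma> i \<le> \<sigma> m"
  shows "i = pos1 n \<sigma>"
proof -
  have n: "1 \<le> n" using assms by simp
  have "\<sigma> i = 1" using assms(4)[of "pos1 n \<sigma>"] pos1[OF assms(1) n] perms_ge1[OF assms(1-3)] by simp
  then show ?thesis using pos1_unique[OF assms(1) n] by blast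
qed

text \<open>Under \<open>c\<close> every value from the smallest entry left of 1 upwards sits to the
  left of 1, so the zone consists of exactly the \<open>pos1 n \<sigma> - 1\<close> largest
  values.\<close>

lemma mzone_cand:
  assumes \<sigma>: "\<sigma> \<in> perms n" and n: "1 \<le> n"
    and c: "\<And>a l. 1 \<le> a \<Longrightarrow> a < pos1 n \<sigma> \<Longrightarrow> pos1 n \<sigma> < l \<Longrightarrow> l \<le> n \<Longrightarrow> \<sigma> l < \<sigma> a"
  shows "mzone n \<sigma> = {n + 2 - pos1 n \<sigma>..n}" "card (mzone n \<sigma>) = pos1 n \<sigma> - 1"
    "1 \<le> l \<Longrightarrow> l \<le> n \<Longrightarrow> l < pos1 n \<sigma> \<longleftrightarrow> n + 1 - pos1 n \<sigma> < \<sigma> l"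
proof -
  note p = pos1[OF \<sigma> n]
  have im: "mzone n \<sigma> = \<sigma> ` {1..<pos1 n \<sigma>}"
  proof (intro equalityI subsetI)
    fix r assume "r \<in> mzone n \<sigma>"
    then obtain a where a: "r \<le> n" "1 \<le> a" "a < pos1 n \<sigma>" "\<sigma> a \<le> r" by (auto simp: mzone_def)
    then have "1 \<le> r" using perms_ge1[OF \<sigma>, of a] p by simp
    then obtain l where l: "1 \<le> l" "l \<le> n" "\<sigma> l = r" using perms_pos[OF \<sigma>, of r] a by auto
    have "l \<noteq> pos1 n \<sigma>" using a l p perms_ge1[OF \<sigma>, of a] perms_inj[OF \<sigma>, of a "pos1 n \<sigma>"] by auto
    then show "r \<in> \<sigma> ` {1..<pos1 n \<sigma>}" using c[of a l] a l by force
  next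
    fix r assume "r \<in> \<sigma> ` {1..<pos1 n \<sigma>}"
    then show "r \<in> mzone n \<sigma>" using perms_len[OF \<sigma>] p by (force simp: mzone_def)
  qed
  have "inj_on \<sigma> {1..<pos1 n \<sigma>}" using perms_inj[OF \<sigma>] by (auto simp: inj_on_def)
  then show card: "card (mzone n \<sigma>) = pos1 n \<sigma> - 1" by (simp add: im card_image)
  show eq: "mzone n \<sigma> = {n + 2 - pos1 n \<sigma>..n}"
  proof (cases rule: mzone_eq[OF \<sigma> n])
    case (2 l)
    then have "\<sigma> l \<le> n" using p by (intro perms_len[OF \<sigma>]) auto
    then have "Suc n - \<sigma> l = pos1 n \<sigma> - 1" using card 2(4) by simp
    then show ?thesis using \<open>\<sigma> l \<le> n\<close> 2(4) p by simp
  qed simp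
  assume l: "1 \<le> l" "l \<le> n"
  have "l < pos1 n \<sigma> \<longleftrightarrow> \<sigma> l \<in> mzone n \<sigma>"
    using l perms_inj[OF \<sigma>] by (auto simp: im)
  then show "l < pos1 n \<sigma> \<longleftrightarrow> n + 1 - pos1 n \<sigma> < \<sigma> l"
    using perms_len[OF \<sigma> l] p by (auto simp: eq)
qed

text \<open>Under \<open>c\<close> the entries up to and including 1 are the smallest values. A slot
  of the zone is one less than such a value, hence the \<open>Suc\<close> in the proof; the value 1
  corresponds to no slot of the zone and is added separately.\<close>

lemma mzone'_cand:
  assumes \<sigma>: "\<sigma> \<in> perms n" and n: "1 \<le> n"
    and c: "\<And>a l. 1 \<le> a \<Longrightarrow> a < pos1 n \<sigma> \<Longrightarrow> pos1 n \<sigma> < l \<Longrightarrow> l \<le> n \<Longrightarrow> \<sigma> a < \<sigma> l"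
  shows "mzone' n \<sigma> = {1..<pos1 n \<sigma>}"
    "1 \<le> l \<Longrightarrow> l \<le> n \<Longrightarrow> l \<le> pos1 n \<sigma> \<longleftrightarrow> \<sigma> l \<le> pos1 n \<sigma>"
proof -
  note p = pos1[OF \<sigma> n]
  have im: "insert (1::nat) (Suc ` mzone' n \<sigma>) = \<sigma> ` {1..pos1 n \<sigma>}"
  proof (intro equalityI subsetI)
    fix r assume "r \<in> insert (1::nat) (Suc ` mzone' n \<sigma>)"
    then consider "r = 1" | s where "r = Suc s" "s \<in> mzone' n \<sigma>" by auto
    then show "r \<in> \<sigma> ` {1..pos1 n \<sigma>}"
    proof cases
      case 2
      then obtain a where a: "1 \<le> s" "s \<le> n" "1 \<le> a" "a < pos1 n \<sigma>" "s < \<sigma> a" by (auto simp: mzone'_def)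
      then have "r \<le> n" using perms_len[OF \<sigma>, of a] p 2 by simp
      then obtain l where l: "1 \<le> l" "l \<le> n" "\<sigma> l = r" using perms_pos[OF \<sigma>, of r] 2 by auto
      then show ?thesis using c[of a l] a 2 by force
    qed (use p in force)
  next
    fix r assume "r \<in> \<sigma> ` {1..pos1 n \<sigma>}"
    then obtain l where l: "1 \<le> l" "l \<le> pos1 n \<sigma>" "r = \<sigma> l" by auto
    show "r \<in> insert (1::nat) (Suc ` mzone' n \<sigma>)"
    proof (cases "r = 1")
      case False
      then have "l < pos1 n \<sigma>" using l p by (metis le_neq_implies_less)
      moreover have "2 \<le> r" "r \<le> n" using False l perms_ge1[OF \<sigma>, of l] perms_len[OF \<sigma>, of l] p by auto
      ultimately have "r - 1 \<in> mzone' n \<sigma>" using l by (auto simp: mzone'_def)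
      then have "Suc (r - 1) \<in> Suc ` mzone' n \<sigma>" by blast
      then show ?thesis using \<open>2 \<le> r\<close> by simp
    qed simp
  qed
  have "inj_on \<sigma> {1..pos1 n \<sigma>}" using perms_inj[OF \<sigma>] by (auto simp: inj_on_def)
  then have "card (insert (1::nat) (Suc ` mzone' n \<sigma>)) = pos1 n \<sigma>" unfolding im by (simp add: card_image)
  moreover have "1 \<notin> Suc ` mzone' n \<sigma>" "finite (mzone' n \<sigma>)" by (auto simp: mzone'_def)
  ultimately have card: "Suc (card (mzone' n \<sigma>)) = pos1 n \<sigma>" by (simp add: card_image)
  show eq: "mzone' n \<sigma> = {1..<pos1 n \<sigma>}"
    by (cases rule: mzone'_eq[OF \<sigma> n]) (use card in auto)
  assume l: "1 \<le> l" "l \<le> n"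
  have "l \<le> pos1 n \<sigma> \<longleftrightarrow> \<sigma> l \<in> \<sigma> ` {1..pos1 n \<sigma>}"
    using l perms_inj[OF \<sigma>] by auto
  also have "\<sigma> ` {1..pos1 n \<sigma>} = {1..pos1 n \<sigma>}" unfolding im[symmetric] eq using p
    by (auto simp: image_Suc_atLeastLessThan)
  finally show "l \<le> pos1 n \<sigma> \<longleftrightarrow> \<sigma> l \<le> pos1 n \<sigma>" using perms_ge1[OF \<sigma> l] by auto
qed

text \<open>A new occurrence starts at the entry 1; entries left of 1 must lie above the new entry,
  and those right of 1 below it. A suitable slot exists exactly as long as the left entries exceed
  the right ones.\<close>

lemma realises_G3:
  "realises (\<lambda>n \<sigma>. (if n \<ge> 1 \<and> (\<forall>a l. 1 \<le> a \<longrightarrow> a < pos1 n \<sigma> \<longrightarrow> pos1 n \<sigma> < l \<longrightarrow> l \<le> n \<longrightarrow> \<sigma> l < \<sigma> a)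
     then Some (pos1 n \<sigma> - 1) else None, sizes {(1,2),(2,2),(0,1),(0,0),(1,0)} n \<sigma>)) gstep (None, {})"
  (is "realises (\<lambda>n \<sigma>. (if _ \<and> ?cand n \<sigma> then _ else _, sizes ?R n \<sigma>)) _ _")
proof (rule realises_G[where K = mzone])
  fix n \<sigma> i j k l assume \<sigma>: "\<sigma> \<in> perms n" and o: "occ ?R n \<sigma> i j" and p: "occ ?R n \<sigma> k l"
  show "forb ?R n \<sigma> i j \<subseteq> forb ?R n \<sigma> k l \<or> forb ?R n \<sigma> k l \<subseteq> forb ?R n \<sigma> i j"
    using occ_len[OF \<sigma> o] occ_len[OF \<sigma> p] by (cases "\<sigma> j \<le> \<sigma> l") (auto simp: mem_forb)
next
  fix n \<sigma> i j assume \<sigma>: "\<sigma> \<in> perms n" and o: "occ ?R n \<sigma> i j"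
  then show "0 \<notin> forb ?R n \<sigma> i j" using occ_len[OF \<sigma> o] by (simp add: mem_forb)
next
  fix n :: nat and \<sigma> assume \<sigma>: "\<sigma> \<in> perms n" and n: "1 \<le> n" and c: "?cand n \<sigma>"
  show "mzone n \<sigma> \<subseteq> {1..n} \<and> card (mzone n \<sigma>) = pos1 n \<sigma> - 1"
    using mzone_cand(1,2)[OF \<sigma> n] c pos1[OF \<sigma> n] by auto
next
  fix n \<sigma> i j assume \<sigma>: "\<sigma> \<in> perms n" and c: "?cand n \<sigma>" and o: "occ ?R n \<sigma> i j"
  have n: "1 \<le> n" using occ_len[OF \<sigma> o] by simp
  have "mzone n \<sigma> = {n + 2 - pos1 n \<sigma>..n}" using mzone_cand(1)[OF \<sigma> n] c by blast
  then show "mzone n \<sigma> \<subseteq> forb ?R n \<sigma> i j \<or> forb ?R n \<sigma> i j \<subseteq> mzone n \<sigma>"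
    using occ_len[OF \<sigma> o] by (cases "\<sigma> j \<le> n + 2 - pos1 n \<sigma>") (auto simp: mem_forb)
next
  fix n :: nat and \<sigma> r assume \<sigma>: "\<sigma> \<in> perms n" and n: "1 \<le> n" and r: "r \<le> n"
  note p = pos1[OF \<sigma> n]
  show "?cand (Suc n) (ext n r \<sigma>) \<longleftrightarrow> r = 0 \<or> ?cand n \<sigma> \<and> r \<notin> mzone n \<sigma>"
  proof (cases "r = 0")
    case True
    then show ?thesis using pos1_ext[OF \<sigma> n r] by simp
  next
    case False
    have "?cand (Suc n) (ext n r \<sigma>) \<longleftrightarrow> ?cand n \<sigma> \<and> (\<forall>a. 1 \<le> a \<longrightarrow> a < pos1 n \<sigma> \<longrightarrow> r < \<sigma> a)"
      (is "?l \<longleftrightarrow> ?r1 \<and> ?r2")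
    proof
      assume l: ?l
      have "\<sigma> l < \<sigma> a" if "1 \<le> a" "a < pos1 n \<sigma>" "pos1 n \<sigma> < l" "l \<le> n" for a l
        using l[rule_format, of a l] that pos1_ext[OF \<sigma> n r] False by simp
      moreover have "r < \<sigma> a" if "1 \<le> a" "a < pos1 n \<sigma>" for a
        using l[rule_format, of a "Suc n"] that pos1_ext[OF \<sigma> n r] False p by simp
      ultimately show "?r1 \<and> ?r2" by blast
    next
      assume r: "?r1 \<and> ?r2"
      show ?l
      proof (intro allI impI)
        fix a l assume "1 \<le> a" "a < pos1 (Suc n) (ext n r \<sigma>)" "pos1 (Suc n) (ext n r \<sigma>) < l" "l \<le> Suc n"
        then show "ext n r \<sigma> l < ext n r \<sigma> a"
          using r pos1_ext[OF \<sigma> n \<open>r \<le> n\<close>] False p by (cases "l = Suc n") auto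
      qed
    qed
    moreover have "?r2 \<longleftrightarrow> r \<notin> mzone n \<sigma>" using r by (auto simp: mzone_def not_le)
    ultimately show ?thesis using False by blast
  qed
  have *: "i = pos1 n \<sigma>" "r \<noteq> 0" "r \<notin> mzone n \<sigma>" "?cand n \<sigma>" "\<And>l. pos1 n \<sigma> < l \<Longrightarrow> l \<le> n \<Longrightarrow> \<sigma> l \<le> r"
    if a: "occ ?R (Suc n) (ext n r \<sigma>) i (Suc n)" for i
  proof -
    show i: "i = pos1 n \<sigma>"
    proof (rule pos1_min[OF \<sigma>])
      show "\<sigma> i \<le> \<sigma> m" if "1 \<le> m" "m \<le> n" for m
        using occ_new_clear[OF \<sigma> a, of m] that by (cases m i rule: linorder_cases) (auto simp: nclear_def)
    qed (use occ_new_len[OF a] in auto)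
    show r0: "r \<noteq> 0" using occ_new_len[OF a] i p by simp
    have A: "r < \<sigma> l" if "1 \<le> l" "l < pos1 n \<sigma>" for l
    proof -
      have "1 < \<sigma> l" using perms_ge1[OF \<sigma>, of l] perms_inj[OF \<sigma>, of l "pos1 n \<sigma>"] that p by fastforce
      then show ?thesis using occ_new_clear(1)[OF \<sigma> a, of l] that i p by (auto simp: nclear_def)
    qed
    show C: "\<sigma> l \<le> r" if "pos1 n \<sigma> < l" "l \<le> n" for l
      using occ_new_clear(2)[OF \<sigma> a, of l] that i by (auto simp: nclear_def)
    show "r \<notin> mzone n \<sigma>" 
    proof
      assume "r \<in> mzone n \<sigma>"
      then obtain l where "1 \<le> l" "l < pos1 n \<sigma>" "\<sigma> l \<le> r" by (auto simp: mzone_def)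
      then show False using A[of l] by simp
    qed
    show "?cand n \<sigma>" using A C by fastforce
  qed
  show "new_sizes ?R n \<sigma> r = {}" if "\<not> (?cand n \<sigma> \<and> r \<noteq> 0 \<and> r \<notin> mzone n \<sigma>)"
    using * that by (fastforce simp: new_sizes_def)
  assume c: "?cand n \<sigma>" and r0: "r \<noteq> 0" and rk: "r \<notin> mzone n \<sigma>"
  \<comment> \<open>The largest value not left of the entry 1. Only slot \<open>?q\<close> creates
    an occurrence; at the slots \<open>1..?q - 1\<close> the entries 1 and \<open>?q\<close> form an
    old occurrence of the same size that survives.\<close>
  let ?q = "n + 1 - pos1 n \<sigma>"
  have mz: "mzone n \<sigma> = {n + 2 - pos1 n \<sigma>..n}" using mzone_cand(1)[OF \<sigma> n] c by blast
  have mem: "l < pos1 n \<sigma> \<longleftrightarrow> ?q < \<sigma> l" if "1 \<le> l" "l \<le> n" for l using mzone_cand(3)[OF \<sigma> n _ that] c by blast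
  have rq: "r \<le> ?q" using rk r p by (simp add: mz)
  have "\<exists>k. 1 \<le> k \<and> k \<le> n \<and> \<sigma> k = ?q" by (rule perms_pos[OF \<sigma>]) (use p in auto)
  then obtain k where k: "1 \<le> k" "k \<le> n" "\<sigma> k = ?q" by blast
  have kp: "pos1 n \<sigma> \<le> k" using mem[of k] k by simp
  show "new_sizes ?R n \<sigma> r = {pos1 n \<sigma>} \<or>
     new_sizes ?R n \<sigma> r = {} \<and> (\<exists>i k. occ ?R n \<sigma> i k \<and> fsize ?R n \<sigma> i k = pos1 n \<sigma> \<and> r \<notin> forb ?R n \<sigma> i k)"
  proof (cases "r = ?q")
    case True
    have "occ ?R (Suc n) (ext n r \<sigma>) (pos1 n \<sigma>) (Suc n)"
    proof (rule occ_newI[OF \<sigma> p(1,2)])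
      show "nclear ?R 0 (\<sigma> (pos1 n \<sigma>)) r (\<sigma> l)" if "1 \<le> l" "l < pos1 n \<sigma>" for l
        using mem[of l] that True p perms_ge1[OF \<sigma>, of l] by (simp add: nclear_def)
      show "nclear ?R 1 (\<sigma> (pos1 n \<sigma>)) r (\<sigma> l)" if "pos1 n \<sigma> < l" "l \<le> n" for l
        using mem[of l] that True p perms_ge1[OF \<sigma>, of l] by (simp add: nclear_def)
    qed (use r0 p in simp)
    then have "occ ?R (Suc n) (ext n r \<sigma>) i (Suc n) \<longleftrightarrow> i = pos1 n \<sigma>" for i using *(1) by blast
    then have "new_sizes ?R n \<sigma> r = {fsize ?R (Suc n) (ext n r \<sigma>) (pos1 n \<sigma>) (Suc n)}"
      by (simp add: new_sizes_def)
    then show ?thesis using True p by (simp add: fsize_def)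
  next
    case False
    have "k \<noteq> pos1 n \<sigma>" using False rq r0 k p by auto
    then have pk: "pos1 n \<sigma> < k" using kp by simp
    have "occ ?R n \<sigma> (pos1 n \<sigma>) k"
    proof (rule occI[OF \<sigma> p(1) pk k(2)])
      show "\<sigma> (pos1 n \<sigma>) < \<sigma> k" using False rq r0 k p by simp
      show "clear ?R 0 (\<sigma> (pos1 n \<sigma>)) (\<sigma> k) (\<sigma> l)" if "1 \<le> l" "l < pos1 n \<sigma>" for l
        using mem[of l] that k p perms_ge1[OF \<sigma>, of l] by (simp add: clear_def)
      show "clear ?R 1 (\<sigma> (pos1 n \<sigma>)) (\<sigma> k) (\<sigma> l)" if "pos1 n \<sigma> < l" "l < k" for l
        using mem[of l] that k p perms_ge1[OF \<sigma>, of l] by (simp add: clear_def)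
      show "clear ?R 2 (\<sigma> (pos1 n \<sigma>)) (\<sigma> k) (\<sigma> l)" if "k < l" "l \<le> n" for l
        using mem[of l] that k p pk perms_ge1[OF \<sigma>, of l] by (simp add: clear_def)
    qed
    moreover have "fsize ?R n \<sigma> (pos1 n \<sigma>) k = pos1 n \<sigma>" using k p by (simp add: fsize_def)
    moreover have "r \<notin> forb ?R n \<sigma> (pos1 n \<sigma>) k"
      using False rq r0 k p by (subst mem_forb) auto
    moreover have "new_sizes ?R n \<sigma> r = {}"
    proof -
      have False if "occ ?R (Suc n) (ext n r \<sigma>) i (Suc n)" for i
        using *(5)[OF that, of k] pk k False rq by simp
      then show ?thesis by (auto simp: new_sizes_def)
    qed
    ultimately show ?thesis by blast
  qed
next
  have "pos1 (Suc 0) (ext 0 0 id) = 1" using pos1[OF ext_perms[of id 0 0]] by (simp add: perms_0)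
  then show "?cand (Suc 0) (ext 0 0 id)" by simp
qed

text \<open>The mirrored situation: entries left of 1 must lie below the new entry and those right
  of 1 above it, which is possible as long as the left entries are smaller than the right
  ones.\<close>

lemma realises_G2:
  "realises (\<lambda>n \<sigma>. (if n \<ge> 1 \<and> (\<forall>a l. 1 \<le> a \<longrightarrow> a < pos1 n \<sigma> \<longrightarrow> pos1 n \<sigma> < l \<longrightarrow> l \<le> n \<longrightarrow> \<sigma> a < \<sigma> l)
     then Some (pos1 n \<sigma> - 1) else None, sizes {(0,2),(1,1),(2,1),(0,0),(1,0)} n \<sigma>)) gstep (None, {})"
  (is "realises (\<lambda>n \<sigma>. (if _ \<and> ?cand n \<sigma> then _ else _, sizes ?R n \<sigma>)) _ _")
proof (rule realises_G[where K = mzone'])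
  have min: "\<sigma> i \<le> \<sigma> m" if \<sigma>: "\<sigma> \<in> perms n" and o: "occ ?R n \<sigma> i j" and m: "1 \<le> m" "m \<le> j" for n \<sigma> i j m
    using occ_clear(1,2)[OF \<sigma> o, of m] occ_len[OF \<sigma> o] m
    by (cases "m = j"; cases m i rule: linorder_cases) (auto simp: clear_def)
  have *: "forb ?R n \<sigma> i j \<subseteq> forb ?R n \<sigma> k l \<or> forb ?R n \<sigma> k l \<subseteq> forb ?R n \<sigma> i j"
    if \<sigma>: "\<sigma> \<in> perms n" and o: "occ ?R n \<sigma> i j" and p: "occ ?R n \<sigma> k l" and le: "j \<le> l" for n \<sigma> i j k l
  proof (cases "k < j")
    case True
    have "\<sigma> i = \<sigma> k"
      using min[OF \<sigma> o, of k] min[OF \<sigma> p, of i] occ_len[OF \<sigma> o] occ_len[OF \<sigma> p] True le by simp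
    then show ?thesis using occ_len[OF \<sigma> o] occ_len[OF \<sigma> p] by (cases "\<sigma> j \<le> \<sigma> l") (auto simp: mem_forb)
  next
    case False
    have "\<sigma> k \<le> \<sigma> i" using min[OF \<sigma> p, of i] occ_len[OF \<sigma> o] le by simp
    then have "k \<noteq> j" using occ_len[OF \<sigma> o] by auto
    then have "\<sigma> j \<le> \<sigma> l" using occ_clear(1)[OF \<sigma> p, of j] occ_len[OF \<sigma> o] False by (auto simp: clear_def)
    then show ?thesis using \<open>\<sigma> k \<le> \<sigma> i\<close> occ_len[OF \<sigma> o] occ_len[OF \<sigma> p] by (auto simp: mem_forb)
  qed
  fix n \<sigma> i j k l assume \<sigma>: "\<sigma> \<in> perms n" and o: "occ ?R n \<sigma> i j" and p: "occ ?R n \<sigma> k l"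
  show "forb ?R n \<sigma> i j \<subseteq> forb ?R n \<sigma> k l \<or> forb ?R n \<sigma> k l \<subseteq> forb ?R n \<sigma> i j"
    using *[OF \<sigma> o p] *[OF \<sigma> p o] by (cases "j \<le> l") auto
next
  fix n \<sigma> i j assume \<sigma>: "\<sigma> \<in> perms n" and o: "occ ?R n \<sigma> i j"
  then show "0 \<notin> forb ?R n \<sigma> i j" using occ_len[OF \<sigma> o] by (simp add: mem_forb)
next
  fix n :: nat and \<sigma> assume \<sigma>: "\<sigma> \<in> perms n" and n: "1 \<le> n" and c: "?cand n \<sigma>"
  have "mzone' n \<sigma> = {1..<pos1 n \<sigma>}" using mzone'_cand(1)[OF \<sigma> n] c by blast
  then show "mzone' n \<sigma> \<subseteq> {1..n} \<and> card (mzone' n \<sigma>) = pos1 n \<sigma> - 1"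
    using pos1[OF \<sigma> n] by auto
next
  fix n \<sigma> i j assume \<sigma>: "\<sigma> \<in> perms n" and c: "?cand n \<sigma>" and o: "occ ?R n \<sigma> i j"
  note l = occ_len[OF \<sigma> o]
  have n: "1 \<le> n" using l by simp
  note p = pos1[OF \<sigma> n]
  have mz: "mzone' n \<sigma> = {1..<pos1 n \<sigma>}" using mzone'_cand(1)[OF \<sigma> n] c by blast
  show "mzone' n \<sigma> \<subseteq> forb ?R n \<sigma> i j \<or> forb ?R n \<sigma> i j \<subseteq> mzone' n \<sigma>"
  proof (cases "\<sigma> i = 1")
    case True
    then show ?thesis using l by (cases "\<sigma> j \<le> pos1 n \<sigma>") (auto simp: mem_forb mz)
  next
    case False
    have "j < pos1 n \<sigma>"
    proof (rule ccontr)
      assume "\<not> j < pos1 n \<sigma>"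
      then have "\<sigma> i \<le> \<sigma> (pos1 n \<sigma>)"
        using occ_clear(1,2)[OF \<sigma> o, of "pos1 n \<sigma>"] l p
        by (cases "pos1 n \<sigma> = j"; cases "pos1 n \<sigma>" i rule: linorder_cases) (auto simp: clear_def)
      then show False using False l p by simp
    qed
    then have "forb ?R n \<sigma> i j \<subseteq> mzone' n \<sigma>" using l by (auto simp: mem_forb mzone'_def intro!: exI[of _ j])
    then show ?thesis by blast
  qed
next
  fix n :: nat and \<sigma> r assume \<sigma>: "\<sigma> \<in> perms n" and n: "1 \<le> n" and r: "r \<le> n"
  note p = pos1[OF \<sigma> n]
  show "?cand (Suc n) (ext n r \<sigma>) \<longleftrightarrow> r = 0 \<or> ?cand n \<sigma> \<and> r \<notin> mzone' n \<sigma>"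
  proof (cases "r = 0")
    case True
    then show ?thesis using pos1_ext[OF \<sigma> n r] by simp
  next
    case False
    have "?cand (Suc n) (ext n r \<sigma>) \<longleftrightarrow> ?cand n \<sigma> \<and> (\<forall>a. 1 \<le> a \<longrightarrow> a < pos1 n \<sigma> \<longrightarrow> \<sigma> a \<le> r)"
      (is "?l \<longleftrightarrow> ?r1 \<and> ?r2")
    proof
      assume l: ?l
      have "\<sigma> a < \<sigma> l" if "1 \<le> a" "a < pos1 n \<sigma>" "pos1 n \<sigma> < l" "l \<le> n" for a l
        using l[rule_format, of a l] that pos1_ext[OF \<sigma> n r] False by simp
      moreover have "\<sigma> a \<le> r" if "1 \<le> a" "a < pos1 n \<sigma>" for a
        using l[rule_format, of a "Suc n"] that pos1_ext[OF \<sigma> n r] False p by (simp add: less_Suc_eq_le)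
      ultimately show "?r1 \<and> ?r2" by blast
    next
      assume r: "?r1 \<and> ?r2"
      show ?l
      proof (intro allI impI)
        fix a l assume "1 \<le> a" "a < pos1 (Suc n) (ext n r \<sigma>)" "pos1 (Suc n) (ext n r \<sigma>) < l" "l \<le> Suc n"
        then show "ext n r \<sigma> a < ext n r \<sigma> l"
          using r pos1_ext[OF \<sigma> n \<open>r \<le> n\<close>] False p by (cases "l = Suc n") (auto simp: less_Suc_eq_le)
      qed
    qed
    moreover have "?r2 \<longleftrightarrow> r \<notin> mzone' n \<sigma>" using r False by (auto simp: mzone'_def not_less)
    ultimately show ?thesis using False by blast
  qed
  have *: "i = pos1 n \<sigma>" "r \<noteq> 0" "r \<notin> mzone' n \<sigma>" "?cand n \<sigma>" "\<And>l. pos1 n \<sigma> < l \<Longrightarrow> l \<le> n \<Longrightarrow> r < \<sigma> l"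
    if a: "occ ?R (Suc n) (ext n r \<sigma>) i (Suc n)" for i
  proof -
    show i: "i = pos1 n \<sigma>"
    proof (rule pos1_min[OF \<sigma>])
      show "\<sigma> i \<le> \<sigma> m" if "1 \<le> m" "m \<le> n" for m
        using occ_new_clear[OF \<sigma> a, of m] that by (cases m i rule: linorder_cases) (auto simp: nclear_def)
    qed (use occ_new_len[OF a] in auto)
    show r0: "r \<noteq> 0" using occ_new_len[OF a] i p by simp
    have A: "\<sigma> l \<le> r" if "1 \<le> l" "l < pos1 n \<sigma>" for l
      using occ_new_clear(1)[OF \<sigma> a, of l] that i by (auto simp: nclear_def)
    show C: "r < \<sigma> l" if "pos1 n \<sigma> < l" "l \<le> n" for l
    proof -
      have "1 < \<sigma> l" using perms_ge1[OF \<sigma>, of l] perms_inj[OF \<sigma>, of l "pos1 n \<sigma>"] that p by fastforce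
      then show ?thesis using occ_new_clear(2)[OF \<sigma> a, of l] that i p by (auto simp: nclear_def)
    qed
    show "r \<notin> mzone' n \<sigma>" 
    proof
      assume "r \<in> mzone' n \<sigma>"
      then obtain l where "1 \<le> l" "l < pos1 n \<sigma>" "r < \<sigma> l" by (auto simp: mzone'_def)
      then show False using A[of l] by simp
    qed
    show "?cand n \<sigma>" using A C by fastforce
  qed
  show "new_sizes ?R n \<sigma> r = {}" if "\<not> (?cand n \<sigma> \<and> r \<noteq> 0 \<and> r \<notin> mzone' n \<sigma>)"
    using * that by (fastforce simp: new_sizes_def)
  assume c: "?cand n \<sigma>" and r0: "r \<noteq> 0" and rk: "r \<notin> mzone' n \<sigma>"
  \<comment> \<open>The smallest value right of the entry 1, if there is any. Only slot
    \<open>pos1 n \<sigma>\<close> creates an occurrence; at higher slots the entries 1 and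
    \<open>?q\<close> form an old occurrence of the same size that survives.\<close>
  let ?q = "Suc (pos1 n \<sigma>)"
  have mz: "mzone' n \<sigma> = {1..<pos1 n \<sigma>}" using mzone'_cand(1)[OF \<sigma> n] c by blast
  have mem: "l \<le> pos1 n \<sigma> \<longleftrightarrow> \<sigma> l \<le> pos1 n \<sigma>" if "1 \<le> l" "l \<le> n" for l using mzone'_cand(2)[OF \<sigma> n _ that] c by blast
  have rq: "pos1 n \<sigma> \<le> r" using rk r0 by (simp add: mz)
  have e1: "ext n r \<sigma> (pos1 n \<sigma>) = 1" using p r0 by (simp add: ext_def)
  show "new_sizes ?R n \<sigma> r = {pos1 n \<sigma>} \<or>
     new_sizes ?R n \<sigma> r = {} \<and> (\<exists>i k. occ ?R n \<sigma> i k \<and> fsize ?R n \<sigma> i k = pos1 n \<sigma> \<and> r \<notin> forb ?R n \<sigma> i k)"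
  proof (cases "r = pos1 n \<sigma>")
    case True
    have "occ ?R (Suc n) (ext n r \<sigma>) (pos1 n \<sigma>) (Suc n)"
    proof (rule occ_newI[OF \<sigma> p(1,2)])
      show "nclear ?R 0 (\<sigma> (pos1 n \<sigma>)) r (\<sigma> l)" if "1 \<le> l" "l < pos1 n \<sigma>" for l
        using mem[of l] that True p perms_ge1[OF \<sigma>, of l] by (simp add: nclear_def)
      show "nclear ?R 1 (\<sigma> (pos1 n \<sigma>)) r (\<sigma> l)" if "pos1 n \<sigma> < l" "l \<le> n" for l
        using mem[of l] that True p perms_ge1[OF \<sigma>, of l] by (simp add: nclear_def)
    qed (use r0 p in simp)
    then have "occ ?R (Suc n) (ext n r \<sigma>) i (Suc n) \<longleftrightarrow> i = pos1 n \<sigma>" for i using *(1) by blast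
    then have "new_sizes ?R n \<sigma> r = {fsize ?R (Suc n) (ext n r \<sigma>) (pos1 n \<sigma>) (Suc n)}"
      by (simp add: new_sizes_def)
    then show ?thesis using True e1 by (simp add: fsize_def)
  next
    case False
    have "\<exists>k. 1 \<le> k \<and> k \<le> n \<and> \<sigma> k = ?q" by (rule perms_pos[OF \<sigma>]) (use p rq r False in auto)
    then obtain k where k: "1 \<le> k" "k \<le> n" "\<sigma> k = ?q" by blast
    then have pk: "pos1 n \<sigma> < k" using mem[of k] by simp
    have "occ ?R n \<sigma> (pos1 n \<sigma>) k"
    proof (rule occI[OF \<sigma> p(1) pk k(2)])
      show "\<sigma> (pos1 n \<sigma>) < \<sigma> k" using k p by simp
      show "clear ?R 0 (\<sigma> (pos1 n \<sigma>)) (\<sigma> k) (\<sigma> l)" if "1 \<le> l" "l < pos1 n \<sigma>" for l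
        using mem[of l] that k p perms_ge1[OF \<sigma>, of l] by (simp add: clear_def)
      show "clear ?R 1 (\<sigma> (pos1 n \<sigma>)) (\<sigma> k) (\<sigma> l)" if "pos1 n \<sigma> < l" "l < k" for l
        using mem[of l] that k p perms_ge1[OF \<sigma>, of l] by (simp add: clear_def)
      show "clear ?R 2 (\<sigma> (pos1 n \<sigma>)) (\<sigma> k) (\<sigma> l)" if "k < l" "l \<le> n" for l
        using mem[of l] that k p pk perms_ge1[OF \<sigma>, of l] by (simp add: clear_def)
    qed
    moreover have "fsize ?R n \<sigma> (pos1 n \<sigma>) k = pos1 n \<sigma>" using k p by (simp add: fsize_def)
    moreover have "r \<notin> forb ?R n \<sigma> (pos1 n \<sigma>) k"
      using False rq r0 k p by (subst mem_forb) auto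
    moreover have "new_sizes ?R n \<sigma> r = {}"
    proof -
      have False if "occ ?R (Suc n) (ext n r \<sigma>) i (Suc n)" for i
        using *(5)[OF that, of k] pk k False rq by simp
      then show ?thesis by (auto simp: new_sizes_def)
    qed
    ultimately show ?thesis by blast
  qed
next
  have "pos1 (Suc 0) (ext 0 0 id) = 1" using pos1[OF ext_perms[of id 0 0]] by (simp add: perms_0)
  then show "?cand (Suc 0) (ext 0 0 id)" by simp
qed

lemma weq_G2_G3: "weq {(0,2),(1,1),(2,1),(0,0),(1,0)} {(1,2),(2,2),(0,1),(0,0),(1,0)}"
  by (rule weq_realises[OF realises_G2 realises_G3])

section \<open>Equivalences from inversion codes\<close>

text \<open>The window \<open>W t u i\<close> contains the values allowed for the code at
  \<open>i\<close> when \<open>t\<close>, \<open>u\<close> is an occurrence. Coordinates before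
  \<open>t\<close> are unconstrained, which makes the decomposition at \<open>t\<close>
  possible.\<close>

definition tail :: "(nat \<Rightarrow> nat \<Rightarrow> nat \<Rightarrow> nat set) \<Rightarrow> nat \<Rightarrow> (nat \<Rightarrow> nat) \<Rightarrow> nat \<Rightarrow> nat \<Rightarrow> bool" where
  "tail W n c t u \<longleftrightarrow> 1 \<le> t \<and> t < u \<and> u \<le> n \<and> (\<forall>i. t \<le> i \<longrightarrow> i \<le> n \<longrightarrow> c i \<in> W t u i)"

definition free :: "(nat \<Rightarrow> nat \<Rightarrow> nat \<Rightarrow> nat set) \<Rightarrow> nat \<Rightarrow> (nat \<Rightarrow> nat) set" where
  "free W n = {c \<in> codes n. \<nexists>t u. tail W n c t u}"

text \<open>Prefix and tail of a code are chosen independently, and so are the coordinates of the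
  tail.\<close>

lemma card_codes_split:
  assumes t: "1 \<le> t" "t \<le> n" and W: "\<And>i. t \<le> i \<Longrightarrow> i \<le> n \<Longrightarrow> W i \<subseteq> {..<i}" and X: "X \<subseteq> codes (t - 1)"
  shows "card {c \<in> codes n. restrict c {1..t-1} \<in> X \<and> (\<forall>i. t \<le> i \<longrightarrow> i \<le> n \<longrightarrow> c i \<in> W i)} = card X * (\<Prod>i\<in>{t..n}. card (W i))"
proof -
  let ?L = "{c \<in> codes n. restrict c {1..t-1} \<in> X \<and> (\<forall>i. t \<le> i \<longrightarrow> i \<le> n \<longrightarrow> c i \<in> W i)}"
  let ?f = "\<lambda>c. (restrict c {1..t-1}, restrict c {t..n})"
  let ?g = "\<lambda>(a, b). \<lambda>i. if i \<in> {t..n} then b i else a i"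
  have "bij_betw ?f ?L (X \<times> (\<Pi>\<^sub>E i\<in>{t..n}. W i))"
  proof (rule bij_betw_byWitness[where f' = ?g])
    show "\<forall>c\<in>?L. ?g (?f c) = c"
    proof (intro ballI ext)
      fix c i assume c: "c \<in> ?L"
      then show "?g (?f c) i = c i" using codes_out[of c n i] t by auto
    qed
    show "\<forall>x\<in>X \<times> (\<Pi>\<^sub>E i\<in>{t..n}. W i). ?f (?g x) = x"
    proof
      fix x assume "x \<in> X \<times> (\<Pi>\<^sub>E i\<in>{t..n}. W i)"
      then obtain a b where x: "x = (a, b)" "a \<in> codes (t - 1)" "b \<in> (\<Pi>\<^sub>E i\<in>{t..n}. W i)" using X by auto
      have "restrict (?g x) {1..t-1} = a"
      proof
        fix i show "restrict (?g x) {1..t-1} i = a i" using codes_out[OF x(2), of i] x(1) by auto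
      qed
      moreover have "restrict (?g x) {t..n} = b"
      proof
        fix i show "restrict (?g x) {t..n} i = b i" using x by (auto simp: PiE_def extensional_def)
      qed
      ultimately show "?f (?g x) = x" using x(1) by simp
    qed
    show "?f ` ?L \<subseteq> X \<times> (\<Pi>\<^sub>E i\<in>{t..n}. W i)" by auto
    show "?g ` (X \<times> (\<Pi>\<^sub>E i\<in>{t..n}. W i)) \<subseteq> ?L"
    proof
      fix c assume "c \<in> ?g ` (X \<times> (\<Pi>\<^sub>E i\<in>{t..n}. W i))"
      then obtain a b where c: "c = ?g (a, b)" "a \<in> X" "b \<in> (\<Pi>\<^sub>E i\<in>{t..n}. W i)" by auto
      have a: "a \<in> codes (t - 1)" using c X by auto
      have ci: "c i = (if i \<in> {t..n} then b i else a i)" for i using c(1) by simp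
      have bW: "b i \<in> W i" if "t \<le> i" "i \<le> n" for i using c(3) that by (auto simp: PiE_def Pi_def)
      have "c \<in> codes n"
      proof (rule codesI)
        fix i assume i: "1 \<le> i" "i \<le> n"
        show "c i < i"
        proof (cases "t \<le> i")
          case True
          then show ?thesis using ci[of i] bW[of i] W[of i] i by auto
        next
          case False
          then show ?thesis using ci[of i] codes_less[OF a, of i] i by simp
        qed
      next
        fix i assume "i \<notin> {1..n}"
        then show "c i = undefined" using ci[of i] codes_out[OF a, of i] t by auto
      qed
      moreover have "restrict c {1..t-1} = a"
      proof
        fix i show "restrict c {1..t-1} i = a i" using codes_out[OF a, of i] ci[of i] by auto
      qed
      moreover have "\<forall>i. t \<le> i \<longrightarrow> i \<le> n \<longrightarrow> c i \<in> W i" using ci bW by simp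
      ultimately show "c \<in> ?L" using c(2) by simp
    qed
  qed
  then have "card ?L = card (X \<times> (\<Pi>\<^sub>E i\<in>{t..n}. W i))" by (rule bij_betw_same_card)
  then show ?thesis by (simp add: card_cartesian_product card_PiE)
qed

text \<open>A code with a confined tail decomposes at the smallest such \<open>t\<close>; its prefix is then free.\<close>

lemma card_free:
  assumes W: "\<And>t u i. t \<le> i \<Longrightarrow> 1 \<le> t \<Longrightarrow> W t u i \<subseteq> {t - 1..<i}"
    and Wu: "\<And>t u. t < u \<Longrightarrow> W t u u = {t - 1}"
    and Wk: "\<And>t u i. t < u \<Longrightarrow> u < i \<Longrightarrow> {t..<i} \<subseteq> W t u i"
    and uni: "\<And>n c t u u'. tail W n c t u \<Longrightarrow> tail W n c t u' \<Longrightarrow> u = u'"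
  shows "card (free W n) + (\<Sum>(t, u)\<in>{(t, u). 1 \<le> t \<and> t < u \<and> u \<le> n}. card (free W (t - 1)) * (\<Prod>i\<in>{t..n}. card (W t u i))) = fact n"
proof -
  let ?T = "{(t, u). 1 \<le> t \<and> t < u \<and> u \<le> n}"
  let ?D = "\<lambda>(t, u). {c \<in> codes n. restrict c {1..t-1} \<in> free W (t - 1) \<and> (\<forall>i. t \<le> i \<longrightarrow> i \<le> n \<longrightarrow> c i \<in> W t u i)}"
  have fT: "finite ?T" by (rule finite_subset[of _ "{..n} \<times> {..n}"]) auto
  \<comment> \<open>Once there is a tail at \<open>s\<close>, a tail starting before
    \<open>s\<close> is already visible in the prefix: codes from \<open>s\<close> on are at least
    \<open>s - 1 \<ge> t\<close>, so they fit the windows after \<open>u\<close> automatically, and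
    none of them can be the code \<open>t - 1\<close> required at \<open>u\<close>.\<close>
  have restr: "tail W n c t u \<longleftrightarrow> tail W (s - 1) (restrict c {1..s-1}) t u"
    if v: "tail W n c s v" and ts: "t < s" for c s v t u
  proof -
    have sn: "1 \<le> s" "s \<le> n" using v by (auto simp: tail_def)
    have big: "c i \<in> {s - 1..<i}" if "s \<le> i" "i \<le> n" for i using v W[of s i v] that by (auto simp: tail_def)
    show ?thesis
    proof
      assume a: "tail W n c t u"
      have "u < s"
      proof (rule ccontr)
        assume "\<not> u < s"
        then have "c u \<in> {s - 1..<u}" using big[of u] a by (auto simp: tail_def)
        moreover have "c u = t - 1" using a Wu[of t u] by (auto simp: tail_def)
        ultimately show False using ts a by (auto simp: tail_def)
      qed
      then show "tail W (s - 1) (restrict c {1..s-1}) t u" using a sn by (auto simp: tail_def)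
    next
      assume a: "tail W (s - 1) (restrict c {1..s-1}) t u"
      then have tu: "1 \<le> t" "t < u" "u \<le> s - 1" by (auto simp: tail_def)
      have a': "\<forall>i. t \<le> i \<longrightarrow> i \<le> s - 1 \<longrightarrow> restrict c {1..s-1} i \<in> W t u i"
        using a unfolding tail_def by blast
      have "c i \<in> W t u i" if i: "t \<le> i" "i \<le> n" for i
      proof (cases "i < s")
        case True
        then have "restrict c {1..s-1} i \<in> W t u i" by (intro a'[rule_format]) (use i True in auto)
        then show ?thesis using True i tu by (simp split: if_splits)
      next
        case False
        then have "c i \<in> {t..<i}" using big[of i] i tu by auto
        moreover have "{t..<i} \<subseteq> W t u i" using Wk[of t u i] tu False by simp
        ultimately show ?thesis by blast
      qed
      then show "tail W n c t u" using tu sn by (auto simp: tail_def)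
    qed
  qed
  have "codes n - free W n = (\<Union>x\<in>?T. ?D x)"
  proof (intro equalityI subsetI)
    fix c assume "c \<in> codes n - free W n"
    then have c: "c \<in> codes n" "\<exists>t. \<exists>u. tail W n c t u" by (auto simp: free_def)
    \<comment> \<open>Minimality makes the prefix free, since by \<open>restr\<close> a tail inside
      the prefix would be one of the whole code.\<close>
    define t where "t = (LEAST t. \<exists>u. tail W n c t u)"
    obtain u where u: "tail W n c t u" using LeastI_ex[OF c(2)] unfolding t_def by blast
    have t: "1 \<le> t" "t < u" "u \<le> n" using u by (auto simp: tail_def)
    have "restrict c {1..t-1} \<in> free W (t - 1)"
    proof -
      have "restrict c {1..t-1} \<in> codes (t - 1)"
        by (rule codesI) (use codes_less[OF c(1)] t in auto)
      moreover have "\<not> tail W (t - 1) (restrict c {1..t-1}) s v" for s v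
      proof
        assume a: "tail W (t - 1) (restrict c {1..t-1}) s v"
        then have "s < t" by (auto simp: tail_def)
        then have "tail W n c s v" using restr[OF u] a by blast
        then have "t \<le> s" unfolding t_def by (intro Least_le) blast
        then show False using \<open>s < t\<close> by simp
      qed
      ultimately show ?thesis by (auto simp: free_def)
    qed
    then have "c \<in> ?D (t, u)" using c(1) u by (auto simp: tail_def)
    then show "c \<in> (\<Union>x\<in>?T. ?D x)" using t by blast
  next
    fix c assume "c \<in> (\<Union>x\<in>?T. ?D x)"
    then obtain t u where "1 \<le> t" "t < u" "u \<le> n" "c \<in> ?D (t, u)" by blast
    then have "c \<in> codes n" "tail W n c t u" by (auto simp: tail_def)
    then show "c \<in> codes n - free W n" by (auto simp: free_def)
  qed
  moreover have "card (\<Union>x\<in>?T. ?D x) = (\<Sum>x\<in>?T. card (?D x))"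
  proof (rule card_UN_disjoint[OF fT])
    have sub: "?D x \<subseteq> codes n" for x by (cases x) auto
    show "\<forall>x\<in>?T. finite (?D x)" using sub finite_subset[OF _ finite_codes] by blast
    have disj: False if c: "c \<in> ?D (t, u)" "c \<in> ?D (s, v)" and tu: "1 \<le> t" "t < u" "u \<le> n" and sv: "1 \<le> s" "s < v" "v \<le> n"
      and ts: "t < s" for c t u s v
    proof -
      have a: "tail W n c t u" "tail W n c s v" using c tu sv by (auto simp: tail_def)
      then have "tail W (s - 1) (restrict c {1..s-1}) t u" using restr[OF a(2) ts] by blast
      then show False using c(2) by (auto simp: free_def)
    qed
    have same: "u = v" if "c \<in> ?D (t, u)" "c \<in> ?D (t, v)" "1 \<le> t" "t < u" "u \<le> n" "t < v" "v \<le> n" for c t u v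
      using uni[of n c t u v] that by (auto simp: tail_def)
    show "\<forall>x\<in>?T. \<forall>y\<in>?T. x \<noteq> y \<longrightarrow> ?D x \<inter> ?D y = {}"
    proof (intro ballI impI)
      fix x y assume xy: "x \<in> ?T" "y \<in> ?T" "x \<noteq> y"
      obtain t u s v where e: "x = (t, u)" "y = (s, v)" by (cases x, cases y) auto
      show "?D x \<inter> ?D y = {}"
      proof (rule ccontr)
        assume "?D x \<inter> ?D y \<noteq> {}"
        then obtain c where c: "c \<in> ?D (t, u)" "c \<in> ?D (s, v)" unfolding e by blast
        have tu: "1 \<le> t" "t < u" "u \<le> n" "1 \<le> s" "s < v" "v \<le> n" using xy e by auto
        show False
          using disj[OF c tu] disj[OF c(2,1) tu(4-6) tu(1-3)] same[of c t u v] c tu xy(3) e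
          by (cases t s rule: linorder_cases) auto
      qed
    qed
  qed
  moreover have "card (?D x) = (case x of (t, u) \<Rightarrow> card (free W (t - 1)) * (\<Prod>i\<in>{t..n}. card (W t u i)))" if x: "x \<in> ?T" for x
  proof -
    obtain t u where e: "x = (t, u)" "1 \<le> t" "t < u" "u \<le> n" using x by auto
    have "W t u i \<subseteq> {..<i}" if "t \<le> i" for i using W[of t i u] that e by fastforce
    then show ?thesis unfolding e(1) prod.case using e by (intro card_codes_split) (auto simp: free_def)
  qed
  moreover have "free W n \<subseteq> codes n" by (auto simp: free_def)
  then have "card (codes n - free W n) = fact n - card (free W n)" "card (free W n) \<le> fact n"
    using card_mono[OF finite_codes, of "free W n" n] finite_subset[OF _ finite_codes]
    by (auto simp: card_Diff_subset card_codes)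
  ultimately show ?thesis by simp
qed

text \<open>The recursion determines the number of free codes from the sizes of the windows
  alone.\<close>

lemma card_free_eq:
  assumes "\<And>n. card (free W n) + (\<Sum>(t, u)\<in>{(t, u). 1 \<le> t \<and> t < u \<and> u \<le> n}. card (free W (t - 1)) * (\<Prod>i\<in>{t..n}. card (W t u i))) = fact n"
    and "\<And>n. card (free W' n) + (\<Sum>(t, u)\<in>{(t, u). 1 \<le> t \<and> t < u \<and> u \<le> n}. card (free W' (t - 1)) * (\<Prod>i\<in>{t..n}. card (W' t u i))) = fact n"
    and c: "\<And>t u i. 1 \<le> t \<Longrightarrow> t < u \<Longrightarrow> t \<le> i \<Longrightarrow> card (W t u i) = card (W' t u i)"
  shows "card (free W n) = card (free W' n)"
proof (induction n rule: less_induct)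
  case (less n)
  have "(\<Sum>(t, u)\<in>{(t, u). 1 \<le> t \<and> t < u \<and> u \<le> n}. card (free W (t - 1)) * (\<Prod>i\<in>{t..n}. card (W t u i))) =
     (\<Sum>(t, u)\<in>{(t, u). 1 \<le> t \<and> t < u \<and> u \<le> n}. card (free W' (t - 1)) * (\<Prod>i\<in>{t..n}. card (W' t u i)))"
  proof (rule sum.cong[OF refl], clarify)
    fix t u assume tu: "1 \<le> t" "t < u" "u \<le> n"
    have "card (free W (t - 1)) = card (free W' (t - 1))" using less.IH[of "t - 1"] tu by simp
    moreover have "(\<Prod>i\<in>{t..n}. card (W t u i)) = (\<Prod>i\<in>{t..n}. card (W' t u i))"
      using c tu by (intro prod.cong) auto
    ultimately show "card (free W (t - 1)) * (\<Prod>i\<in>{t..n}. card (W t u i)) = card (free W' (t - 1)) * (\<Prod>i\<in>{t..n}. card (W' t u i))"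
      by simp
  qed
  then show ?case using assms(1)[of n] assms(2)[of n] by simp
qed

definition W1 :: "nat \<Rightarrow> nat \<Rightarrow> nat \<Rightarrow> nat set" where
  "W1 t u i = (if i = t \<or> i = u then {t - 1} else {t..<i})"

text \<open>Strictly between \<open>t\<close> and \<open>u\<close> the window is that of
  \<open>W1\<close> moved down by one; elsewhere the two agree, so all sizes coincide.\<close>

definition W3 :: "nat \<Rightarrow> nat \<Rightarrow> nat \<Rightarrow> nat set" where
  "W3 t u i = (if i = t \<or> i = u then {t - 1} else if i < u then {t - 1..<i - 1} else {t..<i})"

lemma card_free_W: "card (free W1 n) = card (free W3 n)"
proof (rule card_free_eq[OF card_free card_free])
  fix n c t u u' assume a: "tail W1 n c t u" "tail W1 n c t u'"
  have "c u \<in> W1 t u u" "c u \<in> W1 t u' u" "1 \<le> t" "t < u" using a by (auto simp: tail_def)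
  then show "u = u'" by (auto simp: W1_def split: if_splits)
next
  fix n c t u u' assume a: "tail W3 n c t u" "tail W3 n c t u'"
  have "c u \<in> W3 t u u" "c u \<in> W3 t u' u" "c u' \<in> W3 t u u'" "c u' \<in> W3 t u' u'" "1 \<le> t" "t < u" "t < u'"
    using a by (auto simp: tail_def)
  then show "u = u'" by (cases u u' rule: linorder_cases) (auto simp: W3_def split: if_splits)
qed (auto simp: W1_def W3_def)

lemma bcode_top:
  assumes \<sigma>: "\<sigma> \<in> perms n" and i: "1 \<le> i"
  shows "bcode \<sigma> i = i - 1 \<longleftrightarrow> (\<forall>l. 1 \<le> l \<longrightarrow> l < i \<longrightarrow> \<sigma> i < \<sigma> l)"
proof -
  have "bcode \<sigma> i = i - 1 \<longleftrightarrow> (\<forall>l. 1 \<le> l \<longrightarrow> l < i \<longrightarrow> \<sigma> i \<le> \<sigma> l)"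
    unfolding rcode_0[symmetric] using rcode_bcode[OF \<sigma> i] by linarith
  moreover have "\<sigma> i \<le> \<sigma> l \<longleftrightarrow> \<sigma> i < \<sigma> l" if "l < i" for l
    using perms_inj[OF \<sigma>, of i l] that by (auto simp: le_less)
  ultimately show ?thesis by blast
qed

lemma bcode_ge:
  assumes "\<And>l. 1 \<le> l \<Longrightarrow> l \<le> m \<Longrightarrow> \<sigma> i < \<sigma> l" "m < i"
  shows "m \<le> bcode \<sigma> i"
proof -
  have "card {1..m} \<le> bcode \<sigma> i" unfolding bcode_def using assms by (intro card_mono) auto
  then show ?thesis by simp
qed

lemma bcode_le:
  assumes "\<And>l. 1 \<le> l \<Longrightarrow> l < i \<Longrightarrow> \<sigma> i < \<sigma> l \<Longrightarrow> l \<le> m"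
  shows "bcode \<sigma> i \<le> m" "1 \<le> k \<Longrightarrow> k \<le> m \<Longrightarrow> \<not> \<sigma> i < \<sigma> k \<Longrightarrow> bcode \<sigma> i < m" 
    "bcode \<sigma> i = m \<Longrightarrow> 1 \<le> k \<Longrightarrow> k \<le> m \<Longrightarrow> \<sigma> i < \<sigma> k"
proof -
  let ?S = "{l. 1 \<le> l \<and> l < i \<and> \<sigma> i < \<sigma> l}"
  have sub: "?S \<subseteq> {1..m}" using assms by auto
  then have "card ?S \<le> card {1..m}" by (intro card_mono) auto
  then show "bcode \<sigma> i \<le> m" by (simp add: bcode_def)
  have *: "bcode \<sigma> i < m" if "1 \<le> k" "k \<le> m" "\<not> \<sigma> i < \<sigma> k" for k
  proof -
    have "?S \<subset> {1..m}" using sub that by auto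
    then have "card ?S < card {1..m}" by (intro psubset_card_mono) auto
    then show ?thesis by (simp add: bcode_def)
  qed
  show "1 \<le> k \<Longrightarrow> k \<le> m \<Longrightarrow> \<not> \<sigma> i < \<sigma> k \<Longrightarrow> bcode \<sigma> i < m" by (rule *)
  show "bcode \<sigma> i = m \<Longrightarrow> 1 \<le> k \<Longrightarrow> k \<le> m \<Longrightarrow> \<sigma> i < \<sigma> k" using * by force
qed

text \<open>In an occurrence the entries before \<open>t\<close> exceed \<open>\<sigma> u\<close>,
  those between the positions lie below \<open>\<sigma> t\<close>, and those after \<open>u\<close>
  lie below \<open>\<sigma> u\<close>. So exactly the \<open>t - 1\<close> initial entries are
  larger than either point, while every other entry from \<open>t\<close> on has at least
  \<open>t\<close> larger entries to its left.\<close>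

lemma occ_G1:
  assumes \<sigma>: "\<sigma> \<in> perms n"
  shows "occ {(0,0),(0,1),(1,1),(1,2),(2,2)} n \<sigma> t u \<longleftrightarrow> tail W1 n (bcode \<sigma>) t u" (is "occ ?R n \<sigma> t u \<longleftrightarrow> _")
proof
  assume o: "occ ?R n \<sigma> t u"
  note l = occ_len[OF \<sigma> o]
  have A: "\<sigma> u < \<sigma> k" if "1 \<le> k" "k < t" for k
    using occ_clear(1)[OF \<sigma> o that] that l perms_inj[OF \<sigma>, of k t] perms_inj[OF \<sigma>, of k u] by (auto simp: clear_def)
  have C: "\<sigma> k < \<sigma> t" if "t < k" "k < u" for k
    using occ_clear(2)[OF \<sigma> o that] that perms_inj[OF \<sigma>, of k t] perms_inj[OF \<sigma>, of k u] by (auto simp: clear_def)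
  have B: "\<forall>k. u < k \<longrightarrow> k \<le> n \<longrightarrow> \<sigma> k < \<sigma> u"
  proof (intro allI impI)
    fix k assume "u < k" "k \<le> n"
    then show "\<sigma> k < \<sigma> u" using occ_clear(3)[OF \<sigma> o, of k] perms_inj[OF \<sigma>, of k u] by (auto simp: clear_def)
  qed
  have bt: "bcode \<sigma> t = t - 1" using bcode_top[OF \<sigma> l(1)] A l by (meson less_trans)
  have bu: "bcode \<sigma> u = t - 1"
  proof (rule antisym)
    show "bcode \<sigma> u \<le> t - 1"
    proof (rule bcode_le(1))
      fix k assume k: "1 \<le> k" "k < u" "\<sigma> u < \<sigma> k"
      have "\<not> t < k" using C[of k] k l by auto
      moreover have "k \<noteq> t" using k l by auto
      ultimately show "k \<le> t - 1" by simp
    qed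
    show "t - 1 \<le> bcode \<sigma> u" by (rule bcode_ge) (use A l in auto)
  qed
  have bi: "t \<le> bcode \<sigma> i" if "t < i" "i < u" for i
  proof (rule bcode_ge)
    fix k assume k: "1 \<le> k" "k \<le> t"
    show "\<sigma> i < \<sigma> k" using A[of k] C[OF that] k l by (cases "k = t") auto
  qed (use that in simp)
  have bl: "t \<le> bcode \<sigma> i" if "u < i" "i \<le> n" for i
    using B rlmax_bcode[OF \<sigma>, of u] that bu l by fastforce
  have lt: "bcode \<sigma> i < i" if "1 \<le> i" for i using rcode_bcode[OF \<sigma> that] that by simp
  show "tail W1 n (bcode \<sigma>) t u"
    unfolding tail_def
  proof (intro conjI allI impI)
    fix i assume i: "t \<le> i" "i \<le> n"
    consider "i = t" | "i = u" | "t < i" "i < u" | "u < i" using i by linarith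
    then show "bcode \<sigma> i \<in> W1 t u i"
      by cases (use bt bu bi[of i] bl[of i] lt[of i] i l in \<open>auto simp: W1_def\<close>)
  qed (use l in auto)
next
  assume v: "tail W1 n (bcode \<sigma>) t u"
  then have l: "1 \<le> t" "t < u" "u \<le> n" and w: "\<And>i. t \<le> i \<Longrightarrow> i \<le> n \<Longrightarrow> bcode \<sigma> i \<in> W1 t u i" by (auto simp: tail_def)
  have bt: "bcode \<sigma> t = t - 1" and bu: "bcode \<sigma> u = t - 1" using w[of t] w[of u] l by (auto simp: W1_def)
  have bi: "t \<le> bcode \<sigma> i" if "t < i" "i \<le> n" "i \<noteq> u" for i using w[of i] that by (auto simp: W1_def)
  have A: "\<sigma> t < \<sigma> k" if "1 \<le> k" "k < t" for k using bcode_top[OF \<sigma> l(1)] bt that by blast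
  have C: "t < i \<Longrightarrow> i < u \<Longrightarrow> \<sigma> i < \<sigma> t" for i
  proof (induction i rule: less_induct)
    case (less i)
    show ?case
    proof (rule ccontr)
      assume n: "\<not> \<sigma> i < \<sigma> t"
      have "bcode \<sigma> i \<le> t - 1"
      proof (rule bcode_le(1))
        fix k assume k: "1 \<le> k" "k < i" "\<sigma> i < \<sigma> k"
        then have "\<not> t < k" using less.IH[of k] less.prems n by auto
        moreover have "k \<noteq> t" using k n by auto
        ultimately show "k \<le> t - 1" by simp
      qed
      then show False using bi[of i] less.prems l by simp
    qed
  qed
  have tu: "\<sigma> t < \<sigma> u"
  proof (rule ccontr)
    assume n: "\<not> \<sigma> t < \<sigma> u"
    then have "\<sigma> u < \<sigma> t" using perms_inj[OF \<sigma>, of t u] l by auto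
    then have "\<sigma> u < \<sigma> k" if "1 \<le> k" "k \<le> t" for k using A[of k] that by (cases "k = t") auto
    then have "t \<le> bcode \<sigma> u" by (rule bcode_ge) (use l in auto)
    then show False using bu l by simp
  qed
  have A': "\<sigma> u < \<sigma> k" if "1 \<le> k" "k < t" for k
  proof (rule bcode_le(3)[OF _ bu])
    fix k assume k: "1 \<le> k" "k < u" "\<sigma> u < \<sigma> k"
    have "\<not> t < k" using C[of k] k tu by auto
    moreover have "k \<noteq> t" using k tu by auto
    ultimately show "k \<le> t - 1" by simp
  qed (use that in auto)
  have "\<forall>k. u < k \<longrightarrow> k \<le> n \<longrightarrow> bcode \<sigma> u < bcode \<sigma> k"
  proof (intro allI impI)
    fix k assume "u < k" "k \<le> n"
    then show "bcode \<sigma> u < bcode \<sigma> k" using bi[of k] l bu by simp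
  qed
  then have B: "\<forall>k. u < k \<longrightarrow> k \<le> n \<longrightarrow> \<sigma> k < \<sigma> u" using rlmax_bcode[OF \<sigma>, of u] l by simp
  show "occ ?R n \<sigma> t u"
  proof (rule occI[OF \<sigma> l tu])
    show "clear ?R 0 (\<sigma> t) (\<sigma> u) (\<sigma> k)" if "1 \<le> k" "k < t" for k using A'[OF that] tu by (simp add: clear_def)
    show "clear ?R 1 (\<sigma> t) (\<sigma> u) (\<sigma> k)" if "t < k" "k < u" for k using C[OF that] tu by (simp add: clear_def)
    show "clear ?R 2 (\<sigma> t) (\<sigma> u) (\<sigma> k)" if "u < k" "k \<le> n" for k
    proof -
      have "\<sigma> k < \<sigma> u" using B that by blast
      then show ?thesis by (simp add: clear_def)
    qed
  qed
qed

text \<open>The difference to the previous pattern is between the positions, where entries now lie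
  between the two values: the \<open>t - 1\<close> initial entries are above them and at least one
  earlier entry, that at \<open>t\<close>, is below.\<close>

lemma occ_G3:
  assumes \<sigma>: "\<sigma> \<in> perms n"
  shows "occ {(0,0),(0,1),(1,0),(1,2),(2,2)} n \<sigma> t u \<longleftrightarrow> tail W3 n (bcode \<sigma>) t u" (is "occ ?R n \<sigma> t u \<longleftrightarrow> _")
proof
  assume o: "occ ?R n \<sigma> t u"
  note l = occ_len[OF \<sigma> o]
  have A: "\<sigma> u < \<sigma> k" if "1 \<le> k" "k < t" for k
    using occ_clear(1)[OF \<sigma> o that] that l perms_inj[OF \<sigma>, of k t] perms_inj[OF \<sigma>, of k u] by (auto simp: clear_def)
  have C: "\<sigma> t < \<sigma> k" "\<sigma> k < \<sigma> u" if "t < k" "k < u" for k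
    using occ_clear(2)[OF \<sigma> o that] that perms_inj[OF \<sigma>, of k t] perms_inj[OF \<sigma>, of k u] by (auto simp: clear_def)
  have B: "\<forall>k. u < k \<longrightarrow> k \<le> n \<longrightarrow> \<sigma> k < \<sigma> u"
  proof (intro allI impI)
    fix k assume "u < k" "k \<le> n"
    then show "\<sigma> k < \<sigma> u" using occ_clear(3)[OF \<sigma> o, of k] perms_inj[OF \<sigma>, of k u] by (auto simp: clear_def)
  qed
  have bt: "bcode \<sigma> t = t - 1" using bcode_top[OF \<sigma> l(1)] A l by (meson less_trans)
  have bu: "bcode \<sigma> u = t - 1"
  proof (rule antisym)
    show "bcode \<sigma> u \<le> t - 1"
    proof (rule bcode_le(1))
      fix k assume k: "1 \<le> k" "k < u" "\<sigma> u < \<sigma> k"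
      have "\<not> t < k" using C(2)[of k] k l by auto
      moreover have "k \<noteq> t" using k l by auto
      ultimately show "k \<le> t - 1" by simp
    qed
    show "t - 1 \<le> bcode \<sigma> u" by (rule bcode_ge) (use A l in auto)
  qed
  have bi: "t - 1 \<le> bcode \<sigma> i" "bcode \<sigma> i < i - 1" if i: "t < i" "i < u" for i
  proof -
    show "t - 1 \<le> bcode \<sigma> i"
    proof (rule bcode_ge)
      fix k assume k: "1 \<le> k" "k \<le> t - 1"
      have "\<sigma> u < \<sigma> k" using A[of k] k l by simp
      then show "\<sigma> i < \<sigma> k" using C(2)[OF i] by simp
    qed (use i in simp)
    have "rcode \<sigma> i \<noteq> 0" unfolding rcode_0 using C(1)[OF i] i l by (meson not_le)
    then show "bcode \<sigma> i < i - 1" using rcode_bcode[OF \<sigma>, of i] i l by simp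
  qed
  have bl: "t \<le> bcode \<sigma> i" if "u < i" "i \<le> n" for i
    using B rlmax_bcode[OF \<sigma>, of u] that bu l by fastforce
  have lt: "bcode \<sigma> i < i" if "1 \<le> i" for i using rcode_bcode[OF \<sigma> that] that by simp
  show "tail W3 n (bcode \<sigma>) t u"
    unfolding tail_def
  proof (intro conjI allI impI)
    fix i assume i: "t \<le> i" "i \<le> n"
    consider "i = t" | "i = u" | "t < i" "i < u" | "u < i" using i by linarith
    then show "bcode \<sigma> i \<in> W3 t u i"
      by cases (use bt bu bi[of i] bl[of i] lt[of i] i l in \<open>auto simp: W3_def\<close>)
  qed (use l in auto)
next
  assume v: "tail W3 n (bcode \<sigma>) t u"
  then have l: "1 \<le> t" "t < u" "u \<le> n" and w: "\<And>i. t \<le> i \<Longrightarrow> i \<le> n \<Longrightarrow> bcode \<sigma> i \<in> W3 t u i" by (auto simp: tail_def)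
  have bt: "bcode \<sigma> t = t - 1" and bu: "bcode \<sigma> u = t - 1" using w[of t] w[of u] l by (auto simp: W3_def)
  have bi: "t - 1 \<le> bcode \<sigma> i" "bcode \<sigma> i < i - 1" if "t < i" "i < u" for i using w[of i] that l by (auto simp: W3_def)
  have bl: "t \<le> bcode \<sigma> i" if "u < i" "i \<le> n" for i using w[of i] that l by (auto simp: W3_def)
  have A: "\<sigma> t < \<sigma> k" if "1 \<le> k" "k < t" for k using bcode_top[OF \<sigma> l(1)] bt that by blast
  \<comment> \<open>If \<open>\<sigma> a\<close> were not above \<open>\<sigma> i\<close>, then by
    induction no entry larger than \<open>\<sigma> i\<close> could sit in \<open>t..<i\<close>. All
    of them would be before \<open>t\<close>, with \<open>a\<close> missing, which is too
    few.\<close>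
  have CA: "t \<le> i \<Longrightarrow> i \<le> u \<Longrightarrow> \<forall>a. 1 \<le> a \<longrightarrow> a < t \<longrightarrow> \<sigma> i < \<sigma> a" for i
  proof (induction i rule: less_induct)
    case (less i)
    show ?case
    proof (cases "i = t")
      case False
      show ?thesis
      proof (intro allI impI, rule ccontr)
        fix a assume a: "1 \<le> a" "a < t" "\<not> \<sigma> i < \<sigma> a"
        have "bcode \<sigma> i < t - 1"
        proof (rule bcode_le(2)[OF _ a(1) _ a(3)])
          fix k assume k: "1 \<le> k" "k < i" "\<sigma> i < \<sigma> k"
          have "\<not> t \<le> k"
          proof
            assume "t \<le> k"
            then have "\<sigma> k < \<sigma> a" using less.IH[of k] k less.prems a by simp
            then show False using k a by simp
          qed
          then show "k \<le> t - 1" by simp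
        qed (use a in simp)
        moreover have "t - 1 \<le> bcode \<sigma> i" using bi(1)[of i] bu False less.prems by (cases "i = u") auto
        ultimately show False by simp
      qed
    qed (use A in blast)
  qed
  have C1: "t < i \<Longrightarrow> i < u \<Longrightarrow> \<sigma> t < \<sigma> i" for i
  proof (induction i rule: less_induct)
    case (less i)
    have "rcode \<sigma> i \<noteq> 0" using bi(2)[of i] less.prems rcode_bcode[OF \<sigma>, of i] l by simp
    then obtain m where m: "1 \<le> m" "m < i" "\<sigma> m < \<sigma> i" unfolding rcode_0 by (auto simp: not_le)
    have "\<sigma> t \<le> \<sigma> m" using A[of m] less.IH[of m] m less.prems by (cases m t rule: linorder_cases) auto
    then show ?case using m by simp
  qed
  \<comment> \<open>The initial entries already account for the whole code \<open>t - 1\<close> at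
    \<open>u\<close>, so no further entry before \<open>u\<close> can exceed
    \<open>\<sigma> u\<close>.\<close>
  have Cu: "\<not> \<sigma> u < \<sigma> i" if i: "t \<le> i" "i < u" for i
  proof
    assume lt: "\<sigma> u < \<sigma> i"
    have "card (insert i {1..t-1}) \<le> bcode \<sigma> u"
      unfolding bcode_def using CA[of u] l i lt by (intro card_mono) auto
    moreover have "card (insert i {1..t-1}) = t"
      using i l by (subst card_insert_disjoint) auto
    ultimately show False using bu l by simp
  qed
  have C2: "\<sigma> i < \<sigma> u" if i: "t \<le> i" "i < u" for i
    using Cu[OF i] perms_inj[OF \<sigma>, of i u] i by auto
  have "\<forall>k. u < k \<longrightarrow> k \<le> n \<longrightarrow> bcode \<sigma> u < bcode \<sigma> k"
  proof (intro allI impI)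
    fix k assume "u < k" "k \<le> n"
    then show "bcode \<sigma> u < bcode \<sigma> k" using bl[of k] l bu by simp
  qed
  then have B: "\<forall>k. u < k \<longrightarrow> k \<le> n \<longrightarrow> \<sigma> k < \<sigma> u" using rlmax_bcode[OF \<sigma>, of u] l by simp
  have tu: "\<sigma> t < \<sigma> u" using C2[of t] l by simp
  show "occ ?R n \<sigma> t u"
  proof (rule occI[OF \<sigma> l tu])
    show "clear ?R 0 (\<sigma> t) (\<sigma> u) (\<sigma> k)" if "1 \<le> k" "k < t" for k
      using CA[of u, rule_format, of k] that tu l by (simp add: clear_def)
    show "clear ?R 1 (\<sigma> t) (\<sigma> u) (\<sigma> k)" if "t < k" "k < u" for k
      using C1[of k] C2[of k] that by (simp add: clear_def)
    show "clear ?R 2 (\<sigma> t) (\<sigma> u) (\<sigma> k)" if "u < k" "k \<le> n" for k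
    proof -
      have "\<sigma> k < \<sigma> u" using B that by blast
      then show ?thesis by (simp add: clear_def)
    qed
  qed
qed

lemma weq_G1_G3: "weq {(0,0),(0,1),(1,1),(1,2),(2,2)} {(0,0),(0,1),(1,0),(1,2),(2,2)}" (is "weq ?R ?R'")
proof -
  have "card (av ?R n) = card (av ?R' n)" for n
  proof -
    have W: "tail W n (restrict c {1..n}) t u \<longleftrightarrow> tail W n c t u" for W c t u by (auto simp: tail_def)
    have "card (av ?R n) = card {c \<in> codes n. \<nexists>t u. tail W1 n c t u}"
      unfolding av_def by (rule card_bcode, unfold W, use occ_G1 in auto)
    also have "\<dots> = card {c \<in> codes n. \<nexists>t u. tail W3 n c t u}" using card_free_W by (simp add: free_def)
    also have "\<dots> = card (av ?R' n)"
      unfolding av_def by (rule card_bcode[symmetric], unfold W, use occ_G3 in auto)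
    finally show ?thesis .
  qed
  then show ?thesis by (simp add: weq_def)
qed

section \<open>Adjacent occurrences and an exchange of code values\<close>

lemma occ_adjacent:
  assumes \<sigma>: "\<sigma> \<in> perms n" and o: "occ R n \<sigma> i j" and R: "(1,0) \<in> R" "(1,1) \<in> R" "(1,2) \<in> R"
  shows "j = Suc i"
proof (rule ccontr)
  assume "j \<noteq> Suc i"
  then have l: "i < Suc i" "Suc i < j" using occ_len[OF \<sigma> o] by auto
  then show False
    using occ_clear(2)[OF \<sigma> o l] R perms_inj[OF \<sigma>, of "Suc i" i] perms_inj[OF \<sigma>, of "Suc i" j]
    by (auto simp: clear_def)
qed

text \<open>Strict right-to-left minima of the code. By \<open>rlmax_bcode\<close> they mark the
  right-to-left maxima of the permutation, which is what cell (2,2) demands of the second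
  point.\<close>

definition rlmin :: "nat \<Rightarrow> (nat \<Rightarrow> nat) \<Rightarrow> nat \<Rightarrow> bool" where
  "rlmin n c j \<longleftrightarrow> (\<forall>l. j < l \<longrightarrow> l \<le> n \<longrightarrow> c j < c l)"

text \<open>The full middle column makes the points adjacent, and by \<open>bcode_adjacent\<close>
  cell (0,1) is then empty exactly if the codes at the two points agree.\<close>

lemma contain_F1:
  assumes \<sigma>: "\<sigma> \<in> perms n"
  shows "(\<exists>i j. occ {(0,1),(1,0),(1,1),(1,2),(2,2)} n \<sigma> i j) \<longleftrightarrow>
    (\<exists>i. 1 \<le> i \<and> Suc i \<le> n \<and> bcode \<sigma> i = bcode \<sigma> (Suc i) \<and> rlmin n (bcode \<sigma>) (Suc i))"
    (is "(\<exists>i j. occ ?R n \<sigma> i j) \<longleftrightarrow> _")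
proof
  assume "\<exists>i j. occ ?R n \<sigma> i j"
  then obtain i j where o: "occ ?R n \<sigma> i j" by blast
  note l = occ_len[OF \<sigma> o]
  have j: "j = Suc i" using occ_adjacent[OF \<sigma> o] by simp
  have "bcode \<sigma> (Suc i) = bcode \<sigma> i"
    unfolding bcode_adjacent[OF \<sigma> l(1)] using occ_clear(1)[OF \<sigma> o] l j by (auto simp: clear_def)
  moreover have "\<forall>l. j < l \<longrightarrow> l \<le> n \<longrightarrow> \<sigma> l < \<sigma> j"
  proof (intro allI impI)
    fix l assume "j < l" "l \<le> n"
    then show "\<sigma> l < \<sigma> j" using occ_clear(3)[OF \<sigma> o, of l] perms_inj[OF \<sigma>, of l j] by (auto simp: clear_def)
  qed
  then have "rlmin n (bcode \<sigma>) (Suc i)" unfolding rlmin_def using rlmax_bcode[OF \<sigma>, of j] j l by simp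
  ultimately show "\<exists>i. 1 \<le> i \<and> Suc i \<le> n \<and> bcode \<sigma> i = bcode \<sigma> (Suc i) \<and> rlmin n (bcode \<sigma>) (Suc i)"
    using l j by auto
next
  assume "\<exists>i. 1 \<le> i \<and> Suc i \<le> n \<and> bcode \<sigma> i = bcode \<sigma> (Suc i) \<and> rlmin n (bcode \<sigma>) (Suc i)"
  then obtain i where i: "1 \<le> i" "Suc i \<le> n" "bcode \<sigma> (Suc i) = bcode \<sigma> i" "rlmin n (bcode \<sigma>) (Suc i)" by auto
  have a: "\<sigma> i < \<sigma> (Suc i)" "\<And>l. 1 \<le> l \<Longrightarrow> l < i \<Longrightarrow> \<not> (\<sigma> i < \<sigma> l \<and> \<sigma> l < \<sigma> (Suc i))"
    using i(3) unfolding bcode_adjacent[OF \<sigma> i(1)] by blast+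
  have b: "\<forall>l. Suc i < l \<longrightarrow> l \<le> n \<longrightarrow> \<sigma> l < \<sigma> (Suc i)"
    using i(4) rlmax_bcode[OF \<sigma>, of "Suc i"] unfolding rlmin_def by simp
  have "occ ?R n \<sigma> i (Suc i)"
  proof (rule occI[OF \<sigma> i(1) _ i(2) a(1)])
    show "clear ?R 0 (\<sigma> i) (\<sigma> (Suc i)) (\<sigma> l)" if "1 \<le> l" "l < i" for l
      using a(2)[OF that] by (simp add: clear_def)
    show "clear ?R 2 (\<sigma> i) (\<sigma> (Suc i)) (\<sigma> l)" if "Suc i < l" "l \<le> n" for l
      using b[rule_format, OF that] by (simp add: clear_def)
  qed auto
  then show "\<exists>i j. occ ?R n \<sigma> i j" by blast
qed

text \<open>Cell (0,0) makes the first point a left-to-right minimum, whose code is maximal. Given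
  this, the adjacent pair ascends exactly if the second point is not a left-to-right
  minimum.\<close>

lemma contain_F2:
  assumes \<sigma>: "\<sigma> \<in> perms n"
  shows "(\<exists>i j. occ {(0,0),(1,0),(1,1),(1,2),(2,2)} n \<sigma> i j) \<longleftrightarrow>
    (\<exists>i. 1 \<le> i \<and> Suc i \<le> n \<and> bcode \<sigma> i = i - 1 \<and> bcode \<sigma> (Suc i) \<le> i - 1 \<and> rlmin n (bcode \<sigma>) (Suc i))"
    (is "(\<exists>i j. occ ?R n \<sigma> i j) \<longleftrightarrow> _")
proof -
  have r0: "bcode \<sigma> i = i - 1 \<longleftrightarrow> rcode \<sigma> i = 0" "bcode \<sigma> (Suc i) \<le> i - 1 \<longleftrightarrow> rcode \<sigma> (Suc i) \<noteq> 0" if "1 \<le> i" for i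
    using rcode_bcode[OF \<sigma>, of i] rcode_bcode[OF \<sigma>, of "Suc i"] that by auto
  show ?thesis
  proof
    assume "\<exists>i j. occ ?R n \<sigma> i j"
    then obtain i j where o: "occ ?R n \<sigma> i j" by blast
    note l = occ_len[OF \<sigma> o]
    have j: "j = Suc i" using occ_adjacent[OF \<sigma> o] by simp
    have "rcode \<sigma> i = 0" unfolding rcode_0
    proof (intro allI impI)
      fix l assume "1 \<le> l" "l < i"
      then show "\<sigma> i \<le> \<sigma> l" using occ_clear(1)[OF \<sigma> o, of l] by (auto simp: clear_def)
    qed
    moreover have "rcode \<sigma> (Suc i) \<noteq> 0" unfolding rcode_0 using l j by (metis lessI not_le)
    moreover have "\<forall>l. j < l \<longrightarrow> l \<le> n \<longrightarrow> \<sigma> l < \<sigma> j"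
    proof (intro allI impI)
      fix l assume "j < l" "l \<le> n"
      then show "\<sigma> l < \<sigma> j" using occ_clear(3)[OF \<sigma> o, of l] perms_inj[OF \<sigma>, of l j] by (auto simp: clear_def)
    qed
    then have "rlmin n (bcode \<sigma>) (Suc i)" unfolding rlmin_def using rlmax_bcode[OF \<sigma>, of j] j l by simp
    ultimately show "\<exists>i. 1 \<le> i \<and> Suc i \<le> n \<and> bcode \<sigma> i = i - 1 \<and> bcode \<sigma> (Suc i) \<le> i - 1 \<and> rlmin n (bcode \<sigma>) (Suc i)"
      using l j r0[of i] by auto
  next
    assume "\<exists>i. 1 \<le> i \<and> Suc i \<le> n \<and> bcode \<sigma> i = i - 1 \<and> bcode \<sigma> (Suc i) \<le> i - 1 \<and> rlmin n (bcode \<sigma>) (Suc i)"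
    then obtain i where i: "1 \<le> i" "Suc i \<le> n" "bcode \<sigma> i = i - 1" "bcode \<sigma> (Suc i) \<le> i - 1" "rlmin n (bcode \<sigma>) (Suc i)" by auto
    have a: "\<And>l. 1 \<le> l \<Longrightarrow> l < i \<Longrightarrow> \<sigma> i \<le> \<sigma> l" using i(3) r0(1)[OF i(1)] unfolding rcode_0 by blast
    have "rcode \<sigma> (Suc i) \<noteq> 0" using i(4) r0(2)[OF i(1)] by blast
    then obtain l where l: "1 \<le> l" "l < Suc i" "\<sigma> l < \<sigma> (Suc i)" unfolding rcode_0 by auto
    have lt: "\<sigma> i < \<sigma> (Suc i)" using a[of l] l by (cases "l = i") auto
    have b: "\<forall>l. Suc i < l \<longrightarrow> l \<le> n \<longrightarrow> \<sigma> l < \<sigma> (Suc i)"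
      using i(5) rlmax_bcode[OF \<sigma>, of "Suc i"] unfolding rlmin_def by simp
    have "occ ?R n \<sigma> i (Suc i)"
    proof (rule occI[OF \<sigma> i(1) _ i(2) lt])
      show "clear ?R 0 (\<sigma> i) (\<sigma> (Suc i)) (\<sigma> l)" if "1 \<le> l" "l < i" for l
        using a[OF that] by (simp add: clear_def)
      show "clear ?R 2 (\<sigma> i) (\<sigma> (Suc i)) (\<sigma> l)" if "Suc i < l" "l \<le> n" for l
        using b[rule_format, OF that] by (simp add: clear_def)
    qed auto
    then show "\<exists>i j. occ ?R n \<sigma> i j" by blast
  qed
qed

text \<open>Exchanges the values \<open>c (Suc i)\<close> and \<open>i - 1\<close> of \<open>c i\<close> wherever an occurrence of either pattern could be.\<close>

definition fswap :: "nat \<Rightarrow> (nat \<Rightarrow> nat) \<Rightarrow> nat \<Rightarrow> nat" where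
  "fswap n c i = (if 1 \<le> i \<and> Suc i \<le> n \<and> rlmin n c (Suc i) \<and> c (Suc i) \<le> i - 1 then
     (if c i = c (Suc i) then i - 1 else if c i = i - 1 then c (Suc i) else c i) else c i)"

text \<open>Where a coordinate changes, its old and new value are both at least the code at the next
  position, which is a right-to-left minimum. This is how right-to-left minima are seen to survive
  the exchange.\<close>

lemma fswap_cases:
  obtains "fswap n c i = c i"
  | "1 \<le> i" "Suc i \<le> n" "rlmin n c (Suc i)" "c (Suc i) \<le> i - 1" "c (Suc i) \<le> c i" "c (Suc i) \<le> fswap n c i"
proof (cases "fswap n c i = c i")
  case True
  then show ?thesis using that(1) by blast
next
  case False
  then have "1 \<le> i \<and> Suc i \<le> n \<and> rlmin n c (Suc i) \<and> c (Suc i) \<le> i - 1 \<and> c (Suc i) \<le> c i \<and> c (Suc i) \<le> fswap n c i"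
    by (auto simp: fswap_def split: if_splits)
  then show ?thesis using that(2) by blast
qed

lemma fswap_rlmin_keep:
  assumes r: "rlmin n c j" and j: "j \<le> n"
  shows "fswap n c j = c j \<and> rlmin n (fswap n c) j"
proof -
  have k: "fswap n c j = c j"
  proof (cases rule: fswap_cases[of n c j])
    case 2
    then have "c j < c (Suc j)" using r unfolding rlmin_def by simp
    then show ?thesis using 2 by simp
  qed
  have "c j < fswap n c l" if l: "j < l" "l \<le> n" for l
  proof (cases rule: fswap_cases[of n c l])
    case 1
    then show ?thesis using r l unfolding rlmin_def by simp
  next
    case 2
    then have "c j < c (Suc l)" using r l unfolding rlmin_def by simp
    then show ?thesis using 2 by simp
  qed
  then show ?thesis using k by (simp add: rlmin_def)
qed

lemma fswap_rlmin:
  assumes j: "j \<le> n"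
  shows "rlmin n (fswap n c) j \<longleftrightarrow> rlmin n c j"
proof
  assume r: "rlmin n (fswap n c) j"
  show "rlmin n c j"
  proof (rule ccontr)
    assume "\<not> rlmin n c j"
    then obtain l where l: "j < l" "l \<le> n" "c l \<le> c j" by (auto simp: rlmin_def not_less)
    let ?m = "Min (c ` {j<..n})"
    let ?S = "{k \<in> {j<..n}. c k = ?m}"
    have "?m \<in> c ` {j<..n}" using l by (intro Min_in) auto
    then have ne: "?S \<noteq> {}" by auto
    \<comment> \<open>The last of the minimal codes to the right of \<open>j\<close> is a
      right-to-left minimum. The exchange leaves it in place, so it still prevents \<open>j\<close>
      from being one afterwards.\<close>
    define k where "k = Max ?S"
    have k: "k \<in> ?S" unfolding k_def using ne by (intro Max_in) auto
    have mle: "?m \<le> c i" if "j < i" "i \<le> n" for i using that by (intro Min_le) auto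
    have rk: "rlmin n c k" unfolding rlmin_def
    proof (intro allI impI)
      fix i assume i: "k < i" "i \<le> n"
      have "i \<notin> ?S"
      proof
        assume "i \<in> ?S"
        then have "i \<le> k" unfolding k_def by (intro Max_ge) auto
        then show False using i(1) by simp
      qed
      moreover have "?m \<le> c i" "c k = ?m" using mle[of i] i k by auto
      ultimately show "c k < c i" using i k by (metis (mono_tags, lifting) greaterThanAtMost_iff le_neq_implies_less less_trans mem_Collect_eq)
    qed
    have kj: "c k \<le> c j" using mle[OF l(1,2)] l(3) k by simp
    have fk: "fswap n c k = c k" using fswap_rlmin_keep[OF rk] k by simp
    have "fswap n c j < fswap n c k" using r k unfolding rlmin_def by simp
    moreover have "c k \<le> fswap n c j"
    proof (cases rule: fswap_cases[of n c j])
      case 1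
      then show ?thesis using kj by simp
    next
      case 2
      then have "c k \<le> c (Suc j)" using mle[of "Suc j"] k by simp
      then show ?thesis using 2 by simp
    qed
    ultimately show False using fk by simp
  qed
qed (use fswap_rlmin_keep j in blast)

lemma fswap_fswap:
  "fswap n (fswap n c) = c"
proof
  fix i
  show "fswap n (fswap n c) i = c i"
  proof (cases "1 \<le> i \<and> Suc i \<le> n \<and> rlmin n c (Suc i)")
    case True
    then have "fswap n c (Suc i) = c (Suc i)" "rlmin n (fswap n c) (Suc i)"
      using fswap_rlmin_keep by blast+
    then show ?thesis using True by (simp add: fswap_def[of n "fswap n c"]) (auto simp: fswap_def[of n c])
  next
    case False
    then have "\<not> (1 \<le> i \<and> Suc i \<le> n \<and> rlmin n (fswap n c) (Suc i))" using fswap_rlmin by blast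
    then show ?thesis using False by (auto simp: fswap_def[of n "fswap n c"]) (auto simp: fswap_def[of n c])
  qed
qed

lemma fswap_codes: "c \<in> codes n \<Longrightarrow> fswap n c \<in> codes n"
proof (rule codesI)
  fix i assume c: "c \<in> codes n" and i: "1 \<le> i" "i \<le> n"
  then show "fswap n c i < i" using codes_less[OF c i] by (auto simp: fswap_def)
next
  fix i assume c: "c \<in> codes n" and i: "i \<notin> {1..n}"
  then show "fswap n c i = undefined" using codes_out[OF c i] by (auto simp: fswap_def)
qed

lemma weq_F: "weq {(0,1),(1,0),(1,1),(1,2),(2,2)} {(0,0),(1,0),(1,1),(1,2),(2,2)}" (is "weq ?R ?R'")
proof (rule weqI_contain)
  fix n
  let ?Q = "\<lambda>c. \<exists>i. 1 \<le> i \<and> Suc i \<le> n \<and> c i = c (Suc i) \<and> rlmin n c (Suc i)"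
  let ?Q' = "\<lambda>c. \<exists>i. 1 \<le> i \<and> Suc i \<le> n \<and> c i = i - 1 \<and> c (Suc i) \<le> i - 1 \<and> rlmin n c (Suc i)"
  have r: "rlmin n (restrict f {1..n}) (Suc i) \<longleftrightarrow> rlmin n f (Suc i)" if "Suc i \<le> n" for f i
    using that by (auto simp: rlmin_def)
  have q: "?Q (restrict f {1..n}) \<longleftrightarrow> ?Q f" "?Q' (restrict f {1..n}) \<longleftrightarrow> ?Q' f" for f
    by (rule iff_exI, use r in auto)+
  have "card {\<sigma> \<in> perms n. \<exists>i j. occ ?R n \<sigma> i j} = card {c \<in> codes n. ?Q c}"
    by (rule card_bcode) (simp only: contain_F1 q)
  also have "\<dots> = card {c \<in> codes n. ?Q' c}"
  proof (rule bij_betw_same_card)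
    have "?Q' (fswap n c) \<longleftrightarrow> ?Q c" if c: "c \<in> codes n" for c
    proof -
      have "(1 \<le> i \<and> Suc i \<le> n \<and> fswap n c i = i - 1 \<and> fswap n c (Suc i) \<le> i - 1 \<and> rlmin n (fswap n c) (Suc i)) \<longleftrightarrow>
        (1 \<le> i \<and> Suc i \<le> n \<and> c i = c (Suc i) \<and> rlmin n c (Suc i))" for i
      proof (cases "1 \<le> i \<and> Suc i \<le> n \<and> rlmin n c (Suc i)")
        case True
        have "c i \<le> i - 1" using codes_less[OF c, of i] True by simp
        then show ?thesis using True fswap_rlmin_keep[of n c "Suc i"] by (auto simp: fswap_def[of n c i])
      next
        case False
        then show ?thesis using fswap_rlmin[of "Suc i" n c] by blast
      qed
      then show ?thesis by blast
    qed
    moreover have "bij_betw (fswap n) (codes n) (codes n)"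
      by (rule bij_betw_byWitness[where f' = "fswap n"]) (use fswap_codes in \<open>auto simp: fswap_fswap\<close>)
    ultimately show "bij_betw (fswap n) {c \<in> codes n. ?Q c} {c \<in> codes n. ?Q' c}"
      by (intro bij_betw_Collect)
  qed
  also have "\<dots> = card {\<sigma> \<in> perms n. \<exists>i j. occ ?R' n \<sigma> i j}"
    by (rule card_bcode[symmetric]) (simp only: contain_F2 q)
  finally show "card {\<sigma> \<in> perms n. \<exists>i j. occ ?R n \<sigma> i j} = card {\<sigma> \<in> perms n. \<exists>i j. occ ?R' n \<sigma> i j}" .
qed

section \<open>Patterns with an unshaded right column\<close>

lemma contain_ext:
  assumes "(2,0) \<notin> R" "(2,1) \<notin> R" "(2,2) \<notin> R"
  shows "(\<exists>i j. occ R (Suc n) (ext n r \<sigma>) i j) \<longleftrightarrow>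
    (\<exists>i j. occ R n \<sigma> i j) \<or> (\<exists>i. occ R (Suc n) (ext n r \<sigma>) i (Suc n))"
proof -
  have "(2, strip a b c) \<notin> R" for a b c using assms by (simp add: strip_def)
  then have "j \<le> n \<Longrightarrow> occ R (Suc n) (ext n r \<sigma>) i j \<longleftrightarrow> occ R n \<sigma> i j" for i j
    by (simp add: occ_ext_old)
  moreover have "j \<le> n \<or> j = Suc n" if "occ R (Suc n) (ext n r \<sigma>) i j" for i j
    using that by (auto simp: occ_def)
  moreover have "j \<le> n" if "occ R n \<sigma> i j" for i j using that by (simp add: occ_def)
  ultimately show ?thesis by metis
qed

text \<open>No occurrence can be destroyed, and for each avoider exactly one of the
  \<open>n + 1\<close> slots creates one; so every step multiplies the number by
  \<open>n\<close>.\<close>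

lemma card_av_fact:
  assumes "(2,0) \<notin> R" "(2,1) \<notin> R" "(2,2) \<notin> R"
    and b: "\<And>n \<sigma>. \<sigma> \<in> perms n \<Longrightarrow> 1 \<le> n \<Longrightarrow> b n \<sigma> \<le> n"
    and new: "\<And>n \<sigma> r. \<sigma> \<in> perms n \<Longrightarrow> 1 \<le> n \<Longrightarrow> r \<le> n \<Longrightarrow>
      (\<exists>i. occ R (Suc n) (ext n r \<sigma>) i (Suc n)) \<longleftrightarrow> r = b n \<sigma>"
  shows "card (av R n) = fact (n - 1)"
proof (induction n)
  case 0
  have "av R 0 = {id}" by (auto simp: av_def perms_0 occ_def)
  then show ?case by simp
next
  case (Suc n)
  show ?case
  proof (cases "n = 0")
    case True
    have "av R (Suc 0) = perms (Suc 0)" by (auto simp: av_def occ_def)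
    then show ?thesis using True by (simp add: card_perms)
  next
    case False
    have "card (av R (Suc n)) = (\<Sum>\<sigma>\<in>perms n. if \<sigma> \<in> av R n then n else 0)"
      unfolding av_def[of R "Suc n"] card_perms_Suc
    proof (rule sum.cong[OF refl])
      fix \<sigma> assume \<sigma>: "\<sigma> \<in> perms n"
      have "{r. r \<le> n \<and> (\<nexists>i j. occ R (Suc n) (ext n r \<sigma>) i j)} = (if \<sigma> \<in> av R n then {..n} - {b n \<sigma>} else {})"
      proof -
        have "(\<exists>i j. occ R (Suc n) (ext n r \<sigma>) i j) \<longleftrightarrow> \<sigma> \<notin> av R n \<or> r = b n \<sigma>" if "r \<le> n" for r
          using contain_ext[OF assms(1-3), of n r \<sigma>] new[OF \<sigma> _ that] \<sigma> False by (simp add: av_def)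
        then show ?thesis by auto
      qed
      then show "card {r. r \<le> n \<and> (\<nexists>i j. occ R (Suc n) (ext n r \<sigma>) i j)} = (if \<sigma> \<in> av R n then n else 0)"
        using b[OF \<sigma>] False by auto
    qed
    also have "\<dots> = card (av R n) * n"
      by (subst sum.inter_filter[symmetric]) (auto simp: av_def)
    finally show ?thesis using Suc False by (cases n) (auto simp: algebra_simps)
  qed
qed

lemma card_av_A3: "card (av {(0,0),(0,1),(1,0),(1,1)} n) = fact (n - 1)" (is "card (av ?R n) = _")
proof (rule card_av_fact[where b = "\<lambda>_ _. 1"])
  fix n :: nat and \<sigma> r assume \<sigma>: "\<sigma> \<in> perms n" and n: "1 \<le> n" and r: "r \<le> n"
  show "(\<exists>i. occ ?R (Suc n) (ext n r \<sigma>) i (Suc n)) \<longleftrightarrow> r = 1"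
  proof
    assume "\<exists>i. occ ?R (Suc n) (ext n r \<sigma>) i (Suc n)"
    then obtain i where a: "occ ?R (Suc n) (ext n r \<sigma>) i (Suc n)" by blast
    have "r < \<sigma> l" if "1 \<le> l" "l \<le> n" "l \<noteq> i" for l
      using occ_new_clear[OF \<sigma> a, of l] that perms_inj[OF \<sigma>, of l i]
      by (cases "l < i") (auto simp: nclear_def)
    then show "r = 1" using perms_le_all[OF \<sigma>, of i r] occ_new_len[OF a] r by blast
  next
    assume r1: "r = 1"
    obtain i where i: "1 \<le> i" "i \<le> n" "\<sigma> i = 1" using perms_pos[OF \<sigma>, of 1] n by auto
    have "nclear ?R x (\<sigma> i) r (\<sigma> l)" if "1 \<le> l" "l \<le> n" "x < 2" for l x
      using perms_ge1[OF \<sigma>, of l] that i r1 by (simp add: nclear_def)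
    then have "occ ?R (Suc n) (ext n r \<sigma>) i (Suc n)"
      using i r1 by (intro occ_newI[OF \<sigma>]) auto
    then show "\<exists>i. occ ?R (Suc n) (ext n r \<sigma>) i (Suc n)" by blast
  qed
qed auto

lemma occ_new_adjacent:
  assumes \<sigma>: "\<sigma> \<in> perms n" and o: "occ R (Suc n) (ext n r \<sigma>) i (Suc n)"
    and R: "(1,0) \<in> R" "(1,1) \<in> R" "(1,2) \<in> R"
  shows "i = n"
proof (rule ccontr)
  assume "i \<noteq> n"
  then have "i < n" using occ_new_len[OF o] by simp
  then show False
    using occ_new_clear(2)[OF \<sigma> o, of n] R perms_inj[OF \<sigma>, of n i] by (auto simp: nclear_def)
qed

text \<open>The full middle column ties the new entry to the last old one, and cell (0,1) keeps the
  values between them empty. The only bad slot is the one directly above the last entry.\<close>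

lemma card_av_A2: "card (av {(0,1),(1,0),(1,1),(1,2)} n) = fact (n - 1)" (is "card (av ?R n) = _")
proof (rule card_av_fact[where b = "\<lambda>n \<sigma>. \<sigma> n"])
  fix n :: nat and \<sigma> r assume \<sigma>: "\<sigma> \<in> perms n" and n: "1 \<le> n" and r: "r \<le> n"
  show "(\<exists>i. occ ?R (Suc n) (ext n r \<sigma>) i (Suc n)) \<longleftrightarrow> r = \<sigma> n"
  proof
    assume "\<exists>i. occ ?R (Suc n) (ext n r \<sigma>) i (Suc n)"
    then obtain i where a: "occ ?R (Suc n) (ext n r \<sigma>) i (Suc n)" by blast
    have i: "i = n" using occ_new_adjacent[OF \<sigma> a] by simp
    show "r = \<sigma> n"
    proof (rule ccontr)
      assume ne: "r \<noteq> \<sigma> n"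
      have le: "\<sigma> n \<le> r" using occ_new_len[OF a] i by simp
      then obtain l where l: "1 \<le> l" "l \<le> n" "\<sigma> l = r" using perms_pos[OF \<sigma>, of r] r perms_ge1[OF \<sigma> n] by auto
      then have "l < i" using i ne by (metis le_neq_implies_less)
      then show False using occ_new_clear(1)[OF \<sigma> a, of l] l le ne i by (simp add: nclear_def)
    qed
  next
    assume r1: "r = \<sigma> n"
    have "occ ?R (Suc n) (ext n r \<sigma>) n (Suc n)"
      by (rule occ_newI[OF \<sigma> n]) (auto simp: r1 nclear_def)
    then show "\<exists>i. occ ?R (Suc n) (ext n r \<sigma>) i (Suc n)" by blast
  qed
qed (use perms_len in auto)

section \<open>Patterns whose avoiders end in 1\<close>

lemma contain_N1:
  assumes \<sigma>: "\<sigma> \<in> perms n" and o: "occ R n \<sigma> i j" and R: "(2,0) \<in> R"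
  shows "\<sigma> n \<noteq> 1"
proof
  assume s: "\<sigma> n = 1"
  note l = occ_len[OF \<sigma> o]
  then have "j < n" using s by (cases "j = n") auto
  then show False using occ_clear(3)[OF \<sigma> o, of n] s l R perms_inj[OF \<sigma>, of i n] by (auto simp: clear_def)
qed

text \<open>The entry 1 and its right neighbour form the occurrence: nothing lies between them in
  position, and nothing lies below the first of them.\<close>

lemma contain_N2:
  assumes \<sigma>: "\<sigma> \<in> perms n" and n: "1 \<le> n" "\<sigma> n \<noteq> 1" and R: "R \<subseteq> {(0,0),(1,0),(1,1),(1,2),(2,0)}"
  shows "\<exists>i j. occ R n \<sigma> i j"
proof -
  obtain t where t: "1 \<le> t" "t \<le> n" "\<sigma> t = 1" using perms_pos[OF \<sigma>, of 1] n by auto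
  then have tn: "t < n" using n by (metis le_neq_implies_less)
  have R': "(0,1) \<notin> R" "(0,2) \<notin> R" "(2,1) \<notin> R" "(2,2) \<notin> R"
    by (rule notI, drule subsetD[OF R], simp)+
  have "occ R n \<sigma> t (Suc t)"
  proof (rule occI[OF \<sigma> t(1)])
    have "\<sigma> (Suc t) \<noteq> 1" using perms_inj[OF \<sigma>, of "Suc t" t] t by simp
    then show "\<sigma> t < \<sigma> (Suc t)" using perms_ge1[OF \<sigma>, of "Suc t"] t tn by simp
    show "clear R 0 (\<sigma> t) (\<sigma> (Suc t)) (\<sigma> l)" if "1 \<le> l" "l < t" for l
      using R' that t perms_ge1[OF \<sigma>, of l] by (simp add: clear_def)
    show "clear R 2 (\<sigma> t) (\<sigma> (Suc t)) (\<sigma> l)" if "Suc t < l" "l \<le> n" for l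
      using R' that t perms_ge1[OF \<sigma>, of l] by (simp add: clear_def)
  qed (use tn in auto)
  then show ?thesis by blast
qed

text \<open>A last entry 1 would lie in the shaded cell (2,0) of any occurrence; otherwise the entry
  1 has a right neighbour. So the avoiders are those ending in 1, for every shading in this
  range.\<close>

lemma card_av_N:
  assumes R: "(2,0) \<in> R" "R \<subseteq> {(0,0),(1,0),(1,1),(1,2),(2,0)}"
  shows "card (av R n) = fact (n - 1)"
proof (cases n)
  case 0
  have "av R 0 = {id}" by (auto simp: av_def perms_0 occ_def)
  then show ?thesis using 0 by simp
next
  case (Suc m)
  have "av R n = {\<sigma> \<in> perms (Suc m). \<sigma> (Suc m) = 1}"
  proof -
    have "(\<exists>i j. occ R n \<sigma> i j) \<longleftrightarrow> \<sigma> n \<noteq> 1" if "\<sigma> \<in> perms n" for \<sigma>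
      using contain_N1[OF that _ R(1)] contain_N2[OF that _ _ R(2)] Suc by auto
    then show ?thesis unfolding av_def Suc by blast
  qed
  also have "card \<dots> = (\<Sum>\<sigma>\<in>perms m. card {r. r \<le> m \<and> ext m r \<sigma> (Suc m) = 1})" by (rule card_perms_Suc)
  also have "\<dots> = (\<Sum>\<sigma>\<in>perms m. 1)"
  proof (rule sum.cong[OF refl])
    fix \<sigma>
    have "{r. r \<le> m \<and> ext m r \<sigma> (Suc m) = 1} = {0}" by auto
    then show "card {r. r \<le> m \<and> ext m r \<sigma> (Suc m) = 1} = 1" by simp
  qed
  finally show ?thesis using Suc by (simp add: card_perms)
qed

lemma weq_N_A2: "weq {(2,0)} {(0,1),(1,0),(1,1),(1,2)}"
  and weq_A2_A3: "weq {(0,1),(1,0),(1,1),(1,2)} {(0,0),(0,1),(1,0),(1,1)}"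
  and weq_N_N2: "weq {(2,0)} {(0,0),(1,1),(1,2),(2,0)}"
  using card_av_A2 card_av_A3 card_av_N[of "{(2,0)}"] card_av_N[of "{(0,0),(1,1),(1,2),(2,0)}"]
  by (simp_all add: weq_def)

text \<open>An occurrence of either pattern forces \<open>\<sigma> 1 < n\<close>. Then the first
  entry and the entry one larger form an occurrence of both: nothing lies to the left and no value
  lies between.\<close>

lemma weq_M: "weq {(0,2)} {(0,0),(0,2),(1,1)}" (is "weq ?R ?R'")
proof (rule avI_coincide)
  fix n \<sigma> assume \<sigma>: "\<sigma> \<in> perms n"
  show "(\<exists>i j. occ ?R n \<sigma> i j) \<longleftrightarrow> (\<exists>i j. occ ?R' n \<sigma> i j)"
  proof
    assume "\<exists>i j. occ ?R' n \<sigma> i j"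
    then show "\<exists>i j. occ ?R n \<sigma> i j" unfolding occ_def by blast
  next
    assume "\<exists>i j. occ ?R n \<sigma> i j"
    then obtain i j where o: "occ ?R n \<sigma> i j" by blast
    note l = occ_len[OF \<sigma> o]
    have "\<sigma> 1 < n"
    proof (cases "i = 1")
      case False
      then have "\<sigma> 1 \<le> \<sigma> j" using occ_clear(1)[OF \<sigma> o, of 1] l by (auto simp: clear_def)
      moreover have "\<sigma> 1 \<noteq> \<sigma> j" using perms_inj[OF \<sigma>, of 1 j] l by auto
      ultimately show ?thesis using l by simp
    qed (use l in auto)
    then have "\<exists>k. 1 \<le> k \<and> k \<le> n \<and> \<sigma> k = Suc (\<sigma> 1)" by (intro perms_pos[OF \<sigma>]) auto
    then obtain k where k: "1 \<le> k" "k \<le> n" "\<sigma> k = Suc (\<sigma> 1)" by blast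
    have "k \<noteq> 1" using k by auto
    then have "occ ?R' n \<sigma> 1 k"
      by (intro occI[OF \<sigma>]) (use k in \<open>auto simp: clear_def\<close>)
    then show "\<exists>i j. occ ?R' n \<sigma> i j" by blast
  qed
qed

section \<open>Occurrences created only after a last entry 1\<close>

definition bstep :: "nat \<Rightarrow> bool \<times> bool \<Rightarrow> nat \<Rightarrow> bool \<times> bool" where
  "bstep n l b = (b = 0, snd l \<or> fst l \<and> b = n)"

lemma realises_B:
  assumes "(2,0) \<notin> R" "(2,1) \<notin> R" "(2,2) \<notin> R"
    and \<pi>: "\<And>n. 1 \<le> n \<Longrightarrow> bij_betw (\<pi> n) {..n} {..n}" "\<And>n r. 1 \<le> n \<Longrightarrow> r \<le> n \<Longrightarrow> \<pi> n r = 0 \<longleftrightarrow> r = 0"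
    and new: "\<And>n \<sigma> r. \<sigma> \<in> perms n \<Longrightarrow> 1 \<le> n \<Longrightarrow> r \<le> n \<Longrightarrow>
      (\<exists>i. occ R (Suc n) (ext n r \<sigma>) i (Suc n)) \<longleftrightarrow> \<sigma> n = 1 \<and> \<pi> n r = n"
  shows "realises (\<lambda>n \<sigma>. (1 \<le> n \<and> \<sigma> n = 1, \<exists>i j. occ R n \<sigma> i j)) bstep (False, False)"
  unfolding realises_def
proof (intro conjI allI ballI)
  show "((1::nat) \<le> 0 \<and> id 0 = (1::nat), \<exists>i j. occ R 0 id i j) = (False, False)" by (simp add: occ_def)
  fix n \<sigma> assume \<sigma>: "\<sigma> \<in> perms n"
  show "\<exists>\<pi>. bij_betw \<pi> {..n} {..n} \<and> (\<forall>r\<le>n. (1 \<le> Suc n \<and> ext n r \<sigma> (Suc n) = 1, \<exists>i j. occ R (Suc n) (ext n r \<sigma>) i j) =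
      bstep n (1 \<le> n \<and> \<sigma> n = 1, \<exists>i j. occ R n \<sigma> i j) (\<pi> r))"
  proof (cases "n = 0")
    case True
    then show ?thesis using bij_betw_id[of "{..n}"] by (auto simp: bstep_def occ_def)
  next
    case False
    then have n: "1 \<le> n" by simp
    show ?thesis
      by (rule exI[of _ "\<pi> n"]) (use contain_ext[OF assms(1-3), of n _ \<sigma>] new[OF \<sigma> n] \<pi>[OF n] n in \<open>simp add: bstep_def\<close>)
  qed
qed

text \<open>Both patterns gain an occurrence only when the last entry is 1, and then in one slot:
  slot 1 for the first pattern, slot \<open>n\<close> for the second. Exchanging these ranks aligns
  the rules; slot 0 stays in place because it makes the last entry 1.\<close>

lemma weq_B: "weq {(0,0),(0,1),(1,0),(1,1),(1,2)} {(0,0),(0,2),(1,0),(1,1),(1,2)}" (is "weq ?R ?R'")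
proof -
  define \<pi> where "\<pi> n r = (if r = 1 then n else if r = n then 1 else r)" for n r :: nat
  have 1: "realises (\<lambda>n \<sigma>. (1 \<le> n \<and> \<sigma> n = 1, \<exists>i j. occ ?R n \<sigma> i j)) bstep (False, False)"
  proof (rule realises_B[where \<pi> = \<pi>])
    fix n :: nat assume n: "1 \<le> n"
    show "bij_betw (\<pi> n) {..n} {..n}"
      by (rule bij_betw_byWitness[where f' = "\<pi> n"]) (use n in \<open>auto simp: \<pi>_def\<close>)
    fix r assume r: "r \<le> n"
    show "\<pi> n r = 0 \<longleftrightarrow> r = 0" using n by (auto simp: \<pi>_def)
    fix \<sigma> assume \<sigma>: "\<sigma> \<in> perms n"
    have pr: "\<pi> n r = n \<longleftrightarrow> r = 1" using r n by (auto simp: \<pi>_def)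
    show "(\<exists>i. occ ?R (Suc n) (ext n r \<sigma>) i (Suc n)) \<longleftrightarrow> \<sigma> n = 1 \<and> \<pi> n r = n"
      unfolding pr
    proof
      assume "\<exists>i. occ ?R (Suc n) (ext n r \<sigma>) i (Suc n)"
      then obtain i where a: "occ ?R (Suc n) (ext n r \<sigma>) i (Suc n)" by blast
      have i: "i = n" using occ_new_adjacent[OF \<sigma> a] by simp
      have "r < \<sigma> l" if "1 \<le> l" "l \<le> n" "l \<noteq> i" for l
        using occ_new_clear(1)[OF \<sigma> a, of l] that perms_inj[OF \<sigma>, of l i] i by (auto simp: nclear_def)
      then show "\<sigma> n = 1 \<and> r = 1" using perms_le_all[OF \<sigma>, of i r] occ_new_len[OF a] r i by blast
    next
      assume a: "\<sigma> n = 1 \<and> r = 1"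
      have "nclear ?R 0 (\<sigma> n) r (\<sigma> l)" if "1 \<le> l" "l < n" for l
        using perms_ge1[OF \<sigma>, of l] that a by (simp add: nclear_def)
      then have "occ ?R (Suc n) (ext n r \<sigma>) n (Suc n)"
        using a n by (intro occ_newI[OF \<sigma>]) auto
      then show "\<exists>i. occ ?R (Suc n) (ext n r \<sigma>) i (Suc n)" by blast
    qed
  qed auto
  have 2: "realises (\<lambda>n \<sigma>. (1 \<le> n \<and> \<sigma> n = 1, \<exists>i j. occ ?R' n \<sigma> i j)) bstep (False, False)"
  proof (rule realises_B[where \<pi> = "\<lambda>_ r. r"])
    fix n :: nat and r \<sigma> assume n: "1 \<le> n" and r: "r \<le> n" and \<sigma>: "\<sigma> \<in> perms n"
    show "(\<exists>i. occ ?R' (Suc n) (ext n r \<sigma>) i (Suc n)) \<longleftrightarrow> \<sigma> n = 1 \<and> r = n"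
    proof
      assume "\<exists>i. occ ?R' (Suc n) (ext n r \<sigma>) i (Suc n)"
      then obtain i where a: "occ ?R' (Suc n) (ext n r \<sigma>) i (Suc n)" by blast
      have i: "i = n" using occ_new_adjacent[OF \<sigma> a] by simp
      obtain k where k: "1 \<le> k" "k \<le> n" "\<sigma> k = 1" using perms_pos[OF \<sigma>, of 1] n by auto
      have s: "\<sigma> n = 1"
        using occ_new_clear(1)[OF \<sigma> a, of k] k i perms_ge1[OF \<sigma>, of n] by (cases "k = n") (auto simp: nclear_def)
      moreover obtain m where m: "1 \<le> m" "m \<le> n" "\<sigma> m = n" using perms_pos[OF \<sigma>, of n] n by auto
      have "n \<le> r" using occ_new_clear(1)[OF \<sigma> a, of m] i s m occ_new_len[OF a] by (cases "m = n") (auto simp: nclear_def)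
      ultimately show "\<sigma> n = 1 \<and> r = n" using r by simp
    next
      assume a: "\<sigma> n = 1 \<and> r = n"
      have "nclear ?R' 0 (\<sigma> n) r (\<sigma> l)" if "1 \<le> l" "l < n" for l
        using perms_ge1[OF \<sigma>, of l] perms_len[OF \<sigma>, of l] that a by (simp add: nclear_def)
      then have "occ ?R' (Suc n) (ext n r \<sigma>) n (Suc n)"
        using a n by (intro occ_newI[OF \<sigma>]) auto
      then show "\<exists>i. occ ?R' (Suc n) (ext n r \<sigma>) i (Suc n)" by blast
    qed
  qed (use bij_betw_id[unfolded id_def] in auto)
  show ?thesis unfolding weq_def av_def
    using realises_card[OF 1 2, where P = "\<lambda>l. \<not> snd l"] by simp
qed

section \<open>Succession-free permutations\<close>

fun succ_count :: "nat \<Rightarrow> nat" where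
  "succ_count 0 = 1"
| "succ_count (Suc 0) = 1"
| "succ_count (Suc (Suc n)) = Suc n * succ_count (Suc n) + n * succ_count n"

text \<open>Succession-free permutations are counted through the distribution of the number of successions,
  which satisfies a recursion under appending an entry.\<close>

definition succs :: "nat \<Rightarrow> (nat \<Rightarrow> nat) \<Rightarrow> nat set" where
  "succs n \<sigma> = {i. 1 \<le> i \<and> i < n \<and> \<sigma> (Suc i) = Suc (\<sigma> i)}"

lemma finite_succs [simp]: "finite (succs n \<sigma>)"
  by (simp add: succs_def)

text \<open>Slot \<open>r\<close> separates the values \<open>r\<close> and \<open>r + 1\<close>,
  breaking the succession that starts with value \<open>r\<close>; a new succession arises exactly
  if the new entry is one above the last.\<close>

lemma succs_ext:
  assumes \<sigma>: "\<sigma> \<in> perms n" and n: "1 \<le> n" and r: "r \<le> n"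
  shows "succs (Suc n) (ext n r \<sigma>) = {i \<in> succs n \<sigma>. \<sigma> i \<noteq> r} \<union> (if r = \<sigma> n then {n} else {})"
proof -
  have 1: "ext n r \<sigma> (Suc i) = Suc (ext n r \<sigma> i) \<longleftrightarrow> \<sigma> (Suc i) = Suc (\<sigma> i) \<and> \<sigma> i \<noteq> r" if "i < n" for i
    using that perms_inj[OF \<sigma>, of i "Suc i"] by (auto simp: ext_def)
  have 2: "ext n r \<sigma> (Suc n) = Suc (ext n r \<sigma> n) \<longleftrightarrow> r = \<sigma> n" by (auto simp: ext_def)
  show ?thesis using n 1 2 by (auto simp: succs_def less_Suc_eq)
qed

lemma card_succs_ext:
  assumes \<sigma>: "\<sigma> \<in> perms n" and n: "1 \<le> n" and r: "r \<le> n"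
  shows "card (succs (Suc n) (ext n r \<sigma>)) =
    (if r = \<sigma> n then Suc (card (succs n \<sigma>)) else if r \<in> \<sigma> ` succs n \<sigma> then card (succs n \<sigma>) - 1 else card (succs n \<sigma>))"
proof -
  have nn: "\<sigma> n \<notin> \<sigma> ` succs n \<sigma>" unfolding image_iff perms_inj[OF \<sigma>] by (auto simp: succs_def)
  show ?thesis
  proof (cases "r \<in> \<sigma> ` succs n \<sigma>")
    case True
    then obtain k where k: "k \<in> succs n \<sigma>" "r = \<sigma> k" by blast
    have "{i \<in> succs n \<sigma>. \<sigma> i \<noteq> r} = succs n \<sigma> - {k}" unfolding k(2) perms_inj[OF \<sigma>] by blast
    moreover have "r \<noteq> \<sigma> n" using nn True by blast
    ultimately have "succs (Suc n) (ext n r \<sigma>) = succs n \<sigma> - {k}" using succs_ext[OF assms] by simp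
    then show ?thesis using True \<open>r \<noteq> \<sigma> n\<close> card_Diff_singleton[OF k(1)] by simp
  next
    case False
    then have e: "{i \<in> succs n \<sigma>. \<sigma> i \<noteq> r} = succs n \<sigma>" by blast
    have nm: "n \<notin> succs n \<sigma>" by (simp add: succs_def)
    show ?thesis
    proof (cases "r = \<sigma> n")
      case True
      then have "succs (Suc n) (ext n r \<sigma>) = insert n (succs n \<sigma>)" using succs_ext[OF assms] e by simp
      then show ?thesis using True card_insert_disjoint[OF finite_succs nm] by simp
    next
      case rn: False
      then have "succs (Suc n) (ext n r \<sigma>) = succs n \<sigma>" using succs_ext[OF assms] e by simp
      then show ?thesis using rn False by simp
    qed
  qed
qed

text \<open>Contracting the \<open>k\<close> successions leaves a succession-free permutation of
  \<open>n - k\<close> letters, which explains the product; the proof follows the generating tree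
  instead. \<open>succ_count\<close> begins 1, 1, 1, 3, 11, 53.\<close>

lemma card_perms_succs:
  "1 \<le> n \<Longrightarrow> card {\<sigma> \<in> perms n. card (succs n \<sigma>) = k} = (n - 1 choose k) * succ_count (n - k)"
proof (induction n arbitrary: k rule: nat_induct_at_least)
  case base
  have "succs 1 \<sigma> = {}" for \<sigma> by (auto simp: succs_def)
  then have "{\<sigma> \<in> perms 1. card (succs 1 \<sigma>) = k} = (if k = 0 then perms 1 else {})" by auto
  then show ?case by (cases k) (auto simp: card_perms)
next
  case (Suc n)
  let ?N = "\<lambda>k. card {\<sigma> \<in> perms n. card (succs n \<sigma>) = k}"
  \<comment> \<open>From \<open>s\<close> successions one slot raises the number, \<open>s\<close>
    slots lower it and the other \<open>n - s\<close> keep it. The three terms are the ways of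
    arriving at \<open>k\<close>.\<close>
  define w where "w s = (if s = k then n - k else 0) + (if Suc s = k then 1 else 0) + (if s = Suc k then Suc k else 0)" for s
  have c: "card {r. r \<le> n \<and> card (succs (Suc n) (ext n r \<sigma>)) = k} = w (card (succs n \<sigma>))" if \<sigma>: "\<sigma> \<in> perms n" for \<sigma>
  proof -
    let ?s = "card (succs n \<sigma>)" and ?I = "\<sigma> ` succs n \<sigma>"
    have I: "?I \<subseteq> {..n}" using perms_len[OF \<sigma>] by (auto simp: succs_def)
    have nn: "\<sigma> n \<notin> ?I" "\<sigma> n \<le> n"
      using perms_len[OF \<sigma>, of n] Suc(1) unfolding image_iff perms_inj[OF \<sigma>] by (auto simp: succs_def)
    have cI: "card ?I = ?s" by (rule card_image) (simp add: inj_on_def perms_inj[OF \<sigma>])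
    have "{r. r \<le> n \<and> card (succs (Suc n) (ext n r \<sigma>)) = k} =
      (if ?s = k then {..n} - insert (\<sigma> n) ?I else {}) \<union> (if Suc ?s = k then {\<sigma> n} else {}) \<union> (if ?s = Suc k then ?I else {})"
    proof -
      have pos: "?s > 0" if "r \<in> ?I" for r using that by (auto simp: card_gt_0_iff)
      have "(r \<le> n \<and> card (succs (Suc n) (ext n r \<sigma>)) = k) \<longleftrightarrow> (?s = k \<and> r \<le> n \<and> r \<noteq> \<sigma> n \<and> r \<notin> ?I) \<or>
        (Suc ?s = k \<and> r = \<sigma> n) \<or> (?s = Suc k \<and> r \<in> ?I)" for r
        using card_succs_ext[OF \<sigma> Suc(1), of r] nn I pos[of r]
        by (cases "r \<le> n"; cases "r = \<sigma> n"; cases "r \<in> ?I") auto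
      then show ?thesis by auto
    qed
    also have "card \<dots> = w ?s"
    proof -
      have "card ({..n} - insert (\<sigma> n) ?I) = n - ?s"
        using nn I cI by (subst card_Diff_subset) (auto simp: card_insert_if)
      then show ?thesis using cI by (auto simp: w_def)
    qed
    finally show ?thesis .
  qed
  have "card {\<sigma> \<in> perms (Suc n). card (succs (Suc n) \<sigma>) = k} = (\<Sum>\<sigma>\<in>perms n. w (card (succs n \<sigma>)))"
    unfolding card_perms_Suc by (rule sum.cong) (use c in auto)
  also have "\<dots> = (\<Sum>\<sigma>\<in>perms n. (if card (succs n \<sigma>) = k then n - k else 0)) +
     (\<Sum>\<sigma>\<in>perms n. (if Suc (card (succs n \<sigma>)) = k then 1 else 0)) +
     (\<Sum>\<sigma>\<in>perms n. (if card (succs n \<sigma>) = Suc k then Suc k else 0))"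
    by (simp add: w_def sum.distrib)
  also have "\<dots> = ?N k * (n - k) + (if k = 0 then 0 else ?N (k - 1)) + ?N (Suc k) * Suc k"
  proof -
    have *: "(\<Sum>\<sigma>\<in>perms n. (if P \<sigma> then m else 0)) = card {\<sigma> \<in> perms n. P \<sigma>} * m" for P and m :: nat
      by (simp add: sum.inter_filter[symmetric])
    have "{\<sigma> \<in> perms n. Suc (card (succs n \<sigma>)) = k} = (if k = 0 then {} else {\<sigma> \<in> perms n. card (succs n \<sigma>) = k - 1})"
      by auto
    then show ?thesis unfolding * by simp
  qed
  also have "\<dots> = (n choose k) * succ_count (Suc n - k)"
  proof -
    consider "k < n" | "k = n" | "k > n" by linarith
    then show ?thesis
    proof cases
      case 1
      define m where "m = n - k"
      obtain m' where m': "m = Suc m'" using 1 unfolding m_def by (cases "n - k") auto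
      have nk: "n = k + Suc m'" using m' 1 unfolding m_def by simp
      have p: "(n choose k) = (n - 1 choose k) + (if k = 0 then 0 else (n - 1 choose (k - 1)))"
        using nk by (cases k) (auto simp: add.commute)
      \<comment> \<open>Binomial absorption with \<open>m' = n - 1 - k\<close>; it turns the
        contribution of broken successions into the second term of the recursion for
        \<open>succ_count\<close>.\<close>
      have q: "(n - 1 choose Suc k) * Suc k = (n - 1 choose k) * m'"
        using binomial_absorb_comp[of "n - 1" k] binomial_absorption[of k "n - 1"] nk
        by (metis add_diff_cancel_left' add_Suc_right diff_Suc_1 mult.commute)
      have e: "n - k = Suc m'" "n - Suc k = m'" "Suc n - k = Suc (Suc m')" "k \<noteq> 0 \<Longrightarrow> n - (k - 1) = Suc (Suc m')"
        using nk by auto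
      have "?N k * (n - k) + (if k = 0 then 0 else ?N (k - 1)) + ?N (Suc k) * Suc k =
        (n - 1 choose k) * succ_count (Suc m') * Suc m' + (if k = 0 then 0 else (n - 1 choose (k - 1)) * succ_count (Suc (Suc m'))) +
        ((n - 1 choose Suc k) * Suc k) * succ_count m'"
        unfolding Suc.IH e using e by (auto simp: algebra_simps)
      also have "\<dots> = (n choose k) * succ_count (Suc (Suc m'))"
        unfolding q p by (auto simp: algebra_simps)
      finally show ?thesis using e by simp
    next
      case 2
      then show ?thesis using Suc by (auto simp: Suc.IH)
    next
      case 3
      then show ?thesis using Suc by (auto simp: Suc.IH binomial_eq_0)
    qed
  qed
  finally show ?case by simp
qed

text \<open>The middle row and the middle column are fully shaded, so the two points are neighbours
  in position and in value: a succession.\<close>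

lemma card_av_H1: "card (av {(0,1),(1,0),(1,1),(1,2),(2,1)} n) = succ_count n" (is "card (av ?R n) = _")
proof (cases "n = 0")
  case True
  have "av ?R 0 = {id}" by (auto simp: av_def perms_0 occ_def)
  then show ?thesis using True by simp
next
  case False
  have "(\<exists>i j. occ ?R n \<sigma> i j) \<longleftrightarrow> succs n \<sigma> \<noteq> {}" if \<sigma>: "\<sigma> \<in> perms n" for \<sigma>
  proof
    assume "\<exists>i j. occ ?R n \<sigma> i j"
    then obtain i j where o: "occ ?R n \<sigma> i j" by blast
    note l = occ_len[OF \<sigma> o]
    have j: "j = Suc i" using occ_adjacent[OF \<sigma> o] by simp
    have "\<sigma> j = Suc (\<sigma> i)"
    proof (rule ccontr)
      assume ne: "\<sigma> j \<noteq> Suc (\<sigma> i)"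
      have "\<exists>k. 1 \<le> k \<and> k \<le> n \<and> \<sigma> k = Suc (\<sigma> i)" by (rule perms_pos[OF \<sigma>]) (use l in auto)
      then obtain k where k: "1 \<le> k" "k \<le> n" "\<sigma> k = Suc (\<sigma> i)" by blast
      have "k \<noteq> i" "k \<noteq> j" using k ne by auto
      then have "k < i \<or> j < k" using j by auto
      then show False using occ_clear(1,3)[OF \<sigma> o, of k] k l ne by (auto simp: clear_def)
    qed
    then show "succs n \<sigma> \<noteq> {}" using l j by (auto simp: succs_def intro!: exI[of _ i])
  next
    assume "succs n \<sigma> \<noteq> {}"
    then obtain i where i: "1 \<le> i" "i < n" "\<sigma> (Suc i) = Suc (\<sigma> i)" by (auto simp: succs_def)
    have "occ ?R n \<sigma> i (Suc i)" by (rule occI[OF \<sigma>]) (use i in \<open>auto simp: clear_def\<close>)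
    then show "\<exists>i j. occ ?R n \<sigma> i j" by blast
  qed
  then have "av ?R n = {\<sigma> \<in> perms n. card (succs n \<sigma>) = 0}" by (auto simp: av_def)
  then show ?thesis using card_perms_succs[of n 0] False by simp
qed

text \<open>An occurrence consists of two adjacent left-to-right maxima. Avoiders are split by
  whether they end in the maximum: a new maximum may follow only those that do not, any other entry
  may follow all. This gives the recursion of \<open>succ_count\<close>.\<close>

lemma card_av_H2: "card (av {(0,1),(0,2),(1,0),(1,1),(1,2)} n) = succ_count n" (is "card (av ?R n) = _")
proof -
  let ?X = "\<lambda>n. {\<sigma> \<in> perms n. \<sigma> n = n \<and> (\<nexists>i j. occ ?R n \<sigma> i j)}"
  let ?Y = "\<lambda>n. {\<sigma> \<in> perms n. \<sigma> n \<noteq> n \<and> (\<nexists>i j. occ ?R n \<sigma> i j)}"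
  have new: "(\<exists>i. occ ?R (Suc n) (ext n r \<sigma>) i (Suc n)) \<longleftrightarrow> \<sigma> n = n \<and> r = n"
    if \<sigma>: "\<sigma> \<in> perms n" and n: "1 \<le> n" and r: "r \<le> n" for n \<sigma> r
  proof
    assume "\<exists>i. occ ?R (Suc n) (ext n r \<sigma>) i (Suc n)"
    then obtain i where a: "occ ?R (Suc n) (ext n r \<sigma>) i (Suc n)" by blast
    have i: "i = n" using occ_new_adjacent[OF \<sigma> a] by simp
    obtain m where m: "1 \<le> m" "m \<le> n" "\<sigma> m = n" using perms_pos[OF \<sigma>, of n] n by auto
    have "m = n"
    proof (rule ccontr)
      assume "m \<noteq> n"
      then show False using occ_new_clear(1)[OF \<sigma> a, of m] m i perms_len[OF \<sigma>, of n] n perms_inj[OF \<sigma>, of m n] by (auto simp: nclear_def)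
    qed
    then show "\<sigma> n = n \<and> r = n" using m occ_new_len[OF a] i r by auto
  next
    assume a: "\<sigma> n = n \<and> r = n"
    have "nclear ?R 0 (\<sigma> n) r (\<sigma> l)" if "1 \<le> l" "l < n" for l
      using perms_len[OF \<sigma>, of l] that a by (simp add: nclear_def)
    then have "occ ?R (Suc n) (ext n r \<sigma>) n (Suc n)"
      using a n by (intro occ_newI[OF \<sigma>]) auto
    then show "\<exists>i. occ ?R (Suc n) (ext n r \<sigma>) i (Suc n)" by blast
  qed
  have ce: "(\<exists>i j. occ ?R (Suc n) (ext n r \<sigma>) i j) \<longleftrightarrow> (\<exists>i j. occ ?R n \<sigma> i j) \<or> \<sigma> n = n \<and> r = n"
    if "\<sigma> \<in> perms n" "1 \<le> n" "r \<le> n" for n \<sigma> r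
    using contain_ext[of ?R n r \<sigma>] new[OF that] by simp
  have X: "card (?X (Suc n)) = card (?Y n)" if n: "1 \<le> n" for n
  proof -
    have "card {r. r \<le> n \<and> ext n r \<sigma> (Suc n) = Suc n \<and> (\<nexists>i j. occ ?R (Suc n) (ext n r \<sigma>) i j)} =
      (if \<sigma> n \<noteq> n \<and> (\<nexists>i j. occ ?R n \<sigma> i j) then 1 else 0)" if \<sigma>: "\<sigma> \<in> perms n" for \<sigma>
    proof -
      have "{r. r \<le> n \<and> ext n r \<sigma> (Suc n) = Suc n \<and> (\<nexists>i j. occ ?R (Suc n) (ext n r \<sigma>) i j)} =
        (if \<sigma> n \<noteq> n \<and> (\<nexists>i j. occ ?R n \<sigma> i j) then {n} else {})"
        using ce[OF \<sigma> n] by auto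
      then show ?thesis by simp
    qed
    then show ?thesis by (simp add: card_perms_Suc sum.inter_filter[symmetric])
  qed
  have Y: "card (?Y (Suc n)) = n * (card (?X n) + card (?Y n))" if n: "1 \<le> n" for n
  proof -
    have "card {r. r \<le> n \<and> ext n r \<sigma> (Suc n) \<noteq> Suc n \<and> (\<nexists>i j. occ ?R (Suc n) (ext n r \<sigma>) i j)} =
      (if (\<nexists>i j. occ ?R n \<sigma> i j) then n else 0)" if \<sigma>: "\<sigma> \<in> perms n" for \<sigma>
    proof -
      have "{r. r \<le> n \<and> ext n r \<sigma> (Suc n) \<noteq> Suc n \<and> (\<nexists>i j. occ ?R (Suc n) (ext n r \<sigma>) i j)} =
        (if (\<nexists>i j. occ ?R n \<sigma> i j) then {..<n} else {})"
        proof -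
          have "(r \<le> n \<and> ext n r \<sigma> (Suc n) \<noteq> Suc n \<and> (\<nexists>i j. occ ?R (Suc n) (ext n r \<sigma>) i j)) \<longleftrightarrow>
            r < n \<and> (\<nexists>i j. occ ?R n \<sigma> i j)" for r
            using ce[OF \<sigma> n, of r] by (cases "r \<le> n") auto
          then show ?thesis by auto
        qed
      then show ?thesis by (simp only: if_distrib[of card] card_lessThan card.empty)
    qed
    moreover have "card {\<sigma> \<in> perms n. \<nexists>i j. occ ?R n \<sigma> i j} = card (?X n) + card (?Y n)"
    proof -
      have "{\<sigma> \<in> perms n. \<nexists>i j. occ ?R n \<sigma> i j} = ?X n \<union> ?Y n" by auto
      then show ?thesis by (simp add: card_Un_disjoint disjoint_iff)
    qed
    ultimately show ?thesis by (simp add: card_perms_Suc sum.inter_filter[symmetric] mult.commute)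
  qed
  have A: "card (av ?R n) = card (?X n) + card (?Y n)" for n
  proof -
    have "av ?R n = ?X n \<union> ?Y n" by (auto simp: av_def)
    then show ?thesis by (simp add: card_Un_disjoint disjoint_iff)
  qed
  have one: "?X 1 = perms 1" "?Y 1 = {}" 
  proof -
    have "\<sigma> 1 = 1" if "\<sigma> \<in> perms 1" for \<sigma>
      using perms_ge1[OF that, of 1] perms_len[OF that, of 1] by simp
    then show "?X 1 = perms 1" "?Y 1 = {}" by (auto simp: occ_def)
  qed
  have "card (av ?R n) = succ_count n \<and> card (?Y (Suc n)) = n * succ_count n"
  proof (induction n rule: succ_count.induct)
    case 1
    have "av ?R 0 = {id}" by (auto simp: av_def perms_0 occ_def)
    then show ?case using one by simp
  next
    case 2
    then show ?case using A[of 1] Y[of 1] one by (simp add: card_perms)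
  next
    case (3 n)
    have "card (av ?R (Suc (Suc n))) = card (?Y (Suc n)) + Suc n * card (av ?R (Suc n))"
      using A X[of "Suc n"] Y[of "Suc n"] by simp
    then have a: "card (av ?R (Suc (Suc n))) = succ_count (Suc (Suc n))" using 3 by simp
    then show ?case using Y[of "Suc (Suc n)"] A[of "Suc (Suc n)"] by simp
  qed
  then show ?thesis by blast
qed

lemma weq_H: "weq {(0,1),(1,0),(1,1),(1,2),(2,1)} {(0,1),(0,2),(1,0),(1,1),(1,2)}"
  using card_av_H1 card_av_H2 by (simp add: weq_def)

section \<open>Active coordinates of codes\<close>

lemma bcode_above:
  assumes \<sigma>: "\<sigma> \<in> perms n" and p: "1 \<le> p" "p < i" and ab: "\<And>m. p < m \<Longrightarrow> m < i \<Longrightarrow> \<sigma> p < \<sigma> m"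
  shows "\<sigma> p < \<sigma> i \<longleftrightarrow> bcode \<sigma> i + p < bcode \<sigma> p + i"
    "\<sigma> p < \<sigma> i \<and> (\<forall>l. 1 \<le> l \<longrightarrow> l < i \<longrightarrow> \<not> (\<sigma> p < \<sigma> l \<and> \<sigma> l < \<sigma> i)) \<longleftrightarrow> bcode \<sigma> i + p + 1 = bcode \<sigma> p + i"
proof -
  let ?G = "{m. 1 \<le> m \<and> m < i \<and> \<sigma> p < \<sigma> m}" and ?B = "{m. 1 \<le> m \<and> m < i \<and> \<sigma> i < \<sigma> m}"
  have fin: "finite ?G" "finite ?B" by auto
  \<comment> \<open>Every position strictly between \<open>p\<close> and \<open>i\<close> counts, so
    there are \<open>bcode \<sigma> p + (i - 1 - p)\<close> entries above \<open>\<sigma> p\<close>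
    before \<open>i\<close>. The code at \<open>i\<close> is compared with this number.\<close>
  have "?G = {m. 1 \<le> m \<and> m < p \<and> \<sigma> p < \<sigma> m} \<union> {p<..<i}"
  proof (intro equalityI subsetI)
    fix x assume x: "x \<in> ?G"
    then have "x < p \<or> p < x" by (cases x p rule: linorder_cases) auto
    then show "x \<in> {m. 1 \<le> m \<and> m < p \<and> \<sigma> p < \<sigma> m} \<union> {p<..<i}" using x by auto
  next
    fix x assume "x \<in> {m. 1 \<le> m \<and> m < p \<and> \<sigma> p < \<sigma> m} \<union> {p<..<i}"
    then show "x \<in> ?G" using p ab[of x] by auto
  qed
  then have G: "card ?G = bcode \<sigma> p + (i - 1 - p)"
    unfolding bcode_def by (simp add: card_Un_disjoint disjoint_iff)
  have ne: "\<sigma> i \<noteq> \<sigma> p" using perms_inj[OF \<sigma>] p by auto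
  show "\<sigma> p < \<sigma> i \<longleftrightarrow> bcode \<sigma> i + p < bcode \<sigma> p + i"
  proof (cases "\<sigma> p < \<sigma> i")
    case True
    then have "card ?B \<le> card ?G" by (intro card_mono) auto
    then show ?thesis using True G p by (simp add: bcode_def)
  next
    case False
    then have "card (insert p ?G) \<le> card ?B" using ne p by (intro card_mono) auto
    then show ?thesis using False G p fin by (simp add: bcode_def)
  qed
  show "\<sigma> p < \<sigma> i \<and> (\<forall>l. 1 \<le> l \<longrightarrow> l < i \<longrightarrow> \<not> (\<sigma> p < \<sigma> l \<and> \<sigma> l < \<sigma> i)) \<longleftrightarrow> bcode \<sigma> i + p + 1 = bcode \<sigma> p + i"
  proof (cases "\<sigma> p < \<sigma> i")
    case True
    then have sub: "?B \<subseteq> ?G" by auto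
    have "card ?B = card ?G \<longleftrightarrow> ?B = ?G" 
      by (rule iffI, rule card_subset_eq[OF fin(1) sub], assumption, simp)
    moreover have "?B = ?G \<longleftrightarrow> (\<forall>l. 1 \<le> l \<longrightarrow> l < i \<longrightarrow> \<not> (\<sigma> p < \<sigma> l \<and> \<sigma> l < \<sigma> i))"
    proof
      assume e: "?B = ?G"
      show "\<forall>l. 1 \<le> l \<longrightarrow> l < i \<longrightarrow> \<not> (\<sigma> p < \<sigma> l \<and> \<sigma> l < \<sigma> i)"
      proof (intro allI impI notI)
        fix l assume l: "1 \<le> l" "l < i" "\<sigma> p < \<sigma> l \<and> \<sigma> l < \<sigma> i"
        then have "l \<in> ?B" unfolding e by simp
        then show False using l by auto
      qed
    next
      assume a: "\<forall>l. 1 \<le> l \<longrightarrow> l < i \<longrightarrow> \<not> (\<sigma> p < \<sigma> l \<and> \<sigma> l < \<sigma> i)"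
      have "?G \<subseteq> ?B"
      proof
        fix m assume m: "m \<in> ?G"
        then have "\<not> \<sigma> m < \<sigma> i" "\<sigma> m \<noteq> \<sigma> i" using a perms_inj[OF \<sigma>] by auto
        then show "m \<in> ?B" using m by simp
      qed
      then show "?B = ?G" using sub by blast
    qed
    ultimately show ?thesis using True G p by (auto simp: bcode_def)
  next
    case False
    then have "card (insert p ?G) \<le> card ?B" using ne p by (intro card_mono) auto
    then show ?thesis using False G p fin by (simp add: bcode_def)
  qed
qed

text \<open>The mirror image of \<open>bcode_above\<close>. In an ascending pair \<open>p\<close>
  itself is among the smaller entries counted at \<open>i\<close>, which shifts the second equation
  by one.\<close>

lemma rcode_below:
  assumes \<sigma>: "\<sigma> \<in> perms n" and p: "1 \<le> p" "p < i" and ab: "\<And>m. p < m \<Longrightarrow> m < i \<Longrightarrow> \<sigma> m < \<sigma> p"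
  shows "\<sigma> i < \<sigma> p \<longleftrightarrow> rcode \<sigma> i + p < rcode \<sigma> p + i"
    "\<sigma> p < \<sigma> i \<and> (\<forall>l. 1 \<le> l \<longrightarrow> l < i \<longrightarrow> \<not> (\<sigma> p < \<sigma> l \<and> \<sigma> l < \<sigma> i)) \<longleftrightarrow> rcode \<sigma> i + p = rcode \<sigma> p + i"
proof -
  let ?L = "{m. 1 \<le> m \<and> m < i \<and> \<sigma> m < \<sigma> p}" and ?B = "{m. 1 \<le> m \<and> m < i \<and> \<sigma> m < \<sigma> i}"
  have fin: "finite ?L" "finite ?B" by auto
  have "?L = {m. 1 \<le> m \<and> m < p \<and> \<sigma> m < \<sigma> p} \<union> {p<..<i}"
  proof (intro equalityI subsetI)
    fix x assume x: "x \<in> ?L"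
    then have "x < p \<or> p < x" by (cases x p rule: linorder_cases) auto
    then show "x \<in> {m. 1 \<le> m \<and> m < p \<and> \<sigma> m < \<sigma> p} \<union> {p<..<i}" using x by auto
  next
    fix x assume "x \<in> {m. 1 \<le> m \<and> m < p \<and> \<sigma> m < \<sigma> p} \<union> {p<..<i}"
    then show "x \<in> ?L" using p ab[of x] by auto
  qed
  then have G: "card ?L = rcode \<sigma> p + (i - 1 - p)"
    unfolding rcode_def by (simp add: card_Un_disjoint disjoint_iff)
  have ne: "\<sigma> i \<noteq> \<sigma> p" using perms_inj[OF \<sigma>] p by auto
  show "\<sigma> i < \<sigma> p \<longleftrightarrow> rcode \<sigma> i + p < rcode \<sigma> p + i"
  proof (cases "\<sigma> i < \<sigma> p")
    case True
    then have "card ?B \<le> card ?L" by (intro card_mono) auto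
    then show ?thesis using True G p by (simp add: rcode_def)
  next
    case False
    then have "card (insert p ?L) \<le> card ?B" using ne p by (intro card_mono) auto
    then show ?thesis using False G p fin by (simp add: rcode_def)
  qed
  show "\<sigma> p < \<sigma> i \<and> (\<forall>l. 1 \<le> l \<longrightarrow> l < i \<longrightarrow> \<not> (\<sigma> p < \<sigma> l \<and> \<sigma> l < \<sigma> i)) \<longleftrightarrow> rcode \<sigma> i + p = rcode \<sigma> p + i"
  proof (cases "\<sigma> p < \<sigma> i")
    case True
    then have sub: "insert p ?L \<subseteq> ?B" using p by auto
    have "card (insert p ?L) = card ?B \<longleftrightarrow> insert p ?L = ?B" 
      by (rule iffI, rule card_subset_eq[OF fin(2) sub], assumption, simp)
    moreover have "insert p ?L = ?B \<longleftrightarrow> (\<forall>l. 1 \<le> l \<longrightarrow> l < i \<longrightarrow> \<not> (\<sigma> p < \<sigma> l \<and> \<sigma> l < \<sigma> i))"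
    proof
      assume e: "insert p ?L = ?B"
      show "\<forall>l. 1 \<le> l \<longrightarrow> l < i \<longrightarrow> \<not> (\<sigma> p < \<sigma> l \<and> \<sigma> l < \<sigma> i)"
      proof (intro allI impI notI)
        fix l assume l: "1 \<le> l" "l < i" "\<sigma> p < \<sigma> l \<and> \<sigma> l < \<sigma> i"
        then have "l \<in> insert p ?L" unfolding e by simp
        then show False using l by auto
      qed
    next
      assume a: "\<forall>l. 1 \<le> l \<longrightarrow> l < i \<longrightarrow> \<not> (\<sigma> p < \<sigma> l \<and> \<sigma> l < \<sigma> i)"
      have "?B \<subseteq> insert p ?L"
      proof
        fix m assume m: "m \<in> ?B"
        then have "\<not> \<sigma> p < \<sigma> m" using a by auto
        moreover have "m = p \<or> \<sigma> m \<noteq> \<sigma> p" using perms_inj[OF \<sigma>] by auto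
        ultimately show "m \<in> insert p ?L" using m by auto
      qed
      then show "insert p ?L = ?B" using sub by blast
    qed
    ultimately show ?thesis using True G p fin by (auto simp: rcode_def)
  next
    case False
    then have "card ?B \<le> card ?L" using ne by (intro card_mono) auto
    then show ?thesis using False G p by (simp add: rcode_def)
  qed
qed

text \<open>Incrementing any subset of the coordinates \<open>u\<close> active for the first pattern turns it into a set of coordinates
  active for the second one. Pairs (code, set of active coordinates) are thus equinumerous, and
  inclusion-exclusion yields the number of codes without active coordinates.\<close>

definition act1 :: "nat \<Rightarrow> (nat \<Rightarrow> nat) \<Rightarrow> nat \<Rightarrow> nat \<Rightarrow> bool" where
  "act1 n c p u \<longleftrightarrow> 1 \<le> p \<and> p < u \<and> u \<le> n \<and> c u + p + 1 = c p + u \<and>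
     (\<forall>i. p < i \<longrightarrow> i < u \<longrightarrow> c i + p < c p + i) \<and> (\<forall>i. u < i \<longrightarrow> i \<le> n \<longrightarrow> c u < c i)"

definition act2 :: "nat \<Rightarrow> (nat \<Rightarrow> nat) \<Rightarrow> nat \<Rightarrow> nat \<Rightarrow> bool" where
  "act2 n c p u \<longleftrightarrow> 1 \<le> p \<and> p < u \<and> u \<le> n \<and> c u + p = c p + u \<and>
     (\<forall>i. p < i \<longrightarrow> i < u \<longrightarrow> c i + p < c p + i) \<and> (\<forall>i. u < i \<longrightarrow> i \<le> n \<longrightarrow> c u \<le> c i)"

lemma above_iff:
  assumes \<sigma>: "\<sigma> \<in> perms n" and p: "1 \<le> p"
  shows "(\<forall>i. p < i \<longrightarrow> i < u \<longrightarrow> \<sigma> p < \<sigma> i) \<longleftrightarrow> (\<forall>i. p < i \<longrightarrow> i < u \<longrightarrow> bcode \<sigma> i + p < bcode \<sigma> p + i)"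
proof
  assume a: "\<forall>i. p < i \<longrightarrow> i < u \<longrightarrow> \<sigma> p < \<sigma> i"
  then show "\<forall>i. p < i \<longrightarrow> i < u \<longrightarrow> bcode \<sigma> i + p < bcode \<sigma> p + i"
    using bcode_above(1)[OF \<sigma> p] by (meson less_trans)
next
  assume a: "\<forall>i. p < i \<longrightarrow> i < u \<longrightarrow> bcode \<sigma> i + p < bcode \<sigma> p + i"
  have "p < i \<Longrightarrow> i < u \<Longrightarrow> \<sigma> p < \<sigma> i" for i
  proof (induction i rule: less_induct)
    case (less i)
    then show ?case using bcode_above(1)[OF \<sigma> p, of i] a by (meson less_trans)
  qed
  then show "\<forall>i. p < i \<longrightarrow> i < u \<longrightarrow> \<sigma> p < \<sigma> i" by blast
qed

lemma below_iff:
  assumes \<sigma>: "\<sigma> \<in> perms n" and p: "1 \<le> p"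
  shows "(\<forall>i. p < i \<longrightarrow> i < u \<longrightarrow> \<sigma> i < \<sigma> p) \<longleftrightarrow> (\<forall>i. p < i \<longrightarrow> i < u \<longrightarrow> rcode \<sigma> i + p < rcode \<sigma> p + i)"
proof
  assume a: "\<forall>i. p < i \<longrightarrow> i < u \<longrightarrow> \<sigma> i < \<sigma> p"
  then show "\<forall>i. p < i \<longrightarrow> i < u \<longrightarrow> rcode \<sigma> i + p < rcode \<sigma> p + i"
    using rcode_below(1)[OF \<sigma> p] by (meson less_trans)
next
  assume a: "\<forall>i. p < i \<longrightarrow> i < u \<longrightarrow> rcode \<sigma> i + p < rcode \<sigma> p + i"
  have "p < i \<Longrightarrow> i < u \<Longrightarrow> \<sigma> i < \<sigma> p" for i
  proof (induction i rule: less_induct)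
    case (less i)
    then show ?case using rcode_below(1)[OF \<sigma> p, of i] a by (meson less_trans)
  qed
  then show "\<forall>i. p < i \<longrightarrow> i < u \<longrightarrow> \<sigma> i < \<sigma> p" by blast
qed

text \<open>The shading says that the first point has the next smaller value among the first
  \<open>u\<close> entries, that the entries between the positions exceed it, and that all later
  entries lie below the second point. These are the conditions of \<open>act1\<close>.\<close>

lemma occ_C1:
  assumes \<sigma>: "\<sigma> \<in> perms n"
  shows "occ {(0,1),(1,0),(1,1),(2,2)} n \<sigma> p u \<longleftrightarrow> act1 n (bcode \<sigma>) p u" (is "occ ?R n \<sigma> p u \<longleftrightarrow> _")
proof (cases "1 \<le> p \<and> p < u \<and> u \<le> n")
  case True
  then have p: "1 \<le> p" "p < u" "u \<le> n" "1 \<le> u" by auto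
  have "occ ?R n \<sigma> p u \<longleftrightarrow> (\<sigma> p < \<sigma> u \<and> (\<forall>l. 1 \<le> l \<longrightarrow> l < u \<longrightarrow> \<not> (\<sigma> p < \<sigma> l \<and> \<sigma> l < \<sigma> u))) \<and>
     (\<forall>i. p < i \<longrightarrow> i < u \<longrightarrow> \<sigma> p < \<sigma> i) \<and> (\<forall>l. u < l \<longrightarrow> l \<le> n \<longrightarrow> \<sigma> l < \<sigma> u)" (is "_ \<longleftrightarrow> ?r")
  proof
    assume o: "occ ?R n \<sigma> p u"
    have "\<not> (\<sigma> p < \<sigma> l \<and> \<sigma> l < \<sigma> u)" if "1 \<le> l" "l < u" for l
      using occ_clear(1,2)[OF \<sigma> o, of l] that by (cases l p rule: linorder_cases) (auto simp: clear_def)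
    moreover have "\<sigma> p < \<sigma> l" if "p < l" "l < u" for l
      using occ_clear(2)[OF \<sigma> o, of l] that perms_inj[OF \<sigma>, of l p] by (auto simp: clear_def)
    moreover have "\<sigma> l < \<sigma> u" if "u < l" "l \<le> n" for l
      using occ_clear(3)[OF \<sigma> o, of l] that perms_inj[OF \<sigma>, of l u] by (auto simp: clear_def)
    ultimately show ?r using occ_len[OF \<sigma> o] by blast
  next
    assume r: ?r
    show "occ ?R n \<sigma> p u"
    proof (rule occI[OF \<sigma> p(1-3)])
      show "\<sigma> p < \<sigma> u" using r by blast
      have nb: "\<not> (\<sigma> p < \<sigma> l \<and> \<sigma> l < \<sigma> u)" if "1 \<le> l" "l < u" for l using r that by blast
      show "clear ?R 0 (\<sigma> p) (\<sigma> u) (\<sigma> l)" if "1 \<le> l" "l < p" for l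
        using nb[of l] that p by (simp add: clear_def)
      show "clear ?R 1 (\<sigma> p) (\<sigma> u) (\<sigma> l)" if "p < l" "l < u" for l
      proof -
        have "\<sigma> p < \<sigma> l" using r that by blast
        then show ?thesis using nb[of l] that p by (simp add: clear_def)
      qed
      show "clear ?R 2 (\<sigma> p) (\<sigma> u) (\<sigma> l)" if "u < l" "l \<le> n" for l
      proof -
        have "\<sigma> l < \<sigma> u" using r that by blast
        then show ?thesis by (simp add: clear_def)
      qed
    qed
  qed
  also have "\<dots> \<longleftrightarrow> act1 n (bcode \<sigma>) p u"
    using bcode_above(2)[OF \<sigma> p(1,2)] above_iff[OF \<sigma> p(1), of u] rlmax_bcode[OF \<sigma> p(4)] p
    unfolding act1_def by blast
  finally show ?thesis .
qed (auto simp: occ_def act1_def)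

text \<open>By \<open>im\<close> the entries before \<open>u\<close> and below
  \<open>\<sigma> u\<close> are at most \<open>\<sigma> p\<close>, so a later entry above
  \<open>\<sigma> p\<close> counts them all. Conversely, the first later entry not above
  \<open>\<sigma> p\<close> counts only some of them and misses \<open>p\<close>.\<close>

lemma later_above_rcode:
  assumes \<sigma>: "\<sigma> \<in> perms n" and p: "1 \<le> p" "p < u"
    and im: "\<sigma> p < \<sigma> u" "\<forall>l. 1 \<le> l \<longrightarrow> l < u \<longrightarrow> \<not> (\<sigma> p < \<sigma> l \<and> \<sigma> l < \<sigma> u)"
  shows "(\<forall>l. u < l \<longrightarrow> l \<le> n \<longrightarrow> \<sigma> p < \<sigma> l) \<longleftrightarrow> (\<forall>l. u < l \<longrightarrow> l \<le> n \<longrightarrow> rcode \<sigma> u \<le> rcode \<sigma> l)"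
proof
  assume a: "\<forall>l. u < l \<longrightarrow> l \<le> n \<longrightarrow> \<sigma> p < \<sigma> l"
  show "\<forall>l. u < l \<longrightarrow> l \<le> n \<longrightarrow> rcode \<sigma> u \<le> rcode \<sigma> l"
  proof (intro allI impI)
    fix l assume l: "u < l" "l \<le> n"
    have "{m. 1 \<le> m \<and> m < u \<and> \<sigma> m < \<sigma> u} \<subseteq> {m. 1 \<le> m \<and> m < l \<and> \<sigma> m < \<sigma> l}"
    proof
      fix m assume m: "m \<in> {m. 1 \<le> m \<and> m < u \<and> \<sigma> m < \<sigma> u}"
      then have "\<sigma> m \<le> \<sigma> p" using im(2) by auto
      moreover have "\<sigma> p < \<sigma> l" using a l by blast
      ultimately show "m \<in> {m. 1 \<le> m \<and> m < l \<and> \<sigma> m < \<sigma> l}" using m l by simp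
    qed
    then show "rcode \<sigma> u \<le> rcode \<sigma> l" unfolding rcode_def by (intro card_mono) auto
  qed
next
  assume a: "\<forall>l. u < l \<longrightarrow> l \<le> n \<longrightarrow> rcode \<sigma> u \<le> rcode \<sigma> l"
  have "u < l \<Longrightarrow> l \<le> n \<Longrightarrow> \<sigma> p < \<sigma> l" for l
  proof (induction l rule: less_induct)
    case (less l)
    show ?case
    proof (rule ccontr)
      assume n: "\<not> \<sigma> p < \<sigma> l"
      have "{m. 1 \<le> m \<and> m < l \<and> \<sigma> m < \<sigma> l} \<subset> {m. 1 \<le> m \<and> m < u \<and> \<sigma> m < \<sigma> u}"
      proof
        show "{m. 1 \<le> m \<and> m < l \<and> \<sigma> m < \<sigma> l} \<subseteq> {m. 1 \<le> m \<and> m < u \<and> \<sigma> m < \<sigma> u}"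
        proof
          fix m assume m: "m \<in> {m. 1 \<le> m \<and> m < l \<and> \<sigma> m < \<sigma> l}"
          have "m < u" using less.IH[of m] m n less.prems im(1) by (cases m u rule: linorder_cases) auto
          then show "m \<in> {m. 1 \<le> m \<and> m < u \<and> \<sigma> m < \<sigma> u}" using m n im(1) by simp
        qed
        show "{m. 1 \<le> m \<and> m < l \<and> \<sigma> m < \<sigma> l} \<noteq> {m. 1 \<le> m \<and> m < u \<and> \<sigma> m < \<sigma> u}"
          using n p im(1) less.prems by blast
      qed
      then have "rcode \<sigma> l < rcode \<sigma> u" unfolding rcode_def by (intro psubset_card_mono) auto
      then show False using a less.prems by fastforce
    qed
  qed
  then show "\<forall>l. u < l \<longrightarrow> l \<le> n \<longrightarrow> \<sigma> p < \<sigma> l" by blast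
qed

text \<open>Here the entries between the positions lie below the first point and the later ones
  above it. Counting smaller instead of larger entries makes the description parallel to
  \<open>act1\<close>.\<close>

lemma occ_C2:
  assumes \<sigma>: "\<sigma> \<in> perms n"
  shows "occ {(0,1),(1,1),(1,2),(2,0)} n \<sigma> p u \<longleftrightarrow> act2 n (rcode \<sigma>) p u" (is "occ ?R n \<sigma> p u \<longleftrightarrow> _")
proof (cases "1 \<le> p \<and> p < u \<and> u \<le> n")
  case True
  then have p: "1 \<le> p" "p < u" "u \<le> n" "1 \<le> u" by auto
  let ?im = "\<sigma> p < \<sigma> u \<and> (\<forall>l. 1 \<le> l \<longrightarrow> l < u \<longrightarrow> \<not> (\<sigma> p < \<sigma> l \<and> \<sigma> l < \<sigma> u))"
  have "occ ?R n \<sigma> p u \<longleftrightarrow> ?im \<and>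
     (\<forall>i. p < i \<longrightarrow> i < u \<longrightarrow> \<sigma> i < \<sigma> p) \<and> (\<forall>l. u < l \<longrightarrow> l \<le> n \<longrightarrow> \<sigma> p < \<sigma> l)" (is "_ \<longleftrightarrow> ?r")
  proof
    assume o: "occ ?R n \<sigma> p u"
    have "\<not> (\<sigma> p < \<sigma> l \<and> \<sigma> l < \<sigma> u)" if "1 \<le> l" "l < u" for l
      using occ_clear(1,2)[OF \<sigma> o, of l] that by (cases l p rule: linorder_cases) (auto simp: clear_def)
    moreover have "\<sigma> l < \<sigma> p" if "p < l" "l < u" for l
      using occ_clear(2)[OF \<sigma> o, of l] that perms_inj[OF \<sigma>, of l p] perms_inj[OF \<sigma>, of l u] by (auto simp: clear_def)
    moreover have "\<sigma> p < \<sigma> l" if "u < l" "l \<le> n" for l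
      using occ_clear(3)[OF \<sigma> o, of l] that perms_inj[OF \<sigma>, of l p] p by (auto simp: clear_def)
    ultimately show ?r using occ_len[OF \<sigma> o] by blast
  next
    assume r: ?r
    show "occ ?R n \<sigma> p u"
    proof (rule occI[OF \<sigma> p(1-3)])
      show lt: "\<sigma> p < \<sigma> u" using r by blast
      have nb: "\<not> (\<sigma> p < \<sigma> l \<and> \<sigma> l < \<sigma> u)" if "1 \<le> l" "l < u" for l using r that by blast
      show "clear ?R 0 (\<sigma> p) (\<sigma> u) (\<sigma> l)" if "1 \<le> l" "l < p" for l
        using nb[of l] that p by (simp add: clear_def)
      show "clear ?R 1 (\<sigma> p) (\<sigma> u) (\<sigma> l)" if "p < l" "l < u" for l
      proof -
        have "\<sigma> l < \<sigma> p" using r that by blast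
        then show ?thesis using lt by (simp add: clear_def)
      qed
      show "clear ?R 2 (\<sigma> p) (\<sigma> u) (\<sigma> l)" if "u < l" "l \<le> n" for l
      proof -
        have "\<sigma> p < \<sigma> l" using r that by blast
        then show ?thesis by (simp add: clear_def)
      qed
    qed
  qed
  also have "\<dots> \<longleftrightarrow> ?im \<and> (\<forall>i. p < i \<longrightarrow> i < u \<longrightarrow> \<sigma> i < \<sigma> p) \<and> (\<forall>l. u < l \<longrightarrow> l \<le> n \<longrightarrow> rcode \<sigma> u \<le> rcode \<sigma> l)"
    using later_above_rcode[OF \<sigma> p(1,2)] by blast
  also have "\<dots> \<longleftrightarrow> act2 n (rcode \<sigma>) p u"
    using rcode_below(2)[OF \<sigma> p(1,2)] below_iff[OF \<sigma> p(1), of u] p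
    unfolding act2_def by blast
  finally show ?thesis .
qed (auto simp: occ_def act2_def)

lemma sum_Pow_alternating:
  "finite A \<Longrightarrow> (\<Sum>S\<in>Pow A. (-1::int) ^ card S) = (if A = {} then 1 else 0)"
proof (induction A rule: finite_induct)
  case (insert a A)
  have "(\<Sum>S\<in>Pow (insert a A). (-1::int) ^ card S) = (\<Sum>S\<in>Pow A. (-1) ^ card S) + (\<Sum>S\<in>insert a ` Pow A. (-1) ^ card S)"
    unfolding Pow_insert using insert by (intro sum.union_disjoint) auto
  also have "(\<Sum>S\<in>insert a ` Pow A. (-1::int) ^ card S) = (\<Sum>S\<in>Pow A. (-1) ^ card (insert a S))"
    by (rule sum.reindex_cong[of "insert a"]) (use insert in \<open>auto simp: inj_on_def\<close>)
  also have "\<dots> = (\<Sum>S\<in>Pow A. - ((-1) ^ card S))"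
  proof (rule sum.cong[OF refl])
    fix S assume "S \<in> Pow A"
    then have "a \<notin> S" "finite S" using insert finite_subset by auto
    then show "(-1::int) ^ card (insert a S) = - ((-1) ^ card S)" by simp
  qed
  finally show ?case by (simp add: sum_negf)
qed simp

lemma card_empty_alternating:
  assumes "finite Z" "\<And>x. x \<in> Z \<Longrightarrow> finite (D x)"
  shows "int (card {x \<in> Z. D x = {}}) = (\<Sum>(x, S)\<in>Sigma Z (\<lambda>x. Pow (D x)). (-1) ^ card S)"
proof -
  have "(\<Sum>(x, S)\<in>Sigma Z (\<lambda>x. Pow (D x)). (-1::int) ^ card S) = (\<Sum>x\<in>Z. \<Sum>S\<in>Pow (D x). (-1) ^ card S)"
    using assms by (subst sum.Sigma) auto
  also have "\<dots> = (\<Sum>x\<in>Z. if D x = {} then 1 else 0)"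
    using assms by (intro sum.cong refl sum_Pow_alternating) auto
  finally show ?thesis using assms(1) by (simp add: sum.inter_filter[symmetric])
qed

text \<open>Changing the coordinates in \<open>S\<close> may affect the activity of others, so only
  the inclusion of \<open>S\<close> is controlled. Since \<open>S\<close> is carried along
  unchanged, the signs match and the alternating sums agree.\<close>

lemma card_empty_eq:
  assumes "finite X" "finite Y" and A: "\<And>x. x \<in> X \<Longrightarrow> finite (A x)" and B: "\<And>y. y \<in> Y \<Longrightarrow> finite (B y)"
    and f: "\<And>x S. x \<in> X \<Longrightarrow> S \<subseteq> A x \<Longrightarrow> f S x \<in> Y \<and> S \<subseteq> B (f S x) \<and> g S (f S x) = x"
    and g: "\<And>y S. y \<in> Y \<Longrightarrow> S \<subseteq> B y \<Longrightarrow> g S y \<in> X \<and> S \<subseteq> A (g S y) \<and> f S (g S y) = y"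
  shows "card {x \<in> X. A x = {}} = card {y \<in> Y. B y = {}}"
proof -
  have f1: "f S x \<in> Y" and f2: "S \<subseteq> B (f S x)" and f3: "g S (f S x) = x" if "x \<in> X" "S \<subseteq> A x" for x S
    using f[OF that] by auto
  have g1: "g S y \<in> X" and g2: "S \<subseteq> A (g S y)" and g3: "f S (g S y) = y" if "y \<in> Y" "S \<subseteq> B y" for y S
    using g[OF that] by auto
  have "(\<Sum>(x, S)\<in>Sigma X (\<lambda>x. Pow (A x)). (-1::int) ^ card S) = (\<Sum>(x, S)\<in>Sigma Y (\<lambda>x. Pow (B x)). (-1) ^ card S)"
    by (rule sum.reindex_bij_witness[where i = "\<lambda>(y, S). (g S y, S)" and j = "\<lambda>(x, S). (f S x, S)"])
      (auto simp: f1 f3 g1 g3 intro: subsetD[OF f2] subsetD[OF g2])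
  then have "int (card {x \<in> X. A x = {}}) = int (card {y \<in> Y. B y = {}})"
    using card_empty_alternating[OF assms(1), of A, OF A] card_empty_alternating[OF assms(2), of B, OF B] by simp
  then show ?thesis by simp
qed

text \<open>If \<open>p\<close> were active, the code at \<open>Suc p\<close> would be larger than
  \<open>c p\<close>; but a pair starting at \<open>p\<close> makes it at most
  \<open>c p\<close>.\<close>

lemma act1_start: "act1 n c p u \<Longrightarrow> \<not> act1 n c q p"
proof
  assume a: "act1 n c p u" "act1 n c q p"
  then have l: "p < u" "u \<le> n" "c u + p + 1 = c p + u" "\<And>i. p < i \<Longrightarrow> i \<le> n \<Longrightarrow> c p < c i"
    "\<And>i. p < i \<Longrightarrow> i < u \<Longrightarrow> c i + p < c p + i"
    unfolding act1_def by blast+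
  show False
  proof (cases "u = Suc p")
    case True
    then show ?thesis using l(1-3) l(4)[of u] by simp
  next
    case False
    then show ?thesis using l(1,2) l(4)[of "Suc p"] l(5)[of "Suc p"] by simp
  qed
qed

definition inc :: "nat set \<Rightarrow> (nat \<Rightarrow> nat) \<Rightarrow> nat \<Rightarrow> nat" where
  "inc S c i = (if i \<in> S then Suc (c i) else c i)"

definition dec :: "nat set \<Rightarrow> (nat \<Rightarrow> nat) \<Rightarrow> nat \<Rightarrow> nat" where
  "dec S c i = (if i \<in> S then c i - 1 else c i)"

lemma inc_act:
  assumes S: "S \<subseteq> {u. \<exists>p. act1 n c p u}" and u: "u \<in> S"
  shows "\<exists>p. act2 n (inc S c) p u"
proof -
  obtain p where a: "act1 n c p u" using S u by blast
  then have l: "1 \<le> p" "p < u" "u \<le> n" "c u + p + 1 = c p + u" "\<And>i. u < i \<Longrightarrow> i \<le> n \<Longrightarrow> c u < c i"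
    "\<And>i. p < i \<Longrightarrow> i < u \<Longrightarrow> c i + p < c p + i"
    unfolding act1_def by blast+
  have pS: "p \<notin> S" using act1_start[OF a] S by blast
  \<comment> \<open>Incremented coordinates between \<open>p\<close> and \<open>u\<close> can reach
    the diagonal of slope one through \<open>p\<close>. The last position on it becomes the partner
    of \<open>u\<close>; \<open>p\<close> is on it because it is not incremented.\<close>
  let ?E = "{i \<in> {p..<u}. inc S c i + p = c p + i}"
  have "p \<in> ?E" using l pS by (simp add: inc_def)
  then have m: "Max ?E \<in> ?E" by (intro Max_in) auto
  define q where "q = Max ?E"
  have q: "p \<le> q" "q < u" "inc S c q + p = c p + q" using m by (auto simp: q_def)
  have lt: "inc S c i + p < c p + i" if "q < i" "i < u" for i
  proof -
    have "i \<notin> ?E"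
    proof
      assume "i \<in> ?E"
      then have "i \<le> q" unfolding q_def by (intro Max_ge) auto
      then show False using that by simp
    qed
    then show ?thesis using l(6)[of i] that q by (auto simp: inc_def split: if_splits)
  qed
  have "act2 n (inc S c) q u"
    unfolding act2_def
  proof (intro conjI allI impI)
    show "inc S c u + q = inc S c q + u" using l(4) u q by (simp add: inc_def[of S c u])
    show "inc S c i + q < inc S c q + i" if "q < i" "i < u" for i using lt[OF that] q by simp
    show "inc S c u \<le> inc S c i" if "u < i" "i \<le> n" for i using l(5)[OF that] u by (simp add: inc_def)
  qed (use l q in auto)
  then show ?thesis by blast
qed

lemma act2_pos: "act2 n c p u \<Longrightarrow> 1 \<le> c u"
  by (auto simp: act2_def)

lemma dec_act:
  assumes S: "S \<subseteq> {u. \<exists>p. act2 n c p u}" and u: "u \<in> S"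
  shows "\<exists>p. act1 n (dec S c) p u"
proof -
  obtain p where "act2 n c p u" using S u by blast
  then have l: "1 \<le> p" "p < u" "u \<le> n" "c u + p = c p + u" "\<And>i. u < i \<Longrightarrow> i \<le> n \<Longrightarrow> c u \<le> c i"
    "\<And>i. p < i \<Longrightarrow> i < u \<Longrightarrow> c i + p < c p + i"
    unfolding act2_def by blast+
  have cu: "1 \<le> c u" using l by simp
  \<comment> \<open>Positions on the diagonal of slope one through \<open>u\<close> with no
    coordinate in between above that diagonal. The least of them is not in \<open>S\<close>, because
    its own partner would be such a position further left; so it keeps its value.\<close>
  let ?P = "\<lambda>i. 1 \<le> i \<and> i < u \<and> c u + i = c i + u \<and> (\<forall>m. i < m \<longrightarrow> m < u \<longrightarrow> c m + u \<le> c u + m)"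
  have "?P p" using l by fastforce
  define i0 where "i0 = (LEAST i. ?P i)"
  have i0: "?P i0" unfolding i0_def by (rule LeastI[of ?P, OF \<open>?P p\<close>])
  have "i0 \<notin> S"
  proof
    assume "i0 \<in> S"
    then obtain q where "act2 n c q i0" using S by blast
    then have q: "1 \<le> q" "q < i0" "c i0 + q = c q + i0" "\<And>m. q < m \<Longrightarrow> m < i0 \<Longrightarrow> c m + q < c q + m"
      unfolding act2_def by blast+
    have "?P q"
    proof (intro conjI allI impI)
      fix m assume m: "q < m" "m < u"
      consider "m < i0" | "m = i0" | "i0 < m" by linarith
      then show "c m + u \<le> c u + m"
      proof cases
        case 1
        then show ?thesis using q(4)[of m] q(3) i0 m by linarith
      qed (use i0 m in auto)
    qed (use q i0 in auto)
    then have "i0 \<le> q" unfolding i0_def by (rule Least_le)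
    then show False using q by simp
  qed
  \<comment> \<open>Other positions may have dropped below the diagonal; the last one still on it is
    the partner of \<open>u\<close> after decrementing.\<close>
  let ?E = "{i \<in> {i0..<u}. c u + i = dec S c i + u}"
  have "i0 \<in> ?E" using i0 \<open>i0 \<notin> S\<close> by (simp add: dec_def)
  then have m: "Max ?E \<in> ?E" by (intro Max_in) auto
  define q where "q = Max ?E"
  have q: "i0 \<le> q" "q < u" "c u + q = dec S c q + u" using m by (auto simp: q_def)
  have lt: "dec S c i + u < c u + i" if "q < i" "i < u" for i
  proof -
    have "i \<notin> ?E"
    proof
      assume "i \<in> ?E"
      then have "i \<le> q" unfolding q_def by (intro Max_ge) auto
      then show False using that by simp
    qed
    moreover have "c i + u \<le> c u + i" using i0 that q by simp
    moreover have "dec S c i \<le> c i" by (simp add: dec_def)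
    ultimately show ?thesis using that q by auto
  qed
  have du: "dec S c u + 1 = c u" using u cu by (simp add: dec_def)
  have "act1 n (dec S c) q u"
    unfolding act1_def
  proof (intro conjI allI impI)
    show "dec S c u + q + 1 = dec S c q + u" using du q by simp
    show "dec S c i + q < dec S c q + i" if "q < i" "i < u" for i using lt[OF that] q by linarith
    show "dec S c u < dec S c i" if i: "u < i" "i \<le> n" for i
    proof (cases "i \<in> S")
      case True
      then obtain s where s: "act2 n c s i" using S by blast
      then have s': "1 \<le> s" "s < i" "c i + s = c s + i" "\<And>m. s < m \<Longrightarrow> m < i \<Longrightarrow> c m + s < c s + m"
        unfolding act2_def by blast+
      \<comment> \<open>Decrementing \<open>i\<close> must leave a strict inequality, so equality of
        the old codes has to be excluded. It is impossible wherever the partner \<open>s\<close> of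
        \<open>i\<close> lies relative to \<open>u\<close>.\<close>
      have "c u < c i"
      proof (rule ccontr)
        assume "\<not> c u < c i"
        then have e: "c u = c i" using l(5)[OF i] by simp
        consider "u < s" | "u = s" | "s < u" by linarith
        then show False
        proof cases
          case 1
          then show ?thesis using l(5)[of s] s' e i by simp
        next
          case 2
          then show ?thesis using s' e by simp
        next
          case 3
          then show ?thesis using s'(4)[of u] s' e i by simp
        qed
      qed
      then show ?thesis using du True by (simp add: dec_def)
    next
      case False
      then show ?thesis using du l(5)[OF i] by (simp add: dec_def)
    qed
  qed (use l q i0 in auto)
  then show ?thesis by blast
qed

lemma weq_C: "weq {(0,1),(1,0),(1,1),(2,2)} {(0,1),(1,1),(1,2),(2,0)}" (is "weq ?R ?R'")
proof -
  have "card (av ?R n) = card (av ?R' n)" for n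
  proof -
    let ?A = "\<lambda>c. {u. \<exists>p. act1 n c p u}" and ?B = "\<lambda>c. {u. \<exists>p. act2 n c p u}"
    have r: "act1 n (restrict c {1..n}) p u \<longleftrightarrow> act1 n c p u" "act2 n (restrict c {1..n}) p u \<longleftrightarrow> act2 n c p u" for c p u
      by (auto simp: act1_def act2_def)
    have "card (av ?R n) = card {c \<in> codes n. ?A c = {}}"
      unfolding av_def by (rule card_bcode, unfold r, use occ_C1 in auto)
    also have "\<dots> = card {c \<in> codes n. ?B c = {}}"
    proof (rule card_empty_eq[where f = inc and g = dec])
      fix c S assume c: "c \<in> codes n" and S: "S \<subseteq> ?A c"
      \<comment> \<open>The partner satisfies \<open>c p < p\<close>, so
        \<open>c u + 1 = c p + (u - p)\<close> is below \<open>u\<close> and the incremented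
        function is still a code.\<close>
      have n: "u \<in> {1..n} \<and> Suc (c u) < u" if u: "u \<in> S" for u
      proof -
        obtain p where "act1 n c p u" using S u by blast
        then show ?thesis using codes_less[OF c, of p] by (auto simp: act1_def)
      qed
      have "inc S c \<in> codes n"
        by (rule codesI) (use n codes_less[OF c] codes_out[OF c] in \<open>auto simp: inc_def\<close>)
      moreover have "dec S (inc S c) = c" by (auto simp: inc_def dec_def)
      ultimately show "inc S c \<in> codes n \<and> S \<subseteq> ?B (inc S c) \<and> dec S (inc S c) = c"
        using inc_act[OF S] by blast
    next
      fix c S assume c: "c \<in> codes n" and S: "S \<subseteq> ?B c"
      have n: "u \<in> {1..n} \<and> 1 \<le> c u" if u: "u \<in> S" for u
      proof -
        obtain p where "act2 n c p u" using S u by blast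
        then show ?thesis using act2_pos[of n c p u] by (auto simp: act2_def)
      qed
      have "dec S c \<in> codes n"
      proof (rule codesI)
        fix i assume "1 \<le> i" "i \<le> n"
        then show "dec S c i < i" using codes_less[OF c, of i] by (auto simp: dec_def)
      next
        fix i assume "i \<notin> {1..n}"
        then show "dec S c i = undefined" using codes_out[OF c, of i] n[of i] by (auto simp: dec_def)
      qed
      moreover have "inc S (dec S c) = c" using n by (force simp: inc_def dec_def)
      ultimately show "dec S c \<in> codes n \<and> S \<subseteq> ?A (dec S c) \<and> inc S (dec S c) = c"
        using dec_act[OF S] by blast
    qed (auto intro!: finite_subset[of _ "{..n}"] simp: act1_def act2_def)
    also have "\<dots> = card (av ?R' n)"
      unfolding av_def by (rule card_rcode[symmetric], unfold r, use occ_C2 in auto)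
    finally show ?thesis .
  qed
  then show ?thesis by (simp add: weq_def)
qed

section \<open>Exchange of the cells (2,2) and (2,0)\<close>

definition blk :: "bool \<Rightarrow> nat \<Rightarrow> (nat \<Rightarrow> nat) \<Rightarrow> nat \<Rightarrow> nat \<Rightarrow> bool" where
  "blk \<beta> n \<sigma> i j \<longleftrightarrow> 1 \<le> i \<and> i < j \<and> j \<le> n \<and> \<sigma> i < \<sigma> j \<and>
     (\<forall>l. 1 \<le> l \<longrightarrow> l < i \<longrightarrow> \<sigma> i < \<sigma> l \<and> \<sigma> l < \<sigma> j) \<and>
     (\<forall>l. i < l \<longrightarrow> l < j \<longrightarrow> \<sigma> l < \<sigma> i \<or> \<sigma> j < \<sigma> l) \<and>
     (\<forall>l. j < l \<longrightarrow> l \<le> n \<longrightarrow> (if \<beta> then \<sigma> l < \<sigma> i else \<sigma> j < \<sigma> l))"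

text \<open>Cell (2,1) is shaded for either choice of the corner, so all entries after
  \<open>j\<close> lie on one side of the pair: below it if (2,2) is shaded, above it if (2,0)
  is.\<close>

lemma occ_blk:
  assumes \<sigma>: "\<sigma> \<in> perms n"
  shows "occ {(0,0),(0,2),(1,1),(2,1),if \<beta> then (2,2) else (2,0)} n \<sigma> i j \<longleftrightarrow> blk \<beta> n \<sigma> i j" (is "occ ?R n \<sigma> i j \<longleftrightarrow> _")
proof
  assume o: "occ ?R n \<sigma> i j"
  note l = occ_len[OF \<sigma> o]
  have "\<sigma> i < \<sigma> k \<and> \<sigma> k < \<sigma> j" if "1 \<le> k" "k < i" for k
    using occ_clear(1)[OF \<sigma> o that] that l perms_inj[OF \<sigma>, of k i] perms_inj[OF \<sigma>, of k j]
    by (auto simp: clear_def split: if_splits)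
  moreover have "\<sigma> k < \<sigma> i \<or> \<sigma> j < \<sigma> k" if "i < k" "k < j" for k
    using occ_clear(2)[OF \<sigma> o that] that l perms_inj[OF \<sigma>, of k i] perms_inj[OF \<sigma>, of k j]
    by (auto simp: clear_def split: if_splits)
  moreover have "if \<beta> then \<sigma> k < \<sigma> i else \<sigma> j < \<sigma> k" if "j < k" "k \<le> n" for k
    using occ_clear(3)[OF \<sigma> o that] that l perms_inj[OF \<sigma>, of k i] perms_inj[OF \<sigma>, of k j]
    by (auto simp: clear_def split: if_splits)
  ultimately show "blk \<beta> n \<sigma> i j" using l unfolding blk_def by blast
next
  assume b: "blk \<beta> n \<sigma> i j"
  have k0: "1 \<le> k \<Longrightarrow> k < i \<Longrightarrow> \<sigma> i < \<sigma> k \<and> \<sigma> k < \<sigma> j" for k using b unfolding blk_def by blast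
  have k1: "i < k \<Longrightarrow> k < j \<Longrightarrow> \<sigma> k < \<sigma> i \<or> \<sigma> j < \<sigma> k" for k using b unfolding blk_def by blast
  have k2: "j < k \<Longrightarrow> k \<le> n \<Longrightarrow> if \<beta> then \<sigma> k < \<sigma> i else \<sigma> j < \<sigma> k" for k using b unfolding blk_def by blast
  have ij: "1 \<le> i" "i < j" "j \<le> n" "\<sigma> i < \<sigma> j" using b unfolding blk_def by blast+
  show "occ ?R n \<sigma> i j"
  proof (rule occI[OF \<sigma> ij])
    show "clear ?R 0 (\<sigma> i) (\<sigma> j) (\<sigma> k)" if "1 \<le> k" "k < i" for k using k0[OF that] by (auto simp: clear_def)
    show "clear ?R 1 (\<sigma> i) (\<sigma> j) (\<sigma> k)" if "i < k" "k < j" for k using k1[OF that] by (auto simp: clear_def)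
    show "clear ?R 2 (\<sigma> i) (\<sigma> j) (\<sigma> k)" if "j < k" "k \<le> n" for k
      using k2[OF that] ij by (auto simp: clear_def split: if_splits)
  qed
qed

lemma blkD:
  assumes "blk \<beta> n \<sigma> i j"
  shows "1 \<le> i" "i < j" "j \<le> n" "\<sigma> i < \<sigma> j"
    "1 \<le> l \<Longrightarrow> l < i \<Longrightarrow> \<sigma> i < \<sigma> l" "1 \<le> l \<Longrightarrow> l < i \<Longrightarrow> \<sigma> l < \<sigma> j"
    "i < l \<Longrightarrow> l < j \<Longrightarrow> \<sigma> l < \<sigma> i \<or> \<sigma> j < \<sigma> l"
    "j < l \<Longrightarrow> l \<le> n \<Longrightarrow> if \<beta> then \<sigma> l < \<sigma> i else \<sigma> j < \<sigma> l"
proof -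
  show "1 \<le> i" "i < j" "j \<le> n" "\<sigma> i < \<sigma> j" using assms unfolding blk_def by blast+
  show "1 \<le> l \<Longrightarrow> l < i \<Longrightarrow> \<sigma> i < \<sigma> l" using assms unfolding blk_def by blast
  show "1 \<le> l \<Longrightarrow> l < i \<Longrightarrow> \<sigma> l < \<sigma> j" using assms unfolding blk_def by blast
  show "i < l \<Longrightarrow> l < j \<Longrightarrow> \<sigma> l < \<sigma> i \<or> \<sigma> j < \<sigma> l" using assms unfolding blk_def by blast
  show "j < l \<Longrightarrow> l \<le> n \<Longrightarrow> if \<beta> then \<sigma> l < \<sigma> i else \<sigma> j < \<sigma> l" using assms unfolding blk_def by blast
qed

text \<open>The middle row is unshaded only in the left column.\<close>

lemma blk_between:
  assumes b: "blk \<beta> n \<sigma> i j" and l: "l \<le> n" "\<sigma> i < \<sigma> l" "\<sigma> l < \<sigma> j"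
  shows "l < i"
proof (rule ccontr)
  assume "\<not> l < i"
  then consider "l = i" | "i < l" "l < j" | "l = j" | "j < l" by linarith
  then show False
  proof cases
    case 2
    then show ?thesis using blkD(7)[OF b] l by fastforce
  next
    case 4
    then show ?thesis using blkD(8)[OF b, of l] l by (simp split: if_splits)
  qed (use l in auto)
qed

lemma blk_second_unique:
  assumes \<sigma>: "\<sigma> \<in> perms n" and b: "blk \<beta> n \<sigma> i j" "blk \<beta> n \<sigma> i j'"
  shows "j' = j"
proof -
  have "\<sigma> j \<le> \<sigma> j'" using blk_between[OF b(1), of j'] blkD[OF b(1)] blkD[OF b(2)] by (meson not_less less_asym)
  moreover have "\<sigma> j' \<le> \<sigma> j" using blk_between[OF b(2), of j] blkD[OF b(1)] blkD[OF b(2)] by (meson not_less less_asym)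
  ultimately show ?thesis using perms_inj[OF \<sigma>, of j' j] by simp
qed

text \<open>The value at \<open>k\<close> lies between those at \<open>i\<close> and
  \<open>j\<close>. A smaller value at \<open>l\<close> would put \<open>l\<close> before
  \<open>i\<close>, and then \<open>i\<close> and \<open>j\<close> would come after the pair
  \<open>k\<close>, \<open>l\<close> on different sides of it; a larger value would put
  \<open>j\<close> before \<open>k\<close>.\<close>

lemma blk_nested:
  assumes \<sigma>: "\<sigma> \<in> perms n" and b: "blk \<beta> n \<sigma> i j" and c: "blk \<beta> n \<sigma> k l" and k: "k < i"
  shows "l = j"
proof -
  have ik: "\<sigma> i < \<sigma> k" "\<sigma> k < \<sigma> j" using blkD(5,6)[OF b blkD(1)[OF c] k] by auto
  have "\<not> \<sigma> l < \<sigma> j"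
  proof
    assume lt: "\<sigma> l < \<sigma> j"
    have li: "l < i" using blk_between[OF b, of l] lt ik blkD(1-4)[OF c] by simp
    show False
      using blkD(8)[OF c, of i] blkD(8)[OF c, of j] li blkD(1-4)[OF b] ik blkD(4)[OF c] by (auto split: if_splits)
  qed
  moreover have "\<not> \<sigma> j < \<sigma> l" using blk_between[OF c, of j] ik blkD(1-4)[OF b] k by auto
  ultimately show ?thesis using perms_inj[OF \<sigma>, of l j] by simp
qed

text \<open>Complements the values but keeps the order within \<open>{a..b}\<close>. Applied to the values of the leftmost occurrence,
  this exchanges the shaded cells \<open>(2,2)\<close> and \<open>(2,0)\<close>.\<close>

definition bflip :: "nat \<Rightarrow> nat \<Rightarrow> nat \<Rightarrow> nat \<Rightarrow> nat" where
  "bflip n a b v = (if 1 \<le> v \<and> v \<le> n then if a \<le> v \<and> v \<le> b then v + (n + 1) - a - b else n + 1 - v else v)"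

lemma bflip_inside: "1 \<le> a \<Longrightarrow> a \<le> v \<Longrightarrow> v \<le> b \<Longrightarrow> b \<le> n \<Longrightarrow> bflip n a b v = v + (n + 1) - a - b"
  unfolding bflip_def by auto

lemma bflip_outside: "1 \<le> v \<Longrightarrow> v \<le> n \<Longrightarrow> v < a \<or> b < v \<Longrightarrow> bflip n a b v = n + 1 - v"
  unfolding bflip_def by auto

lemma bflip_bflip:
  assumes ab: "1 \<le> a" "a \<le> b" "b \<le> n"
  shows "bflip n (bflip n a b a) (bflip n a b b) (bflip n a b v) = v"
proof -
  have e: "bflip n a b a = n + 1 - b" "bflip n a b b = n + 1 - a"
    using ab bflip_inside[of a a b n] bflip_inside[of a b b n] by linarith+
  consider "v < 1 \<or> n < v" | "1 \<le> v" "v \<le> n" "v < a \<or> b < v" | "a \<le> v" "v \<le> b" by linarith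
  then show ?thesis
  proof cases
    case 1
    then have "bflip n c d v = v" for c d by (auto simp: bflip_def)
    then show ?thesis by simp
  next
    case 2
    have i: "bflip n a b v = n + 1 - v" using 2 by (rule bflip_outside)
    have "bflip n (n + 1 - b) (n + 1 - a) (n + 1 - v) = n + 1 - (n + 1 - v)"
      by (rule bflip_outside) (use 2 ab in arith)+
    also have "\<dots> = v" using 2 by arith
    finally show ?thesis unfolding e i .
  next
    case 3
    have i: "bflip n a b v = v + (n + 1) - a - b" using ab 3 by (intro bflip_inside)
    have "bflip n (n + 1 - b) (n + 1 - a) (v + (n + 1) - a - b) = v + (n + 1) - a - b + (n + 1) - (n + 1 - b) - (n + 1 - a)"
      by (rule bflip_inside) (use 3 ab in arith)+
    also have "\<dots> = v" using 3 ab by arith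
    finally show ?thesis unfolding e i .
  qed
qed

lemma bflip_perms:
  assumes ab: "1 \<le> a" "a \<le> b" "b \<le> n"
  shows "bflip n a b \<in> perms n"
proof (rule permsI)
  fix i j assume "bflip n a b i = bflip n a b j"
  then show "i = j" using bflip_bflip[OF ab, of i] bflip_bflip[OF ab, of j] by metis
next
  fix i assume "i \<in> {1..n}"
  then show "bflip n a b i \<in> {1..n}"
    using ab bflip_inside[of a i b n] bflip_outside[of i n a b] by (cases "a \<le> i \<and> i \<le> b") auto
qed (auto simp: bflip_def)

lemma bflip_order:
  assumes "1 \<le> a" "a < b" "b \<le> n" "1 \<le> v" "v \<le> n"
  shows "bflip n a b a < bflip n a b b"
    "v < a \<longleftrightarrow> bflip n a b b < bflip n a b v" "b < v \<longleftrightarrow> bflip n a b v < bflip n a b a"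
    "a \<le> v \<Longrightarrow> v \<le> b \<Longrightarrow> a \<le> w \<Longrightarrow> w \<le> b \<Longrightarrow> bflip n a b v < bflip n a b w \<longleftrightarrow> v < w"
proof -
  have i: "bflip n a b x = x + (n + 1) - a - b" if "a \<le> x" "x \<le> b" for x
    using that assms by (simp add: bflip_def)
  have o: "bflip n a b x = n + 1 - x" if "1 \<le> x" "x \<le> n" "x < a \<or> b < x" for x
    using that assms by (auto simp: bflip_def)
  show "bflip n a b a < bflip n a b b" using i[of a] i[of b] assms by simp
  consider "v < a" | "a \<le> v" "v \<le> b" | "b < v" by linarith
  note c = this
  show "v < a \<longleftrightarrow> bflip n a b b < bflip n a b v"
    by (cases rule: c) (use i[of b] i[of v] o[of v] assms in auto)
  show "b < v \<longleftrightarrow> bflip n a b v < bflip n a b a"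
    by (cases rule: c) (use i[of a] i[of v] o[of v] assms in auto)
  show "bflip n a b v < bflip n a b w \<longleftrightarrow> v < w" if "a \<le> v" "v \<le> b" "a \<le> w" "w \<le> b"
    using i[of v] i[of w] that assms by auto
qed

text \<open>Within the value interval of the pair the order is kept and everything else changes
  sides, which exchanges the corner conditions. The last claim shows that no earlier starting
  position appears in the image, so the leftmost occurrence can be recovered from it.\<close>

lemma blk_bflip:
  assumes \<sigma>: "\<sigma> \<in> perms n" and b: "blk \<beta> n \<sigma> i j"
  defines "\<tau> \<equiv> bflip n (\<sigma> i) (\<sigma> j) \<circ> \<sigma>"
  shows "\<tau> \<in> perms n" "blk (\<not> \<beta>) n \<tau> i j" "bflip n (\<tau> i) (\<tau> j) \<circ> \<tau> = \<sigma>"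
    "k < i \<Longrightarrow> blk (\<not> \<beta>) n \<tau> k l \<Longrightarrow> \<exists>m. blk \<beta> n \<sigma> k m"
proof -
  note d = blkD[OF b]
  have ab: "1 \<le> \<sigma> i" "\<sigma> i < \<sigma> j" "\<sigma> j \<le> n" using perms_ge1[OF \<sigma>, of i] perms_len[OF \<sigma>, of j] d(1-4) by auto
  have r: "1 \<le> \<sigma> l" "\<sigma> l \<le> n" if "1 \<le> l" "l \<le> n" for l using perms_ge1[OF \<sigma> that] perms_len[OF \<sigma> that] .
  note o = bflip_order[OF ab]
  show t: "\<tau> \<in> perms n" unfolding \<tau>_def by (intro perms_comp[OF bflip_perms \<sigma>]) (use ab in auto)
  show bt: "blk (\<not> \<beta>) n \<tau> i j"
    unfolding blk_def
  proof (intro conjI allI impI)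
    show "\<tau> i < \<tau> j" using o(1)[of 1] ab by (simp add: \<tau>_def)
    show "\<tau> i < \<tau> l" if "1 \<le> l" "l < i" for l
      using o(4)[of "\<sigma> i" "\<sigma> l"] d(5,6)[OF that] ab by (simp add: \<tau>_def)
    show "\<tau> l < \<tau> j" if l: "1 \<le> l" "l < i" for l
      using o(4)[of "\<sigma> l" "\<sigma> j"] d(5,6)[OF l] ab by (simp add: \<tau>_def)
    show "\<tau> l < \<tau> i \<or> \<tau> j < \<tau> l" if l: "i < l" "l < j" for l
      using o(2,3)[of "\<sigma> l"] d(7)[OF l] r[of l] l d(1-4) by (auto simp: \<tau>_def)
    show "if \<not> \<beta> then \<tau> l < \<tau> i else \<tau> j < \<tau> l" if l: "j < l" "l \<le> n" for l
      using o(2,3)[of "\<sigma> l"] d(8)[OF l] r[of l] l d(1-4) by (auto simp: \<tau>_def split: if_splits)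
  qed (use d(1-4) in auto)
  show "bflip n (\<tau> i) (\<tau> j) \<circ> \<tau> = \<sigma>"
    using bflip_bflip[OF ab(1) less_imp_le[OF ab(2)] ab(3)] by (auto simp: \<tau>_def fun_eq_iff)
  assume k: "k < i" and c: "blk (\<not> \<beta>) n \<tau> k l"
  have l: "l = j" by (rule blk_nested[OF t bt c k])
  note e = blkD[OF c[unfolded l]]
  have kb: "\<sigma> i < \<sigma> k" "\<sigma> k < \<sigma> j" using d(5,6)[OF e(1) k] .
  have ord: "\<tau> x < \<tau> y \<longleftrightarrow> \<sigma> x < \<sigma> y" if "\<sigma> i \<le> \<sigma> x" "\<sigma> x \<le> \<sigma> j" "\<sigma> i \<le> \<sigma> y" "\<sigma> y \<le> \<sigma> j" for x y
    using o(4)[of "\<sigma> x" "\<sigma> y"] that ab by (simp add: \<tau>_def)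
  have "blk \<beta> n \<sigma> k j"
    unfolding blk_def
  proof (intro conjI allI impI)
    show "\<sigma> k < \<sigma> x" if x: "1 \<le> x" "x < k" for x
      using e(5)[OF x] ord[of k x] kb d(5,6)[of x] x k by simp
    show "\<sigma> x < \<sigma> j" if x: "1 \<le> x" "x < k" for x using d(6)[of x] x k by simp
    show "\<sigma> x < \<sigma> k \<or> \<sigma> j < \<sigma> x" if x: "k < x" "x < j" for x
    proof -
      consider "x < i" | "x = i" | "i < x" by linarith
      then show ?thesis
      proof cases
        case 1
        then have "\<sigma> i < \<sigma> x" "\<sigma> x < \<sigma> j" using d(5,6)[of x] x by auto
        then show ?thesis using e(7)[OF x] ord[of x k] ord[of j x] kb ab by auto
      next
        case 3
        then show ?thesis using d(7)[of x] x kb by auto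
      qed (use kb in auto)
    qed
    show "if \<beta> then \<sigma> x < \<sigma> k else \<sigma> j < \<sigma> x" if x: "j < x" "x \<le> n" for x
      using d(8)[OF x] kb by (auto split: if_splits)
  qed (use e(1-4) d(1-4) kb in auto)
  then show "\<exists>m. blk \<beta> n \<sigma> k m" by blast
qed

definition bfst :: "bool \<Rightarrow> nat \<Rightarrow> (nat \<Rightarrow> nat) \<Rightarrow> nat" where
  "bfst \<beta> n \<sigma> = (LEAST i. \<exists>j. blk \<beta> n \<sigma> i j)"

definition bsnd :: "bool \<Rightarrow> nat \<Rightarrow> (nat \<Rightarrow> nat) \<Rightarrow> nat" where
  "bsnd \<beta> n \<sigma> = (SOME j. blk \<beta> n \<sigma> (bfst \<beta> n \<sigma>) j)"

lemma bfst_bsnd: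
  assumes "blk \<beta> n \<sigma> i j"
  shows "blk \<beta> n \<sigma> (bfst \<beta> n \<sigma>) (bsnd \<beta> n \<sigma>)" "bfst \<beta> n \<sigma> \<le> i"
proof -
  have "\<exists>j. blk \<beta> n \<sigma> (bfst \<beta> n \<sigma>) j"
    unfolding bfst_def by (rule LeastI[where P = "\<lambda>i. \<exists>j. blk \<beta> n \<sigma> i j"]) (use assms in blast)
  then show "blk \<beta> n \<sigma> (bfst \<beta> n \<sigma>) (bsnd \<beta> n \<sigma>)" unfolding bsnd_def by (rule someI_ex)
  show "bfst \<beta> n \<sigma> \<le> i" unfolding bfst_def by (rule Least_le) (use assms in blast)
qed

definition bmap :: "bool \<Rightarrow> nat \<Rightarrow> (nat \<Rightarrow> nat) \<Rightarrow> (nat \<Rightarrow> nat)" where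
  "bmap \<beta> n \<sigma> = bflip n (\<sigma> (bfst \<beta> n \<sigma>)) (\<sigma> (bsnd \<beta> n \<sigma>)) \<circ> \<sigma>"

lemma bmap:
  assumes \<sigma>: "\<sigma> \<in> perms n" and b: "\<exists>i j. blk \<beta> n \<sigma> i j"
  shows "bmap \<beta> n \<sigma> \<in> perms n" "\<exists>i j. blk (\<not> \<beta>) n (bmap \<beta> n \<sigma>) i j" "bmap (\<not> \<beta>) n (bmap \<beta> n \<sigma>) = \<sigma>"
proof -
  let ?\<tau> = "bmap \<beta> n \<sigma>" and ?i = "bfst \<beta> n \<sigma>" and ?j = "bsnd \<beta> n \<sigma>"
  obtain i j where "blk \<beta> n \<sigma> i j" using b by blast
  then have m: "blk \<beta> n \<sigma> ?i ?j" by (rule bfst_bsnd)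
  note f = blk_bflip[OF \<sigma> m, folded bmap_def]
  show t: "?\<tau> \<in> perms n" by (rule f(1))
  show "\<exists>i j. blk (\<not> \<beta>) n ?\<tau> i j" using f(2) by blast
  note g = bfst_bsnd[OF f(2)]
  have "bfst (\<not> \<beta>) n ?\<tau> = ?i"
  proof (rule ccontr)
    assume "bfst (\<not> \<beta>) n ?\<tau> \<noteq> ?i"
    then have lt: "bfst (\<not> \<beta>) n ?\<tau> < ?i" using g(2) by simp
    obtain q where "blk \<beta> n \<sigma> (bfst (\<not> \<beta>) n ?\<tau>) q" using f(4)[OF lt g(1)] by blast
    then show False using bfst_bsnd(2) lt by (meson not_le)
  qed
  moreover from this have "bsnd (\<not> \<beta>) n ?\<tau> = ?j" using blk_second_unique[OF t f(2)] g(1) by simp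
  ultimately show "bmap (\<not> \<beta>) n ?\<tau> = \<sigma>" using f(3) by (simp add: bmap_def[of "\<not> \<beta>"])
qed

lemma weq_I: "weq {(0,0),(0,2),(1,1),(2,1),(2,2)} {(0,0),(0,2),(1,1),(2,1),(2,0)}" (is "weq ?R ?R'")
proof (rule weqI_contain)
  fix n
  have *: "card {\<sigma> \<in> perms n. \<exists>i j. blk \<beta> n \<sigma> i j} \<le> card {\<sigma> \<in> perms n. \<exists>i j. blk (\<not> \<beta>) n \<sigma> i j}" for \<beta>
  proof (rule card_inj_on_le)
    show "inj_on (bmap \<beta> n) {\<sigma> \<in> perms n. \<exists>i j. blk \<beta> n \<sigma> i j}"
      by (rule inj_on_inverseI[where g = "bmap (\<not> \<beta>) n"]) (use bmap(3) in blast)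
    show "bmap \<beta> n ` {\<sigma> \<in> perms n. \<exists>i j. blk \<beta> n \<sigma> i j} \<subseteq> {\<sigma> \<in> perms n. \<exists>i j. blk (\<not> \<beta>) n \<sigma> i j}"
      using bmap(1,2) by blast
  qed simp
  \<comment> \<open>The map for one corner is undone by the map for the other, so the two injections
    give both inequalities.\<close>
  have "card {\<sigma> \<in> perms n. \<exists>i j. blk True n \<sigma> i j} = card {\<sigma> \<in> perms n. \<exists>i j. blk False n \<sigma> i j}"
    using *[of True] *[of False] by simp
  moreover have "(\<exists>i j. occ ?R n \<sigma> i j) \<longleftrightarrow> (\<exists>i j. blk True n \<sigma> i j)"
    "(\<exists>i j. occ ?R' n \<sigma> i j) \<longleftrightarrow> (\<exists>i j. blk False n \<sigma> i j)" if "\<sigma> \<in> perms n" for \<sigma>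
    using occ_blk[OF that, of True] occ_blk[OF that, of False] by simp_all
  then have "{\<sigma> \<in> perms n. \<exists>i j. occ ?R n \<sigma> i j} = {\<sigma> \<in> perms n. \<exists>i j. blk True n \<sigma> i j}"
    "{\<sigma> \<in> perms n. \<exists>i j. occ ?R' n \<sigma> i j} = {\<sigma> \<in> perms n. \<exists>i j. blk False n \<sigma> i j}"
    by blast+
  ultimately show "card {\<sigma> \<in> perms n. \<exists>i j. occ ?R n \<sigma> i j} = card {\<sigma> \<in> perms n. \<exists>i j. occ ?R' n \<sigma> i j}" by simp
qed

section \<open>Patterns avoided only by decreasing permutations\<close>

text \<open>Every occurrence is an ascending pair, and by assumption the existence of such a pair
  yields an occurrence of the most restrictive shading \<open>R\<close>. Everything in between is
  contained in the same permutations.\<close>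

lemma weq_empty_sandwich:
  assumes "\<And>n \<sigma> i j. \<sigma> \<in> perms n \<Longrightarrow> 1 \<le> i \<Longrightarrow> i < j \<Longrightarrow> j \<le> n \<Longrightarrow> \<sigma> i < \<sigma> j \<Longrightarrow> \<exists>i j. occ R n \<sigma> i j"
    and "R' \<subseteq> R"
  shows "weq {} R'"
proof (rule avI_coincide)
  fix n \<sigma> assume \<sigma>: "\<sigma> \<in> perms n"
  have "occ R n \<sigma> i j \<Longrightarrow> occ R' n \<sigma> i j" "occ R' n \<sigma> i j \<Longrightarrow> occ {} n \<sigma> i j" for i j
    using assms(2) unfolding occ_def by blast+
  then show "(\<exists>i j. occ {} n \<sigma> i j) \<longleftrightarrow> (\<exists>i j. occ R' n \<sigma> i j)"
    using assms(1)[OF \<sigma>] occ_len[OF \<sigma>] by meson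
qed

text \<open>Take the first position \<open>q\<close> with a smaller entry before it, and the
  leftmost such entry \<open>p\<close>. The entries before \<open>q\<close> decrease, so those
  between the points lie below \<open>\<sigma> p\<close>, and those before \<open>p\<close> lie
  above \<open>\<sigma> q\<close>.\<close>

lemma ascent_first:
  assumes \<sigma>: "\<sigma> \<in> perms n" and ij: "1 \<le> i" "i < j" "j \<le> n" "\<sigma> i < \<sigma> j"
  shows "\<exists>i j. occ {(1,2),(0,1),(1,1),(0,0)} n \<sigma> i j"
proof -
  let ?P = "\<lambda>q. q \<le> n \<and> (\<exists>p. 1 \<le> p \<and> p < q \<and> \<sigma> p < \<sigma> q)"
  define q where "q = (LEAST q. ?P q)"
  have q: "?P q" unfolding q_def by (rule LeastI[of ?P j]) (use ij in blast)
  have min: "\<not> ?P x" if "x < q" for x using not_less_Least[of x ?P] that unfolding q_def by blast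
  obtain p0 where p0: "1 \<le> p0" "p0 < q" "\<sigma> p0 < \<sigma> q" using q by blast
  have dec: "\<sigma> y < \<sigma> x" if "1 \<le> x" "x < y" "y < q" for x y
  proof -
    have "\<not> \<sigma> x < \<sigma> y" using min[of y] that q by auto
    then show ?thesis using perms_inj[OF \<sigma>, of x y] that by simp
  qed
  obtain p where p: "1 \<le> p" "p < q" "\<sigma> p < \<sigma> q" and m: "\<And>x. 1 \<le> x \<and> x < q \<and> \<sigma> x < \<sigma> q \<Longrightarrow> p \<le> x"
    using ex_has_least_nat[of "\<lambda>x. 1 \<le> x \<and> x < q \<and> \<sigma> x < \<sigma> q" p0 "\<lambda>x. x"] p0 by blast
  have "occ {(1,2),(0,1),(1,1),(0,0)} n \<sigma> p q"
  proof (rule occI[OF \<sigma>])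
    fix x assume x: "1 \<le> x" "x < p"
    then have "\<not> \<sigma> x < \<sigma> q" using m[of x] p by auto
    then show "clear {(1,2),(0,1),(1,1),(0,0)} 0 (\<sigma> p) (\<sigma> q) (\<sigma> x)" using p by (auto simp: clear_def)
  next
    fix x assume x: "p < x" "x < q"
    show "clear {(1,2),(0,1),(1,1),(0,0)} 1 (\<sigma> p) (\<sigma> q) (\<sigma> x)" using dec[OF p(1) x] p by (auto simp: clear_def)
  qed (use p q in \<open>auto simp: clear_def\<close>)
  then show ?thesis by blast
qed

text \<open>Take the last position \<open>q\<close> with a smaller entry before it, and the minimum
  \<open>p\<close> of the entries before \<open>q\<close>. Nothing before \<open>q\<close> is below
  \<open>\<sigma> p\<close>, and nothing after \<open>q\<close> can be above it.\<close>

lemma ascent_last: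
  assumes \<sigma>: "\<sigma> \<in> perms n" and ij: "1 \<le> i" "i < j" "j \<le> n" "\<sigma> i < \<sigma> j"
  shows "\<exists>i j. occ {(2,1),(2,2),(1,0),(0,0)} n \<sigma> i j"
proof -
  let ?P = "\<lambda>q. q \<le> n \<and> (\<exists>p. 1 \<le> p \<and> p < q \<and> \<sigma> p < \<sigma> q)"
  obtain q where q: "?P q" and max: "\<And>x. ?P x \<Longrightarrow> x \<le> q"
    using ex_has_greatest_nat[of ?P j "\<lambda>x. x" "Suc n"] ij by (metis le_imp_less_Suc)
  obtain p0 where p0: "1 \<le> p0" "p0 < q" "\<sigma> p0 < \<sigma> q" using q by blast
  obtain p where p: "1 \<le> p" "p < q" and m: "\<And>x. 1 \<le> x \<and> x < q \<Longrightarrow> \<sigma> p \<le> \<sigma> x"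
    using ex_has_least_nat[of "\<lambda>x. 1 \<le> x \<and> x < q" p0 \<sigma>] p0 by metis
  have pq: "\<sigma> p < \<sigma> q" using m[of p0] p0 by simp
  have "occ {(2,1),(2,2),(1,0),(0,0)} n \<sigma> p q"
  proof (rule occI[OF \<sigma>])
    fix x assume x: "1 \<le> x" "x < p"
    then show "clear {(2,1),(2,2),(1,0),(0,0)} 0 (\<sigma> p) (\<sigma> q) (\<sigma> x)" using m[of x] p by (auto simp: clear_def)
  next
    fix x assume x: "p < x" "x < q"
    then show "clear {(2,1),(2,2),(1,0),(0,0)} 1 (\<sigma> p) (\<sigma> q) (\<sigma> x)" using m[of x] p by (auto simp: clear_def)
  next
    fix x assume x: "q < x" "x \<le> n"
    then have "\<not> \<sigma> p < \<sigma> x" using max[of x] p by (meson less_trans not_le)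
    then show "clear {(2,1),(2,2),(1,0),(0,0)} 2 (\<sigma> p) (\<sigma> q) (\<sigma> x)" using pq by (auto simp: clear_def)
  qed (use p pq q in auto)
  then show ?thesis by blast
qed

lemma weq_empty_first: "weq {} {(1,2),(0,1),(1,1),(0,0)}"
  by (rule weq_empty_sandwich[OF ascent_first subset_refl])

lemma weq_empty_first_subset: "weq {} {(1,2),(0,1),(1,1)}"
  by (rule weq_empty_sandwich[OF ascent_first]) auto

lemma weq_empty_last: "weq {} {(2,1),(2,2),(1,0),(0,0)}"
  by (rule weq_empty_sandwich[OF ascent_last subset_refl])

section \<open>Shading and toric moves\<close>

text \<open>The first point of an occurrence is replaced by an extreme point of the non-empty cell \<open>c\<close> until \<open>c\<close> is empty.\<close>

lemma shadeI:
  fixes f :: "nat \<Rightarrow> nat \<Rightarrow> nat"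
  assumes "\<And>n \<sigma> i j k. \<sigma> \<in> perms n \<Longrightarrow> occ R n \<sigma> i j \<Longrightarrow> 1 \<le> k \<Longrightarrow> k \<le> n \<Longrightarrow> k \<noteq> i \<Longrightarrow> k \<noteq> j \<Longrightarrow>
      (strip i j k, strip (\<sigma> i) (\<sigma> j) (\<sigma> k)) = c \<Longrightarrow> \<exists>l. occ R n \<sigma> l j \<and> f l j < f i j"
  shows "weq R (insert c R)"
proof (rule avI_coincide)
  fix n \<sigma> assume \<sigma>: "\<sigma> \<in> perms n"
  have *: "occ R n \<sigma> i j \<Longrightarrow> \<exists>l. occ (insert c R) n \<sigma> l j" for i j
  proof (induction "f i j" arbitrary: i rule: less_induct)
    case less
    show ?case
    proof (cases "\<exists>k. 1 \<le> k \<and> k \<le> n \<and> k \<noteq> i \<and> k \<noteq> j \<and> (strip i j k, strip (\<sigma> i) (\<sigma> j) (\<sigma> k)) = c")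
      case True
      then show ?thesis using assms[OF \<sigma> less.prems] less.hyps by blast
    next
      case False
      then have "occ (insert c R) n \<sigma> i j" using less.prems unfolding occ_def by auto
      then show ?thesis by blast
    qed
  qed
  have "occ (insert c R) n \<sigma> i j \<Longrightarrow> occ R n \<sigma> i j" for i j unfolding occ_def by blast
  with * show "(\<exists>i j. occ R n \<sigma> i j) \<longleftrightarrow> (\<exists>i j. occ (insert c R) n \<sigma> i j)" by blast
qed

lemma strip_eqs: "strip a b x = 0 \<longleftrightarrow> x < a" "strip a b x = 1 \<longleftrightarrow> \<not> x < a \<and> x < b" "strip a b x = 2 \<longleftrightarrow> \<not> x < a \<and> \<not> x < b"
  by (auto simp: strip_def)

lemma ex_least_such:
  fixes g :: "nat \<Rightarrow> nat"
  assumes "P k"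
  obtains l where "P l" "\<And>m. P m \<Longrightarrow> g l \<le> g m"
  using ex_has_least_nat[of P k g] assms by blast

lemma ex_greatest_such:
  fixes n :: nat
  assumes "P k" "\<And>m. P m \<Longrightarrow> m \<le> n"
  obtains l where "P l" "\<And>m. P m \<Longrightarrow> m \<le> l"
  using ex_has_greatest_nat[of P k "\<lambda>x. x" "Suc n"] assms le_imp_less_Suc by auto

text \<open>The first point moves to the lowest point of cell (0,0). Points of column 0 to its right
  then belong to column 1, and points of row 0 above it to row 1; the implications keep such points
  out of shaded cells.\<close>

lemma shade_00:
  assumes R: "(0,0) \<notin> R" "(0,1) \<notin> R" "(1,1) \<notin> R" "(2,1) \<in> R \<Longrightarrow> (2,0) \<in> R" "(1,2) \<in> R \<Longrightarrow> (0,2) \<in> R"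
  shows "weq R (insert (0,0) R)"
proof (rule shadeI[where f = "\<lambda>i j. i"])
  fix n \<sigma> i j k assume \<sigma>: "\<sigma> \<in> perms n" and o: "occ R n \<sigma> i j" and k: "1 \<le> k" "(strip i j k, strip (\<sigma> i) (\<sigma> j) (\<sigma> k)) = (0,0)"
  note d = occ_len[OF \<sigma> o] and c = occ_clear[OF \<sigma> o]
  have "1 \<le> k \<and> k < i \<and> \<sigma> k < \<sigma> i" using k by (simp add: strip_eqs)
  then obtain l where l: "1 \<le> l" "l < i" "\<sigma> l < \<sigma> i" and m: "\<And>x. 1 \<le> x \<and> x < i \<and> \<sigma> x < \<sigma> i \<Longrightarrow> \<sigma> l \<le> \<sigma> x"
    using ex_least_such[of "\<lambda>x. 1 \<le> x \<and> x < i \<and> \<sigma> x < \<sigma> i" k \<sigma>] by metis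
  have "occ R n \<sigma> l j"
  proof (rule occI[OF \<sigma>])
    fix x assume x: "1 \<le> x" "x < l"
    show "clear R 0 (\<sigma> l) (\<sigma> j) (\<sigma> x)"
      using c(1)[of x] R x l d m[of x] by (simp add: clear_def)
  next
    fix x assume x: "l < x" "x < j"
    consider "x < i" | "x = i" | "i < x" by linarith
    then show "clear R 1 (\<sigma> l) (\<sigma> j) (\<sigma> x)"
    proof cases
      case 1
      then show ?thesis using c(1)[of x] R x l d m[of x] by (auto simp: clear_def)
    next
      case 3
      then show ?thesis using c(2)[of x] R x l d by (auto simp: clear_def)
    qed (use R l d in \<open>auto simp: clear_def\<close>)
  next
    fix x assume x: "j < x" "x \<le> n"
    show "clear R 2 (\<sigma> l) (\<sigma> j) (\<sigma> x)"
      using c(3)[of x] R(4) x l d perms_inj[OF \<sigma>, of x i] by (auto simp: clear_def)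
  qed (use l d in auto)
  then show "\<exists>l. occ R n \<sigma> l j \<and> l < i" using l by blast
qed

text \<open>The first point moves to the lowest point of cell (0,1). Points of column 0 to its right
  change to column 1 and points of row 1 below it to row 0, whence the implications for (1,2) and
  (2,0).\<close>

lemma shade_01_lowest:
  assumes R: "(0,1) \<notin> R" "(1,0) \<notin> R" "(1,1) \<notin> R" "(1,2) \<in> R \<Longrightarrow> (0,2) \<in> R" "(2,0) \<in> R \<Longrightarrow> (2,1) \<in> R"
  shows "weq R (insert (0,1) R)"
proof (rule shadeI[where f = "\<lambda>i j. i"])
  fix n \<sigma> i j k assume \<sigma>: "\<sigma> \<in> perms n" and o: "occ R n \<sigma> i j" and k: "1 \<le> k" "k \<noteq> i"
    "(strip i j k, strip (\<sigma> i) (\<sigma> j) (\<sigma> k)) = (0,1)"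
  note d = occ_len[OF \<sigma> o] and c = occ_clear[OF \<sigma> o]
  have "1 \<le> k \<and> k < i \<and> \<sigma> i < \<sigma> k \<and> \<sigma> k < \<sigma> j" 
    using k(1,2) strip_eqs(1,2)[THEN iffD1] strip_eqs(2)[THEN iffD1, of "\<sigma> i" "\<sigma> j" "\<sigma> k"] k(3)[unfolded prod.inject] perms_inj[OF \<sigma>, of k i]
    by (metis linorder_neqE_nat)
  then obtain l where l: "1 \<le> l" "l < i" "\<sigma> i < \<sigma> l" "\<sigma> l < \<sigma> j"
    and m: "\<And>x. 1 \<le> x \<and> x < i \<and> \<sigma> i < \<sigma> x \<and> \<sigma> x < \<sigma> j \<Longrightarrow> \<sigma> l \<le> \<sigma> x"
    using ex_least_such[of "\<lambda>x. 1 \<le> x \<and> x < i \<and> \<sigma> i < \<sigma> x \<and> \<sigma> x < \<sigma> j" k \<sigma>] by metis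
  have "occ R n \<sigma> l j"
  proof (rule occI[OF \<sigma>])
    fix x assume x: "1 \<le> x" "x < l"
    show "clear R 0 (\<sigma> l) (\<sigma> j) (\<sigma> x)"
      using c(1)[of x] R x l d m[of x] perms_inj[OF \<sigma>, of x i] by (auto simp: clear_def)
  next
    fix x assume x: "l < x" "x < j"
    consider "x < i" | "x = i" | "i < x" by linarith
    then show "clear R 1 (\<sigma> l) (\<sigma> j) (\<sigma> x)"
    proof cases
      case 1
      then show ?thesis using c(1)[of x] R x l d by (auto simp: clear_def)
    next
      case 3
      then show ?thesis using c(2)[of x] R x l d by (auto simp: clear_def)
    qed (use R l d in \<open>auto simp: clear_def\<close>)
  next
    fix x assume x: "j < x" "x \<le> n"
    show "clear R 2 (\<sigma> l) (\<sigma> j) (\<sigma> x)"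
      using c(3)[of x] R(5) x l d perms_inj[OF \<sigma>, of x i] by (auto simp: clear_def)
  qed (use l d in auto)
  then show "\<exists>l. occ R n \<sigma> l j \<and> l < i" using l by blast
qed

text \<open>With the rightmost point the new middle column gains nothing in row 1, so (1,1) may be
  shaded. In exchange lower points of the old cell may come to lie in (0,0), which has to be
  unshaded.\<close>

lemma shade_01_rightmost:
  assumes R: "(0,1) \<notin> R" "(0,0) \<notin> R" "(1,0) \<notin> R" "(1,2) \<in> R \<Longrightarrow> (0,2) \<in> R" "(2,0) \<in> R \<Longrightarrow> (2,1) \<in> R"
  shows "weq R (insert (0,1) R)"
proof (rule shadeI[where f = "\<lambda>i j. i"])
  fix n \<sigma> i j k assume \<sigma>: "\<sigma> \<in> perms n" and o: "occ R n \<sigma> i j" and k: "1 \<le> k" "k \<noteq> i"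
    "(strip i j k, strip (\<sigma> i) (\<sigma> j) (\<sigma> k)) = (0,1)"
  note d = occ_len[OF \<sigma> o] and c = occ_clear[OF \<sigma> o]
  have "1 \<le> k \<and> k < i \<and> \<sigma> i < \<sigma> k \<and> \<sigma> k < \<sigma> j" 
    using k(1,2) strip_eqs(1,2)[THEN iffD1] strip_eqs(2)[THEN iffD1, of "\<sigma> i" "\<sigma> j" "\<sigma> k"] k(3)[unfolded prod.inject] perms_inj[OF \<sigma>, of k i]
    by (metis linorder_neqE_nat)
  then obtain l where l: "1 \<le> l" "l < i" "\<sigma> i < \<sigma> l" "\<sigma> l < \<sigma> j"
    and m: "\<And>x. 1 \<le> x \<and> x < i \<and> \<sigma> i < \<sigma> x \<and> \<sigma> x < \<sigma> j \<Longrightarrow> x \<le> l"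
    using ex_greatest_such[of "\<lambda>x. 1 \<le> x \<and> x < i \<and> \<sigma> i < \<sigma> x \<and> \<sigma> x < \<sigma> j" k i] by (metis less_imp_le)
  have "occ R n \<sigma> l j"
  proof (rule occI[OF \<sigma>])
    fix x assume x: "1 \<le> x" "x < l"
    show "clear R 0 (\<sigma> l) (\<sigma> j) (\<sigma> x)"
      using c(1)[of x] R x l d perms_inj[OF \<sigma>, of x i] by (auto simp: clear_def)
  next
    fix x assume x: "l < x" "x < j"
    consider "x < i" | "x = i" | "i < x" by linarith
    then show "clear R 1 (\<sigma> l) (\<sigma> j) (\<sigma> x)"
    proof cases
      case 1
      then show ?thesis using c(1)[of x] R x l d m[of x] by (auto simp: clear_def)
    next
      case 3
      then show ?thesis using c(2)[of x] R x l d by (auto simp: clear_def)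
    qed (use R l d in \<open>auto simp: clear_def\<close>)
  next
    fix x assume x: "j < x" "x \<le> n"
    show "clear R 2 (\<sigma> l) (\<sigma> j) (\<sigma> x)"
      using c(3)[of x] R(5) x l d perms_inj[OF \<sigma>, of x i] by (auto simp: clear_def)
  qed (use l d in auto)
  then show "\<exists>l. occ R n \<sigma> l j \<and> l < i" using l by blast
qed

text \<open>Here the first point moves to the right, to the lowest point of cell (1,1), so the
  measure is the distance \<open>j - i\<close>. Points change from column 1 to column 0 and from row
  1 to row 0.\<close>

lemma shade_11:
  assumes R: "(0,0) \<notin> R" "(0,1) \<notin> R" "(1,1) \<notin> R" "(0,2) \<in> R \<Longrightarrow> (1,2) \<in> R" "(2,0) \<in> R \<Longrightarrow> (2,1) \<in> R"
  shows "weq R (insert (1,1) R)"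
proof (rule shadeI[where f = "\<lambda>i j. j - i"])
  fix n \<sigma> i j k assume \<sigma>: "\<sigma> \<in> perms n" and o: "occ R n \<sigma> i j" and k: "1 \<le> k" "k \<noteq> i"
    "(strip i j k, strip (\<sigma> i) (\<sigma> j) (\<sigma> k)) = (1,1)"
  note d = occ_len[OF \<sigma> o] and c = occ_clear[OF \<sigma> o]
  have "i < k \<and> k < j \<and> \<sigma> i < \<sigma> k \<and> \<sigma> k < \<sigma> j" 
    using k(1,2) strip_eqs(1,2)[THEN iffD1] strip_eqs(2)[THEN iffD1, of "\<sigma> i" "\<sigma> j" "\<sigma> k"] k(3)[unfolded prod.inject] perms_inj[OF \<sigma>, of k i]
    by (metis linorder_neqE_nat)
  then obtain l where l: "i < l" "l < j" "\<sigma> i < \<sigma> l" "\<sigma> l < \<sigma> j"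
    and m: "\<And>x. i < x \<and> x < j \<and> \<sigma> i < \<sigma> x \<and> \<sigma> x < \<sigma> j \<Longrightarrow> \<sigma> l \<le> \<sigma> x"
    using ex_least_such[of "\<lambda>x. i < x \<and> x < j \<and> \<sigma> i < \<sigma> x \<and> \<sigma> x < \<sigma> j" k \<sigma>] by metis
  have "occ R n \<sigma> l j"
  proof (rule occI[OF \<sigma>])
    fix x assume x: "1 \<le> x" "x < l"
    consider "x < i" | "x = i" | "i < x" by linarith
    then show "clear R 0 (\<sigma> l) (\<sigma> j) (\<sigma> x)"
    proof cases
      case 1
      then show ?thesis using c(1)[of x] R x l d perms_inj[OF \<sigma>, of x i] by (auto simp: clear_def)
    next
      case 3
      then show ?thesis using c(2)[of x] R x l d m[of x] by (auto simp: clear_def)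
    qed (use R l d in \<open>auto simp: clear_def\<close>)
  next
    fix x assume x: "l < x" "x < j"
    then show "clear R 1 (\<sigma> l) (\<sigma> j) (\<sigma> x)"
      using c(2)[of x] R x l d m[of x] perms_inj[OF \<sigma>, of x i] by (auto simp: clear_def)
  next
    fix x assume x: "j < x" "x \<le> n"
    show "clear R 2 (\<sigma> l) (\<sigma> j) (\<sigma> x)"
      using c(3)[of x] R(5) x l d perms_inj[OF \<sigma>, of x i] by (auto simp: clear_def)
  qed (use l d in auto)
  then show "\<exists>l. occ R n \<sigma> l j \<and> j - l < j - i" using l by (intro exI[of _ l]) auto
qed

lemma col0_full:
  assumes "(0,0) \<in> R" "(0,1) \<in> R" "(0,2) \<in> R" "occ R n \<sigma> i j"
  shows "i = 1"
proof (rule ccontr)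
  assume "i \<noteq> 1"
  then have "(strip i j 1, strip (\<sigma> i) (\<sigma> j) (\<sigma> 1)) \<notin> R" using assms(4) unfolding occ_def by auto
  moreover have "strip i j 1 = 0" using assms(4) \<open>i \<noteq> 1\<close> by (simp add: occ_def strip_def)
  ultimately show False using assms(1-3) by (auto simp: strip_def split: if_splits)
qed

lemma col2_full:
  assumes "(2,0) \<in> R" "(2,1) \<in> R" "(2,2) \<in> R" "occ R n \<sigma> i j"
  shows "j = n"
proof (rule ccontr)
  assume n: "j \<noteq> n"
  then have "(strip i j n, strip (\<sigma> i) (\<sigma> j) (\<sigma> n)) \<notin> R" using assms(4) unfolding occ_def by auto
  moreover have "strip i j n = 2" using assms(4) n by (simp add: occ_def strip_def)
  ultimately show False using assms(1-3) by (auto simp: strip_def split: if_splits)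
qed

section \<open>Reversal of all entries but the first\<close>

definition swap12 :: "nat \<Rightarrow> nat" where "swap12 x = (if x = 0 then 0 else 3 - x)"

definition rev2 :: "nat \<Rightarrow> nat \<Rightarrow> nat" where
  "rev2 n i = (if 2 \<le> i \<and> i \<le> n then n + 2 - i else i)"

lemma rev2_perms: "rev2 n \<in> perms n"
  by (rule permsI) (auto simp: rev2_def split: if_splits)

lemma rev2_rev2: "rev2 n (rev2 n i) = i"
  by (auto simp: rev2_def)

text \<open>The full left column forces \<open>i = 1\<close>. Reversing the positions
  \<open>2..n\<close> exchanges the part between the two points with the part after them and keeps
  the values.\<close>

lemma occ_rev2:
  assumes R: "(0,0) \<in> R" "(0,1) \<in> R" "(0,2) \<in> R" and \<sigma>: "\<sigma> \<in> perms n" and o: "occ R n \<sigma> i j"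
  shows "occ ((\<lambda>(x, y). (swap12 x, y)) -` R) n (\<sigma> \<circ> rev2 n) 1 (n + 2 - j)"
proof -
  have i: "i = 1" by (rule col0_full[OF R o])
  note d = occ_len[OF \<sigma> o] and c = occ_clear[OF \<sigma> o, unfolded i]
  have e: "rev2 n 1 = 1" "rev2 n (n + 2 - j) = j" using d i by (auto simp: rev2_def)
  show ?thesis
  proof (rule occI[OF perms_comp[OF \<sigma> rev2_perms]])
    fix x assume x: "1 < x" "x < n + 2 - j"
    then have "rev2 n x = n + 2 - x" "j < n + 2 - x" "n + 2 - x \<le> n" using d i by (auto simp: rev2_def)
    then show "clear ((\<lambda>(x, y). (swap12 x, y)) -` R) 1 ((\<sigma> \<circ> rev2 n) 1) ((\<sigma> \<circ> rev2 n) (n + 2 - j)) ((\<sigma> \<circ> rev2 n) x)"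
      using c(3)[of "n + 2 - x"] unfolding comp_def e by (simp add: clear_def swap12_def)
  next
    fix x assume x: "n + 2 - j < x" "x \<le> n"
    then have "rev2 n x = n + 2 - x" "1 < n + 2 - x" "n + 2 - x < j" using d i by (auto simp: rev2_def)
    then show "clear ((\<lambda>(x, y). (swap12 x, y)) -` R) 2 ((\<sigma> \<circ> rev2 n) 1) ((\<sigma> \<circ> rev2 n) (n + 2 - j)) ((\<sigma> \<circ> rev2 n) x)"
      using c(2)[of "n + 2 - x"] unfolding comp_def e by (simp add: clear_def swap12_def)
  qed (use d i in \<open>auto simp: e[simplified]\<close>)
qed

lemma weq_swapcols:
  assumes R: "(0,0) \<in> R" "(0,1) \<in> R" "(0,2) \<in> R" "R \<subseteq> {0..2} \<times> {0..2}"
  shows "weq ((\<lambda>(x, y). (swap12 x, y)) -` R) R" (is "weq ?R R")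
proof (rule weqI_inj[where f = "\<lambda>n \<sigma>. \<sigma> \<circ> rev2 n"])
  fix n
  show "(\<lambda>\<sigma>. \<sigma> \<circ> rev2 n) ` perms n \<subseteq> perms n" using perms_comp[OF _ rev2_perms] by blast
  have *: "\<sigma> \<circ> rev2 n \<circ> rev2 n = \<sigma>" for \<sigma> :: "nat \<Rightarrow> nat" by (simp add: fun_eq_iff rev2_rev2)
  show "inj_on (\<lambda>\<sigma>. \<sigma> \<circ> rev2 n) (perms n)" by (rule inj_onI) (metis *)
  fix \<sigma> assume \<sigma>: "\<sigma> \<in> perms n"
  have r: "(0,0) \<in> ?R" "(0,1) \<in> ?R" "(0,2) \<in> ?R" using R by (auto simp: swap12_def)
  have rr: "occ ((\<lambda>(x, y). (swap12 x, y)) -` ?R) n \<tau> i j \<longleftrightarrow> occ R n \<tau> i j" for \<tau> i j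
    unfolding occ_def by (simp add: swap12_def strip_def)
  show "(\<exists>i j. occ ?R n \<sigma> i j) \<longleftrightarrow> (\<exists>i j. occ R n (\<sigma> \<circ> rev2 n) i j)"
    using occ_rev2[OF r \<sigma>] occ_rev2[OF R(1-3) perms_comp[OF \<sigma> rev2_perms], of ] unfolding rr * by metis
qed

text \<open>The points of \<open>\<sigma>\<close> together with \<open>(0, 0)\<close> lie on a torus of side \<open>n + 1\<close>; the shift moves the first point
  into the origin.\<close>

definition shift :: "nat \<Rightarrow> (nat \<Rightarrow> nat) \<Rightarrow> nat \<Rightarrow> nat" where
  "shift n \<sigma> i = (if i < 1 \<or> n < i then i else if i = n then n + 1 - \<sigma> 1
     else if \<sigma> 1 < \<sigma> (i + 1) then \<sigma> (i + 1) - \<sigma> 1 else \<sigma> (i + 1) + (n + 1) - \<sigma> 1)"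

lemma shift_last: "1 \<le> n \<Longrightarrow> shift n \<sigma> n = n + 1 - \<sigma> 1"
  by (simp add: shift_def)

lemma shift_less: "1 \<le> i \<Longrightarrow> i < n \<Longrightarrow> shift n \<sigma> i = (if \<sigma> 1 < \<sigma> (i + 1) then \<sigma> (i + 1) - \<sigma> 1 else \<sigma> (i + 1) + (n + 1) - \<sigma> 1)"
  by (simp add: shift_def)

lemma shift_perms:
  assumes \<sigma>: "\<sigma> \<in> perms n"
  shows "shift n \<sigma> \<in> perms n"
proof (rule permsI)
  have r: "1 \<le> \<sigma> i" "\<sigma> i \<le> n" if "1 \<le> i" "i \<le> n" for i using perms_ge1[OF \<sigma> that] perms_len[OF \<sigma> that] .
  have ne: "\<sigma> (i + 1) \<noteq> \<sigma> 1" if "1 \<le> i" for i using perms_inj[OF \<sigma>, of "i + 1" 1] that by simp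
  fix i assume "i \<in> {1..n}"
  then consider "i = n" "1 \<le> n" | "1 \<le> i" "i < n" by fastforce
  then show "shift n \<sigma> i \<in> {1..n}"
  proof cases
    case 1
    then show ?thesis using shift_last[of n \<sigma>] r[of 1] by auto
  next
    case 2
    then show ?thesis using shift_less[OF 2, of \<sigma>] r[of 1] r[of "i + 1"] ne[of i] by auto
  qed
next
  have r: "1 \<le> \<sigma> i" "\<sigma> i \<le> n" if "1 \<le> i" "i \<le> n" for i using perms_ge1[OF \<sigma> that] perms_len[OF \<sigma> that] .
  have ne: "\<sigma> (i + 1) \<noteq> \<sigma> 1" if "1 \<le> i" for i using perms_inj[OF \<sigma>, of "i + 1" 1] that by simp
  have last: "shift n \<sigma> n \<noteq> shift n \<sigma> i" if i: "1 \<le> i" "i < n" for i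
    using shift_last[of n \<sigma>] shift_less[OF i, of \<sigma>] r[of 1] r[of "i + 1"] ne[of i] i by (auto split: if_splits)
  fix i j assume ij: "i \<in> {1..n}" "j \<in> {1..n}" and e: "shift n \<sigma> i = shift n \<sigma> j"
  consider "i = j" | "i = n" "j < n" | "j = n" "i < n" | "i < n" "j < n" using ij by fastforce
  then show "i = j"
  proof cases
    case 4
    then have "\<sigma> (i + 1) = \<sigma> (j + 1)"
      using e shift_less[of i n \<sigma>] shift_less[of j n \<sigma>] ij r[of 1] r[of "i + 1"] r[of "j + 1"] by (auto split: if_splits)
    then show ?thesis using perms_inj[OF \<sigma>, of "i + 1" "j + 1"] by simp
  qed (use last[of j] last[of i] e ij in auto)
qed (auto simp: shift_def)

lemma shift_inj:
  assumes \<sigma>: "\<sigma> \<in> perms n" and \<tau>: "\<tau> \<in> perms n" and e: "shift n \<sigma> = shift n \<tau>"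
  shows "\<sigma> = \<tau>"
proof
  fix i
  have r: "1 \<le> \<sigma> i" "\<sigma> i \<le> n" "1 \<le> \<tau> i" "\<tau> i \<le> n" if "1 \<le> i" "i \<le> n" for i
    using perms_ge1[OF \<sigma> that] perms_len[OF \<sigma> that] perms_ge1[OF \<tau> that] perms_len[OF \<tau> that] .
  have 1: "\<sigma> 1 = \<tau> 1" if "1 \<le> n"
    using fun_cong[OF e, of n] shift_last[OF that, of \<sigma>] shift_last[OF that, of \<tau>] r[of 1] that by simp
  consider "i \<notin> {1..n}" | "i = 1" "1 \<le> n" | k where "1 \<le> k" "k < n" "i = k + 1"
    by (cases i) (auto, metis One_nat_def Suc_le_eq Suc_leI neq0_conv)
  then show "\<sigma> i = \<tau> i"
  proof cases
    case 1
    then show ?thesis using perms_out[OF \<sigma>] perms_out[OF \<tau>] by simp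
  next
    case 2
    then show ?thesis using 1 by simp
  next
    case 3
    then show ?thesis
      using fun_cong[OF e, of k] shift_less[OF 3(1,2), of \<sigma>] shift_less[OF 3(1,2), of \<tau>] 1 r[of 1] r[of i]
      by (auto split: if_splits)
  qed
qed

text \<open>The shift makes the first point the origin and the old origin the last point, so the
  pair \<open>1\<close>, \<open>j + 1\<close> becomes \<open>j\<close>, \<open>n\<close>. Columns
  and rows are permuted cyclically, which is the correspondence between \<open>R\<close> and
  \<open>R'\<close>.\<close>

lemma occ_shift:
  assumes \<sigma>: "\<sigma> \<in> perms n" and j: "1 \<le> j" "j < n"
    and R': "\<And>x x'. (x, x') \<in> {(0,1),(1,2),(2,0)} \<Longrightarrow>
      ((x,0) \<in> R' \<longleftrightarrow> (x',1) \<in> R) \<and> ((x,1) \<in> R' \<longleftrightarrow> (x',2) \<in> R) \<and> ((x,2) \<in> R' \<longleftrightarrow> (x',0) \<in> R)"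
  shows "occ R n \<sigma> 1 (j + 1) \<longleftrightarrow> occ R' n (shift n \<sigma>) j n"
proof -
  have r: "1 \<le> \<sigma> i" "\<sigma> i \<le> n" if "1 \<le> i" "i \<le> n" for i using perms_ge1[OF \<sigma> that] perms_len[OF \<sigma> that] .
  have ne: "\<sigma> (i + 1) \<noteq> \<sigma> 1" if "1 \<le> i" for i using perms_inj[OF \<sigma>, of "i + 1" 1] that by simp
  have n: "shift n \<sigma> n = n + 1 - \<sigma> 1" using shift_last[of n] j by simp
  have up: "\<sigma> 1 < \<sigma> (j + 1) \<longleftrightarrow> shift n \<sigma> j < shift n \<sigma> n"
    using n shift_less[OF j, of \<sigma>] r[of 1] r[of "j + 1"] ne[of j] j by auto
  have cl: "clear R x' (\<sigma> 1) (\<sigma> (j + 1)) (\<sigma> (l + 1)) \<longleftrightarrow> clear R' x (shift n \<sigma> j) (shift n \<sigma> n) (shift n \<sigma> l)"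
    if l: "1 \<le> l" "l < n" and x: "(x, x') \<in> {(0,1),(1,2),(2,0)}" and u: "\<sigma> 1 < \<sigma> (j + 1)" for l x x'
  proof -
    \<comment> \<open>In the new order the values above \<open>\<sigma> 1\<close> come first, then
      the old origin, then the values below \<open>\<sigma> 1\<close>.\<close>
    have o: "shift n \<sigma> l < shift n \<sigma> j \<longleftrightarrow> \<sigma> 1 < \<sigma> (l + 1) \<and> \<sigma> (l + 1) < \<sigma> (j + 1)"
      "shift n \<sigma> j < shift n \<sigma> l \<and> shift n \<sigma> l < shift n \<sigma> n \<longleftrightarrow> \<sigma> (j + 1) < \<sigma> (l + 1)"
      "shift n \<sigma> n < shift n \<sigma> l \<longleftrightarrow> \<sigma> (l + 1) < \<sigma> 1"
      using n shift_less[OF j, of \<sigma>] shift_less[OF l, of \<sigma>] r[of 1] r[of "j + 1"] r[of "l + 1"] ne[of l] j l u by auto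
    show ?thesis using R'[OF x] o unfolding clear_def by blast
  qed
  have c1: "(\<forall>l. 1 < l \<longrightarrow> l < j + 1 \<longrightarrow> P l) \<longleftrightarrow> (\<forall>l. 1 \<le> l \<longrightarrow> l < j \<longrightarrow> P (l + 1))" (is "?A \<longleftrightarrow> ?B") for P
  proof (intro iffI allI impI)
    fix l assume "?B" "1 < l" "l < j + 1"
    then show "P l" using spec[of "\<lambda>l. 1 \<le> l \<longrightarrow> l < j \<longrightarrow> P (l + 1)" "l - 1"] by simp
  qed simp
  have c2: "(\<forall>l. j + 1 < l \<longrightarrow> l \<le> n \<longrightarrow> P l) \<longleftrightarrow> (\<forall>l. j < l \<longrightarrow> l < n \<longrightarrow> P (l + 1))" (is "?A \<longleftrightarrow> ?B") for P
  proof (intro iffI allI impI)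
    fix l assume "?B" "j + 1 < l" "l \<le> n"
    then show "P l" using spec[of "\<lambda>l. j < l \<longrightarrow> l < n \<longrightarrow> P (l + 1)" "l - 1"] by simp
  qed simp
  have "occ R n \<sigma> 1 (j + 1) \<longleftrightarrow> \<sigma> 1 < \<sigma> (j + 1) \<and>
     (\<forall>l. 1 \<le> l \<longrightarrow> l < j \<longrightarrow> clear R 1 (\<sigma> 1) (\<sigma> (j + 1)) (\<sigma> (l + 1))) \<and>
     (\<forall>l. j < l \<longrightarrow> l < n \<longrightarrow> clear R 2 (\<sigma> 1) (\<sigma> (j + 1)) (\<sigma> (l + 1)))"
    unfolding occ_cols[OF \<sigma>] c1 c2 using j by auto
  also have "\<dots> \<longleftrightarrow> occ R' n (shift n \<sigma>) j n"
    unfolding occ_cols[OF shift_perms[OF \<sigma>]] using j up cl[of _ 0 1] cl[of _ 1 2] by auto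
  finally show ?thesis .
qed

text \<open>The full left column of \<open>R\<close> pins the first point of each occurrence to
  position 1, and the full right column of \<open>R'\<close> pins the second one to
  \<open>n\<close>; so \<open>occ_shift\<close> covers all occurrences.\<close>

lemma weq_toric:
  assumes R: "(0,0) \<in> R" "(0,1) \<in> R" "(0,2) \<in> R"
    and R': "\<And>x x'. (x, x') \<in> {(0,1),(1,2),(2,0)} \<Longrightarrow>
      ((x,0) \<in> R' \<longleftrightarrow> (x',1) \<in> R) \<and> ((x,1) \<in> R' \<longleftrightarrow> (x',2) \<in> R) \<and> ((x,2) \<in> R' \<longleftrightarrow> (x',0) \<in> R)"
  shows "weq R R'"
proof (rule weqI_inj[where f = shift])
  fix n
  show "shift n ` perms n \<subseteq> perms n" using shift_perms by blast
  show "inj_on (shift n) (perms n)" by (rule inj_onI) (rule shift_inj)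
  fix \<sigma> assume \<sigma>: "\<sigma> \<in> perms n"
  have r: "(2,0) \<in> R'" "(2,1) \<in> R'" "(2,2) \<in> R'" using R R'[of 2 0] by simp_all
  show "(\<exists>i j. occ R n \<sigma> i j) \<longleftrightarrow> (\<exists>i j. occ R' n (shift n \<sigma>) i j)"
  proof
    assume "\<exists>i j. occ R n \<sigma> i j"
    then obtain i j where o: "occ R n \<sigma> i j" by blast
    have "i = 1" by (rule col0_full[OF R o])
    with o have "occ R n \<sigma> 1 (j - 1 + 1)" "1 \<le> j - 1" "j - 1 < n" using occ_len[OF \<sigma> o] by simp_all
    then show "\<exists>i j. occ R' n (shift n \<sigma>) i j" using occ_shift[OF \<sigma> _ _ R', of "j - 1"] by blast
  next
    assume "\<exists>i j. occ R' n (shift n \<sigma>) i j"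
    then obtain i j where o: "occ R' n (shift n \<sigma>) i j" by blast
    have "j = n" by (rule col2_full[OF r o])
    with o show "\<exists>i j. occ R n \<sigma> i j" using occ_shift[OF \<sigma> _ _ R', of i] occ_len[OF shift_perms[OF \<sigma>] o] by blast
  qed
qed

section \<open>Mesh patterns and Wilf classes\<close>

definition flip :: "nat \<times> nat \<Rightarrow> nat \<times> nat" where "flip = (\<lambda>(x, y). (x, 2 - y))"

lemma strip_grid:
  assumes "a < b" "1 \<le> l" "l \<le> n" "x \<le> 2"
  shows "[0, a, b, n + 1] ! x < l \<and> l < [0, a, b, n + 1] ! (x + 1) \<longleftrightarrow> l \<noteq> a \<and> l \<noteq> b \<and> strip a b l = x"
proof -
  consider "x = 0" | "x = 1" | "x = 2" using assms(4) by linarith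
  then show ?thesis by cases (use assms in \<open>auto simp: strip_def numeral_2_eq_2 split: if_splits\<close>)
qed

lemma shading_clear:
  assumes \<sigma>: "\<sigma> \<in> perms n" and R: "R \<subseteq> {0..2} \<times> {0..2}" and i: "1 \<le> i" "i < j" "j \<le> n"
  shows "(\<forall>(x, y)\<in>R. \<not> (\<exists>l\<in>{1..n}. grid_pos n i j x < l \<and> l < grid_pos n i j (x + 1) \<and>
      grid_val n \<sigma> i j y < \<sigma> l \<and> \<sigma> l < grid_val n \<sigma> i j (y + 1))) \<longleftrightarrow>
    (\<forall>l\<in>{1..n}. l \<noteq> i \<longrightarrow> l \<noteq> j \<longrightarrow> (strip i j l, strip (min (\<sigma> i) (\<sigma> j)) (max (\<sigma> i) (\<sigma> j)) (\<sigma> l)) \<notin> R)"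
proof -
  let ?a = "min (\<sigma> i) (\<sigma> j)" and ?b = "max (\<sigma> i) (\<sigma> j)"
  have "\<sigma> i \<noteq> \<sigma> j" using perms_inj[OF \<sigma>, of i j] i by simp
  then have ab: "?a < ?b" by auto
  have cell: "grid_pos n i j x < l \<and> l < grid_pos n i j (x + 1) \<and> grid_val n \<sigma> i j y < \<sigma> l \<and> \<sigma> l < grid_val n \<sigma> i j (y + 1)
      \<longleftrightarrow> l \<noteq> i \<and> l \<noteq> j \<and> strip i j l = x \<and> strip ?a ?b (\<sigma> l) = y"
    if l: "l \<in> {1..n}" and xy: "x \<le> 2" "y \<le> 2" for l x y
  proof -
    have "1 \<le> \<sigma> l" "\<sigma> l \<le> n" using perms_range[OF \<sigma>, of l] l by auto
    then have v: "grid_val n \<sigma> i j y < \<sigma> l \<and> \<sigma> l < grid_val n \<sigma> i j (y + 1) \<longleftrightarrow> \<sigma> l \<noteq> ?a \<and> \<sigma> l \<noteq> ?b \<and> strip ?a ?b (\<sigma> l) = y"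
      unfolding grid_val_def by (intro strip_grid[OF ab _ _ xy(2)])
    have p: "grid_pos n i j x < l \<and> l < grid_pos n i j (x + 1) \<longleftrightarrow> l \<noteq> i \<and> l \<noteq> j \<and> strip i j l = x"
      unfolding grid_pos_def using l by (intro strip_grid[OF i(2) _ _ xy(1)]) auto
    have "\<sigma> l \<noteq> ?a \<and> \<sigma> l \<noteq> ?b \<longleftrightarrow> l \<noteq> i \<and> l \<noteq> j"
      using perms_inj[OF \<sigma>, of l i] perms_inj[OF \<sigma>, of l j] by (auto simp: min_def max_def)
    then show ?thesis using v p by blast
  qed
  show ?thesis
  proof
    assume L: "\<forall>(x, y)\<in>R. \<not> (\<exists>l\<in>{1..n}. grid_pos n i j x < l \<and> l < grid_pos n i j (x + 1) \<and>
      grid_val n \<sigma> i j y < \<sigma> l \<and> \<sigma> l < grid_val n \<sigma> i j (y + 1))"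
    show "\<forall>l\<in>{1..n}. l \<noteq> i \<longrightarrow> l \<noteq> j \<longrightarrow> (strip i j l, strip ?a ?b (\<sigma> l)) \<notin> R"
    proof (intro ballI impI notI)
      fix l assume l: "l \<in> {1..n}" "l \<noteq> i" "l \<noteq> j" "(strip i j l, strip ?a ?b (\<sigma> l)) \<in> R"
      then have "grid_pos n i j (strip i j l) < l \<and> l < grid_pos n i j (strip i j l + 1) \<and>
          grid_val n \<sigma> i j (strip ?a ?b (\<sigma> l)) < \<sigma> l \<and> \<sigma> l < grid_val n \<sigma> i j (strip ?a ?b (\<sigma> l) + 1)"
        using cell[OF l(1) strip_le2[of i j l] strip_le2[of ?a ?b "\<sigma> l"]] by blast
      then show False using bspec[OF L l(4)] l(1) unfolding prod.case by blast
    qed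
  next
    assume r: "\<forall>l\<in>{1..n}. l \<noteq> i \<longrightarrow> l \<noteq> j \<longrightarrow> (strip i j l, strip ?a ?b (\<sigma> l)) \<notin> R"
    show "\<forall>(x, y)\<in>R. \<not> (\<exists>l\<in>{1..n}. grid_pos n i j x < l \<and> l < grid_pos n i j (x + 1) \<and>
      grid_val n \<sigma> i j y < \<sigma> l \<and> \<sigma> l < grid_val n \<sigma> i j (y + 1))"
    proof (clarify)
      fix x y l assume xy: "(x, y) \<in> R" and l: "l \<in> {1..n}" "grid_pos n i j x < l" "l < grid_pos n i j (x + 1)"
        "grid_val n \<sigma> i j y < \<sigma> l" "\<sigma> l < grid_val n \<sigma> i j (y + 1)"
      have "x \<le> 2" "y \<le> 2" using R xy by auto
      then have "l \<noteq> i \<and> l \<noteq> j \<and> strip i j l = x \<and> strip ?a ?b (\<sigma> l) = y" using cell[OF l(1)] l by blast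
      then show False using r l(1) xy by blast
    qed
  qed
qed

lemma mesh_occurrence_id:
  assumes \<sigma>: "\<sigma> \<in> perms n" and R: "R \<subseteq> {0..2} \<times> {0..2}"
  shows "mesh_occurrence (id, R) n \<sigma> i j \<longleftrightarrow> occ R n \<sigma> i j"
proof (cases "1 \<le> i \<and> i < j \<and> j \<le> n \<and> \<sigma> i < \<sigma> j")
  case True
  then have ord: "\<forall>a\<in>{1..2::nat}. \<forall>b\<in>{1..2}. \<sigma> (grid_pos n i j a) < \<sigma> (grid_pos n i j b) \<longleftrightarrow> id a < id b"
    by (simp add: grid_pos_def numeral_2_eq_2 atLeastAtMostSuc_conv)
  show ?thesis
    unfolding mesh_occurrence_def occ_def fst_conv snd_conv using shading_clear[OF \<sigma> R, of i j] ord True by simp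
next
  case False
  have "\<sigma> i < \<sigma> j" if "\<forall>a\<in>{1..2::nat}. \<forall>b\<in>{1..2}. \<sigma> (grid_pos n i j a) < \<sigma> (grid_pos n i j b) \<longleftrightarrow> id a < id b"
    using that[THEN bspec[of _ _ 1], THEN bspec[of _ _ 2]] by (simp add: grid_pos_def)
  then show ?thesis using False unfolding mesh_occurrence_def occ_def fst_conv snd_conv by blast
qed

text \<open>Complementing the values turns a descending pair into an ascending one and reflects the
  shading in its middle row.\<close>

lemma mesh_occurrence_transpose:
  assumes \<sigma>: "\<sigma> \<in> perms n" and R: "R \<subseteq> {0..2} \<times> {0..2}"
  shows "mesh_occurrence (Transposition.transpose 1 2, R) n \<sigma> i j \<longleftrightarrow> occ (flip -` R) n (kappa n \<circ> \<sigma>) i j"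
proof (cases "1 \<le> i \<and> i < j \<and> j \<le> n \<and> \<sigma> j < \<sigma> i")
  case True
  then have ord: "\<forall>a\<in>{1..2::nat}. \<forall>b\<in>{1..2}. \<sigma> (grid_pos n i j a) < \<sigma> (grid_pos n i j b) \<longleftrightarrow>
      Transposition.transpose 1 2 a < Transposition.transpose 1 2 b"
    by (simp add: grid_pos_def numeral_2_eq_2 atLeastAtMostSuc_conv)
  have r: "\<sigma> l \<in> {1..n}" if "l \<in> {1..n}" for l using perms_range[OF \<sigma>] that by simp
  have less: "kappa n (\<sigma> i) < kappa n (\<sigma> j)" using True r[of i] r[of j] by (simp add: kappa_less)
  have m: "min (\<sigma> i) (\<sigma> j) = \<sigma> j" "max (\<sigma> i) (\<sigma> j) = \<sigma> i" using True by auto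
  have s: "(strip i j l, strip (min (\<sigma> i) (\<sigma> j)) (max (\<sigma> i) (\<sigma> j)) (\<sigma> l)) \<in> R \<longleftrightarrow>
      (strip i j l, strip (kappa n (\<sigma> i)) (kappa n (\<sigma> j)) (kappa n (\<sigma> l))) \<in> flip -` R"
    if l: "l \<in> {1..n}" "l \<noteq> i" "l \<noteq> j" for l
  proof -
    have "\<sigma> l \<noteq> \<sigma> j" "\<sigma> l \<noteq> \<sigma> i" using perms_inj[OF \<sigma>, of l i] perms_inj[OF \<sigma>, of l j] l by auto
    then have k: "strip (kappa n (\<sigma> i)) (kappa n (\<sigma> j)) (kappa n (\<sigma> l)) = 2 - strip (\<sigma> j) (\<sigma> i) (\<sigma> l)"
      using True r[of i] r[of j] r[OF l(1)] by (intro strip_kappa) auto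
    have "2 - (2 - strip (\<sigma> j) (\<sigma> i) (\<sigma> l)) = strip (\<sigma> j) (\<sigma> i) (\<sigma> l)" by (simp add: strip_def)
    then show ?thesis unfolding k m by (simp add: flip_def)
  qed
  show ?thesis
    unfolding mesh_occurrence_def occ_def fst_conv snd_conv comp_def using shading_clear[OF \<sigma> R, of i j] ord True less s
    by (simp del: vimage_eq)
next
  case False
  have "\<sigma> j < \<sigma> i" if "\<forall>a\<in>{1..2::nat}. \<forall>b\<in>{1..2}. \<sigma> (grid_pos n i j a) < \<sigma> (grid_pos n i j b) \<longleftrightarrow>
      Transposition.transpose 1 2 a < Transposition.transpose 1 2 b"
    using that[THEN bspec[of _ _ 2], THEN bspec[of _ _ 1]] by (simp add: grid_pos_def)
  moreover have "\<sigma> j < \<sigma> i" if o: "occ (flip -` R) n (kappa n \<circ> \<sigma>) i j"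
    using occ_len[OF perms_comp[OF kappa_perms \<sigma>] o] perms_range[OF \<sigma>, of i] perms_range[OF \<sigma>, of j]
    by (simp add: kappa_less)
  ultimately show ?thesis using False unfolding mesh_occurrence_def occ_def fst_conv snd_conv by blast
qed

text \<open>The shading of the corresponding pattern over 12. The intersection removes the rows
  above the board that truncated subtraction in \<open>flip\<close> sends to row 0.\<close>

definition rising :: "mesh_pattern \<Rightarrow> (nat \<times> nat) set" where
  "rising p = (if fst p = id then snd p else flip -` snd p \<inter> {0..2} \<times> {0..2})"

lemma permutes_12: "\<pi> permutes {1..2::nat} \<longleftrightarrow> \<pi> = id \<or> \<pi> = Transposition.transpose 1 2"
proof -
  have "{1..2::nat} = {1, 2}" by auto
  then show ?thesis by (simp only: permutes_doubleton_iff)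
qed

lemma card_avoiders:
  assumes "p \<in> mesh_patterns2"
  shows "card (avoiders n p) = card (av (rising p) n)"
proof -
  obtain \<pi> R where p: "p = (\<pi>, R)" by (cases p)
  have R: "R \<subseteq> {0..2} \<times> {0..2}" and "\<pi> = id \<or> \<pi> = Transposition.transpose 1 2"
    using assms unfolding p mesh_patterns2_def mem_Times_iff fst_conv snd_conv mem_Collect_eq permutes_12 by blast+
  then consider "\<pi> = id" | "\<pi> = Transposition.transpose 1 2" by blast
  then show ?thesis
  proof cases
    case 1
    have "avoiders n p = av R n"
      unfolding avoiders_def av_def mesh_avoids_def p 1 perms_def[symmetric]
      using mesh_occurrence_id[OF _ R] by (auto simp: perms_def)
    then show ?thesis by (simp add: rising_def p 1)
  next
    case 2
    have ne: "Transposition.transpose (1::nat) 2 \<noteq> id"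
      by (metis id_apply numeral_One numeral_eq_iff semiring_norm(83) transpose_apply_first)
    have cut: "occ (flip -` R \<inter> {0..2} \<times> {0..2}) n \<sigma> i j \<longleftrightarrow> occ (flip -` R) n \<sigma> i j" for \<sigma> i j
      unfolding occ_def by simp
    have k: "kappa n \<circ> (kappa n \<circ> \<sigma>) = \<sigma>" for \<sigma> :: "nat \<Rightarrow> nat" by (auto simp: fun_eq_iff)
    have "bij_betw (\<lambda>\<sigma>. kappa n \<circ> \<sigma>) (avoiders n p) (av (rising p) n)"
    proof (rule bij_betw_byWitness[where f' = "\<lambda>\<sigma>. kappa n \<circ> \<sigma>"])
      have a: "\<sigma> \<in> avoiders n p \<longleftrightarrow> \<sigma> \<in> perms n \<and> (\<nexists>i j. occ (flip -` R) n (kappa n \<circ> \<sigma>) i j)" for \<sigma>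
        using mesh_occurrence_transpose[OF _ R, of \<sigma> n] by (auto simp: avoiders_def mesh_avoids_def p 2 perms_def)
      have b: "\<sigma> \<in> av (rising p) n \<longleftrightarrow> \<sigma> \<in> perms n \<and> (\<nexists>i j. occ (flip -` R) n \<sigma> i j)" for \<sigma>
        unfolding av_def rising_def p 2 fst_conv snd_conv if_not_P[OF ne] cut by simp
      show "(\<lambda>\<sigma>. kappa n \<circ> \<sigma>) ` avoiders n p \<subseteq> av (rising p) n"
        unfolding image_subset_iff a b Ball_def using perms_comp[OF kappa_perms] by blast
      show "(\<lambda>\<sigma>. kappa n \<circ> \<sigma>) ` av (rising p) n \<subseteq> avoiders n p"
        unfolding image_subset_iff a b Ball_def k using perms_comp[OF kappa_perms] by blast
    qed (use k in auto)
    then show ?thesis by (rule bij_betw_same_card)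
  qed
qed

lemma rising_subset: "p \<in> mesh_patterns2 \<Longrightarrow> rising p \<subseteq> {0..2} \<times> {0..2}"
  by (auto simp: mesh_patterns2_def rising_def)

lemma wilf_equivalent_weq:
  "p \<in> mesh_patterns2 \<Longrightarrow> q \<in> mesh_patterns2 \<Longrightarrow> wilf_equivalent p q \<longleftrightarrow> weq (rising p) (rising q)"
  by (simp add: wilf_equivalent_def weq_def card_avoiders)

lemma mesh_patterns2_id: "R \<subseteq> {0..2} \<times> {0..2} \<Longrightarrow> (id, R) \<in> mesh_patterns2"
  by (simp add: mesh_patterns2_def permutes_12)

lemma wilf_relation_weq:
  "(p, q) \<in> wilf_relation \<longleftrightarrow> p \<in> mesh_patterns2 \<and> q \<in> mesh_patterns2 \<and> weq (rising p) (rising q)"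
  unfolding wilf_relation_def using wilf_equivalent_weq by blast

text \<open>A class is recovered from any shading in \<open>X\<close> equivalent to one of its
  members, so there are at most as many classes as elements of \<open>X\<close>.\<close>

lemma wilf_le:
  assumes "finite X" "\<And>R. R \<subseteq> {0..2} \<times> {0..2} \<Longrightarrow> \<exists>s\<in>X. weq R s"
  shows "wilf \<le> card X"
proof -
  let ?c = "\<lambda>s. {q \<in> mesh_patterns2. weq s (rising q)}"
  have "mesh_patterns2 // wilf_relation \<subseteq> ?c ` X"
  proof
    fix q assume "q \<in> mesh_patterns2 // wilf_relation"
    then obtain p where p: "p \<in> mesh_patterns2" "q = wilf_relation `` {p}" by (rule quotientE)
    then obtain s where s: "s \<in> X" "weq (rising p) s" using assms(2) rising_subset by metis
    have "q = ?c s" unfolding p(2) Image_singleton wilf_relation_weq using p(1) s(2) weq_trans weq_sym by blast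
    then show "q \<in> ?c ` X" using s by blast
  qed
  then have "wilf \<le> card (?c ` X)" unfolding wilf_def using assms(1) by (intro card_mono) auto
  also have "\<dots> \<le> card X" by (rule card_image_le[OF assms(1)])
  finally show ?thesis .
qed

lemma finite_mesh_patterns2: "finite mesh_patterns2"
  unfolding mesh_patterns2_def by (intro finite_cartesian_product finite_permutations finite_Pow_iff[THEN iffD2]) auto

lemma wilf_ge:
  assumes "\<And>R. R \<in> X \<Longrightarrow> R \<subseteq> {0..2} \<times> {0..2}" "\<And>R R'. R \<in> X \<Longrightarrow> R' \<in> X \<Longrightarrow> weq R R' \<Longrightarrow> R = R'"
  shows "card X \<le> wilf"
proof -
  let ?c = "\<lambda>R. wilf_relation `` {(id, R)}"
  have r: "rising (id, R) = R" for R by (simp add: rising_def)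
  have "inj_on ?c X"
  proof (rule inj_onI)
    fix R R' assume X: "R \<in> X" "R' \<in> X" and e: "?c R = ?c R'"
    have "(id, R') \<in> ?c R'" using mesh_patterns2_id assms(1) X by (simp add: wilf_relation_weq)
    then have "weq R R'" unfolding e[symmetric] by (simp add: wilf_relation_weq r)
    then show "R = R'" using assms(2) X by blast
  qed
  moreover have "?c ` X \<subseteq> mesh_patterns2 // wilf_relation"
    using mesh_patterns2_id assms(1) by (auto intro!: quotientI)
  moreover have "finite (mesh_patterns2 // wilf_relation)"
    using finite_mesh_patterns2 by (rule finite_quotient) (auto simp: wilf_relation_def)
  ultimately show ?thesis unfolding wilf_def by (metis card_image card_mono)
qed

section \<open>Reduction to 47 shadings\<close>

text \<open>The nine cells column by column, each column from bottom to top, as booleans, so that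
  moves and comparisons can be evaluated.\<close>

datatype shading = Shading bool bool bool bool bool bool bool bool bool

primrec cells :: "shading \<Rightarrow> (nat \<times> nat) set" where
  "cells (Shading a b c d e f g h i) = {(x, y). x = 0 \<and> y = 0 \<and> a \<or> x = 0 \<and> y = 1 \<and> b \<or> x = 0 \<and> y = 2 \<and> c \<or>
     x = 1 \<and> y = 0 \<and> d \<or> x = 1 \<and> y = 1 \<and> e \<or> x = 1 \<and> y = 2 \<and> f \<or>
     x = 2 \<and> y = 0 \<and> g \<or> x = 2 \<and> y = 1 \<and> h \<or> x = 2 \<and> y = 2 \<and> i}"

definition bools :: "bool list" where "bools = [False, True]"

definition shadings :: "shading list" where
  "shadings = [Shading a b c d e f g h i. a \<leftarrow> bools, b \<leftarrow> bools, c \<leftarrow> bools, d \<leftarrow> bools, e \<leftarrow> bools,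
     f \<leftarrow> bools, g \<leftarrow> bools, h \<leftarrow> bools, i \<leftarrow> bools]"

lemma in_bools [simp]: "b \<in> set bools"
  by (cases b) (simp_all add: bools_def)

lemma in_shadings: "s \<in> set shadings"
  by (cases s) (simp add: shadings_def image_iff)

lemma cells_subset: "cells s \<subseteq> {0..2} \<times> {0..2}"
  by (cases s) auto

lemma cells_of: "cells (Shading ((0,0) \<in> R) ((0,1) \<in> R) ((0,2) \<in> R) ((1,0) \<in> R) ((1,1) \<in> R) ((1,2) \<in> R)
    ((2,0) \<in> R) ((2,1) \<in> R) ((2,2) \<in> R)) = R \<inter> {0..2} \<times> {0..2}" (is "?S = _")
proof (rule set_eqI)
  fix p :: "nat \<times> nat"
  obtain x y where p: "p = (x, y)" by (cases p)
  show "p \<in> ?S \<longleftrightarrow> p \<in> R \<inter> {0..2} \<times> {0..2}"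
  proof (cases "(x = 0 \<or> x = 1 \<or> x = 2) \<and> (y = 0 \<or> y = 1 \<or> y = 2)")
    case True
    then show ?thesis unfolding p by (elim conjE disjE) simp_all
  next
    case False
    then have "p \<notin> {0..2} \<times> {0..2}" unfolding p by fastforce
    moreover have "p \<notin> ?S" unfolding p cells.simps using False by blast
    ultimately show ?thesis by blast
  qed
qed

lemma weq_box: "weq (R \<inter> {0..2} \<times> {0..2}) R"
  by (rule avI_coincide) (simp add: occ_def)

lemma cells_inj:
  assumes "cells s = cells t"
  shows "s = t"
proof -
  obtain a b c d e f g h i where s: "s = Shading a b c d e f g h i" by (cases s)
  obtain a' b' c' d' e' f' g' h' i' where t: "t = Shading a' b' c' d' e' f' g' h' i'" by (cases t)
  have p: "p \<in> cells s \<longleftrightarrow> p \<in> cells t" for p using assms by simp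
  show ?thesis
    using p[of "(0,0)"] p[of "(0,1)"] p[of "(0,2)"] p[of "(1,0)"] p[of "(1,1)"] p[of "(1,2)"] p[of "(2,0)"] p[of "(2,1)"] p[of "(2,2)"]
    unfolding s t by simp
qed

text \<open>Oriented so that no shading has two images.\<close>

definition specials :: "(shading \<times> shading) list" where
  "specials = [
    (Shading True True False True True False False False True, Shading False True True False True True True False False),
    (Shading True False True True False True False True False, Shading False True True False True True True False False),
    (Shading True True False True True True False False True, Shading True False True True True True False True False),
    (Shading True True False True False False False False True, Shading True False True True False False False True False),
    (Shading True False True True True False False True False, Shading True True False True False True False False True),
    (Shading False True False True True True False False True, Shading True False False True True True False False True),
    (Shading False True False True True True False False False, Shading False False False False False False True False False),
    (Shading True True False True True False False False False, Shading False True False True True True False False False),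
    (Shading True False False False True True True False False, Shading False False False False False False True False False),
    (Shading True False True False True False False False False, Shading False False True False False False False False False),
    (Shading True True False True True True False False False, Shading True False True True True True False False False),
    (Shading False True False True True True False True False, Shading False True True True True True False False False),
    (Shading False True False True True False False False True, Shading False True False False True True True False False),
    (Shading True False True False True False False True True, Shading True False True False True False True True False),
    (Shading True True False False True True False False True, Shading True True False True False True False False True),
    (Shading True True False False True True False False False, Shading False False False False False False False False False),
    (Shading False True False False True True False False False, Shading False False False False False False False False False),
    (Shading True False False True False False False True True, Shading False False False False False False False False False)]"

lemma weq_cells: "weq R R' \<Longrightarrow> cells s = R \<Longrightarrow> cells t = R' \<Longrightarrow> weq (cells s) (cells t)"
  by simp

lemma specials_weq: "(s, t) \<in> set specials \<Longrightarrow> weq (cells s) (cells t)"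
proof -
  have "\<forall>(s, t)\<in>set specials. weq (cells s) (cells t)"
    unfolding specials_def list.set ball_simps prod.case
  proof (intro conjI TrueI)
    show "weq (cells (Shading True True False True True False False False True)) (cells (Shading False True True False True True True False False))"
      by (rule weq_cells[OF weq_J1_J3]) auto
    show "weq (cells (Shading True False True True False True False True False)) (cells (Shading False True True False True True True False False))"
      by (rule weq_cells[OF weq_J2_J3]) auto
    show "weq (cells (Shading True True False True True True False False True)) (cells (Shading True False True True True True False True False))"
      by (rule weq_cells[OF weq_K]) auto
    show "weq (cells (Shading True True False True False False False False True)) (cells (Shading True False True True False False False True False))"
      by (rule weq_cells[OF weq_E]) auto
    show "weq (cells (Shading True False True True True False False True False)) (cells (Shading True True False True False True False False True))"
      by (rule weq_cells[OF weq_G2_G3]) auto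
    show "weq (cells (Shading False True False True True True False False True)) (cells (Shading True False False True True True False False True))"
      by (rule weq_cells[OF weq_F]) auto
    show "weq (cells (Shading False True False True True True False False False)) (cells (Shading False False False False False False True False False))"
      by (rule weq_cells[OF weq_sym[OF weq_N_A2]]) auto
    show "weq (cells (Shading True True False True True False False False False)) (cells (Shading False True False True True True False False False))"
      by (rule weq_cells[OF weq_sym[OF weq_A2_A3]]) auto
    show "weq (cells (Shading True False False False True True True False False)) (cells (Shading False False False False False False True False False))"
      by (rule weq_cells[OF weq_sym[OF weq_N_N2]]) auto
    show "weq (cells (Shading True False True False True False False False False)) (cells (Shading False False True False False False False False False))"
      by (rule weq_cells[OF weq_sym[OF weq_M]]) auto
    show "weq (cells (Shading True True False True True True False False False)) (cells (Shading True False True True True True False False False))"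
      by (rule weq_cells[OF weq_B]) auto
    show "weq (cells (Shading False True False True True True False True False)) (cells (Shading False True True True True True False False False))"
      by (rule weq_cells[OF weq_H]) auto
    show "weq (cells (Shading False True False True True False False False True)) (cells (Shading False True False False True True True False False))"
      by (rule weq_cells[OF weq_C]) auto
    show "weq (cells (Shading True False True False True False False True True)) (cells (Shading True False True False True False True True False))"
      by (rule weq_cells[OF weq_I]) auto
    show "weq (cells (Shading True True False False True True False False True)) (cells (Shading True True False True False True False False True))"
      by (rule weq_cells[OF weq_G1_G3]) auto
    show "weq (cells (Shading True True False False True True False False False)) (cells (Shading False False False False False False False False False))"
      by (rule weq_cells[OF weq_sym[OF weq_empty_first]]) auto
    show "weq (cells (Shading False True False False True True False False False)) (cells (Shading False False False False False False False False False))"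
      by (rule weq_cells[OF weq_sym[OF weq_empty_first_subset]]) auto
    show "weq (cells (Shading True False False True False False False True True)) (cells (Shading False False False False False False False False False))"
      by (rule weq_cells[OF weq_sym[OF weq_empty_last]]) auto
  qed
  then show "(s, t) \<in> set specials \<Longrightarrow> weq (cells s) (cells t)" by blast
qed

datatype move = Inverse | Rotate | Swap | Toric | Toggle00 | Toggle01 | Toggle01' | Toggle11 | Special

text \<open>A move whose condition fails is the identity, so every sequence of moves is sound. The
  toggles both shade and unshade: their conditions do not involve the toggled cell, and equivalence
  is symmetric.\<close>

fun apply_move :: "move \<Rightarrow> shading \<Rightarrow> shading" where
  "apply_move Inverse (Shading a b c d e f g h i) = Shading a d g b e h c f i"
| "apply_move Rotate (Shading a b c d e f g h i) = Shading i h g f e d c b a"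
| "apply_move Swap (Shading a b c d e f g h i) = (if a \<and> b \<and> c then Shading a b c g h i d e f else Shading a b c d e f g h i)"
| "apply_move Toric (Shading a b c d e f g h i) = (if a \<and> b \<and> c then Shading e f d h i g b c a else Shading a b c d e f g h i)"
| "apply_move Toggle00 (Shading a b c d e f g h i) =
     Shading (if \<not> b \<and> \<not> e \<and> (h \<longrightarrow> g) \<and> (f \<longrightarrow> c) then \<not> a else a) b c d e f g h i"
| "apply_move Toggle01 (Shading a b c d e f g h i) =
     Shading a (if \<not> d \<and> \<not> e \<and> (f \<longrightarrow> c) \<and> (g \<longrightarrow> h) then \<not> b else b) c d e f g h i"
| "apply_move Toggle01' (Shading a b c d e f g h i) =
     Shading a (if \<not> a \<and> \<not> d \<and> (f \<longrightarrow> c) \<and> (g \<longrightarrow> h) then \<not> b else b) c d e f g h i"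
| "apply_move Toggle11 (Shading a b c d e f g h i) =
     Shading a b c d (if \<not> a \<and> \<not> b \<and> (c \<longrightarrow> f) \<and> (g \<longrightarrow> h) then \<not> e else e) f g h i"
| "apply_move Special s = (case map_of specials s of None \<Rightarrow> s | Some t \<Rightarrow> t)"

lemma apply_move_weq: "weq (cells s) (cells (apply_move m s))"
proof -
  obtain a b c d e f g h i where s: "s = Shading a b c d e f g h i" by (cases s)
  show ?thesis
  proof (cases m)
    case Inverse
    have "(cells (apply_move m s))\<inverse> = cells s" unfolding s Inverse by auto
    then show ?thesis using weq_inverse by metis
  next
    case Rotate
    let ?R = "rot -` cells (apply_move m s)"
    \<comment> \<open>The preimage agrees with \<open>s\<close> on the nine cells; whatever lies
      outside the board is cut off by \<open>weq_box\<close>.\<close>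
    have "Shading ((0,0) \<in> ?R) ((0,1) \<in> ?R) ((0,2) \<in> ?R) ((1,0) \<in> ?R) ((1,1) \<in> ?R) ((1,2) \<in> ?R)
      ((2,0) \<in> ?R) ((2,1) \<in> ?R) ((2,2) \<in> ?R) = s"
      unfolding s Rotate by (simp add: rot_def)
    then have "cells s = ?R \<inter> {0..2} \<times> {0..2}" using cells_of[of ?R] by simp
    then show ?thesis using weq_trans[OF weq_box weq_rc[OF cells_subset]] by simp
  next
    case Swap
    show ?thesis
    proof (cases "a \<and> b \<and> c")
      case True
      let ?R = "(\<lambda>(x, y). (swap12 x, y)) -` cells (apply_move m s)"
      have "Shading ((0,0) \<in> ?R) ((0,1) \<in> ?R) ((0,2) \<in> ?R) ((1,0) \<in> ?R) ((1,1) \<in> ?R) ((1,2) \<in> ?R)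
        ((2,0) \<in> ?R) ((2,1) \<in> ?R) ((2,2) \<in> ?R) = s"
        unfolding s Swap using True by (simp add: swap12_def)
      then have "cells s = ?R \<inter> {0..2} \<times> {0..2}" using cells_of[of ?R] by simp
      moreover have "weq ?R (cells (apply_move m s))"
        by (rule weq_swapcols[OF _ _ _ cells_subset]) (use True in \<open>simp_all add: s Swap\<close>)
      ultimately show ?thesis using weq_trans[OF weq_box] by simp
    qed (auto simp: s Swap simp del: cells.simps)
  next
    case Toric
    show ?thesis
    proof (cases "a \<and> b \<and> c")
      case True
      show ?thesis by (rule weq_toric) (use True in \<open>auto simp: s Toric\<close>)
    qed (auto simp: s Toric simp del: cells.simps)
  next
    case Toggle00
    have "weq (cells (Shading False b c d e f g h i)) (insert (0,0) (cells (Shading False b c d e f g h i)))"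
      if "\<not> b \<and> \<not> e \<and> (h \<longrightarrow> g) \<and> (f \<longrightarrow> c)"
      by (rule shade_00) (use that in auto)
    moreover have "insert (0,0) (cells (Shading False b c d e f g h i)) = cells (Shading True b c d e f g h i)" by auto
    ultimately show ?thesis unfolding s Toggle00 by (cases a) (auto simp del: cells.simps intro: weq_sym)
  next
    case Toggle01
    have "weq (cells (Shading a False c d e f g h i)) (insert (0,1) (cells (Shading a False c d e f g h i)))"
      if "\<not> d \<and> \<not> e \<and> (f \<longrightarrow> c) \<and> (g \<longrightarrow> h)"
      by (rule shade_01_lowest) (use that in auto)
    moreover have "insert (0,1) (cells (Shading a False c d e f g h i)) = cells (Shading a True c d e f g h i)" by auto
    ultimately show ?thesis unfolding s Toggle01 by (cases b) (auto simp del: cells.simps intro: weq_sym)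
  next
    case Toggle01'
    have "weq (cells (Shading a False c d e f g h i)) (insert (0,1) (cells (Shading a False c d e f g h i)))"
      if "\<not> a \<and> \<not> d \<and> (f \<longrightarrow> c) \<and> (g \<longrightarrow> h)"
      by (rule shade_01_rightmost) (use that in auto)
    moreover have "insert (0,1) (cells (Shading a False c d e f g h i)) = cells (Shading a True c d e f g h i)" by auto
    ultimately show ?thesis unfolding s Toggle01' by (cases b) (auto simp del: cells.simps intro: weq_sym)
  next
    case Toggle11
    have "weq (cells (Shading a b c d False f g h i)) (insert (1,1) (cells (Shading a b c d False f g h i)))"
      if "\<not> a \<and> \<not> b \<and> (c \<longrightarrow> f) \<and> (g \<longrightarrow> h)"
      by (rule shade_11) (use that in auto)
    moreover have "insert (1,1) (cells (Shading a b c d False f g h i)) = cells (Shading a b c d True f g h i)" by auto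
    ultimately show ?thesis unfolding s Toggle11 by (cases e) (auto simp del: cells.simps intro: weq_sym)
  next
    case Special
    show ?thesis
    proof (cases "map_of specials s")
      case (Some t)
      then show ?thesis using specials_weq[OF map_of_SomeD[OF Some]] by (simp add: Special del: cells.simps)
    qed (simp add: Special del: cells.simps)
  qed
qed

text \<open>The first root and another one have the same numbers of avoiders as far as they were computed; the others are
  pairwise inequivalent.\<close>

definition roots :: "shading list" where
  "roots = [
    Shading True True False False False True False True False,
    Shading True False False False False False False False False,
    Shading False False False False False False True True False,
    Shading False False False False False True False True False,
    Shading False False True False True True False True False,
    Shading False True True False False False True True True,
    Shading True False True True True True False False False,
    Shading True False True False False False True False False,
    Shading True True True False False True True True False,
    Shading True True True False False True True True True,
    Shading False False True False True False True False False,
    Shading True False True False True False True False False,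
    Shading False False True False True False True True False,
    Shading False True True False True False True True True,
    Shading False True False False False True True False False,
    Shading True False True True False False False True False,
    Shading False False True True False True False True False,
    Shading False True False False True True True False False,
    Shading True True False True False True False False True,
    Shading True False True False True False True True False,
    Shading False True True False True True True False False,
    Shading True True True False True True True False False,
    Shading True False False False False True False True False,
    Shading True True True False False True False True False,
    Shading False True False True False True False True False,
    Shading True True False True False True False True False,
    Shading False True True True False True False True False,
    Shading True False False True True True False False True,
    Shading True False True False True True False True False,
    Shading True True False True True True False True False,
    Shading True False True True True True False True False,
    Shading False True True True True True False True False,
    Shading False True True True False True True True False,
    Shading True True True True False True True True False,
    Shading True False True False True True True True False,
    Shading True True True False True True True True False,
    Shading False True True True True True True True False,
    Shading True True True True True False True True True,
    Shading True False False False True False False False True,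
    Shading True True False False True False False False True,
    Shading True False True False True False False False True,
    Shading True False True False True False True False True,
    Shading True True False False False True True False True,
    Shading True True False False True True True False True,
    Shading True True False True False True False True True,
    Shading True True False True True True False True True,
    Shading True True True True True True True True True]"

text \<open>The moves leading from \<open>shadings ! k\<close> to a root, found by breadth-first search.\<close>

definition paths :: "move list list" where
  "paths = [
    [Toggle00], [Rotate], [Rotate, Toggle01, Toggle00], [Rotate, Toggle01], [Inverse, Toggle01, Rotate],
    [Rotate, Toggle00, Toggle01, Rotate], [], [Rotate, Toggle01, Toggle00, Toggle01, Rotate],
    [Rotate, Inverse, Toggle01, Toggle00], [Rotate, Inverse, Toggle01], [],
    [Toggle11, Rotate, Special, Special, Inverse, Toggle01, Rotate], [Inverse, Toggle01, Rotate, Toggle01],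
    [Inverse, Toggle01, Rotate, Toggle01, Toggle00], [Inverse, Toggle11], [Rotate, Toric, Toggle01],
    [Toggle11, Toggle00], [Toggle11, Rotate], [Toggle11, Rotate, Toggle01, Toggle00], [Toggle11, Rotate, Toggle01],
    [Inverse, Toggle01', Rotate, Toggle11], [Rotate, Special, Toggle01, Rotate], [Toggle11],
    [Toggle11, Rotate, Toggle01, Toggle00, Toggle01, Rotate], [Rotate, Toggle11, Inverse, Toggle01, Toggle00],
    [Toggle11, Rotate, Inverse, Toggle01], [Toggle11], [Rotate, Special, Special, Inverse, Toggle01, Rotate],
    [Inverse, Toggle01', Rotate, Toggle01', Toggle11], [Inverse, Toggle01', Rotate, Inverse], [Inverse],
    [Rotate, Swap, Rotate], [Inverse, Toggle01, Toggle00], [Inverse, Toggle01, Rotate],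
    [Toggle11, Inverse, Special, Toggle00], [Toggle11, Rotate, Special, Toggle00], [Inverse, Rotate],
    [Rotate, Toggle00, Inverse], [Inverse, Toggle01, Inverse], [Rotate, Toggle01, Toggle00, Inverse],
    [Inverse, Toggle01, Rotate, Toggle01, Toggle00], [Inverse, Toggle01, Rotate, Toggle01],
    [Toggle11, Rotate, Special, Inverse, Toggle01, Rotate], [Toggle11, Rotate, Special], [Rotate, Inverse, Toggle01],
    [Rotate, Inverse, Toggle01, Toggle00], [Inverse, Toggle01, Toggle11], [Rotate, Toric],
    [Toggle11, Inverse, Toggle01, Toggle00], [Toggle11, Inverse, Toggle01, Rotate], [Inverse, Special, Toggle00],
    [Rotate, Special, Toggle00], [Rotate, Toggle11, Inverse],
    [Inverse, Toggle01', Rotate, Inverse, Special, Toggle01, Rotate], [Toggle11, Inverse, Toggle01, Inverse],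
    [Toggle11, Rotate, Toggle01, Toggle00, Inverse], [Toggle11, Inverse, Toggle01, Rotate, Toggle01, Toggle00],
    [Toggle11, Inverse, Toggle01, Rotate, Toggle01], [Rotate, Special, Inverse, Toggle01, Rotate], [Rotate, Special],
    [Rotate, Toggle11, Inverse, Toggle01], [Rotate], [Inverse, Toggle01'], [Toggle11, Rotate, Toric],
    [Toggle01, Rotate], [Toggle01, Rotate, Toggle00], [Toggle01, Rotate, Toggle01],
    [Toggle01, Rotate, Toggle01, Toggle00], [Toggle00], [Rotate], [Toggle00, Toggle01, Rotate], [Toggle01],
    [Inverse], [Rotate, Toggle00, Inverse, Rotate], [Toggle11], [Toggle01, Rotate, Inverse, Toric],
    [Toggle00, Inverse, Toggle01, Rotate], [Inverse, Toggle01], [Toggle00, Toggle01], [Toggle00, Toggle01],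
    [Toggle01', Rotate, Toggle11], [Rotate, Inverse, Special, Toggle01, Rotate],
    [Toggle01', Rotate, Toggle01', Toggle11], [Toggle01', Rotate, Inverse], [], [Rotate], [], [Toggle01'],
    [Toggle11, Inverse], [Toggle11, Rotate, Toggle00, Inverse, Rotate], [], [Rotate, Inverse, Swap, Rotate],
    [Inverse], [Inverse, Toggle01'], [Toggle11, Toggle00, Toggle01], [Rotate, Toric, Toggle01],
    [Inverse, Rotate, Toggle01, Rotate, Toggle01],
    [Rotate, Inverse, Toggle01, Toric, Rotate, Toggle01, Toggle00, Inverse], [Inverse], [Rotate, Inverse],
    [Toggle00, Inverse, Rotate, Toggle01], [Toggle00, Inverse, Swap, Toric],
    [Toggle00, Inverse, Swap, Toric, Toggle01'], [Toggle00, Inverse, Swap, Toric], [Inverse, Toggle01],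
    [Inverse, Toggle01, Rotate, Toggle01, Toggle00, Toggle01, Rotate], [], [Toggle11, Rotate, Inverse, Swap, Rotate],
    [Toggle00, Inverse, Rotate], [Inverse], [Toggle00, Inverse], [Toggle00, Inverse],
    [Inverse, Rotate, Toggle01', Rotate, Toggle01', Toggle11], [Rotate, Special, Inverse, Toggle01, Rotate],
    [Inverse], [Rotate, Inverse, Special], [Inverse, Rotate], [Rotate, Inverse], [Inverse], [Rotate],
    [Toggle11, Inverse, Toggle01], [Toggle11, Inverse, Toggle01, Rotate, Toggle01, Toggle00, Toggle01, Rotate],
    [Toggle11], [Rotate, Inverse, Swap, Rotate], [Inverse, Toggle01'], [Inverse], [Toggle11, Toggle00, Inverse],
    [Rotate, Toric], [Toggle01, Toggle00], [Toggle01, Rotate], [Toggle01, Rotate, Toggle01, Toggle00],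
    [Toggle01, Rotate, Toggle01], [Rotate, Toggle01, Rotate, Toggle01],
    [Rotate, Toggle01, Toric, Rotate, Toggle01, Toggle00, Inverse], [Toggle01],
    [Toggle01, Rotate, Toggle01, Toggle00, Toggle01, Rotate], [Inverse, Toggle11, Inverse, Special, Toggle00],
    [Inverse, Toggle11, Rotate, Special, Toggle00], [Inverse, Toggle11, Rotate, Special, Inverse, Toggle01, Rotate],
    [Inverse, Toggle11, Rotate, Special], [], [Rotate], [Inverse], [Rotate, Swap, Rotate, Toggle01'],
    [Toggle01', Toggle11, Toggle00], [Toggle01', Toggle11, Rotate],
    [Toggle01', Toggle11, Rotate, Toggle01, Toggle00], [Toggle01', Toggle11, Rotate, Toggle01],
    [Rotate, Toggle01', Rotate, Toggle01', Toggle11], [Rotate, Inverse, Special, Inverse, Toggle01, Rotate],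
    [Toggle01', Toggle11], [Toggle01', Toggle11, Rotate, Toggle01, Toggle00, Toggle01, Rotate], [Special, Toggle00],
    [Rotate, Inverse, Special, Toggle00], [Rotate, Inverse, Special, Inverse, Toggle01, Rotate],
    [Rotate, Inverse, Special], [], [Rotate, Special], [Inverse, Toggle11], [Rotate, Swap, Rotate], [Rotate],
    [Rotate], [Inverse, Rotate, Toggle11, Rotate, Special, Inverse, Toggle01, Rotate], [Rotate], [Rotate, Toggle11],
    [Rotate, Toggle01], [Rotate, Toggle01, Toggle11], [Rotate],
    [Rotate, Toggle11, Rotate, Special, Inverse, Toggle01, Rotate], [Rotate, Inverse], [], [Rotate], [Rotate],
    [Rotate, Special], [Inverse], [Rotate, Toric, Rotate], [Rotate, Toggle11], [Special],
    [Inverse, Special, Inverse, Toggle01, Rotate], [Inverse, Special], [Rotate], [Rotate], [Rotate, Toggle01'],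
    [Rotate, Toric, Inverse, Toric], [Special, Inverse, Toggle01, Rotate], [Special],
    [Special, Inverse, Rotate, Toggle01'], [Rotate], [Rotate, Toggle11], [Rotate], [Inverse],
    [Rotate, Toric, Rotate], [Rotate], [Rotate, Toggle00], [Rotate, Toggle01], [Rotate, Toggle01, Toggle00],
    [Rotate, Toggle00, Toggle01, Rotate], [Rotate, Toggle01, Rotate], [Inverse, Toggle00, Inverse, Rotate], [],
    [Toggle01, Inverse], [Toggle01, Rotate, Toggle00, Inverse, Rotate], [Toggle01, Toggle11],
    [Rotate, Inverse, Toric], [Inverse, Toggle00, Inverse, Swap, Toric, Toggle01'],
    [Inverse, Toggle00, Inverse, Swap, Toric], [Toggle01, Toggle00, Toggle01], [Toggle01, Toggle00, Toggle01],
    [Rotate, Toggle11], [Toggle01', Rotate, Inverse, Special, Toggle01, Rotate], [Rotate, Toggle01', Toggle11],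
    [Rotate, Inverse], [Rotate], [Rotate], [Toggle01'], [], [Toggle01', Toggle11, Inverse],
    [Toggle01', Toggle11, Rotate, Toggle00, Inverse, Rotate], [Toggle01'], [Inverse, Toggle11, Rotate, Toric], [],
    [Rotate, Inverse], [Toggle01', Toggle11, Toggle00, Toggle01], [Rotate, Inverse, Toric],
    [Inverse, Rotate, Toggle11], [Rotate, Inverse, Toggle01], [Inverse, Rotate], [Rotate, Inverse, Special],
    [Rotate, Toggle00, Toggle01], [Rotate, Toggle01], [Rotate, Toggle01, Toggle00, Toggle01], [Rotate],
    [Inverse, Rotate, Toggle01, Toggle11], [Rotate, Inverse], [], [Rotate, Inverse, Toric, Rotate],
    [Rotate, Toggle00, Inverse], [Rotate, Inverse], [], [Rotate], [Inverse, Rotate], [Rotate, Inverse],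
    [Inverse, Rotate, Toggle11], [Rotate, Inverse], [Rotate, Toggle11, Toggle00, Toggle01], [Rotate],
    [Rotate, Toggle01', Toggle11, Toggle00, Toggle01], [Rotate], [Inverse, Rotate, Toggle01'],
    [Rotate, Inverse, Toric, Inverse, Toric], [], [Rotate, Inverse, Toric, Rotate],
    [Rotate, Toggle11, Toggle00, Inverse], [Rotate, Inverse], [], [Rotate, Swap], [], [Toggle00, Rotate],
    [Rotate, Toggle01, Rotate], [Rotate, Toggle01, Toggle00, Rotate], [Inverse, Toggle00, Toggle01, Rotate],
    [Toggle00, Rotate, Toggle00, Toggle01, Rotate], [Toggle00], [Rotate, Swap, Toggle01, Toggle00, Inverse],
    [Inverse, Rotate, Toggle01, Rotate], [Rotate, Inverse, Toggle01, Toggle00, Rotate], [], [Rotate, Special],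
    [Inverse, Toggle01, Toric, Rotate, Toggle01, Toggle00, Inverse],
    [Inverse, Toggle01, Toric, Toggle11, Rotate, Toggle01, Toggle00, Inverse], [Inverse, Toggle01],
    [Rotate, Toric, Toggle01'], [Rotate, Toggle11, Rotate], [], [Rotate, Toggle01', Toggle11, Rotate], [Rotate],
    [Inverse, Special, Toggle01, Rotate], [Inverse], [Rotate, Toggle01', Rotate, Inverse, Special, Toggle01, Rotate],
    [Rotate, Swap], [Rotate, Toggle11, Inverse, Toggle01, Rotate], [Rotate, Inverse], [Rotate, Special],
    [Rotate, Special], [Special, Inverse, Toggle01, Rotate], [Inverse, Special], [Inverse], [Rotate, Swap],
    [Inverse, Toggle01], [Inverse, Toggle01, Toggle00, Rotate],
    [Inverse, Rotate, Toggle11, Rotate, Special, Toggle00], [Special, Toggle00], [Toggle00, Inverse, Rotate],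
    [Toggle00, Rotate, Toggle00, Inverse], [Inverse, Toggle01, Toggle00, Inverse],
    [Toggle00, Rotate, Toggle01, Toggle00, Inverse], [Inverse, Rotate, Toggle01, Rotate, Toggle01],
    [Inverse, Toggle01, Rotate, Toggle01, Toggle00, Rotate], [Inverse], [Rotate],
    [Inverse, Toric, Rotate, Toggle01, Toggle00, Inverse],
    [Inverse, Toric, Toggle11, Rotate, Toggle01, Toggle00, Inverse], [Inverse], [Rotate, Toric],
    [Rotate, Toggle11, Rotate, Inverse, Toggle01], [Inverse], [Inverse, Special, Toggle00], [Inverse, Special],
    [Rotate, Toggle11, Rotate, Toggle00, Inverse, Rotate], [Inverse, Swap],
    [Rotate, Toggle01', Toggle11, Rotate, Toggle00, Inverse, Rotate], [Inverse, Swap, Rotate, Inverse, Toric],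
    [Rotate, Toggle11, Inverse, Toggle01, Rotate, Toggle01], [], [Rotate, Special], [Rotate, Special],
    [Inverse, Toric, Toggle00, Rotate, Toggle01, Toggle00, Inverse], [Inverse, Swap, Toric, Inverse, Toric],
    [Inverse, Toric, Inverse, Toric], [Rotate, Swap], [Toggle00, Toggle01, Rotate],
    [Toggle00, Toggle01, Rotate, Toggle00], [Toggle01, Toric, Rotate, Toggle01, Toggle00, Inverse],
    [Toggle01, Toric, Toggle11, Rotate, Toggle01, Toggle00, Inverse], [], [Toggle00, Rotate], [Toggle01, Rotate],
    [Toggle00, Toggle01], [Toggle00, Inverse], [Toggle00, Rotate, Toggle00, Inverse, Rotate], [Toggle01],
    [Toggle01, Rotate, Inverse, Toric], [Inverse, Toggle01, Rotate], [Toggle00, Inverse, Toggle01], [Toggle01],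
    [Toggle01], [Special, Toggle01, Rotate], [], [Inverse, Special, Inverse, Toggle01, Rotate], [Special], [], [],
    [], [Rotate, Toric, Rotate, Swap], [Inverse, Rotate, Toggle01', Rotate, Inverse, Special, Toggle01, Rotate],
    [Rotate, Inverse, Swap], [], [Rotate, Inverse, Swap], [Inverse], [Rotate, Inverse, Toric, Rotate, Swap], [],
    [Rotate, Swap], [Inverse, Rotate, Toggle01, Rotate, Toggle01, Toggle00],
    [Toggle00, Rotate, Inverse, Toggle01, Toric, Rotate, Toggle01, Toggle00, Inverse], [], [Inverse],
    [Inverse, Rotate, Toggle01], [Inverse, Swap, Toric], [Inverse, Swap, Toric, Toggle01'], [Inverse, Swap, Toric],
    [Inverse, Toggle01, Toggle00], [Inverse, Toggle01, Rotate, Swap, Toggle01, Toggle00, Inverse], [Special],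
    [Rotate, Inverse, Swap], [Inverse, Rotate], [Toggle00, Inverse], [Inverse], [Inverse],
    [Inverse, Rotate, Toggle01', Rotate, Inverse], [Inverse, Rotate, Special], [Special], [Inverse],
    [Inverse, Rotate, Toggle01'], [Inverse, Toric, Rotate, Swap], [Inverse], [Inverse, Toric, Rotate, Swap], [],
    [Rotate, Inverse, Swap, Toric, Inverse, Toric], [], [Rotate, Inverse, Swap], [Inverse, Rotate],
    [Inverse, Toric, Rotate, Swap], [Inverse], [Rotate, Inverse], [Toggle01], [Toggle01, Toggle00, Rotate],
    [Rotate, Toggle01, Rotate, Toggle01], [Toggle01, Rotate, Toggle01, Toggle00, Rotate],
    [Rotate, Toggle01, Rotate, Toggle01, Toggle00],
    [Rotate, Toggle01, Toric, Toggle11, Rotate, Toggle01, Toggle00, Inverse], [Toggle01, Toggle00],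
    [Toggle01, Rotate, Swap, Toggle01, Toggle00, Inverse], [Rotate, Toggle11, Rotate, Special, Toggle00],
    [Inverse, Special, Toggle00], [], [Rotate, Inverse], [Inverse], [], [Inverse, Special], [Rotate, Swap],
    [Rotate, Toggle11, Rotate, Toggle01], [], [Rotate, Toggle01', Toggle11, Rotate, Toggle01], [Inverse],
    [Rotate, Toggle01', Rotate, Inverse], [Rotate, Special], [Inverse], [Rotate, Swap, Toric, Inverse, Toric],
    [Special, Toggle00], [Special], [Inverse, Rotate, Special], [Rotate, Inverse, Special], [Inverse, Special], [],
    [Inverse], [Rotate, Swap], [Rotate, Toggle11, Rotate, Special, Special, Inverse, Toggle01, Rotate], [Special],
    [Inverse, Rotate, Toggle11, Rotate, Special], [Inverse], [Inverse, Toric, Toggle01], [Inverse, Toric, Toggle01'],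
    [Inverse, Toric], [Inverse, Toric], [Rotate, Toggle11, Rotate, Special], [], [], [],
    [Inverse, Swap, Rotate, Toggle01'], [Inverse, Swap], [Inverse, Toric, Rotate], [Inverse, Toric, Rotate],
    [Special, Special, Inverse, Toggle01, Rotate], [Special], [Inverse, Special], [Inverse, Special],
    [Inverse, Swap, Rotate], [Inverse, Swap], [Inverse, Rotate, Toggle11, Rotate, Toric], [Inverse, Swap], [Special],
    [Special], [], [], [Inverse, Swap, Rotate], [Inverse, Swap], [Inverse, Toric, Rotate], [Inverse, Toric],
    [Toggle01, Toggle00, Toggle01, Rotate], [Swap, Toggle01, Toggle00, Inverse],
    [Toric, Rotate, Toggle01, Toggle00, Inverse], [Toric, Toggle11, Rotate, Toggle01, Toggle00, Inverse],
    [Rotate, Toggle01], [Swap, Toric], [Rotate], [Inverse, Toggle00, Inverse], [Toggle01, Toggle00, Inverse],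
    [Toggle01, Toggle00, Rotate, Toggle00, Inverse, Rotate], [], [Rotate, Inverse, Toric], [Swap, Toric, Toggle01'],
    [Swap, Toric], [], [], [Toric, Rotate, Swap, Toggle01, Toggle00, Inverse], [Swap],
    [Toric, Toggle00, Rotate, Toggle01, Toggle00, Inverse], [Swap, Toric, Inverse, Toric], [Rotate, Toggle01'],
    [Toric, Rotate, Swap], [Rotate], [Toric, Rotate, Swap], [Rotate, Toggle11, Rotate, Toggle01, Toggle00, Inverse],
    [Swap, Rotate, Inverse, Toric], [Toric, Inverse, Toric], [Rotate, Inverse, Swap], [], [Toric, Rotate, Swap], [],
    [Rotate], [Toric, Toggle01], [Toric, Toggle01'], [Swap, Rotate, Toggle01'], [Swap], [Rotate, Toggle00, Toggle01],
    [Rotate, Toggle01], [Swap, Toric, Toggle01], [Rotate], [Toric], [Toric], [Toric, Rotate], [Toric, Rotate],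
    [Swap, Rotate, Toggle01], [Inverse, Rotate], [], [Swap, Inverse], [Swap, Rotate], [Swap], [Swap, Rotate], [Swap],
    [Toric, Toggle01], [Swap], [Inverse, Toric], [], [Rotate, Toggle11, Rotate, Toric], [Swap], [Toric, Rotate],
    [Toric], [Toric], [Inverse], [Swap], []]"

lemma fold_apply_move_weq: "weq (cells s) (cells (fold apply_move ms s))"
proof (induction ms arbitrary: s)
  case (Cons m ms)
  then show ?case using weq_trans[OF apply_move_weq[of s m] Cons.IH[of "apply_move m s"]] by simp
qed simp

text \<open>The lists of moves are certificates: each is replayed, and only its end point is looked
  up among the roots.\<close>

lemma paths_to_roots: "list_all2 (\<lambda>s ms. List.member roots (fold apply_move ms s)) shadings paths"
  by code_simp

lemma ex_root: "\<exists>r\<in>set roots. weq (cells s) (cells r)"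
proof -
  obtain k where "k < length shadings" "shadings ! k = s" using in_shadings in_set_conv_nth by metis
  then have "fold apply_move (paths ! k) s \<in> set roots" using list_all2_nthD[OF paths_to_roots] by auto
  then show ?thesis using fold_apply_move_weq by blast
qed

lemma wilf_upper: "wilf \<le> 47"
proof -
  have "wilf \<le> card (cells ` set roots)"
  proof (rule wilf_le)
    fix R :: "(nat \<times> nat) set" assume "R \<subseteq> {0..2} \<times> {0..2}"
    then obtain s where "cells s = R" using cells_of[of R] by (metis inf.absorb1)
    then show "\<exists>r\<in>cells ` set roots. weq R r" using ex_root by blast
  qed simp
  also have "\<dots> \<le> card (set roots)" by (rule card_image_le) simp
  also have "\<dots> \<le> length roots" by (rule card_length)
  also have "\<dots> = 47" by (simp add: roots_def)
  finally show ?thesis .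
qed

section \<open>Counting avoiders\<close>

definition extl :: "nat \<Rightarrow> nat list \<Rightarrow> nat list" where
  "extl r xs = map (\<lambda>v. if v \<le> r then v else Suc v) xs @ [Suc r]"

primrec perm_lists :: "nat \<Rightarrow> nat list list" where
  "perm_lists 0 = [[]]"
| "perm_lists (Suc n) = concat (map (\<lambda>xs. map (\<lambda>r. extl r xs) [0..<Suc n]) (perm_lists n))"

definition perm_of :: "nat list \<Rightarrow> nat \<Rightarrow> nat" where
  "perm_of xs i = (if 1 \<le> i \<and> i \<le> length xs then xs ! (i - 1) else i)"

lemma perm_of_extl: "perm_of (extl r xs) = ext (length xs) r (perm_of xs)"
proof
  fix i
  consider "i = 0" | "1 \<le> i" "i \<le> length xs" | "i = Suc (length xs)" | "Suc (length xs) < i" by linarith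
  then show "perm_of (extl r xs) i = ext (length xs) r (perm_of xs) i"
    by cases (auto simp: perm_of_def extl_def ext_def nth_append)
qed

lemma perm_of_Nil: "perm_of [] = id"
  by (rule ext) (simp add: perm_of_def)

lemma sum_list_concat_map:
  "(\<Sum>y\<leftarrow>concat (map (\<lambda>x. map (h x) K) L). g y) = (\<Sum>x\<leftarrow>L. \<Sum>r\<leftarrow>K. g (h x r))"
  by (induction L) (simp_all add: comp_def)

lemma length_perm_lists: "xs \<in> set (perm_lists n) \<Longrightarrow> length xs = n"
  by (induction n arbitrary: xs) (auto simp: extl_def)

text \<open>Transfers counting from functions to lists, where it can be evaluated.
  \<open>perm_lists\<close> follows the generating tree, so the induction step is the bijection
  \<open>bij_ext\<close>.\<close>

lemma sum_perms:
  fixes g :: "(nat \<Rightarrow> nat) \<Rightarrow> nat"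
  shows "(\<Sum>\<sigma>\<in>perms n. g \<sigma>) = (\<Sum>xs\<leftarrow>perm_lists n. g (perm_of xs))"
proof (induction n arbitrary: g)
  case 0
  show ?case unfolding perms_0 perm_lists.simps by (simp add: perm_of_Nil id_def)
next
  case (Suc n)
  have "(\<Sum>\<sigma>\<in>perms (Suc n). g \<sigma>) = (\<Sum>(\<sigma>, r)\<in>perms n \<times> {..n}. g (ext n r \<sigma>))"
    using sum.reindex_bij_betw[OF bij_ext, of g n] by (simp add: case_prod_unfold)
  also have "\<dots> = (\<Sum>\<sigma>\<in>perms n. \<Sum>r\<le>n. g (ext n r \<sigma>))" by (simp add: sum.cartesian_product)
  also have "\<dots> = (\<Sum>xs\<leftarrow>perm_lists n. \<Sum>r\<le>n. g (ext n r (perm_of xs)))" by (rule Suc.IH)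
  also have "\<dots> = (\<Sum>xs\<leftarrow>perm_lists n. \<Sum>r\<leftarrow>[0..<Suc n]. g (perm_of (extl r xs)))"
  proof (intro arg_cong[where f = sum_list] map_cong refl)
    fix xs assume "xs \<in> set (perm_lists n)"
    then have "length xs = n" by (rule length_perm_lists)
    then show "(\<Sum>r\<le>n. g (ext n r (perm_of xs))) = (\<Sum>r\<leftarrow>[0..<Suc n]. g (perm_of (extl r xs)))"
      unfolding perm_of_extl interv_sum_list_conv_sum_set_nat by (simp only: set_upt atLeast0LessThan lessThan_Suc_atMost)
  qed
  also have "\<dots> = (\<Sum>xs\<leftarrow>perm_lists (Suc n). g (perm_of xs))"
    unfolding perm_lists.simps by (rule sum_list_concat_map[symmetric])
  finally show ?case .
qed

text \<open>Records which of the nine cells contain a point.\<close>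

definition mask :: "nat list \<Rightarrow> nat \<Rightarrow> nat list \<Rightarrow> nat \<Rightarrow> nat list \<Rightarrow> shading" where
  "mask as p cs q bs = Shading
     (list_ex (\<lambda>v. v < p) as) (list_ex (\<lambda>v. p < v \<and> v < q) as) (list_ex (\<lambda>v. q < v) as)
     (list_ex (\<lambda>v. v < p) cs) (list_ex (\<lambda>v. p < v \<and> v < q) cs) (list_ex (\<lambda>v. q < v) cs)
     (list_ex (\<lambda>v. v < p) bs) (list_ex (\<lambda>v. p < v \<and> v < q) bs) (list_ex (\<lambda>v. q < v) bs)"

text \<open>A pass over the list with the first value \<open>p\<close> fixed: \<open>as\<close>
  holds the entries before it and \<open>cs\<close> those already passed after it. Both are
  accumulated in reverse, since only their sets matter.\<close>

primrec masks_at :: "nat list \<Rightarrow> nat \<Rightarrow> nat list \<Rightarrow> nat list \<Rightarrow> shading list" where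
  "masks_at as p cs [] = []"
| "masks_at as p cs (q # bs) = (if p < q then mask as p cs q bs # masks_at as p (q # cs) bs else masks_at as p (q # cs) bs)"

primrec masks :: "nat list \<Rightarrow> nat list \<Rightarrow> shading list" where
  "masks as [] = []"
| "masks as (p # xs) = masks_at as p [] xs @ masks (p # as) xs"

text \<open>A shaded cell is occupied; so an ascending pair fails to be an occurrence exactly if the
  shading clashes with its mask.\<close>

fun clash :: "shading \<Rightarrow> shading \<Rightarrow> bool" where
  "clash (Shading a b c d e f g h i) (Shading a' b' c' d' e' f' g' h' i') \<longleftrightarrow>
     a \<and> a' \<or> b \<and> b' \<or> c \<and> c' \<or> d \<and> d' \<or> e \<and> e' \<or> f \<and> f' \<or> g \<and> g' \<or> h \<and> h' \<or> i \<and> i'"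

definition fits :: "shading \<Rightarrow> nat list \<Rightarrow> nat \<Rightarrow> nat list \<Rightarrow> nat \<Rightarrow> nat list \<Rightarrow> bool" where
  "fits s as p cs q bs \<longleftrightarrow> p < q \<and> (\<forall>v\<in>set as. clear (cells s) 0 p q v) \<and>
     (\<forall>v\<in>set cs. clear (cells s) 1 p q v) \<and> (\<forall>v\<in>set bs. clear (cells s) 2 p q v)"

lemma clear_column:
  "(\<forall>v\<in>set vs. clear R x p q v) \<longleftrightarrow> \<not> ((x, 0) \<in> R \<and> list_ex (\<lambda>v. v < p) vs) \<and>
     \<not> ((x, 1) \<in> R \<and> list_ex (\<lambda>v. p < v \<and> v < q) vs) \<and> \<not> ((x, 2) \<in> R \<and> list_ex (\<lambda>v. q < v) vs)"
  unfolding clear_def list_ex_iff by blast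

lemma clash_mask:
  assumes "p < q"
  shows "\<not> clash s (mask as p cs q bs) \<longleftrightarrow> fits s as p cs q bs"
proof -
  obtain a b c d e f g h i where s: "s = Shading a b c d e f g h i" by (cases s)
  have "(0,0) \<in> cells s \<longleftrightarrow> a" "(0,1) \<in> cells s \<longleftrightarrow> b" "(0,2) \<in> cells s \<longleftrightarrow> c"
    "(1,0) \<in> cells s \<longleftrightarrow> d" "(1,1) \<in> cells s \<longleftrightarrow> e" "(1,2) \<in> cells s \<longleftrightarrow> f"
    "(2,0) \<in> cells s \<longleftrightarrow> g" "(2,1) \<in> cells s \<longleftrightarrow> h" "(2,2) \<in> cells s \<longleftrightarrow> i"
    by (simp_all add: s)
  note mem = this
  show ?thesis
    unfolding fits_def clear_column mem unfolding s mask_def clash.simps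
    by (simp only: de_Morgan_disj simp_thms conj_assoc assms)
qed

lemma masks_at_clash:
  "(\<exists>m\<in>set (masks_at as p cs xs). \<not> clash s m) \<longleftrightarrow> (\<exists>us q bs. xs = us @ q # bs \<and> fits s as p (rev us @ cs) q bs)"
proof (induction xs arbitrary: cs)
  case (Cons q bs)
  have "(\<exists>m\<in>set (masks_at as p cs (q # bs)). \<not> clash s m) \<longleftrightarrow>
      fits s as p cs q bs \<or> (\<exists>m\<in>set (masks_at as p (q # cs) bs). \<not> clash s m)"
    using clash_mask[of p q s as cs bs] by (cases "p < q") (auto simp: fits_def)
  also have "\<dots> \<longleftrightarrow> (\<exists>us q' bs'. q # bs = us @ q' # bs' \<and> fits s as p (rev us @ cs) q' bs')" (is "_ \<longleftrightarrow> ?E")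
  proof
    assume "fits s as p cs q bs \<or> (\<exists>m\<in>set (masks_at as p (q # cs) bs). \<not> clash s m)"
    then show ?E
    proof
      assume "fits s as p cs q bs"
      then show ?E by (intro exI[of _ "[]"]) simp
    next
      assume "\<exists>m\<in>set (masks_at as p (q # cs) bs). \<not> clash s m"
      then obtain us q' bs' where "bs = us @ q' # bs'" "fits s as p (rev us @ q # cs) q' bs'" unfolding Cons.IH by blast
      then show ?E by (intro exI[of _ "q # us"]) simp
    qed
  next
    assume ?E
    then obtain us q' bs' where u: "q # bs = us @ q' # bs'" "fits s as p (rev us @ cs) q' bs'" by blast
    show "fits s as p cs q bs \<or> (\<exists>m\<in>set (masks_at as p (q # cs) bs). \<not> clash s m)"
      unfolding Cons.IH using u by (cases us) auto
  qed
  finally show ?case .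
qed simp

lemma masks_clash:
  "(\<exists>m\<in>set (masks as xs). \<not> clash s m) \<longleftrightarrow>
   (\<exists>us p cs q bs. xs = us @ p # cs @ q # bs \<and> fits s (rev us @ as) p (rev cs) q bs)"
proof (induction xs arbitrary: as)
  case (Cons p xs)
  have "(\<exists>m\<in>set (masks as (p # xs)). \<not> clash s m) \<longleftrightarrow>
      (\<exists>cs q bs. xs = cs @ q # bs \<and> fits s as p (rev cs) q bs) \<or> (\<exists>m\<in>set (masks (p # as) xs). \<not> clash s m)"
    using masks_at_clash[of as p "[]" xs s] by auto
  also have "\<dots> \<longleftrightarrow> (\<exists>us p' cs q bs. p # xs = us @ p' # cs @ q # bs \<and> fits s (rev us @ as) p' (rev cs) q bs)" (is "?L \<longleftrightarrow> ?E")
  proof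
    assume ?L
    then show ?E
    proof
      assume "\<exists>cs q bs. xs = cs @ q # bs \<and> fits s as p (rev cs) q bs"
      then show ?E by (intro exI[of _ "[]"]) simp
    next
      assume "\<exists>m\<in>set (masks (p # as) xs). \<not> clash s m"
      then obtain us p' cs q bs where "xs = us @ p' # cs @ q # bs" "fits s (rev us @ p # as) p' (rev cs) q bs"
        unfolding Cons.IH by blast
      then show ?E by (intro exI[of _ "p # us"] exI[of _ p'] exI[of _ cs] exI[of _ q] exI[of _ bs]) simp
    qed
  next
    assume ?E
    then obtain us p' cs q bs where u: "p # xs = us @ p' # cs @ q # bs" "fits s (rev us @ as) p' (rev cs) q bs" by blast
    show ?L
    proof (cases us)
      case Nil
      then show ?thesis using u by auto
    next
      case (Cons a us')
      then have "xs = us' @ p' # cs @ q # bs \<and> fits s (rev us' @ p # as) p' (rev cs) q bs" using u by simp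
      then show ?thesis unfolding Cons.IH by blast
    qed
  qed
  finally show ?case .
qed simp

lemma occ_perm_of:
  assumes \<sigma>: "perm_of xs \<in> perms (length xs)"
  shows "(\<exists>i j. occ (cells s) (length xs) (perm_of xs) i j) \<longleftrightarrow>
    (\<exists>as p cs q bs. xs = as @ p # cs @ q # bs \<and> fits s as p cs q bs)"
proof
  assume "\<exists>i j. occ (cells s) (length xs) (perm_of xs) i j"
  then obtain i j where o: "occ (cells s) (length xs) (perm_of xs) i j" by blast
  note d = occ_len[OF \<sigma> o] and c = occ_clear[OF \<sigma> o]
  have nth: "perm_of xs (Suc k) = xs ! k" if "k < length xs" for k using that by (simp add: perm_of_def)
  define as where "as = take (i - 1) xs"
  define cs where "cs = take (j - i - 1) (drop i xs)"
  define bs where "bs = drop j xs"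
  have i: "xs = as @ xs ! (i - 1) # drop i xs" using id_take_nth_drop[of "i - 1" xs] d by (simp add: as_def)
  have "drop i xs = cs @ drop i xs ! (j - i - 1) # drop (Suc (j - i - 1)) (drop i xs)"
    unfolding cs_def using d by (intro id_take_nth_drop) simp
  then have j: "drop i xs = cs @ xs ! (j - 1) # bs" using d by (simp add: bs_def)
  have p: "perm_of xs i = xs ! (i - 1)" "perm_of xs j = xs ! (j - 1)" using nth[of "i - 1"] nth[of "j - 1"] d by simp_all
  have "fits s as (xs ! (i - 1)) cs (xs ! (j - 1)) bs"
    unfolding fits_def
  proof (intro conjI ballI)
    show "xs ! (i - 1) < xs ! (j - 1)" using d(4) p by simp
    fix v assume "v \<in> set as"
    then obtain k where "k < i - 1" "v = xs ! k" using d by (auto simp: as_def in_set_conv_nth)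
    then show "clear (cells s) 0 (xs ! (i - 1)) (xs ! (j - 1)) v" using c(1)[of "Suc k"] p nth[of k] d by simp
  next
    fix v assume "v \<in> set cs"
    then obtain k where "k < j - i - 1" "v = xs ! (i + k)" using d by (auto simp: cs_def in_set_conv_nth)
    then show "clear (cells s) 1 (xs ! (i - 1)) (xs ! (j - 1)) v" using c(2)[of "Suc (i + k)"] p nth[of "i + k"] d by simp
  next
    fix v assume "v \<in> set bs"
    then obtain k where "k < length xs - j" "v = xs ! (j + k)" using d by (auto simp: bs_def in_set_conv_nth)
    then show "clear (cells s) 2 (xs ! (i - 1)) (xs ! (j - 1)) v" using c(3)[of "Suc (j + k)"] p nth[of "j + k"] d by simp
  qed
  then show "\<exists>as p cs q bs. xs = as @ p # cs @ q # bs \<and> fits s as p cs q bs" using i j by metis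
next
  assume "\<exists>as p cs q bs. xs = as @ p # cs @ q # bs \<and> fits s as p cs q bs"
  then obtain as p cs q bs where x: "xs = as @ p # cs @ q # bs" and f: "fits s as p cs q bs" by blast
  define i where "i = Suc (length as)"
  define j where "j = Suc (Suc (length as + length cs))"
  have p: "perm_of xs i = p" "perm_of xs j = q" by (auto simp: perm_of_def i_def j_def x nth_append)
  have "occ (cells s) (length xs) (perm_of xs) i j"
  proof (rule occI[OF \<sigma>], unfold p)
    fix l assume l: "1 \<le> l" "l < i"
    then have "perm_of xs l = as ! (l - 1)" "l - 1 < length as" by (auto simp: perm_of_def x i_def nth_append)
    then show "clear (cells s) 0 p q (perm_of xs l)" using f by (simp add: fits_def)
  next
    fix l assume l: "i < l" "l < j"
    then have "perm_of xs l = cs ! (l - i - 1)" "l - i - 1 < length cs"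
      by (auto simp: perm_of_def x i_def j_def nth_append nth_Cons')
    then show "clear (cells s) 1 p q (perm_of xs l)" using f by (simp add: fits_def)
  next
    fix l assume l: "j < l" "l \<le> length xs"
    then have "perm_of xs l = bs ! (l - j - 1)" "l - j - 1 < length bs"
      by (auto simp: perm_of_def x i_def j_def nth_append nth_Cons')
    then show "clear (cells s) 2 p q (perm_of xs l)" using f by (simp add: fits_def)
  qed (use f in \<open>auto simp: i_def j_def x fits_def\<close>)
  then show "\<exists>i j. occ (cells s) (length xs) (perm_of xs) i j" by blast
qed

lemma av_perm_of:
  assumes "perm_of xs \<in> perms (length xs)"
  shows "perm_of xs \<in> av (cells s) (length xs) \<longleftrightarrow> list_all (clash s) (masks [] xs)"
proof -
  \<comment> \<open>The reversal of the accumulated lists disappears here because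
    \<open>fits\<close> depends only on their sets.\<close>
  have eq: "fits s as p (rev cs) q bs \<longleftrightarrow> fits s as p cs q bs" "fits s (rev as) p cs q bs \<longleftrightarrow> fits s as p cs q bs"
    for as p cs q bs by (simp_all add: fits_def)
  have "(\<exists>m\<in>set (masks [] xs). \<not> clash s m) \<longleftrightarrow> (\<exists>i j. occ (cells s) (length xs) (perm_of xs) i j)"
    unfolding masks_clash occ_perm_of[OF assms] by (simp add: eq)
  then show ?thesis unfolding av_def list_all_iff using assms by blast
qed

text \<open>The masks do not depend on the shading, so one table per length serves all the shadings
  to be compared.\<close>

definition mask_table :: "nat \<Rightarrow> shading list list" where
  "mask_table n = map (masks []) (perm_lists n)"

text \<open>Used in place of \<open>if\<close>, whose congruence rule makes the simplifier traverse the remaining table again.\<close>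

definition bump :: "bool \<Rightarrow> int \<Rightarrow> int" where
  "bump b k = (if b then k + 1 else k)"

lemma bump_simps [code]: "bump True k = k + 1" "bump False k = k"
  by (simp_all add: bump_def)

primrec avoid_count :: "shading \<Rightarrow> shading list list \<Rightarrow> int" where
  "avoid_count s [] = 0"
| "avoid_count s (ms # M) = bump (list_all (clash s) ms) (avoid_count s M)"

lemma avoid_count_sum: "avoid_count s M = int (\<Sum>ms\<leftarrow>M. if list_all (clash s) ms then 1 else 0)"
  by (induction M) (simp_all add: bump_def)

lemma perm_of_perms: "xs \<in> set (perm_lists n) \<Longrightarrow> perm_of xs \<in> perms n"
proof (induction n arbitrary: xs)
  case 0
  then have "xs = []" by simp
  then show ?case unfolding perms_0 by (simp only: perm_of_Nil singleton_iff)
next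
  case (Suc n)
  then obtain ys r where "ys \<in> set (perm_lists n)" "r < Suc n" "xs = extl r ys" by (auto simp del: upt_Suc)
  then show ?case using Suc.IH[of ys] length_perm_lists[of ys n] by (simp add: perm_of_extl ext_perms less_Suc_eq_le)
qed

lemma card_av_count: "int (card (av (cells s) n)) = avoid_count s (mask_table n)"
proof -
  have "card (av (cells s) n) = (\<Sum>\<sigma>\<in>perms n. if \<sigma> \<in> av (cells s) n then 1 else 0)"
    by (simp add: sum.If_cases av_def Int_def)
  also have "\<dots> = (\<Sum>xs\<leftarrow>perm_lists n. if perm_of xs \<in> av (cells s) n then 1 else 0)" by (rule sum_perms)
  also have "\<dots> = (\<Sum>xs\<leftarrow>perm_lists n. if list_all (clash s) (masks [] xs) then 1 else 0)"
    using av_perm_of perm_of_perms length_perm_lists by (intro arg_cong[where f = sum_list] map_cong refl) metis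
  finally show ?thesis unfolding avoid_count_sum mask_table_def by (simp add: comp_def)
qed

primrec avoid_counts :: "shading list list \<Rightarrow> shading list list \<Rightarrow> shading list \<Rightarrow> (int \<times> int) list" where
  "avoid_counts M M' [] = []"
| "avoid_counts M M' (s # ss) = (avoid_count s M, avoid_count s M') # avoid_counts M M' ss"

lemma counts_map: "avoid_counts M M' ss = map (\<lambda>s. (avoid_count s M, avoid_count s M')) ss"
  by (induction ss) simp_all

lemma distinct_counts: "distinct (avoid_counts (mask_table 3) (mask_table 6) (tl roots))"
  by code_simp

lemma wilf_lower: "46 \<le> wilf"
proof -
  have d: "distinct (map (\<lambda>s. (avoid_count s (mask_table 3), avoid_count s (mask_table 6))) (tl roots))"
    using distinct_counts unfolding counts_map .
  have "s = t" if "s \<in> set (tl roots)" "t \<in> set (tl roots)" "weq (cells s) (cells t)" for s t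
  proof -
    have "avoid_count s (mask_table n) = avoid_count t (mask_table n)" for n
      unfolding card_av_count[symmetric] using that(3) by (simp add: weq_def)
    then show ?thesis using d that(1,2) unfolding distinct_map inj_on_def by blast
  qed
  then have "card (cells ` set (tl roots)) \<le> wilf" by (intro wilf_ge) (use cells_subset in auto)
  moreover have "card (cells ` set (tl roots)) = card (set (tl roots))"
    by (intro card_image inj_onI) (rule cells_inj)
  moreover have "card (set (tl roots)) = length (tl roots)" using d by (intro distinct_card) (simp add: distinct_map)
  moreover have "length (tl roots) = 46" by (simp add: roots_def)
  ultimately show ?thesis by simp
qed

theorem corollary1p4:
  shows "46 \<le> wilf \<and> wilf \<le> 47"
  using wilf_lower wilf_upper by blast

end
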